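(* Let $n\ge 1$, let $H\in\mathbb{R}$, and let $\gamma$ be a complete solution of the system $( * )_H$ with energy $E$. Then the hypersurface $\Sigma$ generated by $\gamma$ is a constant mean curvature hypersurface in $\mathbb{H}^n$ of one of the following types: (i) If $H=0$ and $E=0$, then $\gamma$ is a straight line orthogonal to the $t$-axis (i.e. a half-line $\{t=c,\ x\ge 0\}$ of the half-plane $\{x\geq 0\}$, once its limit point on the axis is adjoined) and $\Sigma$ is a Euclidean hyperplane. (ii) If $H=0$ and $E\neq 0$, then $\Sigma$ is an embedded hypersurface of catenoidal type. Moreover, when $n\geq 2$, $\Sigma$ is contained inside a slab $\{a<t<b\}$ ($a,b\in\mathbb{R}$) of $\mathbb{R}^{2n+1}$. (iii) If $H\neq 0$ and $E=0$, then $\Sigma$ is a compact hypersurface homeomorphic to a sphere. (iv) If $EH>0$, then $\gamma$ is a periodic graph over the $t$-axis (that is, the graph $x=x(t)$ of a periodic, possibly constant, function defined on the whole $t$-axis), and $\Sigma$ is either a cylinder about the $t$-axis or an embedded hypersurface of unduloid type. (v) If $EH<0$, then $\gamma$ is a locally convex curve and $\Sigma$ is a nodoid type hypersurface, which has self-intersections.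
   Context: Heisenberg group. $\mathbb{H}^n$ is $\mathbb{R}^{2n+1}\equiv\mathbb{C}^n\times\mathbb{R}$, with coordinates $[z,t]$, $z_k=x_k+iy_k$, and product $[z,t]*[z',t']=[z+z',t+t'+\mathrm{Im}(\sum_{i}z_i\overline{z}'_i)]$. Set $X_k=\partial_{x_k}+y_k\partial_t$, $Y_k=\partial_{y_k}-x_k\partial_t$ ($k=1,\dots,n$), $T=\partial_t$. The horizontal distribution is spanned by $\{X_k,Y_k\}$; $U_H$ denotes the projection of $U$ onto it. $g=\langle\cdot,\cdot\rangle$ is the Riemannian metric making $\{X_k,Y_k,T\}$ orthonormal. Mean curvature. For a (possibly immersed) $C^2$ hypersurface $\Sigma$ with unit normal $N$ in $(\mathbb{H}^n,g)$, the singular set is $\Sigma_0=\{N_H=0\}$; on $\Sigma-\Sigma_0$ put $\nu_H=N_H/|N_H|$ and define the mean curvature $H$ by $-2nH=\mathrm{div}_\Sigma\,\nu_H$, where $\mathrm{div}_\Sigma$ is the Riemannian divergence relative to $\Sigma$ in $(\mathbb{H}^n,g)$. $\Sigma$ has constant mean curvature if $H$ is constant on $\Sigma-\Sigma_0$. The system. For $H\in\mathbb{R}$, $( * )_H$ is the system of ODEs for $(x(s),t(s),\sigma(s))$ with $x>0$: $$x'=\sin\sigma,\qquad t'=\cos\sigma,\qquad \sigma'=(2n-1)\frac{\cos^3\sigma}{x^3}+2(n-1)\frac{\sin^2\sigma\cos\sigma}{x}-2nH\frac{(x^2\sin^2\sigma+\cos^2\sigma)^{3/2}}{x^2}.$$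 The function $\frac{x^{2n-1}\cos\sigma}{\sqrt{x^2\sin^2\sigma+\cos^2\sigma}}-Hx^{2n}$ is constant along any solution; its constant value $E$ is called the energy of the solution. A complete solution is a maximal (non-extendable) one; $\gamma=(x,t)$ is the corresponding arc-length parametrized curve in the half-plane $\{(x,t):x\ge 0\}$. The hypersurface $\Sigma$ generated by $\gamma$ is parametrized by $(s,\omega)\mapsto(x(s)\omega,t(s))$, $\omega\in\mathbb{S}^{2n-1}$, i.e. it is obtained by rotating $\gamma$ about the $t$-axis; limit points of $\gamma$ on the $t$-axis, if any, are adjoined to it. The unit normal used for the mean curvature has coordinates with respect to $\{X_k,Y_k,T\}$ given by $(xx'\omega_{n+k}-t'\omega_k,\,-xx'\omega_k-t'\omega_{n+k},\,x')/\sqrt{|\gamma'|^2+x^2(x')^2}$, where $\omega=(\omega_k,\omega_{n+k})\in\mathbb{R}^n\times\mathbb{R}^n$. Types of hypersurfaces of revolution about the $t$-axis (all up to a translation along the $t$-axis): - Catenoidal type: the generating curve is the graph of an even, strictly convex $C^2$ function $x:(-a,a)\to(0,+\infty)$, $0<a\le+\infty$, with $x(t)\to+\infty$ as $t\to\pm a$. - Cylinder: the generating curve is $\{x=r\}$ for some $r>0$. - Unduloid type: the generating curve is the graph of an even, non-constant, periodic $C^2$ function $x:\mathbb{R}\to(0,+\infty)$ of period $2\tau>0$, for which there is $t_1\in(0,\tau)$ such that $x(t)$ is strictly increasing on $(0,\tau)$, strictly convex on $(0,t_1)$ and strictly concave on $(t_1,\tau)$. - Nodoid type: the generating curve is defined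 for all $s\in\mathbb{R}$, is locally convex with tangent angle $\sigma$ strictly monotone in $s$, has $x$ bounded above and bounded below by a positive constant, is invariant under a non-trivial translation along the $t$-axis, is symmetric with respect to the lines $\{t=t(s_0)\}$ through the critical points $s_0$ of $x(s)$, and is not embedded. *)

theory Defs
  imports "HOL-Analysis.Analysis"
begin

section \<open>Hypersurfaces in a Riemannian metric on a Euclidean space\<close>

definition C2_on :: "'a::real_normed_vector set \<Rightarrow> ('a \<Rightarrow> 'b::real_normed_vector) \<Rightarrow> bool" where
  "C2_on U f \<longleftrightarrow> (\<exists>(f' :: 'a \<Rightarrow> 'a \<Rightarrow>\<^sub>L 'b) (f'' :: 'a \<Rightarrow> 'a \<Rightarrow>\<^sub>L ('a \<Rightarrow>\<^sub>L 'b)).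
     (\<forall>p\<in>U. (f has_derivative blinfun_apply (f' p)) (at p)) \<and>
     (\<forall>p\<in>U. (f' has_derivative blinfun_apply (f'' p)) (at p)) \<and>
     continuous_on U f'')"

definition C2_hypersurface :: "'a::euclidean_space set \<Rightarrow> bool" where
  "C2_hypersurface S \<longleftrightarrow> (\<forall>p\<in>S. \<exists>U (f :: 'a \<Rightarrow> real).
     open U \<and> p \<in> U \<and> C2_on U f \<and>
     (\<forall>q\<in>U. frechet_derivative f (at q) \<noteq> (\<lambda>v. 0)) \<and>
     S \<inter> U = {q \<in> U. f q = 0})"

definition tangent_space :: "'a::euclidean_space set \<Rightarrow> 'a \<Rightarrow> 'a set" where
  "tangent_space S p =
     {v. \<exists>c :: real \<Rightarrow> 'a. range c \<subseteq> S \<and> c 0 = p \<and> (c has_vector_derivative v) (at 0)}"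

text \<open>A metric is a function \<open>g\<close> such that \<open>g p\<close> is the inner product on the tangent space at the
  point \<open>p\<close>, which is identified with the ambient Euclidean space through the coordinates.
  \<open>christoffel g p v w\<close> is the vector \<open>\<Sum> \<Gamma>\<^sup>k\<^sub>i\<^sub>j v\<^sub>i w\<^sub>j \<partial>\<^sub>k\<close>, given by the Koszul
  formula for constant-coefficient fields, so that the Levi-Civita derivative of \<open>W\<close> along \<open>v\<close> is
  the coordinatewise derivative of \<open>W\<close> along \<open>v\<close> plus \<open>christoffel g p v (W p)\<close>.\<close>

definition christoffel :: "('a::euclidean_space \<Rightarrow> 'a \<Rightarrow> 'a \<Rightarrow> real) \<Rightarrow> 'a \<Rightarrow> 'a \<Rightarrow> 'a \<Rightarrow> 'a" where
  "christoffel g p v w = (THE c. \<forall>u. g p c u =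
     (frechet_derivative (\<lambda>q. g q w u) (at p) v
      + frechet_derivative (\<lambda>q. g q v u) (at p) w
      - frechet_derivative (\<lambda>q. g q v w) (at p) u) / 2)"

definition orthonormal_basis_of ::
  "('a::euclidean_space \<Rightarrow> 'a \<Rightarrow> 'a \<Rightarrow> real) \<Rightarrow> 'a \<Rightarrow> 'a set \<Rightarrow> 'a set \<Rightarrow> bool" where
  "orthonormal_basis_of g p L B \<longleftrightarrow>
     finite B \<and> span B = L \<and> (\<forall>e\<in>B. \<forall>e'\<in>B. g p e e' = (if e = e' then 1 else 0))"

text \<open>The divergence relative to \<open>S\<close> of a field \<open>W\<close> along \<open>S\<close>, not necessarily tangent to \<open>S\<close>.
  A derivative \<open>W'\<close> within \<open>S\<close> is determined only on tangent vectors, and only these are used.\<close>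

definition has_divergence_along ::
  "('a::euclidean_space \<Rightarrow> 'a \<Rightarrow> 'a \<Rightarrow> real) \<Rightarrow> 'a set \<Rightarrow> ('a \<Rightarrow> 'a) \<Rightarrow> 'a \<Rightarrow> real \<Rightarrow> bool" where
  "has_divergence_along g S W p d \<longleftrightarrow> (\<exists>W' B.
     (W has_derivative W') (at p within S) \<and>
     orthonormal_basis_of g p (tangent_space S p) B \<and>
     d = (\<Sum>e\<in>B. g p (W' e + christoffel g p e (W p)) e))"

definition unit_normal ::
  "('a::euclidean_space \<Rightarrow> 'a \<Rightarrow> 'a \<Rightarrow> real) \<Rightarrow> 'a set \<Rightarrow> ('a \<Rightarrow> 'a) \<Rightarrow> bool" where
  "unit_normal g S \<nu> \<longleftrightarrow> continuous_on S \<nu> \<and>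
     (\<forall>p\<in>S. g p (\<nu> p) (\<nu> p) = 1 \<and> (\<forall>v\<in>tangent_space S p. g p (\<nu> p) v = 0))"


section \<open>The Heisenberg group and its mean curvature\<close>

type_synonym 'n heis = "(complex^'n) \<times> real"

definition X_field :: "'n::finite \<Rightarrow> 'n heis \<Rightarrow> 'n heis" where
  "X_field k p = (axis k 1, Im (fst p $ k))"

definition Y_field :: "'n::finite \<Rightarrow> 'n heis \<Rightarrow> 'n heis" where
  "Y_field k p = (axis k \<i>, - Re (fst p $ k))"

definition T_field :: "'n::finite heis \<Rightarrow> 'n heis" where
  "T_field p = (0, 1)"

text \<open>The component of \<open>v\<close> along \<open>T\<close> in the frame \<open>X, Y, T\<close> at \<open>p\<close>; its components along \<open>X k\<close> and
  \<open>Y k\<close> are the real and imaginary parts of \<open>fst v $ k\<close> (see \<open>heis_frame_expansion\<close>).\<close>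

definition T_component :: "'n::finite heis \<Rightarrow> 'n heis \<Rightarrow> real" where
  "T_component p v = snd v - (\<Sum>k\<in>UNIV. Im (fst p $ k * cnj (fst v $ k)))"

definition heis_metric :: "'n::finite heis \<Rightarrow> 'n heis \<Rightarrow> 'n heis \<Rightarrow> real" where
  "heis_metric p v w =
     (\<Sum>k\<in>UNIV. Re (fst v $ k) * Re (fst w $ k) + Im (fst v $ k) * Im (fst w $ k))
     + T_component p v * T_component p w"

lemma Re_Im_axis:
  fixes m i :: "'n::finite"
  shows "Re (axis m 1 $ i) = (if i = m then 1 else 0)" "Im (axis m 1 $ i) = 0"
    "Re (axis m \<i> $ i) = 0" "Im (axis m \<i> $ i) = (if i = m then 1 else 0)"
  by (auto simp: axis_def)

lemma heis_frame_expansion: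
  fixes p v :: "'n::finite heis"
  shows "v = (\<Sum>k\<in>UNIV. Re (fst v $ k) *\<^sub>R X_field k p + Im (fst v $ k) *\<^sub>R Y_field k p)
             + T_component p v *\<^sub>R T_field p"
proof (rule prod_eqI)
  have "(\<Sum>k\<in>UNIV. Re (fst v $ k) *\<^sub>R (axis k 1 :: complex^'n) + Im (fst v $ k) *\<^sub>R axis k \<i>) = fst v"
    (is "?s = _")
  proof (rule vec_eq_iff[THEN iffD2], intro allI)
    fix i
    show "?s $ i = fst v $ i"
      by (simp add: complex_eq_iff Re_Im_axis mult_delta_right)
  qed
  then show "fst v = fst ((\<Sum>k\<in>UNIV. Re (fst v $ k) *\<^sub>R X_field k p + Im (fst v $ k) *\<^sub>R Y_field k p)
             + T_component p v *\<^sub>R T_field p)"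
    by (simp add: X_field_def Y_field_def T_field_def fst_sum)
  show "snd v = snd ((\<Sum>k\<in>UNIV. Re (fst v $ k) *\<^sub>R X_field k p + Im (fst v $ k) *\<^sub>R Y_field k p)
             + T_component p v *\<^sub>R T_field p)"
    by (simp add: X_field_def Y_field_def T_field_def snd_sum T_component_def algebra_simps)
qed

lemma T_component_frame:
  fixes p :: "'n::finite heis"
  shows "T_component p (X_field j p) = 0" "T_component p (Y_field j p) = 0"
    "T_component p (T_field p) = 1"
proof -
  show "T_component p (X_field j p) = 0" "T_component p (Y_field j p) = 0"
    by (simp_all add: T_component_def X_field_def Y_field_def Re_Im_axis mult_delta_right sum_negf)
  show "T_component p (T_field p) = 1" by (simp add: T_component_def T_field_def)
qed

lemma heis_metric_frame:
  fixes p :: "'n::finite heis"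
  shows "heis_metric p (X_field j p) (X_field k p) = (if j = k then 1 else 0)"
    "heis_metric p (Y_field j p) (Y_field k p) = (if j = k then 1 else 0)"
    "heis_metric p (X_field j p) (Y_field k p) = 0"
    "heis_metric p (X_field j p) (T_field p) = 0"
    "heis_metric p (Y_field j p) (T_field p) = 0"
    "heis_metric p (T_field p) (T_field p) = 1"
proof -
  have delta: "(\<Sum>i\<in>UNIV. (if i = j then (1::real) else 0) * (if i = k then 1 else 0))
      = (if j = k then 1 else 0)"
    by (subst sum.cong[OF refl, of _ _ "\<lambda>i. if i = j then if j = k then 1 else 0 else 0"]) auto
  show "heis_metric p (X_field j p) (X_field k p) = (if j = k then 1 else 0)"
    "heis_metric p (Y_field j p) (Y_field k p) = (if j = k then 1 else 0)"
    "heis_metric p (X_field j p) (Y_field k p) = 0"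
    "heis_metric p (X_field j p) (T_field p) = 0"
    "heis_metric p (Y_field j p) (T_field p) = 0"
    "heis_metric p (T_field p) (T_field p) = 1"
    unfolding heis_metric_def T_component_frame
    by (simp_all add: X_field_def Y_field_def T_field_def Re_Im_axis delta)
qed

definition horizontal_part :: "'n::finite heis \<Rightarrow> 'n heis \<Rightarrow> 'n heis" where
  "horizontal_part p v = v - heis_metric p v (T_field p) *\<^sub>R T_field p"

definition horizontal_normal :: "('n::finite heis \<Rightarrow> 'n heis) \<Rightarrow> 'n heis \<Rightarrow> 'n heis" where
  "horizontal_normal \<nu> p =
     (let h = horizontal_part p (\<nu> p) in (1 / sqrt (heis_metric p h h)) *\<^sub>R h)"

definition singular_set :: "'n::finite heis set \<Rightarrow> ('n heis \<Rightarrow> 'n heis) \<Rightarrow> 'n heis set" where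
  "singular_set S \<nu> = {p \<in> S. horizontal_part p (\<nu> p) = 0}"

definition has_mean_curvature ::
  "'n::finite heis set \<Rightarrow> ('n heis \<Rightarrow> 'n heis) \<Rightarrow> 'n heis \<Rightarrow> real \<Rightarrow> bool" where
  "has_mean_curvature S \<nu> p h \<longleftrightarrow>
     has_divergence_along heis_metric (S - singular_set S \<nu>) (horizontal_normal \<nu>) p
       (- 2 * real CARD('n) * h)"

text \<open>A hypersurface immersed by \<open>F\<close>, with unit normal \<open>N\<close> along \<open>F\<close> and with constant mean
  curvature \<open>h\<close> off the singular set: locally, \<open>F\<close> is a homeomorphism onto an embedded \<open>C\<^sup>2\<close>
  hypersurface, and the \<open>C\<^sup>2\<close> structure of the source \<open>M\<close> is the one pulled back by \<open>F\<close>.\<close>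

definition cmc_immersion ::
  "'m::topological_space set \<Rightarrow> ('m \<Rightarrow> 'n::finite heis) \<Rightarrow> ('m \<Rightarrow> 'n heis) \<Rightarrow> real \<Rightarrow> bool" where
  "cmc_immersion M F N h \<longleftrightarrow> (\<forall>m\<in>M. \<exists>V S G.
     openin (top_of_set M) V \<and> m \<in> V \<and> homeomorphism V S F G \<and>
     C2_hypersurface S \<and> unit_normal heis_metric S (N \<circ> G) \<and>
     (\<forall>p \<in> S - singular_set S (N \<circ> G). has_mean_curvature S (N \<circ> G) p h))"

definition embedding_on :: "'a::topological_space set \<Rightarrow> ('a \<Rightarrow> 'b::topological_space) \<Rightarrow> bool" where
  "embedding_on M F \<longleftrightarrow> (\<exists>G. homeomorphism M (F ` M) F G)"


section \<open>The system of ordinary differential equations\<close>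

definition profile_solution ::
  "nat \<Rightarrow> real \<Rightarrow> real set \<Rightarrow> (real \<Rightarrow> real) \<Rightarrow> (real \<Rightarrow> real) \<Rightarrow> (real \<Rightarrow> real) \<Rightarrow> bool" where
  "profile_solution n H I x t \<sigma> \<longleftrightarrow>
     open I \<and> is_interval I \<and> I \<noteq> {} \<and>
     (\<forall>s\<in>I. x s > 0 \<and>
        (x has_real_derivative sin (\<sigma> s)) (at s) \<and>
        (t has_real_derivative cos (\<sigma> s)) (at s) \<and>
        (\<sigma> has_real_derivative
           ((2 * real n - 1) * cos (\<sigma> s) ^ 3 / x s ^ 3
            + 2 * (real n - 1) * ((sin (\<sigma> s))\<^sup>2 * cos (\<sigma> s)) / x s
            - 2 * real n * H
                * (((x s)\<^sup>2 * (sin (\<sigma> s))\<^sup>2 + (cos (\<sigma> s))\<^sup>2) powr (3 / 2) / (x s)\<^sup>2))) (at s))"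

definition complete_profile_solution ::
  "nat \<Rightarrow> real \<Rightarrow> real set \<Rightarrow> (real \<Rightarrow> real) \<Rightarrow> (real \<Rightarrow> real) \<Rightarrow> (real \<Rightarrow> real) \<Rightarrow> bool" where
  "complete_profile_solution n H I x t \<sigma> \<longleftrightarrow>
     profile_solution n H I x t \<sigma> \<and>
     (\<forall>J x1 t1 \<sigma>1. profile_solution n H J x1 t1 \<sigma>1 \<and> I \<subseteq> J \<and>
        (\<forall>s\<in>I. x1 s = x s \<and> t1 s = t s \<and> \<sigma>1 s = \<sigma> s) \<longrightarrow> J = I)"

definition profile_energy :: "nat \<Rightarrow> real \<Rightarrow> real \<Rightarrow> real \<Rightarrow> real" where
  "profile_energy n H r \<theta> =
     r ^ (2 * n - 1) * cos \<theta> / sqrt (r\<^sup>2 * (sin \<theta>)\<^sup>2 + (cos \<theta>)\<^sup>2) - H * r ^ (2 * n)"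


section \<open>Hypersurfaces of revolution\<close>

definition profile_curve :: "(real \<Rightarrow> real) \<Rightarrow> (real \<Rightarrow> real) \<Rightarrow> real \<Rightarrow> real \<times> real" where
  "profile_curve x t s = (x s, t s)"

definition generating_curve :: "real set \<Rightarrow> (real \<Rightarrow> real) \<Rightarrow> (real \<Rightarrow> real) \<Rightarrow> (real \<times> real) set" where
  "generating_curve I x t =
     profile_curve x t ` I \<union> {(r, u). r = 0 \<and> (r, u) \<in> closure (profile_curve x t ` I)}"

definition revolve :: "(real \<times> real) set \<Rightarrow> 'n::finite heis set" where
  "revolve C = {(r *\<^sub>R \<omega>, u) | r u \<omega>. (r, u) \<in> C \<and> norm \<omega> = 1}"

text \<open>The hypersurface generated by the curve is immersed by \<open>revolution_map\<close>. Its source is the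
  product of \<open>I\<close> with the unit sphere, with one pole adjoined at each end of \<open>I\<close> at which the curve
  tends to a point of the axis. It is realised as the set of pairs \<open>(s, x s *\<^sub>R \<omega>)\<close>, so
  that its topology near a pole is that of a ball.\<close>

definition axis_ends :: "real set \<Rightarrow> (real \<Rightarrow> real) \<Rightarrow> (real \<Rightarrow> real) \<Rightarrow> real set" where
  "axis_ends I x t =
     {a \<in> closure I - I. \<exists>u. (profile_curve x t \<longlongrightarrow> (0, u)) (at a within I)}"

definition revolution_source ::
  "real set \<Rightarrow> (real \<Rightarrow> real) \<Rightarrow> (real \<Rightarrow> real) \<Rightarrow> (real \<times> (complex^'n::finite)) set" where
  "revolution_source I x t =
     {(s, x s *\<^sub>R \<omega>) | s \<omega>. s \<in> I \<and> norm \<omega> = 1} \<union> {(a, 0) | a. a \<in> axis_ends I x t}"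

definition revolution_map ::
  "real set \<Rightarrow> (real \<Rightarrow> real) \<Rightarrow> real \<times> (complex^'n::finite) \<Rightarrow> 'n heis" where
  "revolution_map I t = (\<lambda>(s, z). (z, if s \<in> I then t s else Lim (at s within I) t))"

text \<open>The unit normal at the point \<open>(r *\<^sub>R \<omega>, u)\<close>, where \<open>(r', t')\<close> is the velocity of the curve.\<close>

definition revolution_normal ::
  "real \<Rightarrow> real \<Rightarrow> real \<Rightarrow> real \<Rightarrow> complex^'n::finite \<Rightarrow> 'n heis" where
  "revolution_normal r u r' t' \<omega> =
     (let p = (r *\<^sub>R \<omega>, u) in
      (1 / sqrt (r'\<^sup>2 + t'\<^sup>2 + r\<^sup>2 * r'\<^sup>2)) *\<^sub>R
        ((\<Sum>k\<in>UNIV. (r * r' * Im (\<omega> $ k) - t' * Re (\<omega> $ k)) *\<^sub>R X_field k p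
                   + (- r * r' * Re (\<omega> $ k) - t' * Im (\<omega> $ k)) *\<^sub>R Y_field k p)
         + r' *\<^sub>R T_field p))"


section \<open>Types of generating curves\<close>

definition strictly_convex_on :: "real set \<Rightarrow> (real \<Rightarrow> real) \<Rightarrow> bool" where
  "strictly_convex_on A f \<longleftrightarrow> convex A \<and>
     (\<forall>u\<in>A. \<forall>v\<in>A. \<forall>\<theta>. u \<noteq> v \<and> 0 < \<theta> \<and> \<theta> < 1 \<longrightarrow>
        f ((1 - \<theta>) * u + \<theta> * v) < (1 - \<theta>) * f u + \<theta> * f v)"

definition strictly_concave_on :: "real set \<Rightarrow> (real \<Rightarrow> real) \<Rightarrow> bool" where
  "strictly_concave_on A f \<longleftrightarrow> strictly_convex_on A (\<lambda>u. - f u)"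

text \<open>\<open>einterval (- a) a\<close> consists of the real numbers between the extended reals \<open>- a\<close> and \<open>a\<close>.
  In the next three definitions, the translation along the axis is by \<open>c\<close>; cylinders
  are invariant under it.\<close>

definition catenoidal_curve :: "(real \<times> real) set \<Rightarrow> bool" where
  "catenoidal_curve C \<longleftrightarrow> (\<exists>(c::real) (a::ereal) (f::real \<Rightarrow> real).
     0 < a \<and>
     C2_on (einterval (- a) a) f \<and>
     (\<forall>u \<in> einterval (- a) a. 0 < f u \<and> f (- u) = f u) \<and>
     strictly_convex_on (einterval (- a) a) f \<and>
     filterlim (f \<circ> real_of_ereal) at_top (at_left a) \<and>
     filterlim (f \<circ> real_of_ereal) at_top (at_right (- a)) \<and>
     C = {(f u, c + u) | u. u \<in> einterval (- a) a})"

definition cylinder_curve :: "(real \<times> real) set \<Rightarrow> bool" where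
  "cylinder_curve C \<longleftrightarrow> (\<exists>r>0. C = {(r, u) | u. True})"

definition unduloid_curve :: "(real \<times> real) set \<Rightarrow> bool" where
  "unduloid_curve C \<longleftrightarrow> (\<exists>c \<tau> t1 (f::real \<Rightarrow> real).
     0 < \<tau> \<and> 0 < t1 \<and> t1 < \<tau> \<and>
     C2_on UNIV f \<and> (\<forall>u. 0 < f u \<and> f (- u) = f u \<and> f (u + 2 * \<tau>) = f u) \<and>
     \<not> f constant_on UNIV \<and>
     strict_mono_on {0<..<\<tau>} f \<and>
     strictly_convex_on {0<..<t1} f \<and> strictly_concave_on {t1<..<\<tau>} f \<and>
     C = {(f u, c + u) | u. True})"

definition periodic_graph :: "(real \<times> real) set \<Rightarrow> bool" where
  "periodic_graph C \<longleftrightarrow>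
     (\<exists>P>0. \<exists>f::real \<Rightarrow> real. (\<forall>u. f (u + P) = f u) \<and> C = {(f u, u) | u. True})"

definition locally_convex_curve :: "real set \<Rightarrow> (real \<Rightarrow> real \<times> real) \<Rightarrow> bool" where
  "locally_convex_curve I \<gamma> \<longleftrightarrow>
     (\<forall>s\<in>I. \<exists>J K. open J \<and> s \<in> J \<and> convex K \<and> \<gamma> ` (I \<inter> J) \<subseteq> frontier K)"

definition nodoid_curve ::
  "real set \<Rightarrow> (real \<Rightarrow> real) \<Rightarrow> (real \<Rightarrow> real) \<Rightarrow> (real \<Rightarrow> real) \<Rightarrow> bool" where
  "nodoid_curve I x t \<sigma> \<longleftrightarrow>
     I = UNIV \<and>
     locally_convex_curve UNIV (profile_curve x t) \<and>
     (strict_mono \<sigma> \<or> strict_mono (\<lambda>s. - \<sigma> s)) \<and>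
     (\<exists>m M. 0 < m \<and> (\<forall>s. m \<le> x s \<and> x s \<le> M)) \<and>
     (\<exists>d. d \<noteq> 0 \<and> (\<lambda>(r, u). (r, u + d)) ` range (profile_curve x t) = range (profile_curve x t)) \<and>
     (\<forall>s0. deriv x s0 = 0 \<longrightarrow>
        (\<lambda>(r, u). (r, 2 * t s0 - u)) ` range (profile_curve x t) = range (profile_curve x t)) \<and>
     \<not> embedding_on UNIV (profile_curve x t)"

end

theory Submission
  imports Defs
begin

text \<open>Write \<open>W\<close> for \<open>sqrt (x\<^sup>2 (sin \<sigma>)\<^sup>2 + (cos \<sigma>)\<^sup>2)\<close>, \<open>P\<close> for \<open>cos \<sigma> / W\<close> and \<open>y\<close> for \<open>x sin \<sigma> / W\<close>. Then
  \<open>P\<^sup>2 + y\<^sup>2 = 1\<close>, the horizontal unit normal at \<open>(x \<omega>, t)\<close> is \<open>- (P + y J) \<omega>\<close>, \<open>J\<close> being multiplication by \<open>\<i>\<close>, and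
  the conservation of energy reads \<open>P = PP x\<close>, where \<open>PP r = E / r ^ (2 n - 1) + H r\<close>. The system becomes
  \<open>x' = W y / x\<close>, \<open>t' = W P\<close>, \<open>y' = - P W PP' x / x\<close>. If \<open>E \<noteq> 0\<close>, then \<open>x\<close> is bounded below, so solutions are
  defined on the whole line, and the shape of the curve is read off from the signs of \<open>P\<close>, \<open>y\<close> and
  \<open>PP'\<close>, using that a solution is symmetric about each zero of \<open>y\<close>. If \<open>E = 0\<close>, the system is integrated
  explicitly, and near the axis the hypersurface is the graph of a \<open>C\<^sup>2\<close> function. The flip \<open>t \<mapsto> - t\<close>
  changes the signs of both \<open>E\<close> and \<open>H\<close>.\<close>

section \<open>Ordinary differential equations\<close>

text \<open>The system is the mean curvature equation in disguise: \<kappa>, the angular speed of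
  \<open>(P, y)\<close>, makes the divergence of the horizontal normal
  \<open>x \<kappa> / W - (2 n - 1) P / x\<close>, and the system says that this is
  \<open>- 2 n H\<close>. The energy is \<open>E = x ^ (2 n - 1) (P - H x)\<close> with
  \<open>\<bar>P\<bar> \<le> 1\<close>; this is the origin of \<open>PP\<close>. The right-hand side
  is singular only at \<open>x = 0\<close> and \<open>x\<close> has Lipschitz constant 1, so a
  maximal solution can end only where \<open>x\<close> has no positive lower bound, which a nonzero
  energy excludes. Periodicity needs no integration: reflections about two zeros of \<open>y\<close>
  compose to a translation. The work lies in producing a second zero for the unduloid, and for the
  nodoid in showing that the translation moves the curve along the axis although the curve turns
  back within half a period. At a pole the obstacle is the corner of \<open>\<bar>z\<bar>\<close> at
  0; it disappears because the gradient of the graph is a \<open>C^1\<close> multiple of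
  \<open>\<bar>z\<bar> z\<close>.\<close>

lemma picard_local_solution:
  fixes f :: "'a::euclidean_space \<Rightarrow> 'a"
  assumes lip: "L-lipschitz_on UNIV f" and h: "0 < h" "h * L \<le> 1 / 2"
  obtains Y where "Y 0 = y0"
    and "\<And>s. s \<in> {- h<..<h} \<Longrightarrow> (Y has_vector_derivative f (Y s)) (at s)"
proof -
  \<comment> \<open>Clamping time to \<open>{- h..h}\<close> lets the Picard operator act on bounded
    continuous functions on the whole line, which form a complete space.\<close>
  define cl where "cl s = max (- h) (min h s)" for s :: real
  have cl_in: "cl s \<in> {- h..h}" for s using h by (auto simp: cl_def)
  have cl_id: "cl s = s" if "s \<in> {- h..h}" for s using that by (auto simp: cl_def)
  have cont_cl: "continuous_on UNIV cl" unfolding cl_def by (intro continuous_intros)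
  have cont_f: "continuous_on S f" for S
    using lipschitz_on_continuous_on[OF lip] continuous_on_subset by blast
  \<comment> \<open>Subtracting the integral up to 0 makes the value at 0 equal to \<open>y0\<close>
    and treats times of both signs at once.\<close>
  define A where "A y s = y0 + (integral {- h..s} (\<lambda>r. f (apply_bcontfun y r))
                                - integral {- h..0} (\<lambda>r. f (apply_bcontfun y r)))" for y s
  have contfy: "continuous_on S (\<lambda>r. f (apply_bcontfun y r))" for y S
    by (rule continuous_on_compose2[OF cont_f[of UNIV]]) auto
  have A_deriv: "(A y has_vector_derivative f (apply_bcontfun y s)) (at s within {- h..h})"
    if "s \<in> {- h..h}" for y s
    unfolding A_def
    by (rule derivative_eq_intros integral_has_vector_derivative contfy that refl)+ simp
  have A_cont: "continuous_on {- h..h} (A y)" for y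
    unfolding continuous_on_eq_continuous_within
    using A_deriv has_vector_derivative_continuous by blast
  have A0: "A y 0 = y0" for y by (simp add: A_def)
  define \<Phi> where "\<Phi> y = Bcontfun (\<lambda>s. A y (cl s))" for y
  have bc: "(\<lambda>s. A y (cl s)) \<in> bcontfun" for y
  proof -
    have "continuous_on UNIV (\<lambda>s. A y (cl s))"
      by (rule continuous_on_compose2[OF A_cont cont_cl]) (use cl_in in auto)
    moreover have "bounded (range (\<lambda>s. A y (cl s)))"
      by (rule bounded_subset[OF compact_imp_bounded[OF compact_continuous_image[OF A_cont compact_Icc]]])
        (use cl_in in blast)
    ultimately show ?thesis by (simp add: bcontfun_def)
  qed
  have \<Phi>: "apply_bcontfun (\<Phi> y) s = A y (cl s)" for y s
    unfolding \<Phi>_def using Bcontfun_inverse[OF bc] by metis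
  have L0: "0 \<le> L" using lip by (rule lipschitz_on_nonneg)
  \<comment> \<open>Both images start at \<open>y0\<close> and their difference has derivative at
    most \<open>L * dist y z\<close>; over a time \<open>h\<close> with
    \<open>h * L \<le> 1 / 2\<close> this at least halves the distance.\<close>
  have contr: "dist (\<Phi> y) (\<Phi> z) \<le> (1 / 2) * dist y z" for y z
  proof (rule dist_bound)
    fix s
    define D where "D s = A y s - A z s" for s
    have D': "(D has_derivative (\<lambda>d. d *\<^sub>R (f (apply_bcontfun y r) - f (apply_bcontfun z r))))
                (at r within {- h..h})" if "r \<in> {- h..h}" for r
      unfolding D_def
      using has_vector_derivative_diff[OF A_deriv[OF that, of y] A_deriv[OF that, of z]]
      by (simp add: has_vector_derivative_def)
    have "norm (D (cl s) - D 0) \<le> (L * dist y z) * norm (cl s - 0)"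
    proof (rule differentiable_bound[OF convex_real_interval(5) D'])
      fix r assume "r \<in> {- h..h}"
      have "norm (f (apply_bcontfun y r) - f (apply_bcontfun z r)) \<le> L * dist y z"
        using lipschitz_onD[OF lip, of "apply_bcontfun y r" "apply_bcontfun z r"]
          mult_left_mono[OF dist_bounded[of y r z] L0]
        by (simp add: dist_norm)
      then show "onorm (\<lambda>d. d *\<^sub>R (f (apply_bcontfun y r) - f (apply_bcontfun z r))) \<le> L * dist y z"
        by (intro onorm_le) (simp add: mult.commute mult_left_mono)
    qed (use h cl_in in auto)
    also have "\<dots> \<le> (L * dist y z) * h"
      using cl_in[of s] L0 by (intro mult_left_mono) auto
    also have "\<dots> = (h * L) * dist y z" by simp
    also have "\<dots> \<le> (1 / 2) * dist y z" using h by (intro mult_right_mono) auto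
    finally show "dist (apply_bcontfun (\<Phi> y) s) (apply_bcontfun (\<Phi> z) s) \<le> (1 / 2) * dist y z"
      by (simp add: \<Phi> D_def A0 dist_norm)
  qed
  obtain y where y: "\<Phi> y = y"
    using banach_fix_type[of "1/2" \<Phi>] contr by auto
  define Y where "Y = apply_bcontfun y"
  have YA: "Y s = A y s" if "s \<in> {- h..h}" for s
    using \<Phi>[of y s] cl_id[OF that] y by (simp add: Y_def)
  have "(Y has_vector_derivative f (Y s)) (at s)" if s: "s \<in> {- h<..<h}" for s
  proof -
    have "(A y has_vector_derivative f (Y s)) (at s within {- h<..<h})"
      unfolding Y_def by (rule has_vector_derivative_within_subset[OF A_deriv]) (use s in auto)
    then have "(A y has_vector_derivative f (Y s)) (at s)"
      unfolding at_within_open[OF s open_greaterThanLessThan] .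
    then show ?thesis
      by (rule has_vector_derivative_transform_within_open[of _ _ _ "{- h<..<h}"])
        (use s YA in auto)
  qed
  moreover have "Y 0 = y0" using YA[of 0] h A0 by simp
  ultimately show ?thesis using that by blast
qed

text \<open>Gronwall's argument on the squared distance \<open>v\<close>: from
  \<open>\<bar>v'\<bar> \<le> 2 L v\<close>, the product of \<open>v\<close> with
  \<open>exp (- 2 L s)\<close> is nonincreasing and that with \<open>exp (2 L s)\<close>
  nondecreasing. Since \<open>v\<close> vanishes at \<open>s0\<close>, the first settles the later
  and the second the earlier parameters.\<close>

lemma lipschitz_ode_unique:
  fixes f :: "'a::euclidean_space \<Rightarrow> 'a"
  assumes lip: "L-lipschitz_on UNIV f" and int: "is_interval I" and s0: "s0 \<in> I" and s: "s \<in> I"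
    and Y: "\<And>s. s \<in> I \<Longrightarrow> (Y has_vector_derivative f (Y s)) (at s)"
    and Z: "\<And>s. s \<in> I \<Longrightarrow> (Z has_vector_derivative f (Z s)) (at s)"
    and eq: "Y s0 = Z s0"
  shows "Y s = Z s"
proof -
  define v where "v s = (Y s - Z s) \<bullet> (Y s - Z s)" for s
  define v' where "v' s = 2 * ((Y s - Z s) \<bullet> (f (Y s) - f (Z s)))" for s
  have v: "(v has_real_derivative v' s) (at s)" if "s \<in> I" for s
  proof -
    have D: "((\<lambda>s. Y s - Z s) has_derivative (\<lambda>d. d *\<^sub>R (f (Y s) - f (Z s)))) (at s)"
      using has_vector_derivative_diff[OF Y[OF that] Z[OF that]]
      by (simp add: has_vector_derivative_def)
    show ?thesis
      unfolding v_def v'_def has_field_derivative_def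
      by (rule has_derivative_eq_rhs[OF has_derivative_inner[OF D D]])
        (simp add: inner_commute fun_eq_iff)
  qed
  have bnd: "\<bar>v' s\<bar> \<le> 2 * L * v s" for s
  proof -
    have "\<bar>(Y s - Z s) \<bullet> (f (Y s) - f (Z s))\<bar> \<le> norm (Y s - Z s) * norm (f (Y s) - f (Z s))"
      by (rule Cauchy_Schwarz_ineq2)
    also have "\<dots> \<le> norm (Y s - Z s) * (L * norm (Y s - Z s))"
      using lipschitz_onD[OF lip, of "Y s" "Z s"] by (intro mult_left_mono) (auto simp: dist_norm)
    also have "\<dots> = L * v s" by (simp add: v_def power2_norm_eq_inner[symmetric] power2_eq_square)
    finally show ?thesis by (simp add: v'_def abs_mult)
  qed
  have sub: "{min s0 s..max s0 s} \<subseteq> I"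
    using mem_is_interval_1_I[OF int s0 s] mem_is_interval_1_I[OF int s s0]
    by (cases "s0 \<le> s") auto
  have v0: "v s0 = 0" by (simp add: v_def eq)
  have "v s \<le> 0"
  proof (cases "s0 \<le> s")
    case True
    define g where "g r = v r * exp (- 2 * L * r)" for r
    have "g s \<le> g s0"
    proof (rule DERIV_nonpos_imp_nonincreasing[where f = g and a = s0 and b = s])
      fix r assume "s0 \<le> r" "r \<le> s"
      then have "r \<in> I" using sub True by auto
      from v[OF this] have "(g has_real_derivative (v' r - 2 * L * v r) * exp (- 2 * L * r)) (at r)"
        unfolding g_def by (auto intro!: derivative_eq_intros simp: algebra_simps)
      moreover have "(v' r - 2 * L * v r) * exp (- 2 * L * r) \<le> 0"
        using bnd[of r] by (intro mult_nonpos_nonneg) auto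
      ultimately show "\<exists>y. (g has_real_derivative y) (at r) \<and> y \<le> 0"
        by blast
    qed (use True in simp)
    then have "v s * exp (- 2 * L * s) \<le> 0" unfolding g_def v0 by simp
    then show ?thesis using exp_gt_zero[of "- 2 * L * s"] by (simp only: mult_le_0_iff) linarith
  next
    case False
    define g where "g r = v r * exp (2 * L * r)" for r
    have "g s \<le> g s0"
    proof (rule DERIV_nonneg_imp_nondecreasing[where f = g and a = s and b = s0])
      fix r assume "s \<le> r" "r \<le> s0"
      then have "r \<in> I" using sub False by auto
      from v[OF this] have "(g has_real_derivative (v' r + 2 * L * v r) * exp (2 * L * r)) (at r)"
        unfolding g_def by (auto intro!: derivative_eq_intros simp: algebra_simps)
      moreover have "(v' r + 2 * L * v r) * exp (2 * L * r) \<ge> 0"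
        using bnd[of r] by (intro mult_nonneg_nonneg) auto
      ultimately show "\<exists>y. (g has_real_derivative y) (at r) \<and> 0 \<le> y"
        by blast
    qed (use False in simp)
    then have "v s * exp (2 * L * s) \<le> 0" unfolding g_def v0 by simp
    then show ?thesis using exp_gt_zero[of "2 * L * s"] by (simp only: mult_le_0_iff) linarith
  qed
  then have "(Y s - Z s) \<bullet> (Y s - Z s) = 0" unfolding v_def by (metis antisym inner_ge_zero)
  then show ?thesis by simp
qed

text \<open>The boundedness makes this class of functions closed under products.\<close>

definition bounded_lipschitz_on :: "'a::metric_space set \<Rightarrow> ('a \<Rightarrow> real) \<Rightarrow> bool" where
  "bounded_lipschitz_on D f \<longleftrightarrow> (\<exists>B L. 0 \<le> L \<and>
     (\<forall>p\<in>D. \<bar>f p\<bar> \<le> B) \<and> (\<forall>p\<in>D. \<forall>q\<in>D. \<bar>f p - f q\<bar> \<le> L * dist p q))"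

lemma bounded_lipschitz_onI:
  assumes "0 \<le> L" "\<And>p. p \<in> D \<Longrightarrow> \<bar>f p\<bar> \<le> B"
    "\<And>p q. p \<in> D \<Longrightarrow> q \<in> D \<Longrightarrow> \<bar>f p - f q\<bar> \<le> L * dist p q"
  shows "bounded_lipschitz_on D f"
  using assms unfolding bounded_lipschitz_on_def by blast

lemma bounded_lipschitz_onE:
  assumes "bounded_lipschitz_on D f"
  obtains B L where "0 \<le> L" "0 \<le> B" "\<And>p. p \<in> D \<Longrightarrow> \<bar>f p\<bar> \<le> B"
    "\<And>p q. p \<in> D \<Longrightarrow> q \<in> D \<Longrightarrow> \<bar>f p - f q\<bar> \<le> L * dist p q"
proof -
  from assms obtain B L where "0 \<le> L" "\<forall>p\<in>D. \<bar>f p\<bar> \<le> B" "\<forall>p\<in>D. \<forall>q\<in>D. \<bar>f p - f q\<bar> \<le> L * dist p q"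
    unfolding bounded_lipschitz_on_def by blast
  then show ?thesis using that[of L "max B 0"] by force
qed

lemma bounded_lipschitz_on_const: "bounded_lipschitz_on D (\<lambda>_. c)"
  by (rule bounded_lipschitz_onI[of 0 _ _ "\<bar>c\<bar>"]) auto

lemma bounded_lipschitz_on_add:
  assumes "bounded_lipschitz_on D f" "bounded_lipschitz_on D g"
  shows "bounded_lipschitz_on D (\<lambda>p. f p + g p)"
proof -
  from assms(1) obtain B L where f: "0 \<le> L" "\<And>p. p \<in> D \<Longrightarrow> \<bar>f p\<bar> \<le> B"
    "\<And>p q. p \<in> D \<Longrightarrow> q \<in> D \<Longrightarrow> \<bar>f p - f q\<bar> \<le> L * dist p q" by (rule bounded_lipschitz_onE) blast
  from assms(2) obtain B' L' where g: "0 \<le> L'" "\<And>p. p \<in> D \<Longrightarrow> \<bar>g p\<bar> \<le> B'"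
    "\<And>p q. p \<in> D \<Longrightarrow> q \<in> D \<Longrightarrow> \<bar>g p - g q\<bar> \<le> L' * dist p q" by (rule bounded_lipschitz_onE) blast
  show ?thesis
  proof (rule bounded_lipschitz_onI[of "L + L'" _ _ "B + B'"])
    fix p q assume "p \<in> D" "q \<in> D"
    then show "\<bar>f p + g p - (f q + g q)\<bar> \<le> (L + L') * dist p q"
      using f(3)[of p q] g(3)[of p q] by (auto simp: distrib_right)
  next
    fix p assume "p \<in> D"
    then show "\<bar>f p + g p\<bar> \<le> B + B'" using f(2)[of p] g(2)[of p] by linarith
  qed (use f(1) g(1) in linarith)
qed

lemma bounded_lipschitz_on_mult:
  assumes "bounded_lipschitz_on D f" "bounded_lipschitz_on D g"
  shows "bounded_lipschitz_on D (\<lambda>p. f p * g p)"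
proof -
  from assms(1) obtain B L where f: "0 \<le> L" "0 \<le> B" "\<And>p. p \<in> D \<Longrightarrow> \<bar>f p\<bar> \<le> B"
    "\<And>p q. p \<in> D \<Longrightarrow> q \<in> D \<Longrightarrow> \<bar>f p - f q\<bar> \<le> L * dist p q" by (rule bounded_lipschitz_onE) blast
  from assms(2) obtain B' L' where g: "0 \<le> L'" "0 \<le> B'" "\<And>p. p \<in> D \<Longrightarrow> \<bar>g p\<bar> \<le> B'"
    "\<And>p q. p \<in> D \<Longrightarrow> q \<in> D \<Longrightarrow> \<bar>g p - g q\<bar> \<le> L' * dist p q" by (rule bounded_lipschitz_onE) blast
  show ?thesis
  proof (rule bounded_lipschitz_onI[of "L * B' + B * L'" _ _ "B * B'"])
    fix p assume "p \<in> D"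
    then show "\<bar>f p * g p\<bar> \<le> B * B'" using f g by (auto simp: abs_mult intro!: mult_mono)
  next
    fix p q assume pq: "p \<in> D" "q \<in> D"
    have "\<bar>f p * g p - f q * g q\<bar> = \<bar>(f p - f q) * g p + f q * (g p - g q)\<bar>"
      by (simp add: algebra_simps)
    also have "\<dots> \<le> \<bar>f p - f q\<bar> * \<bar>g p\<bar> + \<bar>f q\<bar> * \<bar>g p - g q\<bar>"
      by (metis abs_mult abs_triangle_ineq)
    also have "\<dots> \<le> (L * dist p q) * B' + B * (L' * dist p q)"
      using f g pq by (intro add_mono mult_mono) auto
    finally show "\<bar>f p * g p - f q * g q\<bar> \<le> (L * B' + B * L') * dist p q"
      by (simp add: algebra_simps)
  qed (use f g in auto)
qed

lemma bounded_lipschitz_on_power: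
  "bounded_lipschitz_on D f \<Longrightarrow> bounded_lipschitz_on D (\<lambda>p. f p ^ k)"
  by (induction k) (auto intro: bounded_lipschitz_on_const bounded_lipschitz_on_mult)

lemma bounded_lipschitz_on_compose:
  assumes "bounded_lipschitz_on D f" and g: "bounded_lipschitz_on D' g"
    and "\<And>p. p \<in> D \<Longrightarrow> f p \<in> D'"
  shows "bounded_lipschitz_on D (\<lambda>p. g (f p))"
proof -
  from assms(1) obtain B L where f: "0 \<le> L" "0 \<le> B" "\<And>p. p \<in> D \<Longrightarrow> \<bar>f p\<bar> \<le> B"
    "\<And>p q. p \<in> D \<Longrightarrow> q \<in> D \<Longrightarrow> \<bar>f p - f q\<bar> \<le> L * dist p q" by (rule bounded_lipschitz_onE) blast
  from assms(2) obtain B' L' where g: "0 \<le> L'" "0 \<le> B'" "\<And>p. p \<in> D' \<Longrightarrow> \<bar>g p\<bar> \<le> B'"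
    "\<And>p q. p \<in> D' \<Longrightarrow> q \<in> D' \<Longrightarrow> \<bar>g p - g q\<bar> \<le> L' * dist p q" by (rule bounded_lipschitz_onE) blast
  show ?thesis
  proof (rule bounded_lipschitz_onI[of "L' * L" _ _ B'])
    fix p q assume pq: "p \<in> D" "q \<in> D"
    then have "\<bar>g (f p) - g (f q)\<bar> \<le> L' * dist (f p) (f q)" using g assms(3) by blast
    also have "\<dots> \<le> L' * (L * dist p q)" using f(4)[OF pq] g(1) by (auto simp: dist_real_def intro: mult_left_mono)
    finally show "\<bar>g (f p) - g (f q)\<bar> \<le> L' * L * dist p q" by simp
  qed (use f g assms(3) in auto)
qed

lemma bounded_lipschitz_on_inverse:
  assumes "0 < m" shows "bounded_lipschitz_on {m..} (\<lambda>r::real. inverse r)"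
proof (rule bounded_lipschitz_onI[of "inverse (m * m)" _ _ "inverse m"])
  fix p q assume pq: "p \<in> {m..}" "q \<in> {m..}"
  then have "\<bar>inverse p - inverse q\<bar> = dist p q * inverse (p * q)"
    using assms by (simp add: field_simps dist_real_def abs_divide abs_mult abs_minus_commute)
  also have "\<dots> \<le> dist p q * inverse (m * m)"
    using pq assms by (intro mult_left_mono le_imp_inverse_le mult_mono) auto
  finally show "\<bar>inverse p - inverse q\<bar> \<le> inverse (m * m) * dist p q" by (simp add: mult.commute)
qed (use assms in \<open>auto simp: field_simps\<close>)

lemma bounded_lipschitz_on_sqrt:
  assumes "0 < m" shows "bounded_lipschitz_on {m..M} sqrt"
proof (rule bounded_lipschitz_onI[of "inverse (sqrt m)" _ _ "sqrt M"])
  fix p q assume pq: "p \<in> {m..M}" "q \<in> {m..M}"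
  then have s: "sqrt m \<le> sqrt p" "sqrt m \<le> sqrt q" "0 < sqrt m" using assms by auto
  have "p - q = (sqrt p - sqrt q) * (sqrt p + sqrt q)"
    using pq assms by (simp add: algebra_simps)
  then have "dist p q = \<bar>sqrt p - sqrt q\<bar> * (sqrt p + sqrt q)"
    using s by (simp add: dist_real_def abs_mult)
  moreover have "\<bar>sqrt p - sqrt q\<bar> * sqrt m \<le> \<bar>sqrt p - sqrt q\<bar> * (sqrt p + sqrt q)"
    by (rule mult_left_mono) (use s in linarith, simp)
  ultimately show "\<bar>sqrt p - sqrt q\<bar> \<le> inverse (sqrt m) * dist p q"
    using s by (simp add: field_simps)
qed (use assms in auto)

section \<open>The profile system\<close>

text \<open>The power 3/2 is written as the cube of a square root, so that the expression is built
  by sums and products from functions that are bounded and Lipschitz once the radius is bounded away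
  from 0 and infinity.\<close>

definition profile_rhs :: "nat \<Rightarrow> real \<Rightarrow> real \<Rightarrow> real \<Rightarrow> real" where
  "profile_rhs n H r \<theta> =
     (2 * real n - 1) * cos \<theta> ^ 3 / r ^ 3 + 2 * (real n - 1) * ((sin \<theta>)\<^sup>2 * cos \<theta>) / r
     - 2 * real n * H * (sqrt (r\<^sup>2 * (sin \<theta>)\<^sup>2 + (cos \<theta>)\<^sup>2) ^ 3 / r\<^sup>2)"

text \<open>The weight is the convex combination of \<open>r^2\<close> and 1 with coefficients
  \<open>(sin \<theta>)^2\<close> and \<open>(cos \<theta>)^2\<close>.\<close>

lemma profile_weight_bounds:
  fixes r \<theta> :: real
  assumes "0 < m" "m \<le> r" "r \<le> M"
  shows "min (m\<^sup>2) 1 \<le> r\<^sup>2 * (sin \<theta>)\<^sup>2 + (cos \<theta>)\<^sup>2"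
    and "r\<^sup>2 * (sin \<theta>)\<^sup>2 + (cos \<theta>)\<^sup>2 \<le> max (M\<^sup>2) 1"
proof -
  have r: "m\<^sup>2 \<le> r\<^sup>2" "r\<^sup>2 \<le> M\<^sup>2" using assms by (auto intro: power_mono)
  have one: "(sin \<theta>)\<^sup>2 + (cos \<theta>)\<^sup>2 = 1" by simp
  have "min (m\<^sup>2) 1 * (sin \<theta>)\<^sup>2 + min (m\<^sup>2) 1 * (cos \<theta>)\<^sup>2 \<le> r\<^sup>2 * (sin \<theta>)\<^sup>2 + 1 * (cos \<theta>)\<^sup>2"
    using r by (intro add_mono mult_right_mono) auto
  then show "min (m\<^sup>2) 1 \<le> r\<^sup>2 * (sin \<theta>)\<^sup>2 + (cos \<theta>)\<^sup>2"
    by (simp add: distrib_left[symmetric])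
  have "r\<^sup>2 * (sin \<theta>)\<^sup>2 + 1 * (cos \<theta>)\<^sup>2 \<le> max (M\<^sup>2) 1 * (sin \<theta>)\<^sup>2 + max (M\<^sup>2) 1 * (cos \<theta>)\<^sup>2"
    using r by (intro add_mono mult_right_mono) auto
  then show "r\<^sup>2 * (sin \<theta>)\<^sup>2 + (cos \<theta>)\<^sup>2 \<le> max (M\<^sup>2) 1"
    by (simp add: distrib_left[symmetric])
qed

lemma profile_weight_pos: "0 < r \<Longrightarrow> 0 < r\<^sup>2 * (sin \<theta>)\<^sup>2 + (cos \<theta>)\<^sup>2" for r \<theta> :: real
  by (rule less_le_trans[OF _ profile_weight_bounds(1)[of r r r \<theta>]]) auto

lemma powr_three_halves: "0 < a \<Longrightarrow> a powr (3 / 2) = sqrt a ^ 3"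
proof -
  assume a: "0 < a"
  have "a powr (3 / 2) = (a powr (1 / 2)) powr 3" by (simp add: powr_powr)
  also have "\<dots> = sqrt a powr 3" using a by (simp add: powr_half_sqrt)
  also have "\<dots> = sqrt a ^ 3" using a powr_realpow[of "sqrt a" 3] by simp
  finally show ?thesis .
qed

lemma profile_solution_iff:
  "profile_solution n H I x t \<sigma> \<longleftrightarrow>
     open I \<and> is_interval I \<and> I \<noteq> {} \<and>
     (\<forall>s\<in>I. x s > 0 \<and> (x has_real_derivative sin (\<sigma> s)) (at s) \<and>
        (t has_real_derivative cos (\<sigma> s)) (at s) \<and>
        (\<sigma> has_real_derivative profile_rhs n H (x s) (\<sigma> s)) (at s))"
proof -
  have "(2 * real n - 1) * cos (\<sigma> s) ^ 3 / x s ^ 3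
            + 2 * (real n - 1) * ((sin (\<sigma> s))\<^sup>2 * cos (\<sigma> s)) / x s
            - 2 * real n * H * (((x s)\<^sup>2 * (sin (\<sigma> s))\<^sup>2 + (cos (\<sigma> s))\<^sup>2) powr (3 / 2) / (x s)\<^sup>2)
        = profile_rhs n H (x s) (\<sigma> s)" if "x s > 0" for s
    using powr_three_halves[OF profile_weight_pos[OF that, of "\<sigma> s"]] by (simp add: profile_rhs_def)
  then show ?thesis unfolding profile_solution_def by (metis (no_types, lifting))
qed

lemma profile_solution_subset:
  assumes "profile_solution n H I x t \<sigma>" "J \<subseteq> I" "open J" "is_interval J" "J \<noteq> {}"
  shows "profile_solution n H J x t \<sigma>"
  using assms by (simp add: profile_solution_def subset_eq)

text \<open>Clamping the radius to \<open>[m, M]\<close> before evaluating the singular right-hand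
  side gives a globally Lipschitz field, which agrees with the system as long as the radius stays in
  \<open>[m, M]\<close>.\<close>

definition clamped_field :: "nat \<Rightarrow> real \<Rightarrow> real \<Rightarrow> real \<Rightarrow> real \<times> real \<times> real \<Rightarrow> real \<times> real \<times> real" where
  "clamped_field n H m M = (\<lambda>(r, u, \<theta>). (sin \<theta>, cos \<theta>, profile_rhs n H (max m (min M r)) \<theta>))"

lemma clamped_field_lipschitz:
  assumes m: "0 < m" "m \<le> M"
  obtains L where "L-lipschitz_on UNIV (clamped_field n H m M)"
proof -
  define cx where "cx p = max m (min M (fst p))" for p :: "real \<times> real \<times> real"
  define sn where "sn p = sin (snd (snd p))" for p :: "real \<times> real \<times> real"
  define cs where "cs p = cos (snd (snd p))" for p :: "real \<times> real \<times> real"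
  have cx_in: "m \<le> cx p" "cx p \<le> M" for p using m by (auto simp: cx_def)
  have d1: "\<bar>fst p - fst q\<bar> \<le> dist p q" for p q :: "real \<times> real \<times> real"
    using dist_fst_le[of p q] by (simp add: dist_real_def)
  have d2: "\<bar>snd (snd p) - snd (snd q)\<bar> \<le> dist p q" for p q :: "real \<times> real \<times> real"
    using dist_snd_le[of "snd p" "snd q"] dist_snd_le[of p q] by (simp add: dist_real_def)
  have bx: "bounded_lipschitz_on UNIV cx"
  proof (rule bounded_lipschitz_onI[of 1 _ _ M])
    show "\<bar>cx p - cx q\<bar> \<le> 1 * dist p q" for p q using d1[of p q] unfolding cx_def by linarith
    show "\<bar>cx p\<bar> \<le> M" for p using cx_in[of p] m by linarith
  qed auto
  have lip_sin: "\<bar>sin a - sin b\<bar> \<le> \<bar>a - b\<bar>" for a b :: real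
    using field_differentiable_bound[of UNIV sin cos 1 a b] by (auto intro: DERIV_sin)
  have lip_cos: "\<bar>cos a - cos b\<bar> \<le> \<bar>a - b\<bar>" for a b :: real
    using lip_sin[of "a + pi / 2" "b + pi / 2"] by (simp add: sin_add)
  have bs: "bounded_lipschitz_on UNIV sn"
  proof (rule bounded_lipschitz_onI[of 1 _ _ 1])
    show "\<bar>sn p - sn q\<bar> \<le> 1 * dist p q" for p q
      using d2[of p q] lip_sin unfolding sn_def by (metis mult_1 order_trans)
  qed (auto simp: sn_def)
  have bc: "bounded_lipschitz_on UNIV cs"
  proof (rule bounded_lipschitz_onI[of 1 _ _ 1])
    show "\<bar>cs p - cs q\<bar> \<le> 1 * dist p q" for p q
      using d2[of p q] lip_cos unfolding cs_def by (metis mult_1 order_trans)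
  qed (auto simp: cs_def)
  have bi: "bounded_lipschitz_on UNIV (\<lambda>p. inverse (cx p))"
    by (rule bounded_lipschitz_on_compose[OF bx bounded_lipschitz_on_inverse[OF m(1)]]) (use cx_in in auto)
  have bw: "bounded_lipschitz_on UNIV (\<lambda>p. cx p ^ 2 * sn p ^ 2 + cs p ^ 2)"
    by (intro bounded_lipschitz_on_add bounded_lipschitz_on_mult bounded_lipschitz_on_power bx bs bc)
  have m2: "0 < min (m\<^sup>2) 1" using m by simp
  have bq: "bounded_lipschitz_on UNIV (\<lambda>p. sqrt (cx p ^ 2 * sn p ^ 2 + cs p ^ 2))"
    by (rule bounded_lipschitz_on_compose[OF bw bounded_lipschitz_on_sqrt[OF m2, of "max (M\<^sup>2) 1"]])
      (use profile_weight_bounds[OF m(1) cx_in] in \<open>auto simp: sn_def cs_def\<close>)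
  have rhs_eq: "profile_rhs n H (cx p) (snd (snd p)) =
      (2 * real n - 1) * (cs p ^ 3 * inverse (cx p) ^ 3)
      + (2 * (real n - 1)) * ((sn p ^ 2 * cs p) * inverse (cx p))
      + (- 2 * real n * H) * (sqrt (cx p ^ 2 * sn p ^ 2 + cs p ^ 2) ^ 3 * inverse (cx p) ^ 2)" for p
    unfolding profile_rhs_def sn_def cs_def by (simp add: divide_inverse power_inverse)
  have br: "bounded_lipschitz_on UNIV (\<lambda>p. profile_rhs n H (cx p) (snd (snd p)))"
    unfolding rhs_eq
    by (intro bounded_lipschitz_on_add bounded_lipschitz_on_mult bounded_lipschitz_on_power
        bounded_lipschitz_on_const bs bc bi bq)
  have F: "clamped_field n H m M p = (sn p, cs p, profile_rhs n H (cx p) (snd (snd p)))" for p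
    by (simp add: clamped_field_def sn_def cs_def cx_def split: prod.split)
  obtain L1 where L1: "0 \<le> L1" "\<And>p q. \<bar>sn p - sn q\<bar> \<le> L1 * dist p q"
    using bounded_lipschitz_onE[OF bs] by (metis UNIV_I)
  obtain L2 where L2: "0 \<le> L2" "\<And>p q. \<bar>cs p - cs q\<bar> \<le> L2 * dist p q"
    using bounded_lipschitz_onE[OF bc] by (metis UNIV_I)
  obtain L3 where L3: "0 \<le> L3" "\<And>p q. \<bar>profile_rhs n H (cx p) (snd (snd p))
      - profile_rhs n H (cx q) (snd (snd q))\<bar> \<le> L3 * dist p q"
    using bounded_lipschitz_onE[OF br] by (metis UNIV_I)
  have "(L1 + (L2 + L3))-lipschitz_on UNIV (clamped_field n H m M)"
  proof (rule lipschitz_onI)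
    fix p q
    have "dist (clamped_field n H m M p) (clamped_field n H m M q)
        \<le> \<bar>sn p - sn q\<bar> + (\<bar>cs p - cs q\<bar> + \<bar>profile_rhs n H (cx p) (snd (snd p))
            - profile_rhs n H (cx q) (snd (snd q))\<bar>)"
    proof -
      have "norm (a, b, c) \<le> \<bar>a\<bar> + (\<bar>b\<bar> + \<bar>c\<bar>)" for a b c :: real
        using norm_Pair_le[of a "(b, c)"] norm_Pair_le[of b c] by simp
      then show ?thesis unfolding F dist_norm by simp
    qed
    also have "\<dots> \<le> L1 * dist p q + (L2 * dist p q + L3 * dist p q)"
      using L1 L2 L3 by (intro add_mono) auto
    finally show "dist (clamped_field n H m M p) (clamped_field n H m M q) \<le> (L1 + (L2 + L3)) * dist p q"
      by (simp add: distrib_right)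
  qed (use L1 L2 L3 in auto)
  then show ?thesis by (rule that)
qed

lemma derivative_bound_interval:
  fixes f f' :: "real \<Rightarrow> real"
  assumes "is_interval I" "\<And>s. s \<in> I \<Longrightarrow> (f has_real_derivative f' s) (at s)"
    "\<And>s. s \<in> I \<Longrightarrow> \<bar>f' s\<bar> \<le> B" "a \<in> I" "b \<in> I"
  shows "\<bar>f a - f b\<bar> \<le> B * \<bar>a - b\<bar>"
proof -
  have "norm (f a - f b) \<le> B * norm (a - b)"
  proof (rule field_differentiable_bound)
    show "convex I" using assms(1) by (simp add: is_interval_convex)
    show "(f has_field_derivative f' s) (at s within I)" if "s \<in> I" for s
      by (rule has_field_derivative_at_within[OF assms(2)[OF that]])
  qed (use assms in auto)
  then show ?thesis by simp
qed

text \<open>The existence time depends only on \<open>m\<close> and \<open>M\<close>. As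
  \<open>\<bar>x'\<bar> \<le> 1\<close> and \<open>h \<le> m / 2\<close>, a solution of the clamped
  system started in \<open>[m, M]\<close> stays in \<open>[m / 2, M + m]\<close>, where the clamping
  has no effect.\<close>

lemma profile_local_existence:
  assumes m: "0 < m"
  obtains h where "0 < h"
    "\<And>x0 t0 \<sigma>0 s1. m \<le> x0 \<Longrightarrow> x0 \<le> M \<Longrightarrow> \<exists>x t \<sigma>. profile_solution n H {s1 - h<..<s1 + h} x t \<sigma> \<and>
       x s1 = x0 \<and> t s1 = t0 \<and> \<sigma> s1 = \<sigma>0"
proof (cases "m \<le> M")
  case False
  then show ?thesis using that[of 1] by force
next
  case True
  obtain L where L: "L-lipschitz_on UNIV (clamped_field n H (m / 2) (M + m))"
    using clamped_field_lipschitz[of "m / 2" "M + m" n H] m True by force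
  have L0: "0 \<le> L" using L by (rule lipschitz_on_nonneg)
  \<comment> \<open>The first bound confines the radius, the second gives
    \<open>h * L \<le> 1 / 2\<close>; \<open>L + 1\<close> keeps the denominator positive when
    \<open>L = 0\<close>.\<close>
  define h where "h = min (m / 2) (1 / (2 * (L + 1)))"
  have h: "0 < h" "h \<le> m / 2" using m L0 by (auto simp: h_def)
  have "h * L \<le> 1 / (2 * (L + 1)) * L" using L0 by (intro mult_right_mono) (auto simp: h_def)
  also have "\<dots> \<le> 1 / 2" using L0 by (simp add: field_simps)
  finally have hL: "h * L \<le> 1 / 2" .
  have "\<exists>x t \<sigma>. profile_solution n H {s1 - h<..<s1 + h} x t \<sigma> \<and> x s1 = x0 \<and> t s1 = t0 \<and> \<sigma> s1 = \<sigma>0"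
    if x0: "m \<le> x0" "x0 \<le> M" for x0 t0 \<sigma>0 s1 :: real
  proof -
    obtain Y where Y0: "Y 0 = (x0, t0, \<sigma>0)" and Y:
      "\<And>s. s \<in> {- h<..<h} \<Longrightarrow> (Y has_vector_derivative clamped_field n H (m / 2) (M + m) (Y s)) (at s)"
      using picard_local_solution[OF L h(1) hL, of "(x0, t0, \<sigma>0)"] by blast
    define X where "X s = fst (Y s)" for s
    define U where "U s = fst (snd (Y s))" for s
    define S where "S s = snd (snd (Y s))" for s
    have Yeq: "Y s = (X s, U s, S s)" for s by (simp add: X_def U_def S_def)
    have D: "(X has_real_derivative sin (S s)) (at s)" "(U has_real_derivative cos (S s)) (at s)"
      "(S has_real_derivative profile_rhs n H (max (m / 2) (min (M + m) (X s))) (S s)) (at s)"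
      if "s \<in> {- h<..<h}" for s
    proof -
      let ?F = "clamped_field n H (m / 2) (M + m) (Y s)"
      note Y' = Y[OF that]
      have "(X has_vector_derivative fst ?F) (at s)"
        unfolding X_def using bounded_linear.has_vector_derivative[OF bounded_linear_fst Y'] by simp
      then show "(X has_real_derivative sin (S s)) (at s)"
        by (simp add: has_real_derivative_iff_has_vector_derivative clamped_field_def Yeq)
      have "(U has_vector_derivative fst (snd ?F)) (at s)"
        unfolding U_def
        using bounded_linear.has_vector_derivative[OF bounded_linear_fst
            bounded_linear.has_vector_derivative[OF bounded_linear_snd Y']] by simp
      then show "(U has_real_derivative cos (S s)) (at s)"
        by (simp add: has_real_derivative_iff_has_vector_derivative clamped_field_def Yeq)
      have "(S has_vector_derivative snd (snd ?F)) (at s)"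
        unfolding S_def
        using bounded_linear.has_vector_derivative[OF bounded_linear_snd
            bounded_linear.has_vector_derivative[OF bounded_linear_snd Y']] by simp
      then show "(S has_real_derivative profile_rhs n H (max (m / 2) (min (M + m) (X s))) (S s)) (at s)"
        by (simp add: has_real_derivative_iff_has_vector_derivative clamped_field_def Yeq)
    qed
    have Xb: "m / 2 \<le> X s \<and> X s \<le> M + m" if s: "s \<in> {- h<..<h}" for s
    proof -
      have "\<bar>X s - X 0\<bar> \<le> 1 * \<bar>s - 0\<bar>"
        by (rule derivative_bound_interval[of "{- h<..<h}" X "\<lambda>s. sin (S s)"]) (use D s h in auto)
      then show ?thesis using s h x0 Y0 by (auto simp: X_def)
    qed
    have "profile_solution n H {s1 - h<..<s1 + h} (\<lambda>s. X (s - s1)) (\<lambda>s. U (s - s1)) (\<lambda>s. S (s - s1))"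
      unfolding profile_solution_iff
    proof (intro conjI ballI)
      fix s assume "s \<in> {s1 - h<..<s1 + h}"
      then have s: "s - s1 \<in> {- h<..<h}" by auto
      have sh: "((\<lambda>s. s - s1) has_real_derivative 1) (at s)" by (auto intro!: derivative_eq_intros)
      show "0 < X (s - s1)" using Xb[OF s] m by auto
      show "((\<lambda>s. X (s - s1)) has_real_derivative sin (S (s - s1))) (at s)"
        using DERIV_chain2[OF D(1)[OF s] sh] by simp
      show "((\<lambda>s. U (s - s1)) has_real_derivative cos (S (s - s1))) (at s)"
        using DERIV_chain2[OF D(2)[OF s] sh] by simp
      have "max (m / 2) (min (M + m) (X (s - s1))) = X (s - s1)" using Xb[OF s] by auto
      then show "((\<lambda>s. S (s - s1)) has_real_derivative profile_rhs n H (X (s - s1)) (S (s - s1))) (at s)"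
        using DERIV_chain2[OF D(3)[OF s] sh] by simp
    qed (use h in \<open>auto simp: is_interval_oo\<close>)
    moreover have "X (s1 - s1) = x0" "U (s1 - s1) = t0" "S (s1 - s1) = \<sigma>0"
      using Y0 by (simp_all add: X_def U_def S_def)
    ultimately show ?thesis by blast
  qed
  then show ?thesis using h(1) that by blast
qed

section \<open>Uniqueness and continuation of profile solutions\<close>

lemma profile_solution_clamped:
  assumes "profile_solution n H I x t \<sigma>" "s \<in> I" "m \<le> x s" "x s \<le> M"
  shows "((\<lambda>s. (x s, t s, \<sigma> s)) has_vector_derivative clamped_field n H m M (x s, t s, \<sigma> s)) (at s)"
proof -
  have "max m (min M (x s)) = x s" using assms by auto
  then show ?thesis
    using assms unfolding profile_solution_iff clamped_field_def
    by (auto intro!: has_vector_derivative_Pair simp: has_real_derivative_iff_has_vector_derivative)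
qed

text \<open>On the compact interval between \<open>s0\<close> and \<open>s\<close> both radii have
  positive minima and finite maxima, so there both solutions solve one and the same clamped,
  globally Lipschitz system.\<close>

lemma profile_solution_unique:
  assumes sol: "profile_solution n H I x t \<sigma>" and sol1: "profile_solution n H I x1 t1 \<sigma>1"
    and s0: "s0 \<in> I" and s: "s \<in> I" and eq: "x s0 = x1 s0" "t s0 = t1 s0" "\<sigma> s0 = \<sigma>1 s0"
  shows "x s = x1 s" "t s = t1 s" "\<sigma> s = \<sigma>1 s"
proof -
  define K where "K = {min s0 s..max s0 s}"
  have int: "is_interval I" using sol by (simp add: profile_solution_def)
  have K: "K \<subseteq> I" unfolding K_def
    using mem_is_interval_1_I[OF int s0 s] mem_is_interval_1_I[OF int s s0]
    by (cases "s0 \<le> s") auto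
  have cK: "compact K" "K \<noteq> {}" "is_interval K" "s0 \<in> K" "s \<in> K" by (auto simp: K_def is_interval_cc)
  have cont: "continuous_on K x" "continuous_on K x1"
    using sol sol1 K unfolding profile_solution_def
    by (meson DERIV_isCont continuous_at_imp_continuous_on subsetD)+
  obtain a where a: "a \<in> K" "\<forall>s\<in>K. x a \<le> x s" using continuous_attains_inf[OF cK(1,2) cont(1)] by blast
  obtain a1 where a1: "a1 \<in> K" "\<forall>s\<in>K. x1 a1 \<le> x1 s" using continuous_attains_inf[OF cK(1,2) cont(2)] by blast
  obtain b where b: "b \<in> K" "\<forall>s\<in>K. x s \<le> x b" using continuous_attains_sup[OF cK(1,2) cont(1)] by blast
  obtain b1 where b1: "b1 \<in> K" "\<forall>s\<in>K. x1 s \<le> x1 b1" using continuous_attains_sup[OF cK(1,2) cont(2)] by blast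
  define m where "m = min (x a) (x1 a1)"
  define M where "M = max (x b) (x1 b1)"
  have m: "0 < m" using a a1 K sol sol1 unfolding m_def profile_solution_def by (simp add: subset_eq)
  have mM: "m \<le> x r" "x r \<le> M" "m \<le> x1 r" "x1 r \<le> M" if "r \<in> K" for r
    using that a a1 b b1 by (auto simp: m_def M_def min_le_iff_disj le_max_iff_disj)
  have "m \<le> M" using mM[OF cK(4)] by linarith
  then obtain L where L: "L-lipschitz_on UNIV (clamped_field n H m M)"
    using clamped_field_lipschitz[OF m, of M n H] by blast
  have "(x s, t s, \<sigma> s) = (x1 s, t1 s, \<sigma>1 s)"
    by (rule lipschitz_ode_unique[OF L cK(3) cK(4) cK(5), where Y = "\<lambda>s. (x s, t s, \<sigma> s)" and Z = "\<lambda>s. (x1 s, t1 s, \<sigma>1 s)"])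
      (use profile_solution_clamped[OF sol] profile_solution_clamped[OF sol1] K mM eq in \<open>auto\<close>)
  then show "x s = x1 s" "t s = t1 s" "\<sigma> s = \<sigma>1 s" by auto
qed

text \<open>A local solution started at a parameter of \<open>I\<close> agrees with the given one on
  the overlap, so the two glue, and by maximality the glued solution cannot enlarge
  \<open>I\<close>. The local existence time depends only on \<open>m\<close> and \<open>M\<close>,
  hence one \<open>h\<close> serves for all parameters with radius in \<open>[m, M]\<close>.\<close>

lemma complete_profile_solution_extend:
  assumes comp: "complete_profile_solution n H I x t \<sigma>" and m: "0 < m"
  obtains h where "0 < h" "\<And>s. s \<in> I \<Longrightarrow> m \<le> x s \<Longrightarrow> x s \<le> M \<Longrightarrow> {s - h<..<s + h} \<subseteq> I"
proof -
  have sol: "profile_solution n H I x t \<sigma>" using comp by (simp add: complete_profile_solution_def)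
  obtain h where h: "0 < h" and ex: "\<And>x0 t0 \<sigma>0 s1. m \<le> x0 \<Longrightarrow> x0 \<le> M \<Longrightarrow>
      \<exists>x t \<sigma>. profile_solution n H {s1 - h<..<s1 + h} x t \<sigma> \<and> x s1 = x0 \<and> t s1 = t0 \<and> \<sigma> s1 = \<sigma>0"
    by (rule profile_local_existence[OF m, of M n H]) blast
  have "{s1 - h<..<s1 + h} \<subseteq> I" if s1: "s1 \<in> I" "m \<le> x s1" "x s1 \<le> M" for s1
  proof -
    let ?K = "{s1 - h<..<s1 + h}"
    obtain x1 t1 \<sigma>1 where sol1: "profile_solution n H ?K x1 t1 \<sigma>1"
      and eq: "x1 s1 = x s1" "t1 s1 = t s1" "\<sigma>1 s1 = \<sigma> s1"
      using ex[OF s1(2,3), of s1 "t s1" "\<sigma> s1"] by blast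
    have s1K: "s1 \<in> ?K" using h by auto
    have I: "open I" "is_interval I" using sol by (auto simp: profile_solution_def)
    have cap: "is_interval (I \<inter> ?K)" "open (I \<inter> ?K)" "s1 \<in> I \<inter> ?K"
      using I s1 s1K by (auto intro: is_interval_Int is_interval_oo)
    have ne: "I \<inter> ?K \<noteq> {}" using cap(3) by blast
    have agree: "x s = x1 s" "t s = t1 s" "\<sigma> s = \<sigma>1 s" if "s \<in> I" "s \<in> ?K" for s
      using profile_solution_unique[OF profile_solution_subset[OF sol, of "I \<inter> ?K"]
          profile_solution_subset[OF sol1, of "I \<inter> ?K"] cap(3), of s] cap(1,2) ne eq that
      by simp_all
    have un: "open (I \<union> ?K)" "is_interval (I \<union> ?K)" "I \<union> ?K \<noteq> {}"
      using I(1) cap(3) connected_Un[OF _ _ ne] I(2) is_interval_oo[of "s1 - h" "s1 + h"]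
      unfolding is_interval_connected_1 by auto
    define glue where "glue f g s = (if s \<in> I then f s else g s)" for f g :: "real \<Rightarrow> real" and s
    have glueI: "(glue f g has_real_derivative d) (at s)" if "(f has_real_derivative d) (at s)" "s \<in> I" for f g d s
      using that(1) by (rule has_field_derivative_transform_within_open[OF _ I(1)]) (use that in \<open>auto simp: glue_def\<close>)
    have glueK: "(glue f g has_real_derivative d) (at s)"
      if "(g has_real_derivative d) (at s)" "s \<in> ?K" "\<And>s. s \<in> I \<Longrightarrow> s \<in> ?K \<Longrightarrow> f s = g s" for f g d s
      using that(1) by (rule has_field_derivative_transform_within_open[where S = ?K])
        (use that in \<open>auto simp: glue_def\<close>)
    have "profile_solution n H (I \<union> ?K) (glue x x1) (glue t t1) (glue \<sigma> \<sigma>1)"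
      unfolding profile_solution_iff
    proof (intro conjI ballI un)
      fix s assume "s \<in> I \<union> ?K"
      then consider "s \<in> I" | "s \<in> ?K" "s \<notin> I" by blast
      then have "glue x x1 s > 0 \<and> (glue x x1 has_real_derivative sin (glue \<sigma> \<sigma>1 s)) (at s) \<and>
        (glue t t1 has_real_derivative cos (glue \<sigma> \<sigma>1 s)) (at s) \<and>
        (glue \<sigma> \<sigma>1 has_real_derivative profile_rhs n H (glue x x1 s) (glue \<sigma> \<sigma>1 s)) (at s)"
      proof cases
        case 1
        then have v: "glue x x1 s = x s" "glue \<sigma> \<sigma>1 s = \<sigma> s" by (auto simp: glue_def)
        show ?thesis unfolding v using sol 1 glueI unfolding profile_solution_iff by blast
      next
        case 2
        then have v: "glue x x1 s = x1 s" "glue \<sigma> \<sigma>1 s = \<sigma>1 s" by (auto simp: glue_def)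
        have d: "x1 s > 0" "(x1 has_real_derivative sin (\<sigma>1 s)) (at s)"
          "(t1 has_real_derivative cos (\<sigma>1 s)) (at s)"
          "(\<sigma>1 has_real_derivative profile_rhs n H (x1 s) (\<sigma>1 s)) (at s)"
          using sol1 2 unfolding profile_solution_iff by blast+
        show ?thesis unfolding v
          using d(1) glueK[OF d(2) 2(1) agree(1)] glueK[OF d(3) 2(1) agree(2)] glueK[OF d(4) 2(1) agree(3)]
          by blast
      qed
      then show "glue x x1 s > 0" "(glue x x1 has_real_derivative sin (glue \<sigma> \<sigma>1 s)) (at s)"
        "(glue t t1 has_real_derivative cos (glue \<sigma> \<sigma>1 s)) (at s)"
        "(glue \<sigma> \<sigma>1 has_real_derivative profile_rhs n H (glue x x1 s) (glue \<sigma> \<sigma>1 s)) (at s)"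
        by blast+
    qed
    moreover have "\<forall>s\<in>I. glue x x1 s = x s \<and> glue t t1 s = t s \<and> glue \<sigma> \<sigma>1 s = \<sigma> s"
      by (simp add: glue_def)
    ultimately have "I \<union> ?K = I"
      using comp unfolding complete_profile_solution_def by (metis Un_upper1)
    then show ?thesis by blast
  qed
  then show ?thesis using that h by blast
qed

section \<open>Symmetries of the profile system\<close>

lemma profile_solution_reflect:
  assumes "profile_solution n H UNIV x t \<sigma>" "sin c = 0" "cos c = 1"
  shows "profile_solution n H UNIV (\<lambda>s. x (a - s)) (\<lambda>s. b - t (a - s)) (\<lambda>s. c - \<sigma> (a - s))"
proof -
  have d: "((\<lambda>s. a - s) has_real_derivative - 1) (at s)" for s by (auto intro!: derivative_eq_intros)
  have f: "((\<lambda>s. f (a - s)) has_real_derivative - D (a - s)) (at s)"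
    if "\<And>s. (f has_real_derivative D s) (at s)" for f D s
    using DERIV_chain2[OF that d] by simp
  have g: "((\<lambda>s. c - f (a - s)) has_real_derivative D (a - s)) (at s)"
    if "\<And>s. (f has_real_derivative D s) (at s)" for f D s c
    using DERIV_diff[OF DERIV_const f[OF that]] by simp
  have tr: "sin (c - \<sigma> s) = - sin (\<sigma> s)" "cos (c - \<sigma> s) = cos (\<sigma> s)" for s
    using assms by (simp_all add: sin_diff cos_diff)
  then have "profile_rhs n H r (c - \<sigma> s) = profile_rhs n H r (\<sigma> s)" for r s
    by (simp add: profile_rhs_def)
  then show ?thesis
    using assms(1) unfolding profile_solution_iff tr
    by (auto intro!: f g[of t "\<lambda>s. cos (\<sigma> s)"] g[of \<sigma> "\<lambda>s. profile_rhs n H (x s) (\<sigma> s)"]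
        f[of x "\<lambda>s. sin (\<sigma> s)"])
qed

text \<open>If \<open>sin (\<sigma> s0) = 0\<close>, then \<open>2 * \<sigma> s0\<close> is a
  multiple of \<open>2 * pi\<close>. The reflected solution with this shift of the angle has the
  same data at \<open>s0\<close> as the original one, and uniqueness identifies them.\<close>

lemma profile_solution_symmetric:
  assumes sol: "profile_solution n H UNIV x t \<sigma>" and s0: "sin (\<sigma> s0) = 0"
  shows "x (2 * s0 - s) = x s" "t (2 * s0 - s) = 2 * t s0 - t s" "\<sigma> (2 * s0 - s) = 2 * \<sigma> s0 - \<sigma> s"
proof -
  have "(cos (\<sigma> s0))\<^sup>2 = 1" using s0 by (simp add: cos_squared_eq)
  then have "sin (2 * \<sigma> s0) = 0" "cos (2 * \<sigma> s0) = 1" using s0 by (simp_all add: sin_double cos_double)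
  from profile_solution_reflect[OF sol this, of "2 * s0" "2 * t s0"]
  have "profile_solution n H UNIV (\<lambda>s. x (2 * s0 - s)) (\<lambda>s. 2 * t s0 - t (2 * s0 - s))
    (\<lambda>s. 2 * \<sigma> s0 - \<sigma> (2 * s0 - s))" .
  from profile_solution_unique[OF this sol, of s0 s]
  show "x (2 * s0 - s) = x s" "t (2 * s0 - s) = 2 * t s0 - t s" "\<sigma> (2 * s0 - s) = 2 * \<sigma> s0 - \<sigma> s"
    by simp_all
qed

text \<open>Passing to \<open>pi - \<theta>\<close> keeps the sine and negates the cosine; together
  with the sign of \<open>H\<close> every term of the right-hand side changes sign.\<close>

lemma profile_solution_flip:
  assumes "profile_solution n H I x t \<sigma>"
  shows "profile_solution n (- H) I x (\<lambda>s. - t s) (\<lambda>s. pi - \<sigma> s)"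
proof -
  have rhs: "profile_rhs n (- H) r (pi - \<theta>) = - profile_rhs n H r \<theta>" for r \<theta>
    by (simp add: profile_rhs_def algebra_simps add_divide_distrib diff_divide_distrib)
  have "((\<lambda>s. pi - \<sigma> s) has_real_derivative - D) (at s)" if "(\<sigma> has_real_derivative D) (at s)" for D s
    using DERIV_diff[OF DERIV_const that, of pi] by simp
  then show ?thesis
    using assms unfolding profile_solution_iff rhs by (auto intro!: DERIV_minus)
qed

lemma complete_profile_solution_flip:
  assumes "complete_profile_solution n H I x t \<sigma>"
  shows "complete_profile_solution n (- H) I x (\<lambda>s. - t s) (\<lambda>s. pi - \<sigma> s)"
  unfolding complete_profile_solution_def
proof (intro conjI allI impI)
  show "profile_solution n (- H) I x (\<lambda>s. - t s) (\<lambda>s. pi - \<sigma> s)"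
    using assms profile_solution_flip[of n H I x t \<sigma>] by (simp add: complete_profile_solution_def)
  fix J x1 t1 \<sigma>1
  assume J: "profile_solution n (- H) J x1 t1 \<sigma>1 \<and> I \<subseteq> J \<and>
    (\<forall>s\<in>I. x1 s = x s \<and> t1 s = - t s \<and> \<sigma>1 s = pi - \<sigma> s)"
  then have "profile_solution n H J x1 (\<lambda>s. - t1 s) (\<lambda>s. pi - \<sigma>1 s)"
    using profile_solution_flip[of n "- H" J x1 t1 \<sigma>1] by simp
  moreover have "\<forall>s\<in>I. x1 s = x s \<and> - t1 s = t s \<and> pi - \<sigma>1 s = \<sigma> s" using J by simp
  ultimately show "J = I" using assms J unfolding complete_profile_solution_def by blast
qed

lemma profile_energy_flip: "profile_energy n (- H) r (pi - \<theta>) = - profile_energy n H r \<theta>"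
  by (simp add: profile_energy_def)

section \<open>Twice continuously differentiable functions\<close>

text \<open>Replaces the operator-valued derivatives of \<open>C2_on\<close> by a gradient and a
  Hessian applied to vectors; continuity of an operator-valued map may be tested on basis
  vectors.\<close>

lemma C2_on_gradientI:
  fixes f :: "'a::euclidean_space \<Rightarrow> real"
  assumes f: "\<And>p. p \<in> U \<Longrightarrow> (f has_derivative (\<lambda>v. grad p \<bullet> v)) (at p)"
    and grad: "\<And>p. p \<in> U \<Longrightarrow> (grad has_derivative hess p) (at p)"
    and cont: "\<And>v. continuous_on U (\<lambda>p. hess p v)"
  shows "C2_on U f"
proof -
  define f'' where "f'' p = Blinfun (\<lambda>v. blinfun_inner_right (hess p v))" for p
  have bl: "bounded_linear (\<lambda>v. blinfun_inner_right (hess p v))" if "p \<in> U" for p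
    using bounded_linear_compose[OF bounded_linear_blinfun_inner_right has_derivative_bounded_linear[OF grad[OF that]]] .
  have ap: "blinfun_apply (f'' p) = (\<lambda>v. blinfun_inner_right (hess p v))" if "p \<in> U" for p
    unfolding f''_def by (rule bounded_linear_Blinfun_apply[OF bl[OF that]])
  have "continuous_on U f''"
  proof (rule continuous_on_blinfun_componentwise)
    fix v :: 'a assume "v \<in> Basis"
    have "continuous_on U (\<lambda>p. blinfun_inner_right (hess p v))"
      by (rule bounded_linear.continuous_on[OF bounded_linear_blinfun_inner_right cont])
    then show "continuous_on U (\<lambda>p. blinfun_apply (f'' p) v)"
      by (rule continuous_on_eq) (simp add: ap)
  qed
  moreover have "((\<lambda>p. blinfun_inner_right (grad p)) has_derivative blinfun_apply (f'' p)) (at p)" if "p \<in> U" for p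
    unfolding ap[OF that]
    by (rule bounded_linear.has_derivative[OF bounded_linear_blinfun_inner_right grad[OF that]])
  moreover have "(f has_derivative blinfun_apply (blinfun_inner_right (grad p))) (at p)" if "p \<in> U" for p
    using f[OF that] by simp
  ultimately show ?thesis unfolding C2_on_def
    by (intro exI[of _ "\<lambda>p. blinfun_inner_right (grad p)"] exI[of _ f''] conjI ballI)
qed

lemma has_real_derivative_continuous_on:
  fixes f f' :: "real \<Rightarrow> real"
  assumes "\<And>s. s \<in> U \<Longrightarrow> (f has_real_derivative f' s) (at s)"
  shows "continuous_on U f"
  by (rule DERIV_continuous_on[OF has_field_derivative_at_within[OF assms]])

lemma C2_on_realI:
  fixes f f' f'' :: "real \<Rightarrow> real"
  assumes "\<And>s. s \<in> U \<Longrightarrow> (f has_real_derivative f' s) (at s)"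
    "\<And>s. s \<in> U \<Longrightarrow> (f' has_real_derivative f'' s) (at s)" "continuous_on U f''"
  shows "C2_on U f"
proof (rule C2_on_gradientI[where grad = f' and hess = "\<lambda>s v. f'' s * v"])
  show "(f has_derivative (\<lambda>v. f' p \<bullet> v)) (at p)" if "p \<in> U" for p
    using assms(1)[OF that] by (simp add: has_field_derivative_def)
  show "(f' has_derivative (\<lambda>v. f'' p * v)) (at p)" if "p \<in> U" for p
    using assms(2)[OF that] by (simp add: has_field_derivative_def)
  show "continuous_on U (\<lambda>p. f'' p * v)" for v
    using assms(3) by (intro continuous_intros)
qed

lemma positive_derivative_strict_mono_on:
  fixes f f' :: "real \<Rightarrow> real"
  assumes "is_interval J" "\<And>s. s \<in> J \<Longrightarrow> (f has_real_derivative f' s) (at s)"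
    "\<And>s. s \<in> J \<Longrightarrow> 0 < f' s"
  shows "strict_mono_on J f"
proof (rule strict_mono_onI)
  fix a b assume ab: "a \<in> J" "b \<in> J" "a < b"
  have "r \<in> J" if "a \<le> r" "r \<le> b" for r using mem_is_interval_1_I[OF assms(1) ab(1,2) that] .
  then show "f a < f b" using DERIV_pos_imp_increasing[OF ab(3), of f] assms(2,3) by blast
qed

lemma increasing_inverse:
  fixes f f' :: "real \<Rightarrow> real"
  assumes J: "open J" "is_interval J" and f: "\<And>s. s \<in> J \<Longrightarrow> (f has_real_derivative f' s) (at s)"
    "\<And>s. s \<in> J \<Longrightarrow> 0 < f' s"
  obtains g where "open (f ` J)" "is_interval (f ` J)" "\<And>s. s \<in> J \<Longrightarrow> g (f s) = s"
    "\<And>u. u \<in> f ` J \<Longrightarrow> g u \<in> J" "\<And>u. u \<in> f ` J \<Longrightarrow> f (g u) = u"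
    "\<And>u. u \<in> f ` J \<Longrightarrow> (g has_real_derivative 1 / f' (g u)) (at u)"
proof -
  have mono: "strict_mono_on J f" by (rule positive_derivative_strict_mono_on[OF J(2) f])
  then have inj: "inj_on f J" by (rule strict_mono_on_imp_inj_on)
  define g where "g = inv_into J f"
  have gf: "g (f s) = s" if "s \<in> J" for s using inv_into_f_f[OF inj that] by (simp add: g_def)
  have cont: "continuous_on J f"
    by (rule has_real_derivative_continuous_on[OF f(1)])
  have int: "is_interval (f ` J)"
    using connected_continuous_image[OF cont] J(2) by (simp add: is_interval_connected_1)
  have op: "open (f ` J)"
    by (rule injective_eq_1d_open_map_UNIV[THEN iffD1, rule_format, of J f J])
      (use J cont inj in auto)
  have g': "(g has_real_derivative 1 / f' (g u)) (at u)" if u: "u \<in> f ` J" for u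
  proof -
    obtain s where s: "s \<in> J" "u = f s" using u by blast
    have "(g has_derivative (\<lambda>v. v / f' s)) (at (f s))"
    proof (rule has_derivative_inverse_strong[OF J(1) s(1) cont gf])
      show "(f has_derivative (\<lambda>v. f' s * v)) (at s)" using f(1)[OF s(1)] by (simp add: has_field_derivative_def)
      show "(\<lambda>v. f' s * v) \<circ> (\<lambda>v. v / f' s) = id" using f(2)[OF s(1)] by auto
    qed
    moreover have "(\<lambda>v. v / f' s) = (*) (1 / f' s)" by auto
    ultimately show ?thesis using s gf by (simp add: has_field_derivative_def)
  qed
  show ?thesis
    by (rule that[of g]) (use op int gf g' in \<open>auto\<close>)
qed

section \<open>Defining functions of hypersurfaces of revolution\<close>

lemma has_derivative_norm_fst:
  fixes q :: "'b::euclidean_space \<times> real"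
  assumes "fst q \<noteq> 0"
  shows "((\<lambda>q. norm (fst q)) has_derivative (\<lambda>v. sgn (fst q) \<bullet> fst v)) (at q)"
  using has_derivative_compose[OF has_derivative_fst[OF has_derivative_ident] has_derivative_norm[OF assms]]
  by (simp add: inner_commute)

lemma has_derivative_sgn_fst:
  fixes q :: "'b::euclidean_space \<times> real"
  assumes "fst q \<noteq> 0"
  shows "((\<lambda>q. sgn (fst q)) has_derivative
    (\<lambda>v. (fst v - (sgn (fst q) \<bullet> fst v) *\<^sub>R sgn (fst q)) /\<^sub>R norm (fst q))) (at q)"
proof -
  have "((\<lambda>q. inverse (norm (fst q))) has_derivative
      (\<lambda>v. - (inverse (norm (fst q)) * (sgn (fst q) \<bullet> fst v) * inverse (norm (fst q))))) (at q)"
    by (rule Deriv.has_derivative_inverse[OF _ has_derivative_norm_fst[OF assms]]) (simp add: assms)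
  from has_derivative_scaleR[OF this has_derivative_fst[OF has_derivative_ident]]
  have "((\<lambda>q. inverse (norm (fst q)) *\<^sub>R fst q) has_derivative
    (\<lambda>v. (fst v - (sgn (fst q) \<bullet> fst v) *\<^sub>R sgn (fst q)) /\<^sub>R norm (fst q))) (at q)"
    by (rule has_derivative_eq_rhs) (simp add: fun_eq_iff sgn_div_norm algebra_simps)
  then show ?thesis by (simp add: sgn_div_norm)
qed

text \<open>With \<open>(\<alpha>1, \<alpha>2)\<close> tangent and
  \<open>(\<beta>1, \<beta>2)\<close> normal to a plane curve at one point, \<open>f = 0\<close>
  says that the curve is the graph of \<open>h\<close> over its tangent line, in the half-plane of
  the points \<open>(norm (fst q), snd q)\<close>. The derivative of \<open>f\<close> never vanishes
  because orthogonality makes it 1 in the direction of \<open>(\<beta>1, \<beta>2)\<close>.\<close>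

lemma C2_rotated_graph:
  fixes h h1 h2 :: "real \<Rightarrow> real" and \<alpha>1 \<alpha>2 \<beta>1 \<beta>2 k0 k1 :: real and T :: "real set"
  defines "A \<equiv> \<lambda>q::'b::euclidean_space \<times> real. \<alpha>1 * norm (fst q) + \<alpha>2 * snd q + k1"
  defines "f \<equiv> \<lambda>q. \<beta>1 * norm (fst q) + \<beta>2 * snd q + k0 - h (A q)"
  defines "U \<equiv> {q. fst q \<noteq> 0 \<and> A q \<in> T}"
  assumes T: "open T" and h: "\<And>s. s \<in> T \<Longrightarrow> (h has_real_derivative h1 s) (at s)"
    "\<And>s. s \<in> T \<Longrightarrow> (h1 has_real_derivative h2 s) (at s)" "continuous_on T h2"
    and orth: "\<beta>1 * \<beta>1 + \<beta>2 * \<beta>2 = 1" "\<alpha>1 * \<beta>1 + \<alpha>2 * \<beta>2 = 0"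
  shows "open U" "C2_on U f" "\<forall>q\<in>U. frechet_derivative f (at q) \<noteq> (\<lambda>v. 0)"
proof -
  have contA: "continuous_on S A" for S unfolding A_def by (intro continuous_intros)
  have "U = {q. fst q \<noteq> 0} \<inter> A -` T" unfolding U_def by blast
  moreover have "open {q :: 'b \<times> real. fst q \<noteq> 0}"
    by (intro open_Collect_neq continuous_intros)
  moreover have "open (A -` T)" by (rule open_vimage[OF T contA])
  ultimately show "open U" by auto
  define dA where "dA q v = \<alpha>1 * (sgn (fst q) \<bullet> fst v) + \<alpha>2 * snd v" for q v :: "'b \<times> real"
  define grad where "grad q = ((\<beta>1 - h1 (A q) * \<alpha>1) *\<^sub>R sgn (fst q), \<beta>2 - h1 (A q) * \<alpha>2)" for q
  define hess where "hess q v = ((- (h2 (A q) * dA q v * \<alpha>1)) *\<^sub>R sgn (fst q)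
      + (\<beta>1 - h1 (A q) * \<alpha>1) *\<^sub>R ((fst v - (sgn (fst q) \<bullet> fst v) *\<^sub>R sgn (fst q)) /\<^sub>R norm (fst q)),
      - (h2 (A q) * dA q v * \<alpha>2))" for q v
  have A': "(A has_derivative dA q) (at q)" if "q \<in> U" for q
    unfolding A_def dA_def
    by (intro has_derivative_add_const has_derivative_add has_derivative_mult_right
        has_derivative_norm_fst has_derivative_snd has_derivative_ident)
      (use that in \<open>auto simp: U_def\<close>)
  have chain: "((\<lambda>q. k (A q)) has_derivative (\<lambda>v. k' (A q) * dA q v)) (at q)"
    if "q \<in> U" "\<And>s. s \<in> T \<Longrightarrow> (k has_real_derivative k' s) (at s)" for k k' q
    using has_derivative_compose[OF A'[OF that(1)], of k "\<lambda>v. k' (A q) * v"] that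
    by (simp add: U_def has_field_derivative_def)
  have f': "(f has_derivative (\<lambda>v. grad q \<bullet> v)) (at q)" if q: "q \<in> U" for q
  proof -
    have nz: "fst q \<noteq> 0" using q by (simp add: U_def)
    show ?thesis unfolding f_def
      by (rule has_derivative_eq_rhs[OF has_derivative_diff[OF has_derivative_add_const[OF has_derivative_add[OF
              has_derivative_mult_right[OF has_derivative_norm_fst[OF nz]]
              has_derivative_mult_right[OF has_derivative_snd[OF has_derivative_ident]]]] chain[OF q h(1)]]])
        (auto simp: grad_def dA_def inner_prod_def fun_eq_iff algebra_simps)
  qed
  have g': "(grad has_derivative hess q) (at q)" if q: "q \<in> U" for q
  proof -
    have nz: "fst q \<noteq> 0" using q by (simp add: U_def)
    have d: "((\<lambda>q. \<beta> - h1 (A q) * \<alpha>) has_derivative (\<lambda>v. - (h2 (A q) * dA q v * \<alpha>))) (at q)" for \<alpha> \<beta>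
      using has_derivative_diff[OF has_derivative_const has_derivative_mult_left[OF chain[OF q h(2)]]]
      by simp
    show ?thesis unfolding grad_def
      by (rule has_derivative_eq_rhs[OF has_derivative_Pair[OF
              has_derivative_scaleR[OF d has_derivative_sgn_fst[OF nz]] d]])
        (auto simp: hess_def fun_eq_iff)
  qed
  have "continuous_on U (\<lambda>q. hess q v)" for v
  proof -
    have "continuous_on U (\<lambda>q. h2 (A q))"
      by (rule continuous_on_compose2[OF h(3) contA]) (auto simp: U_def)
    moreover have "continuous_on U (\<lambda>q. h1 (A q))"
      by (rule continuous_on_compose2[OF has_real_derivative_continuous_on[OF h(2)] contA]) (auto simp: U_def)
    moreover have "continuous_on U (\<lambda>q. sgn (fst q))"
      by (intro continuous_intros) (auto simp: U_def)
    ultimately show ?thesis unfolding hess_def dA_def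
      by (intro continuous_intros) (auto simp: U_def)
  qed
  then show "C2_on U f" using C2_on_gradientI[OF f' g'] by blast
  show "\<forall>q\<in>U. frechet_derivative f (at q) \<noteq> (\<lambda>v. 0)"
  proof
    fix q assume q: "q \<in> U"
    have "frechet_derivative f (at q) = (\<lambda>v. grad q \<bullet> v)"
      using frechet_derivative_at[OF f'[OF q]] by simp
    moreover have "grad q \<bullet> (\<beta>1 *\<^sub>R sgn (fst q), \<beta>2) = \<beta>1 * \<beta>1 + \<beta>2 * \<beta>2 - h1 (A q) * (\<alpha>1 * \<beta>1 + \<alpha>2 * \<beta>2)"
      using q by (simp add: grad_def U_def inner_prod_def sgn_div_norm dot_square_norm power2_eq_square algebra_simps)
    ultimately show "frechet_derivative f (at q) \<noteq> (\<lambda>v. 0)"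
      by (metis orth mult_zero_right diff_zero zero_neq_one)
  qed
qed

text \<open>The norm has a corner at 0, but the difference quotient of \<open>k (norm z)\<close>
  there is, up to sign, that of \<open>k\<close> at \<open>norm z\<close>, which tends to 0.\<close>

lemma has_derivative_radial_zero:
  fixes k :: "real \<Rightarrow> real"
  assumes "(k has_real_derivative 0) (at 0)"
  shows "((\<lambda>z::'b::euclidean_space. k (norm z)) has_derivative (\<lambda>v. 0)) (at 0)"
proof -
  have lim: "(\<lambda>h. \<bar>k h - k 0\<bar> / \<bar>h\<bar>) \<midarrow>0\<rightarrow> 0"
    using assms by (simp add: has_field_derivative_def has_derivative_at)
  have "filterlim (norm :: 'b \<Rightarrow> real) (at 0) (at 0)"
    unfolding filterlim_at
    by (auto simp: eventually_at_filter intro!: tendsto_norm_zero tendsto_ident_at)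
  from filterlim_compose[OF lim this]
  show ?thesis by (simp add: has_derivative_at)
qed

text \<open>The factor \<open>z\<close> flattens the corner of the norm at 0, where the derivative
  is 0. The gradient in \<open>C2_radial_graph\<close> is a \<open>C^1\<close> multiple of this
  map.\<close>

lemma has_derivative_norm_scaleR:
  "((\<lambda>z::'b::euclidean_space. norm z *\<^sub>R z) has_derivative
     (\<lambda>v. norm z *\<^sub>R v + (sgn z \<bullet> v) *\<^sub>R z)) (at z)"
proof (cases "z = 0")
  case True
  have "(\<lambda>h::'b. norm h) \<midarrow>0\<rightarrow> 0" by (intro tendsto_norm_zero tendsto_ident_at)
  then have "(\<lambda>h::'b. norm (norm h *\<^sub>R h) / norm h) \<midarrow>0\<rightarrow> 0"
    by (rule Lim_transform_within[OF _ zero_less_one]) auto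
  then show ?thesis using True by (simp add: has_derivative_at)
next
  case False
  have "((\<lambda>z::'b. norm z) has_derivative (\<lambda>v. sgn z \<bullet> v)) (at z)"
    using has_derivative_norm[OF False] by (simp add: inner_commute)
  from has_derivative_scaleR[OF this has_derivative_ident] show ?thesis by simp
qed

text \<open>\<open>sgn\<close> jumps at 0 but stays bounded, and the factor \<open>z\<close> tends
  to 0.\<close>

lemma continuous_on_sgn_inner_scaleR:
  "continuous_on UNIV (\<lambda>z::'b::euclidean_space. (sgn z \<bullet> v) *\<^sub>R z)"
  unfolding continuous_on_eq_continuous_at[OF open_UNIV]
proof
  fix z :: 'b
  show "isCont (\<lambda>z. (sgn z \<bullet> v) *\<^sub>R z) z"
  proof (cases "z = 0")
    case True
    have b: "norm ((sgn h \<bullet> v) *\<^sub>R h) \<le> norm v * norm h" for h :: 'b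
      using Cauchy_Schwarz_ineq2[of "sgn h" v]
      by (simp add: norm_sgn mult_right_mono split: if_splits)
    have "(\<lambda>h::'b. norm v * norm h) \<midarrow>0\<rightarrow> 0" by (intro tendsto_mult_right_zero tendsto_norm_zero tendsto_ident_at)
    then have "(\<lambda>h::'b. (sgn h \<bullet> v) *\<^sub>R h) \<midarrow>0\<rightarrow> 0"
      by (rule Lim_null_comparison[rotated]) (use b in auto)
    then show ?thesis using True by (simp add: isCont_def)
  next
    case False
    then show ?thesis by (intro continuous_intros) auto
  qed
qed

text \<open>The gradient of \<open>k (norm z)\<close> is \<open>k' (norm z)\<close> times
  \<open>sgn z\<close>. The factor \<open>r * r\<close> in \<open>k'\<close> cancels the division by
  the norm and leaves \<open>\<mu> (z \<bullet> z)\<close> times \<open>norm z *\<^sub>R z\<close>;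
  as \<mu> is \<open>C^1\<close> and is evaluated at the smooth function
  \<open>z \<bullet> z\<close>, this gradient is \<open>C^1\<close> at \<open>z = 0\<close>
  too.\<close>

lemma C2_radial_graph:
  fixes k \<mu> \<mu>1 :: "real \<Rightarrow> real" and u0 \<delta> :: real
  defines "f \<equiv> \<lambda>q::'b::euclidean_space \<times> real. snd q - u0 - k (norm (fst q))"
  defines "U \<equiv> {q::'b \<times> real. norm (fst q) < \<delta>}"
  assumes k: "\<And>r. \<bar>r\<bar> < \<delta> \<Longrightarrow> (k has_real_derivative \<mu> (r * r) * r * r) (at r)"
    and \<mu>: "\<And>w. w < \<delta> * \<delta> \<Longrightarrow> (\<mu> has_real_derivative \<mu>1 w) (at w)" "continuous_on {..<\<delta> * \<delta>} \<mu>1"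
  shows "open U" "C2_on U f" "\<forall>q\<in>U. frechet_derivative f (at q) \<noteq> (\<lambda>v. 0)"
    "\<forall>q\<in>U. (f has_derivative (\<lambda>v. snd v - \<mu> (fst q \<bullet> fst q) * norm (fst q) * (fst q \<bullet> fst v))) (at q)"
proof -
  show "open U" unfolding U_def by (intro open_Collect_less continuous_intros)
  have sq: "z \<bullet> z < \<delta> * \<delta>" if "norm z < \<delta>" for z :: 'b
    using that mult_strict_mono[of "norm z" \<delta> "norm z" \<delta>]
    by (cases "z = 0") (auto simp: dot_square_norm power2_eq_square)
  define grad where "grad q = (- \<mu> (fst q \<bullet> fst q) *\<^sub>R (norm (fst q) *\<^sub>R fst q), 1 :: real)" for q :: "'b \<times> real"
  define hess where "hess q v = (- \<mu> (fst q \<bullet> fst q) *\<^sub>R (norm (fst q) *\<^sub>R fst v + (sgn (fst q) \<bullet> fst v) *\<^sub>R fst q)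
      - (\<mu>1 (fst q \<bullet> fst q) * (2 * (fst q \<bullet> fst v))) *\<^sub>R (norm (fst q) *\<^sub>R fst q), 0 :: real)" for q v :: "'b \<times> real"
  have kn: "((\<lambda>z. k (norm z)) has_derivative (\<lambda>v. \<mu> (z \<bullet> z) * norm z * (z \<bullet> v))) (at z)"
    if "norm z < \<delta>" for z :: 'b
  proof (cases "z = 0")
    case True
    then have "(k has_real_derivative 0) (at 0)" using k[of 0] that by simp
    from has_derivative_radial_zero[OF this] True show ?thesis by simp
  next
    case False
    have "((\<lambda>z. k (norm z)) has_derivative (\<lambda>v. \<mu> (norm z * norm z) * norm z * norm z * (v \<bullet> sgn z))) (at z)"
      using has_derivative_compose[OF has_derivative_norm[OF False] k[of "norm z", unfolded has_field_derivative_def]] that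
      by simp
    moreover have "\<mu> (norm z * norm z) * norm z * norm z * (v \<bullet> sgn z) = \<mu> (z \<bullet> z) * norm z * (z \<bullet> v)" for v
      using False by (simp add: sgn_div_norm inner_commute dot_square_norm power2_eq_square)
    ultimately show ?thesis by simp
  qed
  have f'0: "(f has_derivative (\<lambda>v. snd v - \<mu> (fst q \<bullet> fst q) * norm (fst q) * (fst q \<bullet> fst v))) (at q)"
    if q: "q \<in> U" for q
  proof -
    have "((\<lambda>q. k (norm (fst q))) has_derivative (\<lambda>v. \<mu> (fst q \<bullet> fst q) * norm (fst q) * (fst q \<bullet> fst v))) (at q)"
      using has_derivative_compose[OF has_derivative_fst[OF has_derivative_ident] kn[of "fst q"]] q
      by (simp add: U_def)
    from has_derivative_diff[OF has_derivative_diff[OF has_derivative_snd[OF has_derivative_ident] has_derivative_const] this]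
    show ?thesis unfolding f_def by simp
  qed
  then show "\<forall>q\<in>U. (f has_derivative (\<lambda>v. snd v - \<mu> (fst q \<bullet> fst q) * norm (fst q) * (fst q \<bullet> fst v))) (at q)" by blast
  have f': "(f has_derivative (\<lambda>v. grad q \<bullet> v)) (at q)" if q: "q \<in> U" for q
    using f'0[OF q] by (simp add: grad_def inner_prod_def)
  have g': "(grad has_derivative hess q) (at q)" if q: "q \<in> U" for q
  proof -
    have m: "((\<lambda>q. \<mu> (fst q \<bullet> fst q)) has_derivative (\<lambda>v. \<mu>1 (fst q \<bullet> fst q) * (2 * (fst q \<bullet> fst v)))) (at q)"
    proof -
      have "((\<lambda>q. fst q \<bullet> fst q) has_derivative (\<lambda>v. 2 * (fst q \<bullet> fst v))) (at q)"
        by (rule has_derivative_eq_rhs, (rule derivative_intros)+) (auto simp: fun_eq_iff inner_commute)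
      from has_derivative_compose[OF this \<mu>(1)[OF sq, unfolded has_field_derivative_def]] q
      show ?thesis by (simp add: U_def)
    qed
    have z: "((\<lambda>q::'b \<times> real. norm (fst q) *\<^sub>R fst q) has_derivative (\<lambda>v. norm (fst q) *\<^sub>R fst v + (sgn (fst q) \<bullet> fst v) *\<^sub>R fst q)) (at q)"
      using has_derivative_compose[OF has_derivative_fst[OF has_derivative_ident] has_derivative_norm_scaleR] .
    show ?thesis unfolding grad_def
      by (rule has_derivative_eq_rhs, rule has_derivative_Pair[OF has_derivative_scaleR[OF has_derivative_minus[OF m] z] has_derivative_const])
        (simp add: hess_def fun_eq_iff)
  qed
  have "continuous_on U (\<lambda>q. hess q v)" for v
  proof -
    have sq': "continuous_on U (\<lambda>q. fst q \<bullet> fst q)" by (intro continuous_intros)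
    have c1: "continuous_on U (\<lambda>q. \<mu>1 (fst q \<bullet> fst q))"
      by (rule continuous_on_compose2[OF \<mu>(2) sq']) (auto simp: U_def sq)
    have c2: "continuous_on U (\<lambda>q. \<mu> (fst q \<bullet> fst q))"
      by (rule continuous_on_compose2[OF has_real_derivative_continuous_on[OF \<mu>(1)] sq', of "{..<\<delta> * \<delta>}"])
        (auto simp: U_def sq)
    define w where "w q = (sgn (fst q) \<bullet> fst v) *\<^sub>R fst q" for q :: "'b \<times> real"
    have c3: "continuous_on U w"
      unfolding w_def
      by (rule continuous_on_compose2[OF continuous_on_sgn_inner_scaleR continuous_on_fst[OF continuous_on_id]]) auto
    have "continuous_on U (\<lambda>q. (- \<mu> (fst q \<bullet> fst q) *\<^sub>R (norm (fst q) *\<^sub>R fst v + w q)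
      - (\<mu>1 (fst q \<bullet> fst q) * (2 * (fst q \<bullet> fst v))) *\<^sub>R (norm (fst q) *\<^sub>R fst q), 0 :: real))"
      by (intro continuous_intros c1 c2 c3)
    then show ?thesis by (simp add: hess_def w_def)
  qed
  then show "C2_on U f" using C2_on_gradientI[OF f' g'] by blast
  show "\<forall>q\<in>U. frechet_derivative f (at q) \<noteq> (\<lambda>v. 0)"
  proof
    fix q assume q: "q \<in> U"
    have "frechet_derivative f (at q) = (\<lambda>v. grad q \<bullet> v)"
      using frechet_derivative_at[OF f'[OF q]] by simp
    moreover have "grad q \<bullet> (0, 1) = 1" by (simp add: grad_def inner_prod_def)
    ultimately show "frechet_derivative f (at q) \<noteq> (\<lambda>v. 0)" by (metis zero_neq_one)
  qed
qed

section \<open>The geometry of the Heisenberg group\<close>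

text \<open>The complex structure. The form \<open>a \<bullet> rot b\<close> is the symplectic form
  of the group law, so coordinate sums become inner products.\<close>

definition rot :: "complex^'n::finite \<Rightarrow> complex^'n" where
  "rot z = (\<chi> k. \<i> * z $ k)"

lemma rot_linear: "linear rot"
  by (rule linearI) (simp_all add: rot_def vec_eq_iff algebra_simps)

lemmas rot_simps = linear_add[OF rot_linear] linear_cmul[OF rot_linear] linear_neg[OF rot_linear]
  linear_diff[OF rot_linear] linear_0[OF rot_linear]

lemma bounded_linear_rot: "bounded_linear rot"
  using rot_linear by (rule linear_conv_bounded_linear[THEN iffD1])

lemma rot_rot [simp]: "rot (rot z) = - z"
  by (simp add: rot_def vec_eq_iff)

lemma inner_rot_right: "a \<bullet> rot b = (\<Sum>k\<in>UNIV. Im (a $ k * cnj (b $ k)))"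
  by (simp add: inner_vec_def rot_def inner_complex_def algebra_simps)

lemma inner_rot_left: "rot a \<bullet> b = - (a \<bullet> rot b)"
  unfolding inner_vec_def rot_def sum_negf[symmetric] by (simp add: inner_complex_def algebra_simps)

lemma inner_rot_self [simp]: "a \<bullet> rot a = 0" "rot a \<bullet> a = 0"
  using inner_rot_left[of a a] by (simp_all add: inner_commute)

lemma inner_rot_rot [simp]: "rot a \<bullet> rot b = a \<bullet> b"
  by (simp add: inner_rot_left)

lemma norm_rot [simp]: "norm (rot z) = norm z"
  by (simp add: norm_eq_sqrt_inner)

lemma T_component_rot: "T_component p v = snd v - fst p \<bullet> rot (fst v)"
  by (simp add: T_component_def inner_rot_right)

lemma heis_metric_inner: "heis_metric p v w = fst v \<bullet> fst w + T_component p v * T_component p w"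
  by (simp add: heis_metric_def inner_vec_def inner_complex_def)

lemma horizontal_part_eq: "horizontal_part p v = (fst v, fst p \<bullet> rot (fst v))"
  by (rule prod_eqI)
    (simp_all add: horizontal_part_def heis_metric_inner T_component_rot T_field_def rot_simps)

lemma singular_set_eq: "singular_set S \<nu> = {p \<in> S. fst (\<nu> p) = 0}"
proof -
  have "horizontal_part p (\<nu> p) = 0 \<longleftrightarrow> fst (\<nu> p) = 0" for p
    unfolding horizontal_part_eq prod_eq_iff by (cases "fst (\<nu> p) = 0") (simp_all add: rot_simps)
  then show ?thesis unfolding singular_set_def by blast
qed

lemma horizontal_normal_eq:
  "horizontal_normal \<nu> p = (sgn (fst (\<nu> p)), fst p \<bullet> rot (sgn (fst (\<nu> p))))"
proof -
  have "heis_metric p (horizontal_part p (\<nu> p)) (horizontal_part p (\<nu> p)) = (norm (fst (\<nu> p)))\<^sup>2"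
    by (simp add: horizontal_part_eq heis_metric_inner T_component_rot dot_square_norm)
  then show ?thesis
    by (simp add: horizontal_normal_def Let_def horizontal_part_eq sgn_div_norm rot_simps inverse_eq_divide)
qed

lemma heis_metric_derivative:
  "((\<lambda>q. heis_metric q w u) has_derivative
     (\<lambda>v. - (fst v \<bullet> rot (fst w)) * T_component p u - T_component p w * (fst v \<bullet> rot (fst u)))) (at p)"
proof -
  have T: "((\<lambda>q. T_component q w) has_derivative (\<lambda>v. - (fst v \<bullet> rot (fst w)))) (at p)" for w
    unfolding T_component_rot
    by (rule has_derivative_eq_rhs, (rule derivative_intros)+) simp
  show ?thesis unfolding heis_metric_inner
    by (rule has_derivative_eq_rhs[OF has_derivative_add[OF has_derivative_const has_derivative_mult[OF T T]]])
      (simp add: fun_eq_iff algebra_simps)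
qed

text \<open>The metric depends on the base point only through \<open>T_component\<close>, whose
  derivative in the base point is the symplectic form. By antisymmetry the vertical parts of the
  Koszul expression cancel and \<open>c \<bullet> fst u\<close> remains; the vector representing
  this functional is the horizontal lift of \<open>c\<close>.\<close>

lemma christoffel_heis:
  fixes p v w :: "'n::finite heis"
  defines "c \<equiv> T_component p w *\<^sub>R rot (fst v) + T_component p v *\<^sub>R rot (fst w)"
  shows "christoffel heis_metric p v w = (c, fst p \<bullet> rot c)"
proof -
  define R where "R u = (frechet_derivative (\<lambda>q. heis_metric q w u) (at p) v
      + frechet_derivative (\<lambda>q. heis_metric q v u) (at p) w
      - frechet_derivative (\<lambda>q. heis_metric q v w) (at p) u) / 2" for u
  have fd: "frechet_derivative (\<lambda>q. heis_metric q w u) (at p) v =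
      - (fst v \<bullet> rot (fst w)) * T_component p u - T_component p w * (fst v \<bullet> rot (fst u))" for w u v
    using fun_cong[OF frechet_derivative_at[OF heis_metric_derivative[of w u p]], of v] by simp
  have sym: "a \<bullet> rot b = - (b \<bullet> rot a)" for a b :: "complex^'n"
    by (metis inner_commute inner_rot_left)
  have R: "R u = c \<bullet> fst u" for u
    unfolding R_def fd c_def
    using sym[of "fst w" "fst v"] sym[of "fst u" "fst v"] sym[of "fst u" "fst w"]
    by (simp add: inner_add_left inner_rot_left field_simps)
  show ?thesis
    unfolding christoffel_def
  proof (rule the_equality)
    show "\<forall>u. heis_metric p (c, fst p \<bullet> rot c) u = (frechet_derivative (\<lambda>q. heis_metric q w u) (at p) v
      + frechet_derivative (\<lambda>q. heis_metric q v u) (at p) w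
      - frechet_derivative (\<lambda>q. heis_metric q v w) (at p) u) / 2"
      using R unfolding R_def by (simp add: heis_metric_inner T_component_rot)
  next
    fix d assume d: "\<forall>u. heis_metric p d u = (frechet_derivative (\<lambda>q. heis_metric q w u) (at p) v
      + frechet_derivative (\<lambda>q. heis_metric q v u) (at p) w
      - frechet_derivative (\<lambda>q. heis_metric q v w) (at p) u) / 2"
    have "heis_metric p d u = R u" for u using d unfolding R_def by blast
    then have d: "fst d \<bullet> fst u + T_component p d * T_component p u = c \<bullet> fst u" for u
      by (simp add: heis_metric_inner R)
    \<comment> \<open>Uniqueness: testing against \<open>T\<close> removes the vertical component,
      then testing against the difference of the first components shows that it vanishes.\<close>
    have T: "T_component p d = 0" using d[of "(0, 1)"] by (simp add: T_component_rot rot_simps)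
    then have "(fst d - c) \<bullet> (fst d - c) = 0"
      using d[of "(fst d - c, 0)"] by (simp add: inner_diff_left)
    then show "d = (c, fst p \<bullet> rot c)"
      using T by (intro prod_eqI) (simp_all add: T_component_rot)
  qed
qed

text \<open>This passes from the frame to coordinates. The last coordinate exceeds the component
  \<open>r'\<close> along \<open>T\<close> by \<open>r^2 r'\<close>, the contribution of the
  vertical coordinates of the horizontal frame fields.\<close>

lemma revolution_normal_eq:
  fixes \<omega> :: "complex^'n::finite"
  assumes "norm \<omega> = 1"
  shows "revolution_normal r u r' t' \<omega> =
    (1 / sqrt (r'\<^sup>2 + t'\<^sup>2 + r\<^sup>2 * r'\<^sup>2)) *\<^sub>R (- (r * r') *\<^sub>R rot \<omega> - t' *\<^sub>R \<omega>, r' + r\<^sup>2 * r')"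
proof -
  define V :: "'n heis" where "V = (- (r * r') *\<^sub>R rot \<omega> - t' *\<^sub>R \<omega>, r' + r\<^sup>2 * r')"
  let ?p = "(r *\<^sub>R \<omega>, u)"
  have T: "T_component ?p V = r'"
    using assms by (simp add: V_def T_component_rot rot_simps inner_diff_right dot_square_norm power2_eq_square)
  have c: "Re (fst V $ k) = r * r' * Im (\<omega> $ k) - t' * Re (\<omega> $ k)"
    "Im (fst V $ k) = - r * r' * Re (\<omega> $ k) - t' * Im (\<omega> $ k)" for k
    by (simp_all add: V_def rot_def)
  note heis_frame_expansion[of V ?p, unfolded T c, symmetric]
  then show ?thesis
    unfolding revolution_normal_def Let_def V_def[symmetric] by (simp only:)
qed

section \<open>Tangent space and divergence at a point of a hypersurface of revolution\<close>

lemma subspace_heis_tangent: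
  "subspace {v :: (complex^'n::finite) \<times> real. \<exists>\<alpha>. \<omega> \<bullet> fst v = \<alpha> * a \<and> snd v = \<alpha> * b}"
proof (rule subspaceI)
  fix v w :: "(complex^'n) \<times> real"
  assume "v \<in> {v. \<exists>\<alpha>. \<omega> \<bullet> fst v = \<alpha> * a \<and> snd v = \<alpha> * b}" "w \<in> {v. \<exists>\<alpha>. \<omega> \<bullet> fst v = \<alpha> * a \<and> snd v = \<alpha> * b}"
  then obtain \<alpha> \<beta> where "\<omega> \<bullet> fst v = \<alpha> * a" "snd v = \<alpha> * b" "\<omega> \<bullet> fst w = \<beta> * a" "snd w = \<beta> * b" by auto
  then show "v + w \<in> {v. \<exists>\<alpha>. \<omega> \<bullet> fst v = \<alpha> * a \<and> snd v = \<alpha> * b}"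
    by (auto intro!: exI[of _ "\<alpha> + \<beta>"] simp: inner_add_right algebra_simps)
next
  fix c and v :: "(complex^'n) \<times> real"
  assume "v \<in> {v. \<exists>\<alpha>. \<omega> \<bullet> fst v = \<alpha> * a \<and> snd v = \<alpha> * b}"
  then obtain \<alpha> where "\<omega> \<bullet> fst v = \<alpha> * a" "snd v = \<alpha> * b" by auto
  then show "c *\<^sub>R v \<in> {v. \<exists>\<alpha>. \<omega> \<bullet> fst v = \<alpha> * a \<and> snd v = \<alpha> * b}"
    by (auto intro!: exI[of _ "c * \<alpha>"])
qed (auto intro!: exI[of _ 0])

text \<open>The local data of a hypersurface of revolution at a point: \<open>sf\<close> recovers the parameter of
  the curve, \<open>(a, b)\<close> is its velocity, and \<open>(P, y)\<close>, of angular speed \<open>\<kappa>\<close>, is the unit vector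
  \<open>(cos \<phi>, sin \<phi>)\<close> such that the horizontal normal is \<open>- e\<^sup>i\<^sup>\<phi> \<omega>\<close>.\<close>

locale revolution_point =
  fixes S :: "'n::finite heis set" and \<omega> :: "complex^'n" and r a b W P y \<kappa> s0 :: real
    and x t Pf yf :: "real \<Rightarrow> real" and sf :: "'n heis \<Rightarrow> real" and sf' :: "'n heis \<Rightarrow> real"
    and U :: "'n heis set" and \<epsilon> :: real
  assumes \<omega>: "norm \<omega> = 1" and r: "0 < r" and ab: "a\<^sup>2 + b\<^sup>2 = 1" and W: "0 < W"
    and aW: "r * a = W * y" and bW: "b = W * P" and Py: "P\<^sup>2 + y\<^sup>2 = 1"
    and x0: "x s0 = r" and P0: "Pf s0 = P" and y0: "yf s0 = y"
    and x': "(x has_real_derivative a) (at s0)" and t': "(t has_real_derivative b) (at s0)"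
    and Pf': "(Pf has_real_derivative - y * \<kappa>) (at s0)" and yf': "(yf has_real_derivative P * \<kappa>) (at s0)"
    and sf': "(sf has_derivative sf') (at (r *\<^sub>R \<omega>, t s0))" and sf0: "sf (r *\<^sub>R \<omega>, t s0) = s0"
    and U: "open U" "(r *\<^sub>R \<omega>, t s0) \<in> U"
    and SU: "\<And>q. q \<in> S \<Longrightarrow> q \<in> U \<Longrightarrow> norm (fst q) = x (sf q) \<and> snd q = t (sf q)"
    and \<epsilon>: "0 < \<epsilon>"
    and in_S: "\<And>s \<omega>'. \<bar>s - s0\<bar> < \<epsilon> \<Longrightarrow> norm \<omega>' = 1 \<Longrightarrow> norm (\<omega>' - \<omega>) < \<epsilon> \<Longrightarrow> (x s *\<^sub>R \<omega>', t s) \<in> S"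
begin

definition p where "p = (r *\<^sub>R \<omega>, t s0)"

definition TS where "TS = {v :: 'n heis. \<exists>\<alpha>. \<omega> \<bullet> fst v = \<alpha> * a \<and> snd v = \<alpha> * b}"

lemma \<omega>_simps [simp]: "\<omega> \<bullet> \<omega> = 1" "sgn (r *\<^sub>R \<omega>) = \<omega>" "\<omega> \<noteq> 0" "norm (r *\<^sub>R \<omega>) = r"
  using \<omega> r by (auto simp: dot_square_norm sgn_div_norm)

lemma p_in_S: "p \<in> S"
  using in_S[of s0 \<omega>] \<epsilon> \<omega> x0 by (simp add: p_def)

text \<open>Along a curve in \<open>S\<close> the radius and the height are \<open>x\<close> and
  \<open>t\<close> composed with \<open>sf\<close>. The chain rule then gives both equations, with
  the derivative of \<open>sf\<close> along \<open>v\<close> as the common factor.\<close>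

lemma tangent_space_le:
  assumes "v \<in> tangent_space S p"
  shows "\<omega> \<bullet> fst v = a * sf' v" "snd v = b * sf' v"
proof -
  obtain c where c: "range c \<subseteq> S" "c 0 = p" "(c has_vector_derivative v) (at 0)"
    using assms unfolding tangent_space_def by blast
  have c': "(c has_derivative (\<lambda>h. h *\<^sub>R v)) (at 0)" using c(3) by (simp add: has_vector_derivative_def)
  have lin: "linear sf'" using sf' has_derivative_linear by blast
  have "(c \<longlongrightarrow> p) (at 0)" using has_vector_derivative_continuous[OF c(3)] c(2) by (simp add: isCont_def)
  then have ev: "\<forall>\<^sub>F h in at 0. c h \<in> U" using U unfolding p_def by (metis topological_tendstoD)
  have sfc: "((\<lambda>h. sf (c h)) has_real_derivative sf' v) (at 0)"
    using has_derivative_compose[OF c' sf'[folded p_def c(2)]]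
    unfolding has_field_derivative_def
    by (rule has_derivative_eq_rhs) (simp add: linear_cmul[OF lin] fun_eq_iff)
  have s0: "sf (c 0) = s0" using sf0 c(2) by (simp add: p_def)
  have d1: "((\<lambda>h. x (sf (c h))) has_real_derivative a * sf' v) (at 0)"
    using DERIV_chain2[OF _ sfc, of x a] x' s0 by simp
  have d2: "((\<lambda>h. t (sf (c h))) has_real_derivative b * sf' v) (at 0)"
    using DERIV_chain2[OF _ sfc, of t b] t' s0 by simp
  have "((\<lambda>q. norm (fst q)) has_derivative (\<lambda>v. sgn (fst p) \<bullet> fst v)) (at (c 0))"
    unfolding c(2) by (rule has_derivative_norm_fst) (use r in \<open>auto simp: p_def\<close>)
  from has_derivative_compose[OF c' this]
  have n1: "((\<lambda>h. norm (fst (c h))) has_real_derivative \<omega> \<bullet> fst v) (at 0)"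
    unfolding has_field_derivative_def
    by (rule has_derivative_eq_rhs) (simp add: p_def fun_eq_iff)
  have n2: "((\<lambda>h. snd (c h)) has_real_derivative snd v) (at 0)"
    unfolding has_field_derivative_def
    by (rule has_derivative_eq_rhs[OF has_derivative_snd[OF c']]) (simp add: fun_eq_iff)
  have e: "\<forall>\<^sub>F h in at 0. norm (fst (c h)) = x (sf (c h))" "\<forall>\<^sub>F h in at 0. snd (c h) = t (sf (c h))"
    by (rule eventually_mono[OF ev], use c(1) SU in blast)+
  have at0: "norm (fst (c 0)) = x (sf (c 0))" "snd (c 0) = t (sf (c 0))"
    using SU[of p] p_in_S U c(2) by (auto simp: p_def)
  have "((\<lambda>h. x (sf (c h))) has_real_derivative \<omega> \<bullet> fst v) (at 0)"
    using n1 unfolding has_field_derivative_def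
    by (rule has_derivative_transform_eventually[OF _ e(1) at0(1)]) simp
  then show "\<omega> \<bullet> fst v = a * sf' v" using DERIV_unique d1 by blast
  have "((\<lambda>h. t (sf (c h))) has_real_derivative snd v) (at 0)"
    using n2 unfolding has_field_derivative_def
    by (rule has_derivative_transform_eventually[OF _ e(2) at0(2)]) simp
  then show "snd v = b * sf' v" using DERIV_unique d2 by blast
qed

text \<open>A curve with velocity \<open>v\<close> is obtained by moving the profile parameter at
  speed \<alpha> and the direction along the normalised line \<open>\<omega> + h wr\<close>. The
  vector \<open>wr\<close> is orthogonal to \<omega>, so normalising does not change the velocity,
  and it carries a factor \<open>1 / r\<close> because directions are multiplied by the
  radius.\<close>

lemma TS_le_tangent_space:
  assumes "v \<in> TS"
  shows "v \<in> tangent_space S p"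
proof -
  obtain \<alpha> where \<alpha>: "\<omega> \<bullet> fst v = \<alpha> * a" "snd v = \<alpha> * b" using assms by (auto simp: TS_def)
  define w where "w = fst v - (\<alpha> * a) *\<^sub>R \<omega>"
  have w: "\<omega> \<bullet> w = 0" using \<alpha> by (simp add: w_def inner_diff_right)
  define wr where "wr = (1 / r) *\<^sub>R w"
  have wr: "\<omega> \<bullet> wr = 0" "r *\<^sub>R wr = w" using w r by (simp_all add: wr_def)
  define m where "m h = \<omega> + h *\<^sub>R wr" for h
  define c0 where "c0 h = (x (s0 + \<alpha> * h) *\<^sub>R sgn (m h), t (s0 + \<alpha> * h))" for h
  \<comment> \<open>\<open>tangent_space\<close> asks for curves defined on the whole line with
    range in \<open>S\<close>; outside the set where \<open>c0\<close> is known to lie in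
    \<open>S\<close> the curve is therefore set to the constant \<open>p\<close>.\<close>
  define Q where "Q h \<longleftrightarrow> \<bar>\<alpha> * h\<bar> < \<epsilon> \<and> m h \<noteq> 0 \<and> norm (sgn (m h) - \<omega>) < \<epsilon>" for h
  define c where "c h = (if Q h then c0 h else p)" for h
  have m0: "m 0 = \<omega>" by (simp add: m_def)
  have sm0: "sgn (m 0) = \<omega>" using \<omega> by (simp add: m_def sgn_div_norm)
  have m': "(m has_derivative (\<lambda>h. h *\<^sub>R wr)) (at 0)"
    unfolding m_def by (auto intro!: derivative_eq_intros)
  have mnz: "m 0 \<noteq> 0" using m0 by simp
  have cont_m: "isCont m 0" unfolding m_def by (intro continuous_intros) 
  have cont_s: "isCont (\<lambda>h. sgn (m h)) 0" by (intro continuous_intros cont_m mnz)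
  have "\<forall>\<^sub>F h in at 0. \<bar>\<alpha> * h\<bar> < \<epsilon>"
  proof -
    have "((\<lambda>h. \<bar>\<alpha> * h\<bar>) \<longlongrightarrow> \<bar>\<alpha> * 0\<bar>) (at 0)" by (intro tendsto_intros)
    then show ?thesis using order_tendstoD(2)[of _ "\<bar>\<alpha> * 0\<bar>" "at 0" \<epsilon>] \<epsilon> by simp
  qed
  moreover have "\<forall>\<^sub>F h in at 0. m h \<noteq> 0"
    using tendsto_imp_eventually_ne[OF cont_m[unfolded isCont_def] mnz] .
  moreover have "\<forall>\<^sub>F h in at 0. norm (sgn (m h) - \<omega>) < \<epsilon>"
    using tendstoD[OF cont_s[unfolded isCont_def] \<epsilon>] sm0 by (simp add: dist_norm)
  ultimately have evQ: "\<forall>\<^sub>F h in at 0. c0 h = c h"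
    by eventually_elim (simp add: c_def Q_def)
  have Q0: "Q 0" using \<epsilon> sm0 mnz by (simp add: Q_def)
  have c00: "c0 0 = p" using sm0 x0 by (simp add: c0_def p_def)
  have ng: "((\<lambda>h. inverse (norm (m h))) has_derivative (\<lambda>h. 0)) (at 0)"
  proof -
    have "((\<lambda>h. norm (m h)) has_derivative (\<lambda>h. 0)) (at 0)"
      using has_derivative_compose[OF m' has_derivative_norm[OF mnz]] m0 \<omega> wr
      by (simp add: sgn_div_norm inner_commute)
    from Deriv.has_derivative_inverse[OF _ this] mnz show ?thesis by simp
  qed
  have sg: "((\<lambda>h. sgn (m h)) has_derivative (\<lambda>h. h *\<^sub>R wr)) (at 0)"
    using has_derivative_scaleR[OF ng m'] m0 \<omega> by (simp add: sgn_div_norm)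
  have sh: "((\<lambda>h. s0 + \<alpha> * h) has_real_derivative \<alpha>) (at 0)" by (auto intro!: derivative_eq_intros)
  have xs: "((\<lambda>h. x (s0 + \<alpha> * h)) has_derivative (\<lambda>h. a * \<alpha> * h)) (at 0)"
    using DERIV_chain2[OF _ sh, of x a] x' by (simp add: has_field_derivative_def)
  have ts: "((\<lambda>h. t (s0 + \<alpha> * h)) has_derivative (\<lambda>h. b * \<alpha> * h)) (at 0)"
    using DERIV_chain2[OF _ sh, of t b] t' by (simp add: has_field_derivative_def)
  have eqf: "(x (s0 + \<alpha> * 0) *\<^sub>R h *\<^sub>R wr + (a * \<alpha> * h) *\<^sub>R sgn (m 0), b * \<alpha> * h) = h *\<^sub>R v" for h
  proof -
    have "r *\<^sub>R h *\<^sub>R wr = h *\<^sub>R w" using wr(2) by (metis scaleR_left_commute)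
    then show ?thesis using x0 sm0 \<alpha> by (simp add: w_def prod_eq_iff algebra_simps)
  qed
  have "(c0 has_derivative (\<lambda>h. h *\<^sub>R v)) (at 0)"
    unfolding c0_def
    by (rule has_derivative_eq_rhs[OF has_derivative_Pair[OF has_derivative_scaleR[OF xs sg] ts]])
      (simp only: eqf)
  then have "(c has_vector_derivative v) (at 0)"
    unfolding has_vector_derivative_def
    by (rule has_derivative_transform_eventually[OF _ evQ]) (use Q0 in \<open>auto simp: c_def\<close>)
  moreover have "range c \<subseteq> S"
  proof (rule image_subsetI)
    fix h :: real show "c h \<in> S"
    proof (cases "Q h")
      case True
      then show ?thesis using in_S[of "s0 + \<alpha> * h" "sgn (m h)"] by (simp add: c_def c0_def Q_def norm_sgn)
    qed (simp add: c_def p_in_S)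
  qed
  moreover have "c 0 = p" using Q0 c00 by (simp add: c_def)
  ultimately show ?thesis unfolding tangent_space_def by blast
qed

lemma tangent_space_eq: "tangent_space S p = TS"
proof (intro subset_antisym subsetI)
  fix v assume "v \<in> tangent_space S p"
  from tangent_space_le[OF this] show "v \<in> TS"
    unfolding TS_def by (intro CollectI exI[of _ "sf' v"]) (simp add: mult.commute)
qed (rule TS_le_tangent_space)

text \<open>\<open>(a, b)\<close> is a unit vector, so one of the two tangency equations determines
  the derivative of \<open>sf\<close> on tangent vectors.\<close>

lemma sf'_TS:
  assumes "\<omega> \<bullet> fst v = \<alpha> * a" "snd v = \<alpha> * b"
  shows "sf' v = \<alpha>"
proof -
  have "v \<in> tangent_space S p" using assms TS_le_tangent_space[of v] by (auto simp: TS_def)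
  from tangent_space_le[OF this] assms have "(sf' v - \<alpha>) * a = 0" "(sf' v - \<alpha>) * b = 0"
    by (auto simp: algebra_simps)
  then show ?thesis using ab by auto
qed

definition A where "A = sqrt (W\<^sup>2 + a\<^sup>2)"

text \<open>Up to sign the horizontal normal turned by \<open>rot\<close> and lifted horizontally:
  the horizontal tangent direction that exists also in the smallest dimension.\<close>

definition e1 :: "'n heis" where "e1 = (P *\<^sub>R rot \<omega> - y *\<^sub>R \<omega>, - r * P)"

text \<open>The normal of the hypersurface is proportional to \<open>- W\<close> times the lift of
  \<open>P *\<^sub>R \<omega> + y *\<^sub>R rot \<omega>\<close> plus \<open>a\<close> times
  \<open>T\<close>, of length \<open>A\<close>. Turning it by a right angle in the plane of these
  two vectors gives \<open>a / A\<close> and \<open>W / A\<close> as the new coefficients.\<close>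

definition e2 :: "'n heis" where "e2 = ((a / A) *\<^sub>R (P *\<^sub>R \<omega> + y *\<^sub>R rot \<omega>), W * P\<^sup>2 / A)"

lemma A_pos: "0 < A" and A2: "A\<^sup>2 = W\<^sup>2 + a\<^sup>2"
proof -
  have "0 < W\<^sup>2 + a\<^sup>2" using W by (simp add: add_pos_nonneg)
  then show "0 < A" "A\<^sup>2 = W\<^sup>2 + a\<^sup>2" by (simp_all add: A_def)
qed

lemma T_e1: "T_component p e1 = 0"
  by (simp add: T_component_rot e1_def p_def rot_simps inner_diff_right)

lemma T_e2: "T_component p e2 = W / A"
proof -
  have "T_component p e2 = (W * P\<^sup>2 + r * a * y) / A"
    by (simp add: T_component_rot e2_def p_def rot_simps inner_add_right inner_diff_right add_divide_distrib)
  also have "W * P\<^sup>2 + r * a * y = W * (P\<^sup>2 + y\<^sup>2)" unfolding aW by (simp add: algebra_simps power2_eq_square)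
  finally show ?thesis using Py by simp
qed

lemma metric_e: "heis_metric p e1 e1 = 1" "heis_metric p e2 e2 = 1" "heis_metric p e1 e2 = 0"
proof -
  have "heis_metric p e1 e1 = P\<^sup>2 + y\<^sup>2"
    by (simp add: heis_metric_inner T_e1)
      (simp add: e1_def inner_diff_left inner_diff_right power2_eq_square)
  then show "heis_metric p e1 e1 = 1" using Py by simp
  have "heis_metric p e2 e2 = (a / A)\<^sup>2 * (P\<^sup>2 + y\<^sup>2) + (W / A)\<^sup>2"
    by (simp add: heis_metric_inner T_e2) (simp add: e2_def inner_add_left inner_add_right power2_eq_square algebra_simps add_divide_distrib)
  also have "\<dots> = (W\<^sup>2 + a\<^sup>2) / A\<^sup>2" using Py by (simp add: power_divide add_divide_distrib)
  finally show "heis_metric p e2 e2 = 1" using A2 A_pos W by (metis divide_self less_irrefl zero_less_power)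
  show "heis_metric p e1 e2 = 0"
    by (simp add: heis_metric_inner T_e1) (simp add: e1_def e2_def inner_diff_left inner_add_right)
qed

text \<open>The complex orthogonal complement of \<omega>: at \<open>p\<close> its vectors, with
  last coordinate 0, are at once horizontal and tangent.\<close>

definition K0 where "K0 = {v :: complex^'n. \<omega> \<bullet> v = 0 \<and> rot \<omega> \<bullet> v = 0}"

lemma subspace_K0: "subspace K0"
  by (rule subspaceI) (auto simp: K0_def inner_add_right)

lemma dim_K0: "dim K0 + 2 = 2 * CARD('n)"
proof -
  have nz: "rot \<omega> \<noteq> 0" using \<omega> norm_rot by (metis norm_zero zero_neq_one)
  have "independent {\<omega>, rot \<omega>}"
    by (rule pairwise_orthogonal_independent) (use nz in \<open>auto simp: pairwise_def orthogonal_def\<close>)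
  moreover have ne: "\<omega> \<noteq> rot \<omega>"
    by (metis \<omega>_simps(1) inner_rot_self(1) zero_neq_one)
  ultimately have "dim (span {\<omega>, rot \<omega>}) = 2" by (simp add: dim_eq_card_independent)
  moreover have "{v \<in> UNIV. \<forall>u\<in>span {\<omega>, rot \<omega>}. orthogonal u v} = K0"
  proof (intro subset_antisym subsetI)
    fix v assume "v \<in> {v \<in> UNIV. \<forall>u\<in>span {\<omega>, rot \<omega>}. orthogonal u v}"
    then have "orthogonal \<omega> v" "orthogonal (rot \<omega>) v" by (auto intro: span_base)
    then show "v \<in> K0" by (simp add: K0_def orthogonal_def)
  next
    fix v assume v: "v \<in> K0"
    have "orthogonal v u" if u: "u \<in> span {\<omega>, rot \<omega>}" for u
      by (rule orthogonal_to_span[OF u]) (use v in \<open>auto simp: K0_def orthogonal_def inner_commute\<close>)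
    then show "v \<in> {v \<in> UNIV. \<forall>u\<in>span {\<omega>, rot \<omega>}. orthogonal u v}"
      by (simp add: orthogonal_commute)
  qed
  ultimately show ?thesis
    using dim_subspace_orthogonal_to_vectors[of "span {\<omega>, rot \<omega>}" UNIV] by simp
qed

lemma orthonormal_frame:
  obtains B0 where "finite B0" "card B0 = 2 * CARD('n) - 2" "\<And>v. v \<in> B0 \<Longrightarrow> v \<bullet> v = 1" "B0 \<subseteq> K0"
    "e1 \<noteq> e2" "e1 \<notin> (\<lambda>v. (v, 0)) ` B0" "e2 \<notin> (\<lambda>v. (v, 0)) ` B0"
    "orthonormal_basis_of heis_metric p TS (insert e1 (insert e2 ((\<lambda>v. (v, 0)) ` B0)))"
proof -
  obtain B0 where B0: "B0 \<subseteq> K0" "pairwise orthogonal B0" "\<And>v. v \<in> B0 \<Longrightarrow> norm v = 1"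
    "independent B0" "card B0 = dim K0" "span B0 = K0"
    using orthonormal_basis_subspace[OF subspace_K0] by blast
  have fin: "finite B0" using B0(4) by (rule independent_imp_finite)
  define B where "B = insert e1 (insert e2 ((\<lambda>v. (v, 0)) ` B0))"
  have K0D: "\<omega> \<bullet> v = 0" "rot \<omega> \<bullet> v = 0" "v \<bullet> \<omega> = 0" "v \<bullet> rot \<omega> = 0" "\<omega> \<bullet> rot v = 0"
    "T_component p (v, 0) = 0" if "v \<in> B0" for v
    using that B0(1) inner_rot_left[of \<omega> v] by (auto simp: K0_def T_component_rot p_def inner_commute)
  have bb: "heis_metric p (v, 0) (w, 0) = (if v = w then 1 else 0)" if "v \<in> B0" "w \<in> B0" for v w
    using that K0D B0(2,3) by (auto simp: heis_metric_inner dot_square_norm pairwise_def orthogonal_def)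
  have b1: "heis_metric p (v, 0) e1 = 0" "heis_metric p e1 (v, 0) = 0"
    "heis_metric p (v, 0) e2 = 0" "heis_metric p e2 (v, 0) = 0" if "v \<in> B0" for v
    using K0D[OF that] by (simp_all add: heis_metric_inner)
      (simp_all add: e1_def e2_def inner_add_right inner_diff_right inner_add_left inner_diff_left)
  have sym: "heis_metric p e2 e1 = 0" using metric_e(3) by (simp add: heis_metric_inner inner_commute mult.commute)
  have ne': "e1 \<noteq> (v, 0)" "e2 \<noteq> (v, 0)" "(v, 0) \<noteq> e1" "(v, 0) \<noteq> e2" if "v \<in> B0" for v
    using b1(1,3)[OF that] metric_e(1,2) by (metis zero_neq_one)+
  have ne12: "e1 \<noteq> e2" using metric_e by (metis zero_neq_one)
  have ne: "e1 \<noteq> e2" "e1 \<notin> (\<lambda>v. (v, 0)) ` B0" "e2 \<notin> (\<lambda>v. (v, 0)) ` B0"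
    using ne12 ne' by blast+
  have TSs: "subspace TS" unfolding TS_def by (rule subspace_heis_tangent)
  have e1T: "e1 \<in> TS" unfolding TS_def
    by (rule CollectI, rule exI[of _ "- (r / W)"])
      (use aW bW W in \<open>simp add: e1_def inner_diff_right\<close>)
  have e2T: "e2 \<in> TS" unfolding TS_def
    by (rule CollectI, rule exI[of _ "P / A"])
      (use bW in \<open>simp add: e2_def inner_add_right power2_eq_square\<close>)
  have "span B = TS"
  proof
    show "span B \<subseteq> TS"
      by (rule span_minimal[OF _ TSs]) (use e1T e2T K0D in \<open>auto simp: B_def TS_def\<close>)
    show "TS \<subseteq> span B"
    proof
      fix v assume "v \<in> TS"
      then obtain \<alpha> where \<alpha>: "\<omega> \<bullet> fst v = \<alpha> * a" "snd v = \<alpha> * b" by (auto simp: TS_def)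
      define v0 where "v0 = fst v - (\<alpha> * a) *\<^sub>R \<omega> - (rot \<omega> \<bullet> fst v) *\<^sub>R rot \<omega>"
      have "v0 \<in> K0" using \<alpha> by (simp add: v0_def K0_def inner_diff_right)
      then have "(v0, 0::real) \<in> (\<lambda>v. (v, 0)) ` span B0" using B0(6) by blast
      also have "(\<lambda>v. (v, 0::real)) ` span B0 = span ((\<lambda>v. (v, 0)) ` B0)"
        by (rule linear_span_image[symmetric]) (auto intro!: linearI)
      finally have 1: "(v0, 0) \<in> span B" using span_mono[of "(\<lambda>v. (v, 0)) ` B0" B] by (auto simp: B_def)
      have e: "e1 \<in> span B" "e2 \<in> span B" by (auto simp: B_def intro: span_base)
      \<comment> \<open>Besides \<open>K0\<close>, the space \<open>TS\<close> contains the sphere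
        direction \<open>rot \<omega>\<close> and the velocity of the curve. The coefficients of
        these two vectors in \<open>e1\<close> and \<open>e2\<close> are their metric products with
        the frame.\<close>
      have 2: "(rot \<omega>, 0) = P *\<^sub>R e1 + (r * A / W) *\<^sub>R e2"
      proof (rule prod_eqI)
        have "P *\<^sub>R (P *\<^sub>R rot \<omega> - y *\<^sub>R \<omega>) + (r * a / W) *\<^sub>R (P *\<^sub>R \<omega> + y *\<^sub>R rot \<omega>) = (P\<^sup>2 + y\<^sup>2) *\<^sub>R rot \<omega>"
          unfolding aW using W by (simp add: algebra_simps power2_eq_square)
        then show "fst (rot \<omega>, 0::real) = fst (P *\<^sub>R e1 + (r * A / W) *\<^sub>R e2)"
          using A_pos Py by (simp add: e1_def e2_def)
        show "snd (rot \<omega>, 0::real) = snd (P *\<^sub>R e1 + (r * A / W) *\<^sub>R e2)"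
          using A_pos W by (simp add: e1_def e2_def power2_eq_square)
      qed
      have 3: "(a *\<^sub>R \<omega>, b) = (- (a * y)) *\<^sub>R e1 + (A * P) *\<^sub>R e2"
      proof (rule prod_eqI)
        have "(- (a * y)) *\<^sub>R (P *\<^sub>R rot \<omega> - y *\<^sub>R \<omega>) + (P * a) *\<^sub>R (P *\<^sub>R \<omega> + y *\<^sub>R rot \<omega>) = (a * (P\<^sup>2 + y\<^sup>2)) *\<^sub>R \<omega>"
          by (simp add: algebra_simps power2_eq_square)
        then show "fst (a *\<^sub>R \<omega>, b) = fst ((- (a * y)) *\<^sub>R e1 + (A * P) *\<^sub>R e2)"
          using A_pos Py by (simp add: e1_def e2_def)
        have "(- (a * y)) * (- r * P) + (A * P) * (W * P\<^sup>2 / A) = P * (r * a * y + W * P\<^sup>2)"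
          using A_pos by (simp add: algebra_simps)
        also have "\<dots> = W * P * (P\<^sup>2 + y\<^sup>2)" unfolding aW by (simp add: algebra_simps power2_eq_square)
        finally show "snd (a *\<^sub>R \<omega>, b) = snd ((- (a * y)) *\<^sub>R e1 + (A * P) *\<^sub>R e2)"
          using bW Py by (simp add: e1_def e2_def)
      qed
      have "(rot \<omega>, 0) \<in> span B" "(a *\<^sub>R \<omega>, b) \<in> span B"
        unfolding 2 3 by (intro span_add span_scale e)+
      then have "(v0, 0) + (rot \<omega> \<bullet> fst v) *\<^sub>R (rot \<omega>, 0) + \<alpha> *\<^sub>R (a *\<^sub>R \<omega>, b) \<in> span B"
        using 1 by (intro span_add span_scale)
      also have "(v0, 0) + (rot \<omega> \<bullet> fst v) *\<^sub>R (rot \<omega>, 0) + \<alpha> *\<^sub>R (a *\<^sub>R \<omega>, b) = v"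
        using \<alpha> by (simp add: v0_def prod_eq_iff)
      finally show "v \<in> span B" .
    qed
  qed
  moreover have "\<forall>e\<in>B. \<forall>e'\<in>B. heis_metric p e e' = (if e = e' then 1 else 0)"
    unfolding B_def by (simp add: metric_e sym b1 bb ne12 ne12[symmetric] ne')
  ultimately have "orthonormal_basis_of heis_metric p TS B"
    using fin by (simp add: orthonormal_basis_of_def B_def)
  then show ?thesis
    using that[OF fin _ _ B0(1) ne] B0(3,5) dim_K0 by (simp add: B_def dot_square_norm)
qed

text \<open>In the adapted frame each of the \<open>2 n - 2\<close> directions of \<open>K0\<close>
  contributes \<open>- P / r\<close>, as on a sphere of radius \<open>r\<close>. The vector
  \<open>e1\<close> contributes \<open>r \<kappa> / W - P / r\<close>, since it moves both the
  direction and, at speed \<open>- r / W\<close>, the parameter; the contributions to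
  \<open>e2\<close> cancel.\<close>

lemma divergence:
  assumes Hn: "\<And>q. q \<in> S \<Longrightarrow> q \<in> U \<Longrightarrow> Hn q = (let w = - (Pf (sf q) *\<^sub>R sgn (fst q) + yf (sf q) *\<^sub>R rot (sgn (fst q)))
      in (w, fst q \<bullet> rot w))"
  shows "has_divergence_along heis_metric S Hn p (r * \<kappa> / W - (2 * real CARD('n) - 1) * P / r)"
proof -
  define D where "D v = (fst v - (\<omega> \<bullet> fst v) *\<^sub>R \<omega>) /\<^sub>R r" for v :: "'n heis"
  define w where "w q = - (Pf (sf q) *\<^sub>R sgn (fst q) + yf (sf q) *\<^sub>R rot (sgn (fst q)))" for q
  define w' where "w' v = - ((- y * \<kappa> * sf' v) *\<^sub>R \<omega> + P *\<^sub>R D v + (P * \<kappa> * sf' v) *\<^sub>R rot \<omega> + y *\<^sub>R rot (D v))" for v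
  define w0 where "w0 = - (P *\<^sub>R \<omega> + y *\<^sub>R rot \<omega>)"
  have w0: "w p = w0" using sf0 P0 y0 by (simp add: w_def w0_def p_def)
  define W' where "W' v = (w' v, fst v \<bullet> rot w0 + fst p \<bullet> rot (w' v))" for v
  have sg: "((\<lambda>q. sgn (fst q)) has_derivative D) (at p)"
    unfolding D_def
    by (rule has_derivative_eq_rhs[OF has_derivative_sgn_fst]) (use r \<omega> in \<open>auto simp: p_def fun_eq_iff\<close>)
  have rsg: "((\<lambda>q. rot (sgn (fst q))) has_derivative (\<lambda>v. rot (D v))) (at p)"
    by (rule bounded_linear.has_derivative[OF bounded_linear_rot sg])
  have sfp: "sf p = s0" using sf0 by (simp add: p_def)
  have Pd: "((\<lambda>q. Pf (sf q)) has_derivative (\<lambda>v. - y * \<kappa> * sf' v)) (at p)"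
  proof -
    have "(Pf has_derivative (\<lambda>v. - y * \<kappa> * v)) (at (sf p))"
      using Pf' unfolding has_field_derivative_def sfp .
    then show ?thesis by (rule has_derivative_compose[OF sf'[folded p_def]])
  qed
  have yd: "((\<lambda>q. yf (sf q)) has_derivative (\<lambda>v. P * \<kappa> * sf' v)) (at p)"
  proof -
    have "(yf has_derivative (\<lambda>v. P * \<kappa> * v)) (at (sf p))"
      using yf' unfolding has_field_derivative_def sfp .
    then show ?thesis by (rule has_derivative_compose[OF sf'[folded p_def]])
  qed
  have wd: "(w has_derivative w') (at p)"
    unfolding w_def
    by (rule has_derivative_eq_rhs[OF has_derivative_minus[OF has_derivative_add[OF
            has_derivative_scaleR[OF Pd sg] has_derivative_scaleR[OF yd rsg]]]])
      (use sf0 P0 y0 in \<open>auto simp: w'_def fun_eq_iff p_def algebra_simps\<close>)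
  have "((\<lambda>q. (w q, fst q \<bullet> rot (w q))) has_derivative W') (at p)"
    unfolding W'_def
    by (rule has_derivative_eq_rhs[OF has_derivative_Pair[OF wd has_derivative_inner[OF
            has_derivative_fst[OF has_derivative_ident] bounded_linear.has_derivative[OF bounded_linear_rot wd]]]])
      (auto simp: fun_eq_iff w0)
  then have ext: "((\<lambda>q. (w q, fst q \<bullet> rot (w q))) has_derivative W') (at p within S)"
    by (rule has_derivative_at_withinI)
  obtain d where d: "0 < d" "ball p d \<subseteq> U" using U unfolding p_def open_contains_ball by blast
  have HnD: "(Hn has_derivative W') (at p within S)"
  proof (rule has_derivative_transform_within[OF ext d(1) p_in_S])
    fix q assume q: "q \<in> S" "dist q p < d"
    then have "q \<in> U" using d(2) by (auto simp: dist_commute)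
    then show "(w q, fst q \<bullet> rot (w q)) = Hn q" using Hn[OF q(1)] by (simp add: w_def Let_def)
  qed
  have Hnp: "Hn p = (w0, fst p \<bullet> rot w0)"
    using Hn[OF p_in_S] U w0 by (simp add: p_def[symmetric] w_def Let_def)
  define qf where "qf e = heis_metric p (W' e + christoffel heis_metric p e (Hn p)) e" for e
  \<comment> \<open>The factor 2 has two sources: the Christoffel term, and the base point
    derivative of the horizontal lift, each contributing
    \<open>T_component p e * (rot w0 \<bullet> fst e)\<close>.\<close>
  have qf: "qf e = w' e \<bullet> fst e + 2 * T_component p e * (rot w0 \<bullet> fst e)" for e
  proof -
    define V where "V = W' e + christoffel heis_metric p e (Hn p)"
    have T0: "T_component p (Hn p) = 0" by (simp add: Hnp T_component_rot)
    have V1: "fst V = w' e + T_component p e *\<^sub>R rot w0"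
      unfolding V_def christoffel_heis T0 by (simp add: W'_def Hnp)
    have V2: "snd V = fst e \<bullet> rot w0 + fst p \<bullet> rot (fst V)"
      unfolding V1 unfolding V_def christoffel_heis T0 by (simp add: W'_def Hnp rot_simps inner_diff_right)
    have "T_component p V = fst e \<bullet> rot w0" by (simp add: T_component_rot V2)
    then show ?thesis
      unfolding qf_def V_def[symmetric] heis_metric_inner V1
      by (simp add: inner_add_left inner_add_right inner_commute)
  qed
  obtain B0 where B0: "finite B0" "card B0 = 2 * CARD('n) - 2" "\<And>v. v \<in> B0 \<Longrightarrow> v \<bullet> v = 1" "B0 \<subseteq> K0"
    "e1 \<noteq> e2" "e1 \<notin> (\<lambda>v. (v, 0)) ` B0" "e2 \<notin> (\<lambda>v. (v, 0)) ` B0"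
    "orthonormal_basis_of heis_metric p TS (insert e1 (insert e2 ((\<lambda>v. (v, 0)) ` B0)))"
    by (rule orthonormal_frame) blast
  have q0: "qf (v, 0) = - P / r" if "v \<in> B0" for v
  proof -
    have v: "\<omega> \<bullet> v = 0" "rot \<omega> \<bullet> v = 0" "\<omega> \<bullet> rot v = 0" "v \<bullet> v = 1"
      using that B0(3,4) inner_rot_left[of \<omega> v] by (auto simp: K0_def)
    have "sf' (v, 0) = 0" by (rule sf'_TS) (use v in auto)
    then have "w' (v, 0) = - (P / r) *\<^sub>R v - (y / r) *\<^sub>R rot v"
      using v by (simp add: w'_def D_def rot_simps divide_inverse mult.commute)
    then show ?thesis
      unfolding qf using v by (simp add: T_component_rot p_def inner_diff_left)
  qed
  have q1: "qf e1 = r * \<kappa> / W - P / r"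
  proof -
    have sfe: "sf' e1 = - (r / W)"
      by (rule sf'_TS) (use aW bW W in \<open>simp_all add: e1_def inner_diff_right\<close>)
    have De: "D e1 = (P / r) *\<^sub>R rot \<omega>" by (simp add: D_def e1_def inner_diff_right divide_inverse mult.commute)
    have we: "w' e1 = - (y * \<kappa> * (r / W) - y * P / r) *\<^sub>R \<omega> - (P * (P / r) - P * \<kappa> * (r / W)) *\<^sub>R rot \<omega>"
      unfolding w'_def sfe De by (simp add: rot_simps algebra_simps)
    have fe: "fst e1 = P *\<^sub>R rot \<omega> - y *\<^sub>R \<omega>" by (simp add: e1_def)
    have "qf e1 = w' e1 \<bullet> fst e1" by (simp add: qf T_e1)
    also have "\<dots> = (P\<^sup>2 + y\<^sup>2) * (r * \<kappa> / W) - (P\<^sup>2 + y\<^sup>2) * (P / r)"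
      unfolding we fe
      by (simp add: inner_diff_left inner_diff_right power2_eq_square algebra_simps add_divide_distrib diff_divide_distrib)
    finally show ?thesis using Py by simp
  qed
  have q2: "qf e2 = 0"
  proof -
    have sfe: "sf' e2 = P / A"
      by (rule sf'_TS) (use bW in \<open>simp_all add: e2_def inner_add_right power2_eq_square\<close>)
    have De: "D e2 = (a / A * y / r) *\<^sub>R rot \<omega>"
      by (simp add: D_def e2_def inner_add_right divide_inverse algebra_simps)
    have we: "w' e2 = - (- y * \<kappa> * (P / A) - y * (a / A * y / r)) *\<^sub>R \<omega> - (P * (a / A * y / r) + P * \<kappa> * (P / A)) *\<^sub>R rot \<omega>"
      unfolding w'_def sfe De by (simp add: rot_simps algebra_simps)
    have fe: "fst e2 = (a / A) *\<^sub>R (P *\<^sub>R \<omega> + y *\<^sub>R rot \<omega>)" by (simp add: e2_def)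
    have "rot w0 \<bullet> fst e2 = 0"
      by (simp add: w0_def e2_def rot_simps inner_diff_left inner_add_right inner_add_left)
    then have "qf e2 = w' e2 \<bullet> fst e2" by (simp add: qf)
    also have "\<dots> = 0"
      unfolding we fe
      by (simp add: inner_diff_left inner_add_right algebra_simps)
    finally show ?thesis .
  qed
  have inj: "inj_on (\<lambda>v. (v, 0::real)) B0" by (auto simp: inj_on_def)
  have "(\<Sum>e\<in>insert e1 (insert e2 ((\<lambda>v. (v, 0)) ` B0)). qf e) = qf e1 + (qf e2 + (\<Sum>v\<in>B0. qf (v, 0)))"
    using B0 by (simp add: sum.reindex[OF inj])
  also have "\<dots> = r * \<kappa> / W - P / r - real (2 * CARD('n) - 2) * (P / r)"
    using q0 B0(2) by (simp add: q1 q2)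
  also have "\<dots> = r * \<kappa> / W - (2 * real CARD('n) - 1) * P / r"
  proof -
    \<comment> \<open>\<open>dim_K0\<close> excludes truncation in the natural subtraction.\<close>
    have "real (2 * CARD('n) - 2) = 2 * real CARD('n) - 2"
      using dim_K0 by linarith
    then show ?thesis by (simp add: algebra_simps diff_divide_distrib)
  qed
  finally have sum_eq: "(\<Sum>e\<in>insert e1 (insert e2 ((\<lambda>v. (v, 0)) ` B0)). qf e)
    = r * \<kappa> / W - (2 * real CARD('n) - 1) * P / r" .
  show ?thesis
    unfolding has_divergence_along_def tangent_space_eq
    by (rule exI[of _ W'], rule exI[of _ "insert e1 (insert e2 ((\<lambda>v. (v, 0)) ` B0))"], intro conjI,
        rule HnD, rule B0(8), rule sum_eq[symmetric, unfolded qf_def])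
qed

end

section \<open>Solutions with their energy\<close>

text \<open>Eliminating \<open>(sin \<theta>)^2\<close> through \<open>W^2\<close> leaves a cubic in
  \<open>cos \<theta> / W\<close>. On a solution this quotient is a function of the radius, so the
  sign of \<open>\<sigma>'\<close> depends on \<open>x\<close> alone.\<close>

lemma profile_rhs_eq:
  fixes r \<theta> H :: real
  defines "W \<equiv> sqrt (r\<^sup>2 * (sin \<theta>)\<^sup>2 + (cos \<theta>)\<^sup>2)"
  assumes r: "0 < r"
  shows "profile_rhs n H r \<theta> = (W / r) ^ 3 * ((cos \<theta> / W) ^ 3 + (2 * real n - 2) * (cos \<theta> / W) - 2 * real n * H * r)"
proof -
  have W: "0 < W" "W\<^sup>2 = r\<^sup>2 * (sin \<theta>)\<^sup>2 + (cos \<theta>)\<^sup>2"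
    using profile_weight_pos[OF r, of \<theta>] by (simp_all add: W_def)
  define c where "c = cos \<theta>"
  define s where "s = sin \<theta>"
  have "(W / r) ^ 3 * ((c / W) ^ 3 + (2 * real n - 2) * (c / W) - 2 * real n * H * r)
      = c ^ 3 / r ^ 3 + (2 * real n - 2) * c * W\<^sup>2 / r ^ 3 - 2 * real n * H * W ^ 3 / r\<^sup>2"
    using W(1) r by (simp add: field_simps power2_eq_square power3_eq_cube)
  also have "(2 * real n - 2) * c * W\<^sup>2 / r ^ 3 = (2 * real n - 2) * (s\<^sup>2 * c) / r + (2 * real n - 2) * (c ^ 3 / r ^ 3)"
    unfolding W(2) s_def[symmetric] c_def[symmetric] using r
    by (simp add: field_simps power2_eq_square power3_eq_cube)
  finally show ?thesis
    unfolding profile_rhs_def s_def[symmetric] c_def[symmetric] W_def[unfolded s_def[symmetric] c_def[symmetric], symmetric]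
    by (simp add: algebra_simps diff_divide_distrib add_divide_distrib)
qed

text \<open>The left-hand side is the angular speed of the vector
  \<open>(cos \<sigma>, x * sin \<sigma>)\<close>, of length \<open>W\<close>, along a solution; the
  right-hand side no longer contains the sine.\<close>

lemma profile_rhs_turning:
  fixes r \<theta> H :: real
  defines "W \<equiv> sqrt (r\<^sup>2 * (sin \<theta>)\<^sup>2 + (cos \<theta>)\<^sup>2)"
  assumes r: "0 < r"
  shows "(r * profile_rhs n H r \<theta> + cos \<theta> * (sin \<theta>)\<^sup>2) / W\<^sup>2
    = W * ((2 * real n - 1) * (cos \<theta> / W) / r\<^sup>2 - 2 * real n * H / r)"
proof -
  have W: "0 < W" "W\<^sup>2 = r\<^sup>2 * (sin \<theta>)\<^sup>2 + (cos \<theta>)\<^sup>2"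
    using profile_weight_pos[OF r, of \<theta>] by (simp_all add: W_def)
  define c where "c = cos \<theta>"
  define s where "s = sin \<theta>"
  have s: "c * s\<^sup>2 = (c * W\<^sup>2 - c ^ 3) / r\<^sup>2"
    unfolding W(2) s_def[symmetric] c_def[symmetric] using r
    by (simp add: field_simps power2_eq_square power3_eq_cube)
  have "r * ((W / r) ^ 3 * ((c / W) ^ 3 + (2 * real n - 2) * (c / W) - 2 * real n * H * r)) + (c * W\<^sup>2 - c ^ 3) / r\<^sup>2
      = W\<^sup>2 * (W * ((2 * real n - 1) * (c / W) / r\<^sup>2 - 2 * real n * H / r))"
    using W(1) r by (simp add: field_simps power2_eq_square power3_eq_cube)
  then show ?thesis
    unfolding profile_rhs_eq[OF r] W_def[symmetric]
    unfolding s_def[symmetric] c_def[symmetric] s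
    using W(1) by simp
qed

locale profile =
  fixes n :: nat and H E :: real and I :: "real set" and x t \<sigma> :: "real \<Rightarrow> real"
  assumes n: "1 \<le> n" and comp: "complete_profile_solution n H I x t \<sigma>"
    and energy: "\<And>s. s \<in> I \<Longrightarrow> profile_energy n H (x s) (\<sigma> s) = E"
begin

definition W where "W s = sqrt ((x s)\<^sup>2 * (sin (\<sigma> s))\<^sup>2 + (cos (\<sigma> s))\<^sup>2)"
definition P where "P s = cos (\<sigma> s) / W s"
definition y where "y s = x s * sin (\<sigma> s) / W s"
text \<open>Obtained by solving \<open>x \<kappa> / W - (2 n - 1) P / x = - 2 n H\<close>, the mean
  curvature equation. That this is the angular speed of \<open>(P, y)\<close> is the content of
  \<open>turning\<close>.\<close>

definition \<kappa> where "\<kappa> s = W s * ((2 * real n - 1) * P s / (x s)\<^sup>2 - 2 * real n * H / x s)"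
definition PP where "PP r = E / r ^ (2 * n - 1) + H * r"
definition PP' where "PP' r = H - (2 * real n - 1) * E / r ^ (2 * n)"
text \<open>The factor that carries the sign of \<open>\<sigma>'\<close>, written as a function of
  the radius: \<open>\<sigma>' = (W / x) ^ 3 * SS x\<close>.\<close>

definition SS where "SS r = PP r ^ 3 + (2 * real n - 2) * PP r - 2 * real n * H * r"

lemma sol: "profile_solution n H I x t \<sigma>"
  using comp by (simp add: complete_profile_solution_def)

lemma I: "open I" "is_interval I" "I \<noteq> {}"
  using sol by (auto simp: profile_solution_def)

lemma xpos: "s \<in> I \<Longrightarrow> 0 < x s"
  and x': "s \<in> I \<Longrightarrow> (x has_real_derivative sin (\<sigma> s)) (at s)"
  and t': "s \<in> I \<Longrightarrow> (t has_real_derivative cos (\<sigma> s)) (at s)"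
  and \<sigma>'_rhs: "s \<in> I \<Longrightarrow> (\<sigma> has_real_derivative profile_rhs n H (x s) (\<sigma> s)) (at s)"
  using sol unfolding profile_solution_iff by blast+

lemma continuous_on_profile: "continuous_on I x" "continuous_on I t" "continuous_on I \<sigma>"
  by (rule has_real_derivative_continuous_on[OF x'] has_real_derivative_continuous_on[OF t']
      has_real_derivative_continuous_on[OF \<sigma>'_rhs], assumption)+

lemma continuous_on_rhs: "continuous_on I (\<lambda>s. profile_rhs n H (x s) (\<sigma> s))"
  unfolding profile_rhs_def
  by (intro continuous_intros continuous_on_profile) (use xpos in force)+

context
  fixes s assumes s: "s \<in> I"
begin

lemma Wpos: "0 < W s"
  using profile_weight_pos[OF xpos[OF s]] by (simp add: W_def)

lemma W2: "(W s)\<^sup>2 = (x s)\<^sup>2 * (sin (\<sigma> s))\<^sup>2 + (cos (\<sigma> s))\<^sup>2"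
  using profile_weight_pos[OF xpos[OF s], of "\<sigma> s"] by (simp add: W_def)

lemma cos_eq: "cos (\<sigma> s) = W s * P s" and sin_eq: "x s * sin (\<sigma> s) = W s * y s"
  using Wpos by (simp_all add: P_def y_def)

lemma Py: "(P s)\<^sup>2 + (y s)\<^sup>2 = 1"
proof -
  have "(P s)\<^sup>2 + (y s)\<^sup>2 = ((x s)\<^sup>2 * (sin (\<sigma> s))\<^sup>2 + (cos (\<sigma> s))\<^sup>2) / (W s)\<^sup>2"
    by (simp add: P_def y_def power_divide power_mult_distrib add_divide_distrib)
  also have "\<dots> = (W s)\<^sup>2 / (W s)\<^sup>2" by (simp only: W2)
  finally show ?thesis using Wpos by simp
qed

lemma P_le: "\<bar>P s\<bar> \<le> 1" and y_le: "\<bar>y s\<bar> \<le> 1"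
  using Py by (simp_all add: abs_le_square_iff[of _ 1, simplified] ) (smt (verit) zero_le_power2)+

lemma P_eq: "P s = PP (x s)"
proof -
  have "x s ^ (2 * n) = x s ^ (2 * n - 1) * x s" using n by (cases n) auto
  then have "x s ^ (2 * n - 1) * P s - H * (x s ^ (2 * n - 1) * x s) = E"
    using energy[OF s] by (simp add: profile_energy_def P_def W_def)
  then have "x s ^ (2 * n - 1) * (P s - H * x s) = E" by (simp add: algebra_simps)
  then show ?thesis using xpos[OF s] by (auto simp: PP_def field_simps)
qed

lemma \<kappa>_eq: "\<kappa> s = - W s * PP' (x s) / x s"
proof -
  have e: "x s ^ (2 * n) = x s ^ (2 * n - 1) * x s" using n by (cases n) auto
  show ?thesis unfolding \<kappa>_def P_eq PP_def PP'_def e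
    using xpos[OF s] by (simp add: field_simps power2_eq_square)
qed

lemma turning: "\<kappa> s = (x s * profile_rhs n H (x s) (\<sigma> s) + cos (\<sigma> s) * (sin (\<sigma> s))\<^sup>2) / (W s)\<^sup>2"
  unfolding W_def profile_rhs_turning[OF xpos[OF s]] \<kappa>_def P_def ..

lemma \<sigma>': "(\<sigma> has_real_derivative (W s / x s) ^ 3 * SS (x s)) (at s)"
  using \<sigma>'_rhs[OF s] unfolding profile_rhs_eq[OF xpos[OF s]] SS_def P_eq[symmetric] P_def W_def .

lemma W': "(W has_real_derivative (x s * sin (\<sigma> s) ^ 3
    + ((x s)\<^sup>2 - 1) * sin (\<sigma> s) * cos (\<sigma> s) * profile_rhs n H (x s) (\<sigma> s)) / W s) (at s)"
proof -
  have d: "((\<lambda>s. (x s)\<^sup>2 * (sin (\<sigma> s))\<^sup>2 + (cos (\<sigma> s))\<^sup>2) has_real_derivative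
     2 * (x s * sin (\<sigma> s) ^ 3 + ((x s)\<^sup>2 - 1) * sin (\<sigma> s) * cos (\<sigma> s) * profile_rhs n H (x s) (\<sigma> s))) (at s)"
    by (rule derivative_eq_intros x'[OF s] \<sigma>'_rhs[OF s] refl)+
      (simp add: algebra_simps power2_eq_square power3_eq_cube)
  have inv: "inverse q / 2 * (2 * N) = N / q" for q N :: real
    by (cases "q = 0") (simp_all add: field_simps)
  have W: "W = (\<lambda>s. sqrt ((x s)\<^sup>2 * (sin (\<sigma> s))\<^sup>2 + (cos (\<sigma> s))\<^sup>2))"
    by (rule ext) (rule W_def)
  show ?thesis
    unfolding W
    by (rule DERIV_cong[OF DERIV_chain2[OF DERIV_real_sqrt[OF profile_weight_pos[OF xpos[OF s]]] d]])
      (rule inv)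
qed

text \<open>\<open>(P, y)\<close> is the vector \<open>(cos \<sigma>, x * sin \<sigma>)\<close>
  normalised to length 1, so its derivative is \<kappa> times the vector turned by a right
  angle.\<close>

lemma P': "(P has_real_derivative - y s * \<kappa> s) (at s)"
  and y': "(y has_real_derivative P s * \<kappa> s) (at s)"
proof -
  define a where "a = sin (\<sigma> s)"
  define b where "b = cos (\<sigma> s)"
  define D where "D = profile_rhs n H (x s) (\<sigma> s)"
  have ab: "a ^ 2 + b ^ 2 = 1" by (simp add: a_def b_def)
  have W2': "W s ^ 2 = x s ^ 2 * a ^ 2 + b ^ 2" by (simp add: W2 a_def b_def)
  have cd: "((\<lambda>s. cos (\<sigma> s)) has_real_derivative - a * D) (at s)"
    unfolding a_def D_def by (auto intro!: derivative_eq_intros \<sigma>'_rhs[OF s])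
  have sd: "((\<lambda>s. x s * sin (\<sigma> s)) has_real_derivative a * a + x s * (b * D)) (at s)"
    unfolding a_def b_def D_def by (auto intro!: derivative_eq_intros x'[OF s] \<sigma>'_rhs[OF s] simp: algebra_simps)
  have nz: "W s \<noteq> 0" using Wpos by simp
  define N where "N = x s * a ^ 3 + ((x s)\<^sup>2 - 1) * a * b * D"
  define K where "K = x s * D + b * a\<^sup>2"
  note Wd = W'[folded a_def b_def D_def, folded N_def]
  have \<kappa>: "\<kappa> s = K / (W s)\<^sup>2" by (simp add: K_def turning a_def b_def D_def)
  have "(P has_real_derivative (- a * D * W s - b * (N / W s)) / (W s * W s)) (at s)"
    unfolding P_def[abs_def] using DERIV_divide[OF cd Wd nz] by (simp add: b_def)
  moreover have "(- a * D * W s - b * (N / W s)) / (W s * W s) = - y s * \<kappa> s"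
  proof -
    have "- a * D * W s ^ 2 - b * N = - (x s * a) * K"
      unfolding N_def K_def using ab W2' by algebra
    then have e: "(- a * D * W s ^ 2 - b * N) / W s ^ 3 = - (x s * a) * K / W s ^ 3"
      by simp
    have "(- a * D * W s - b * (N / W s)) / (W s * W s) = (- a * D * W s ^ 2 - b * N) / W s ^ 3"
      using nz by (simp add: field_simps power2_eq_square power3_eq_cube)
    also note e
    also have "- (x s * a) * K / W s ^ 3 = - (x s * a / W s) * (K / (W s)\<^sup>2)"
      by (simp add: power2_eq_square power3_eq_cube)
    finally show ?thesis unfolding \<kappa> y_def a_def[symmetric] .
  qed
  ultimately show "(P has_real_derivative - y s * \<kappa> s) (at s)" by simp
  have "(y has_real_derivative ((a * a + x s * (b * D)) * W s - x s * a * (N / W s)) / (W s * W s)) (at s)"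
    unfolding y_def[abs_def] using DERIV_divide[OF sd Wd nz] by (simp add: a_def)
  moreover have "((a * a + x s * (b * D)) * W s - x s * a * (N / W s)) / (W s * W s) = P s * \<kappa> s"
  proof -
    have "(a * a + x s * (b * D)) * W s ^ 2 - x s * a * N = b * K"
      unfolding N_def K_def using ab W2' by algebra
    then have e: "((a * a + x s * (b * D)) * W s ^ 2 - x s * a * N) / W s ^ 3 = b * K / W s ^ 3"
      by simp
    have "((a * a + x s * (b * D)) * W s - x s * a * (N / W s)) / (W s * W s)
        = ((a * a + x s * (b * D)) * W s ^ 2 - x s * a * N) / W s ^ 3"
      using nz by (simp add: field_simps power2_eq_square power3_eq_cube)
    also note e
    also have "b * K / W s ^ 3 = (b / W s) * (K / (W s)\<^sup>2)"
      by (simp add: power2_eq_square power3_eq_cube)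
    finally show ?thesis unfolding \<kappa> P_def b_def[symmetric] .
  qed
  ultimately show "(y has_real_derivative P s * \<kappa> s) (at s)" by simp
qed

end

section \<open>Local parameters on the hypersurface\<close>

definition Rev :: "real set \<Rightarrow> 'n::finite heis set" where
  "Rev J = {(x s *\<^sub>R \<omega>, t s) | s \<omega>. s \<in> J \<and> norm \<omega> = 1}"

definition hnormal :: "real \<Rightarrow> complex^'n::finite \<Rightarrow> 'n heis" where
  "hnormal s \<omega> = (let w = - (P s *\<^sub>R \<omega> + y s *\<^sub>R rot \<omega>) in (w, (x s *\<^sub>R \<omega>) \<bullet> rot w))"

text \<open>As long as \<sigma> has turned by less than a right angle from
  \<open>\<sigma> s0\<close>, the coordinate along the tangent at \<open>s0\<close> increases, so
  the arc is a graph over its tangent line. Inverting this coordinate recovers the parameter as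
  \<open>sf\<close>, and the graph gives the defining function \<open>f\<close>; working in the
  rotated frame treats all directions of the tangent alike.\<close>

lemma local_parameter:
  assumes s0: "s0 \<in> I"
  obtains J and U :: "'n::finite heis set" and sf f :: "'n heis \<Rightarrow> real" where
    "open J" "is_interval J" "s0 \<in> J" "J \<subseteq> I" "open U"
    "\<And>s \<omega>. s \<in> J \<Longrightarrow> norm \<omega> = 1 \<Longrightarrow> (x s *\<^sub>R \<omega>, t s) \<in> U \<and> sf (x s *\<^sub>R \<omega>, t s) = s"
    "\<And>q. q \<in> U \<Longrightarrow> sf q \<in> J \<and> (\<exists>D. (sf has_derivative D) (at q))"
    "C2_on U f" "\<forall>q\<in>U. frechet_derivative f (at q) \<noteq> (\<lambda>v. 0)"
    "\<And>q. q \<in> U \<Longrightarrow> f q = 0 \<longleftrightarrow> norm (fst q) = x (sf q) \<and> snd q = t (sf q)"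
    "\<And>q. q \<in> U \<Longrightarrow> fst q \<noteq> 0"
proof -
  define a where "a = sin (\<sigma> s0)"
  define b where "b = cos (\<sigma> s0)"
  have ab: "a * a + b * b = 1" using sin_cos_squared_add3[of "\<sigma> s0"] by (simp add: a_def b_def add.commute)
  have "isCont \<sigma> s0" using \<sigma>'_rhs[OF s0] DERIV_isCont by blast
  then obtain d1 where d1: "0 < d1" "\<And>s. \<bar>s - s0\<bar> < d1 \<Longrightarrow> \<bar>\<sigma> s - \<sigma> s0\<bar> < 1"
    using continuous_at_real_range[of s0 \<sigma>] by (metis real_norm_def zero_less_one)
  obtain d2 where d2: "0 < d2" "\<And>s. \<bar>s - s0\<bar> < d2 \<Longrightarrow> s \<in> I"
    using I(1) s0 unfolding open_dist dist_real_def by blast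
  define d where "d = min d1 d2"
  define J where "J = {s0 - d<..<s0 + d}"
  have J: "open J" "is_interval J" "s0 \<in> J" using d1 d2 by (auto simp: J_def d_def is_interval_oo)
  have JI: "J \<subseteq> I" using d2 by (auto simp: J_def d_def)
  have cpos: "0 < cos (\<sigma> s0 - \<sigma> s)" if "s \<in> J" for s
  proof (rule cos_gt_zero_pi)
    have "\<bar>s - s0\<bar> < d1" using that by (auto simp: J_def d_def abs_less_iff)
    from d1(2)[OF this] show "- (pi / 2) < \<sigma> s0 - \<sigma> s" "\<sigma> s0 - \<sigma> s < pi / 2"
      using pi_gt3 by linarith+
  qed
  define k1 where "k1 = - (a * x s0 + b * t s0)"
  \<comment> \<open>\<open>lam\<close> and \<open>B\<close> are the coordinates of the curve along
    its tangent and its normal at \<open>s0\<close>; their derivatives are the cosine and the sine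
    of \<open>\<sigma> s0 - \<sigma> s\<close>.\<close>
  define lam where "lam s = a * x s + b * t s + k1" for s
  define B where "B s = - b * x s + a * t s" for s
  have lam': "(lam has_real_derivative cos (\<sigma> s0 - \<sigma> s)) (at s)" if "s \<in> J" for s
    unfolding lam_def[abs_def] using that JI
    by (auto intro!: derivative_eq_intros x' t' simp: cos_diff a_def b_def)
  have B': "(B has_real_derivative sin (\<sigma> s0 - \<sigma> s)) (at s)" if "s \<in> J" for s
    unfolding B_def[abs_def] using that JI
    by (auto intro!: derivative_eq_intros x' t' simp: sin_diff a_def b_def)
  obtain g where g: "open (lam ` J)" "\<And>s. s \<in> J \<Longrightarrow> g (lam s) = s" "\<And>u. u \<in> lam ` J \<Longrightarrow> g u \<in> J"
    "\<And>u. u \<in> lam ` J \<Longrightarrow> lam (g u) = u" "\<And>u. u \<in> lam ` J \<Longrightarrow> (g has_real_derivative 1 / cos (\<sigma> s0 - \<sigma> (g u))) (at u)"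
    by (rule increasing_inverse[OF J(1,2) lam' cpos]) blast+
  define T where "T = lam ` J"
  define h where "h u = B (g u)" for u
  define h1 where "h1 u = tan (\<sigma> s0 - \<sigma> (g u))" for u
  define h2 where "h2 u = - profile_rhs n H (x (g u)) (\<sigma> (g u)) / cos (\<sigma> s0 - \<sigma> (g u)) ^ 3" for u
  have hd: "(h has_real_derivative h1 u) (at u)" if "u \<in> T" for u
    using DERIV_chain2[OF B'[OF g(3)] g(5), of u] that by (simp add: h_def[abs_def] h1_def tan_def T_def)
  have h1d: "(h1 has_real_derivative h2 u) (at u)" if u: "u \<in> T" for u
  proof -
    have gu: "g u \<in> J" "g u \<in> I" using g(3) u JI by (auto simp: T_def)
    have "((\<lambda>u. \<sigma> s0 - \<sigma> (g u)) has_real_derivative - (profile_rhs n H (x (g u)) (\<sigma> (g u)) * (1 / cos (\<sigma> s0 - \<sigma> (g u))))) (at u)"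
      using DERIV_diff[OF DERIV_const DERIV_chain2[OF \<sigma>'_rhs[OF gu(2)] g(5)], of "\<sigma> s0"] u by (simp add: T_def)
    from DERIV_chain2[OF DERIV_tan this] cpos[OF gu(1)]
    have "(h1 has_real_derivative inverse ((cos (\<sigma> s0 - \<sigma> (g u)))\<^sup>2) * - (profile_rhs n H (x (g u)) (\<sigma> (g u)) * (1 / cos (\<sigma> s0 - \<sigma> (g u))))) (at u)"
      unfolding h1_def[abs_def] by simp
    then show ?thesis by (rule DERIV_cong) (simp add: h2_def field_simps power2_eq_square power3_eq_cube)
  qed
  have cg: "continuous_on T g" by (rule has_real_derivative_continuous_on[OF g(5)]) (simp add: T_def)
  have gT: "g ` T \<subseteq> I" using g(3) JI by (auto simp: T_def)
  have h2c: "continuous_on T h2"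
    unfolding h2_def[abs_def]
  proof (intro continuous_intros)
    show "continuous_on T (\<lambda>u. profile_rhs n H (x (g u)) (\<sigma> (g u)))"
      by (rule continuous_on_compose2[OF continuous_on_rhs cg gT])
    show "continuous_on T (\<lambda>u. \<sigma> (g u))"
      by (rule continuous_on_compose2[OF continuous_on_profile(3) cg gT])
    show "\<forall>u\<in>T. cos (\<sigma> s0 - \<sigma> (g u)) ^ 3 \<noteq> 0" using cpos g(3) by (force simp: T_def)
  qed
  define A where "A q = a * norm (fst q) + b * snd q + k1" for q :: "'n heis"
  define f where "f q = - b * norm (fst q) + a * snd q + 0 - h (A q)" for q :: "'n heis"
  define U where "U = {q :: 'n heis. fst q \<noteq> 0 \<and> A q \<in> T}"
  have "(- b) * (- b) + a * a = 1" "a * (- b) + b * a = 0" using ab by simp_all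
  note prem = g(1)[folded T_def] hd h1d h2c this
  note graph = C2_rotated_graph(1)[where ?k1.0 = k1 and 'b = "complex^'n", OF prem]
    C2_rotated_graph(2,3)[where ?k0.0 = 0 and ?k1.0 = k1 and 'b = "complex^'n", OF prem]
  have U: "open U" "C2_on U f" "\<forall>q\<in>U. frechet_derivative f (at q) \<noteq> (\<lambda>v. 0)"
    using graph unfolding U_def f_def[abs_def] A_def by blast+
  define sf where "sf q = g (A q)" for q
  have P1: "(x s *\<^sub>R \<omega>, t s) \<in> U \<and> sf (x s *\<^sub>R \<omega>, t s) = s" if s: "s \<in> J" "norm \<omega> = 1" for s \<omega>
  proof -
    have "0 < x s" using xpos s JI by blast
    then have "A (x s *\<^sub>R \<omega>, t s) = lam s" "x s *\<^sub>R \<omega> \<noteq> 0"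
      using s by (auto simp: A_def lam_def)
    then show ?thesis using s g(2) by (simp add: U_def T_def sf_def)
  qed
  have P2: "sf q \<in> J \<and> (\<exists>D. (sf has_derivative D) (at q))" if q: "q \<in> U" for q
  proof -
    have q': "fst q \<noteq> 0" "A q \<in> T" using q by (auto simp: U_def)
    have "(A has_derivative (\<lambda>v. a * (sgn (fst q) \<bullet> fst v) + b * snd v)) (at q)"
      unfolding A_def[abs_def]
      by (intro has_derivative_add_const has_derivative_add has_derivative_mult_right
        has_derivative_norm_fst has_derivative_snd has_derivative_ident q')
    from has_derivative_compose[OF this g(5)[folded T_def, OF q'(2), unfolded has_field_derivative_def]]
    show ?thesis using g(3)[folded T_def, OF q'(2)] unfolding sf_def[abs_def] by blast
  qed
  have P3: "f q = 0 \<longleftrightarrow> norm (fst q) = x (sf q) \<and> snd q = t (sf q)" if q: "q \<in> U" for q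
  proof -
    have "lam (sf q) = A q" using g(4)[folded T_def, of "A q"] q by (simp add: sf_def U_def)
    then have 1: "a * (norm (fst q) - x (sf q)) + b * (snd q - t (sf q)) = 0"
      by (simp add: lam_def A_def algebra_simps)
    have 2: "f q = - b * (norm (fst q) - x (sf q)) + a * (snd q - t (sf q))"
      by (simp add: f_def h_def B_def sf_def algebra_simps)
    show ?thesis
    proof
      assume "f q = 0"
      define X where "X = norm (fst q) - x (sf q)"
      define Y where "Y = snd q - t (sf q)"
      have e: "a * X + b * Y = 0" "- b * X + a * Y = 0" using 1 2 \<open>f q = 0\<close> by (simp_all add: X_def Y_def)
      \<comment> \<open>The rotation that sends \<open>(X, Y)\<close> to the two vanishing
        expressions is inverted by its transpose.\<close>
      have "X = (a * a + b * b) * X" "Y = (a * a + b * b) * Y" using ab by simp_all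
      then have "X = a * (a * X + b * Y) - b * (- b * X + a * Y)" "Y = b * (a * X + b * Y) + a * (- b * X + a * Y)"
        by (simp_all add: algebra_simps)
      then have "X = 0" "Y = 0" using e by simp_all
      then show "norm (fst q) = x (sf q) \<and> snd q = t (sf q)" by (simp add: X_def Y_def)
    qed (use 2 in simp)
  qed
  show ?thesis by (rule that[OF J JI U(1) P1 P2 U(2,3) P3]) (auto simp: U_def)
qed

end

section \<open>The mean curvature of the hypersurface of revolution\<close>

context profile
begin

text \<open>The normal of the immersion in the coordinates \<open>(s, z)\<close> of the source, with
  \<open>z = x s *\<^sub>R \<omega>\<close>. At a pole, where no direction \<omega> is left, its
  value is vertical with coefficient prescribed by \<open>e\<close>.\<close>

definition normal_field :: "(real \<Rightarrow> real) \<Rightarrow> real \<times> (complex^'n::finite) \<Rightarrow> 'n heis" where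
  "normal_field e = (\<lambda>(s, z). if s \<in> I
     then (1 / sqrt (1 + (norm z)\<^sup>2 * (sin (\<sigma> s))\<^sup>2)) *\<^sub>R
       (- sin (\<sigma> s) *\<^sub>R rot z - cos (\<sigma> s) *\<^sub>R sgn z, sin (\<sigma> s) * (1 + (norm z)\<^sup>2))
     else (0, e s))"

lemma normal_field_eq:
  fixes \<omega> :: "complex^'n::finite"
  assumes "s \<in> I" "norm \<omega> = 1"
  shows "normal_field e (s, x s *\<^sub>R \<omega>) = revolution_normal (x s) (t s) (deriv x s) (deriv t s) \<omega>"
proof -
  have d: "deriv x s = sin (\<sigma> s)" "deriv t s = cos (\<sigma> s)"
    using x'[OF assms(1)] t'[OF assms(1)] DERIV_imp_deriv by blast+
  have "sgn (x s *\<^sub>R \<omega>) = \<omega>" "norm (x s *\<^sub>R \<omega>) = x s"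
    using assms xpos[OF assms(1)] by (simp_all add: sgn_div_norm)
  then show ?thesis
    unfolding revolution_normal_eq[OF assms(2)] d normal_field_def
    using assms(1) by (simp add: rot_simps algebra_simps)
qed

context
  fixes s :: real and \<omega> :: "complex^'n::finite"
  assumes s: "s \<in> I" and \<omega>: "norm \<omega> = 1"
begin

lemma normal_field_W:
  "normal_field e (s, x s *\<^sub>R \<omega>) = (1 / sqrt (1 + (x s)\<^sup>2 * (sin (\<sigma> s))\<^sup>2)) *\<^sub>R
     (- W s *\<^sub>R (P s *\<^sub>R \<omega> + y s *\<^sub>R rot \<omega>), sin (\<sigma> s) * (1 + (x s)\<^sup>2))"
proof -
  have "sgn (x s *\<^sub>R \<omega>) = \<omega>" "norm (x s *\<^sub>R \<omega>) = x s"
    using \<omega> xpos[OF s] by (simp_all add: sgn_div_norm)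
  moreover have "- sin (\<sigma> s) *\<^sub>R rot (x s *\<^sub>R \<omega>) - cos (\<sigma> s) *\<^sub>R \<omega> = - W s *\<^sub>R (P s *\<^sub>R \<omega> + y s *\<^sub>R rot \<omega>)"
    using sin_eq[OF s] cos_eq[OF s] by (simp add: rot_simps scaleR_add_right mult.commute)
  ultimately show ?thesis using s by (simp add: normal_field_def)
qed

lemma normal_field_root_pos: "0 < sqrt (1 + (x s)\<^sup>2 * (sin (\<sigma> s))\<^sup>2)"
  by (simp add: add_pos_nonneg)

lemma norm_Py: "norm (P s *\<^sub>R \<omega> + y s *\<^sub>R rot \<omega>) = 1"
proof -
  have "\<omega> \<bullet> \<omega> = 1" using \<omega> by (simp add: dot_square_norm)
  then have "(P s *\<^sub>R \<omega> + y s *\<^sub>R rot \<omega>) \<bullet> (P s *\<^sub>R \<omega> + y s *\<^sub>R rot \<omega>) = (P s)\<^sup>2 + (y s)\<^sup>2"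
    by (simp add: inner_add_left inner_add_right power2_eq_square)
  then show ?thesis using Py[OF s] by (simp add: norm_eq_sqrt_inner)
qed

lemma sgn_normal_field: "sgn (fst (normal_field e (s, x s *\<^sub>R \<omega>))) = - (P s *\<^sub>R \<omega> + y s *\<^sub>R rot \<omega>)"
  unfolding normal_field_W
  using normal_field_root_pos Wpos[OF s] norm_Py
  by (simp add: sgn_scaleR sgn_minus sgn_div_norm[of "P s *\<^sub>R \<omega> + y s *\<^sub>R rot \<omega>"])

lemma fst_normal_field: "fst (normal_field e (s, x s *\<^sub>R \<omega>)) \<noteq> 0"
  using sgn_normal_field[of e] norm_Py by (metis norm_minus_cancel norm_zero sgn_zero zero_neq_one)

lemma T_normal_field: "T_component (x s *\<^sub>R \<omega>, t s) (normal_field e (s, x s *\<^sub>R \<omega>)) =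
    sin (\<sigma> s) / sqrt (1 + (x s)\<^sup>2 * (sin (\<sigma> s))\<^sup>2)"
proof -
  define c where "c = 1 / sqrt (1 + (x s)\<^sup>2 * (sin (\<sigma> s))\<^sup>2)"
  have "T_component (x s *\<^sub>R \<omega>, t s) (normal_field e (s, x s *\<^sub>R \<omega>)) =
    c * (sin (\<sigma> s) * (1 + (x s)\<^sup>2) - x s * (W s * y s))"
    unfolding normal_field_W c_def[symmetric]
    using \<omega> by (simp add: T_component_rot rot_simps inner_diff_right dot_square_norm algebra_simps)
  also have "x s * (W s * y s) = (x s)\<^sup>2 * sin (\<sigma> s)"
    unfolding sin_eq[OF s, symmetric] by (simp add: power2_eq_square)
  finally show ?thesis by (simp add: c_def algebra_simps)
qed

lemma normal_field_unit:
  "heis_metric (x s *\<^sub>R \<omega>, t s) (normal_field e (s, x s *\<^sub>R \<omega>)) (normal_field e (s, x s *\<^sub>R \<omega>)) = 1"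
proof -
  define A where "A = sqrt (1 + (x s)\<^sup>2 * (sin (\<sigma> s))\<^sup>2)"
  have A: "A\<^sup>2 = 1 + (x s)\<^sup>2 * (sin (\<sigma> s))\<^sup>2" "0 < A" unfolding A_def by (auto simp: add_pos_nonneg)
  have "fst (normal_field e (s, x s *\<^sub>R \<omega>)) = - (W s / A) *\<^sub>R (P s *\<^sub>R \<omega> + y s *\<^sub>R rot \<omega>)"
    unfolding normal_field_W A_def by simp
  then have "fst (normal_field e (s, x s *\<^sub>R \<omega>)) \<bullet> fst (normal_field e (s, x s *\<^sub>R \<omega>)) = (W s / A)\<^sup>2"
    using norm_Py by (simp add: dot_square_norm power_mult_distrib power_divide)
  then have "heis_metric (x s *\<^sub>R \<omega>, t s) (normal_field e (s, x s *\<^sub>R \<omega>)) (normal_field e (s, x s *\<^sub>R \<omega>))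
    = ((W s)\<^sup>2 + (sin (\<sigma> s))\<^sup>2) / A\<^sup>2"
    unfolding heis_metric_inner T_normal_field A_def[symmetric]
    by (simp add: power_divide add_divide_distrib power2_eq_square)
  also have "(W s)\<^sup>2 + (sin (\<sigma> s))\<^sup>2 = A\<^sup>2"
    unfolding A W2[OF s] using sin_cos_squared_add[of "\<sigma> s"] by linarith
  finally show ?thesis using A(2) by simp
qed

lemma normal_field_orthogonal:
  assumes v: "\<omega> \<bullet> fst v = \<alpha> * sin (\<sigma> s)" "snd v = \<alpha> * cos (\<sigma> s)"
  shows "heis_metric (x s *\<^sub>R \<omega>, t s) (normal_field e (s, x s *\<^sub>R \<omega>)) v = 0"
proof -
  define A where "A = sqrt (1 + (x s)\<^sup>2 * (sin (\<sigma> s))\<^sup>2)"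
  have f: "fst (normal_field e (s, x s *\<^sub>R \<omega>)) = - (W s / A) *\<^sub>R (P s *\<^sub>R \<omega> + y s *\<^sub>R rot \<omega>)"
    unfolding normal_field_W A_def by simp
  have T: "T_component (x s *\<^sub>R \<omega>, t s) v = \<alpha> * cos (\<sigma> s) + x s * (rot \<omega> \<bullet> fst v)"
    using v by (simp add: T_component_rot inner_rot_left)
  have "heis_metric (x s *\<^sub>R \<omega>, t s) (normal_field e (s, x s *\<^sub>R \<omega>)) v =
    (- (W s * P s) * (\<alpha> * sin (\<sigma> s)) - (W s * y s) * (rot \<omega> \<bullet> fst v)
      + sin (\<sigma> s) * (\<alpha> * cos (\<sigma> s) + x s * (rot \<omega> \<bullet> fst v))) / A"
    unfolding heis_metric_inner T_normal_field T f A_def[symmetric]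
    using v by (simp add: inner_add_left algebra_simps add_divide_distrib diff_divide_distrib)
  also have "\<dots> = 0"
    unfolding sin_eq[OF s, symmetric] cos_eq[OF s, symmetric] by (simp add: algebra_simps)
  finally show ?thesis .
qed

end

text \<open>The interval is chosen before the set \<open>S\<close>, so that the same statement
  applies to a piece of the hypersurface and to the piece with its singular set removed. The
  conclusion on the divergence is \<open>divergence\<close> with \<kappa> inserted.\<close>

lemma local_geometry:
  fixes \<omega> :: "complex^'n::finite"
  assumes s1: "s1 \<in> I" and \<omega>: "norm \<omega> = 1" and card: "CARD('n) = n"
  obtains J where "open J" "s1 \<in> J" "J \<subseteq> I"
    "\<And>(S :: 'n heis set) U' Hn J1 J2. open U' \<Longrightarrow> (x s1 *\<^sub>R \<omega>, t s1) \<in> U' \<Longrightarrow>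
       S \<inter> U' \<subseteq> Rev J2 \<Longrightarrow> J2 \<subseteq> J \<Longrightarrow> open J1 \<Longrightarrow> s1 \<in> J1 \<Longrightarrow> Rev J1 \<subseteq> S \<Longrightarrow>
       (\<And>s \<omega>'. s \<in> J2 \<Longrightarrow> norm \<omega>' = 1 \<Longrightarrow> (x s *\<^sub>R \<omega>', t s) \<in> S \<Longrightarrow>
          Hn (x s *\<^sub>R \<omega>', t s) = hnormal s \<omega>') \<Longrightarrow>
       tangent_space S (x s1 *\<^sub>R \<omega>, t s1) = {v. \<exists>\<alpha>. \<omega> \<bullet> fst v = \<alpha> * sin (\<sigma> s1) \<and> snd v = \<alpha> * cos (\<sigma> s1)} \<and>
       has_divergence_along heis_metric S Hn (x s1 *\<^sub>R \<omega>, t s1) (- 2 * real n * H)"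
proof -
  obtain J and U :: "'n heis set" and sf f :: "'n heis \<Rightarrow> real" where L:
    "open J" "is_interval J" "s1 \<in> J" "J \<subseteq> I" "open U"
    "\<And>s \<omega>. s \<in> J \<Longrightarrow> norm \<omega> = 1 \<Longrightarrow> (x s *\<^sub>R \<omega>, t s) \<in> U \<and> sf (x s *\<^sub>R \<omega>, t s) = s"
    "\<And>q. q \<in> U \<Longrightarrow> sf q \<in> J \<and> (\<exists>D. (sf has_derivative D) (at q))"
    by (rule local_parameter[OF s1]) blast
  let ?p = "(x s1 *\<^sub>R \<omega>, t s1)"
  have pU: "?p \<in> U" using L(6)[OF L(3) \<omega>] by blast
  obtain D where D: "(sf has_derivative D) (at ?p)" using L(7)[OF pU] by blast
  have "tangent_space S ?p = {v. \<exists>\<alpha>. \<omega> \<bullet> fst v = \<alpha> * sin (\<sigma> s1) \<and> snd v = \<alpha> * cos (\<sigma> s1)} \<and>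
       has_divergence_along heis_metric S Hn ?p (- 2 * real n * H)"
    if U': "open U'" "?p \<in> U'" and S: "S \<inter> U' \<subseteq> Rev J2" "J2 \<subseteq> J"
      and J1: "open J1" "s1 \<in> J1" "Rev J1 \<subseteq> S"
      and Hn: "\<And>s \<omega>'. s \<in> J2 \<Longrightarrow> norm \<omega>' = 1 \<Longrightarrow> (x s *\<^sub>R \<omega>', t s) \<in> S \<Longrightarrow> Hn (x s *\<^sub>R \<omega>', t s) = hnormal s \<omega>'"
    for S :: "'n heis set" and U' Hn J1 J2
  proof -
    obtain \<epsilon> where \<epsilon>: "0 < \<epsilon>" "\<And>s. \<bar>s - s1\<bar> < \<epsilon> \<Longrightarrow> s \<in> J1"
      using J1(1,2) unfolding open_dist dist_real_def by blast
    have rep: "\<exists>s \<omega>'. s \<in> J2 \<and> s \<in> I \<and> norm \<omega>' = 1 \<and> q = (x s *\<^sub>R \<omega>', t s) \<and> sf q = s" if q: "q \<in> S" "q \<in> U \<inter> U'" for q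
    proof -
      have "q \<in> Rev J2" using q S by blast
      then obtain s \<omega>' where "s \<in> J2" "norm \<omega>' = 1" "q = (x s *\<^sub>R \<omega>', t s)" by (auto simp: Rev_def)
      then show ?thesis using L(6)[of s \<omega>'] S(2) L(4) by blast
    qed
    have xs1: "0 < x s1" by (rule xpos[OF s1])
    interpret R: revolution_point S \<omega> "x s1" "sin (\<sigma> s1)" "cos (\<sigma> s1)" "W s1" "P s1" "y s1" "\<kappa> s1" s1 x t P y sf D
      "U \<inter> U'" \<epsilon>
    proof
      show "(sin (\<sigma> s1))\<^sup>2 + (cos (\<sigma> s1))\<^sup>2 = 1" by simp
      show "norm (fst q) = x (sf q) \<and> snd q = t (sf q)" if q: "q \<in> S" "q \<in> U \<inter> U'" for q
      proof -
        obtain s \<omega>' where "s \<in> I" "norm \<omega>' = 1" "q = (x s *\<^sub>R \<omega>', t s)" "sf q = s" using rep[OF q] by blast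
        then show ?thesis using xpos[of s] by simp
      qed
      show "(x s *\<^sub>R \<omega>', t s) \<in> S" if "\<bar>s - s1\<bar> < \<epsilon>" "norm \<omega>' = 1" for s \<omega>'
        using \<epsilon>(2)[OF that(1)] that(2) J1(3) unfolding Rev_def by blast
    qed (use s1 \<omega> U' L(5,6) pU D \<epsilon>(1) xs1 Wpos[OF s1] sin_eq[OF s1] cos_eq[OF s1] Py[OF s1] x'[OF s1] t'[OF s1]
        P'[OF s1] y'[OF s1] L(3) in auto)
    have "has_divergence_along heis_metric S Hn R.p (x s1 * \<kappa> s1 / W s1 - (2 * real CARD('n) - 1) * P s1 / x s1)"
    proof (rule R.divergence)
      fix q assume q: "q \<in> S" "q \<in> U \<inter> U'"
      obtain s \<omega>' where s: "s \<in> J2" "s \<in> I" "norm \<omega>' = 1" "q = (x s *\<^sub>R \<omega>', t s)" "sf q = s" using rep[OF q] by blast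
      have "sgn (fst q) = \<omega>'" using s xpos[OF s(2)] by (simp add: sgn_div_norm)
      moreover have "Hn q = hnormal s \<omega>'" using Hn[OF s(1,3)] s(4) q(1) by simp
      ultimately show "Hn q = (let w = - (P (sf q) *\<^sub>R sgn (fst q) + y (sf q) *\<^sub>R rot (sgn (fst q))) in (w, fst q \<bullet> rot w))"
        using s(4,5) by (simp add: hnormal_def)
    qed
    \<comment> \<open>This is the equation from which \<kappa> was defined.\<close>
    moreover have "x s1 * \<kappa> s1 / W s1 - (2 * real CARD('n) - 1) * P s1 / x s1 = - 2 * real n * H"
      using xs1 Wpos[OF s1] unfolding card \<kappa>_def by (simp add: field_simps power2_eq_square)
    ultimately show ?thesis
      using R.tangent_space_eq unfolding R.p_def R.TS_def by simp
  qed
  then show ?thesis using that[OF L(1,3,4)] by blast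
qed

text \<open>What the charts around regular points and around poles have in common. The hypothesis
  \<open>loc\<close> states that \<open>S\<close> has no second sheet near the point: nearby points
  of \<open>S\<close> come from parameters near \<open>s1\<close>. The singular set stays away
  because the normal has nonzero horizontal part on \<open>Rev J\<close>.\<close>

lemma regular_point:
  fixes \<omega> :: "complex^'n::finite" and S :: "'n heis set"
  assumes s1: "s1 \<in> I" and \<omega>: "norm \<omega> = 1" and card: "CARD('n) = n"
    and J: "open J" "s1 \<in> J" "J \<subseteq> I" "Rev J \<subseteq> S"
    and loc: "\<And>J'. open J' \<Longrightarrow> s1 \<in> J' \<Longrightarrow> J' \<subseteq> J \<Longrightarrow> \<exists>U'. open U' \<and> (x s1 *\<^sub>R \<omega>, t s1) \<in> U' \<and> S \<inter> U' \<subseteq> Rev J'"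
    and \<nu>: "\<And>s \<omega>'. s \<in> J \<Longrightarrow> norm \<omega>' = 1 \<Longrightarrow> \<nu> (x s *\<^sub>R \<omega>', t s) = normal_field e (s, x s *\<^sub>R \<omega>')"
  defines "p \<equiv> (x s1 *\<^sub>R \<omega>, t s1)"
  shows "heis_metric p (\<nu> p) (\<nu> p) = 1" "\<forall>v\<in>tangent_space S p. heis_metric p (\<nu> p) v = 0"
    "has_mean_curvature S \<nu> p H"
proof -
  obtain J' where J': "open J'" "s1 \<in> J'" "J' \<subseteq> I" and geo:
    "\<And>(S :: 'n heis set) U' Hn J1 J2. open U' \<Longrightarrow> p \<in> U' \<Longrightarrow>
       S \<inter> U' \<subseteq> Rev J2 \<Longrightarrow> J2 \<subseteq> J' \<Longrightarrow> open J1 \<Longrightarrow> s1 \<in> J1 \<Longrightarrow> Rev J1 \<subseteq> S \<Longrightarrow>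
       (\<And>s \<omega>'. s \<in> J2 \<Longrightarrow> norm \<omega>' = 1 \<Longrightarrow> (x s *\<^sub>R \<omega>', t s) \<in> S \<Longrightarrow>
          Hn (x s *\<^sub>R \<omega>', t s) = hnormal s \<omega>') \<Longrightarrow>
       tangent_space S p = {v. \<exists>\<alpha>. \<omega> \<bullet> fst v = \<alpha> * sin (\<sigma> s1) \<and> snd v = \<alpha> * cos (\<sigma> s1)} \<and>
       has_divergence_along heis_metric S Hn p (- 2 * real n * H)"
    unfolding p_def by (rule local_geometry[OF s1 \<omega> card]) blast
  obtain U' where U': "open U'" "p \<in> U'" "S \<inter> U' \<subseteq> Rev (J \<inter> J')"
    using loc[of "J \<inter> J'"] J J' unfolding p_def by auto
  have Hn: "horizontal_normal \<nu> (x s *\<^sub>R \<omega>', t s) = hnormal s \<omega>'" if "s \<in> J" "norm \<omega>' = 1" for s \<omega>'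
  proof -
    have sI: "s \<in> I" using that J(3) by blast
    show ?thesis
      unfolding horizontal_normal_eq hnormal_def \<nu>[OF that] sgn_normal_field[OF sI that(2)] Let_def by simp
  qed
  have tan: "tangent_space S p = {v. \<exists>\<alpha>. \<omega> \<bullet> fst v = \<alpha> * sin (\<sigma> s1) \<and> snd v = \<alpha> * cos (\<sigma> s1)}"
    using geo[OF U' _ J(1,2,4), of "horizontal_normal \<nu>"] Hn by blast
  have \<nu>p: "\<nu> p = normal_field e (s1, x s1 *\<^sub>R \<omega>)" using \<nu>[OF J(2) \<omega>] by (simp add: p_def)
  show "heis_metric p (\<nu> p) (\<nu> p) = 1"
    unfolding \<nu>p unfolding p_def by (rule normal_field_unit[OF s1 \<omega>])
  show "\<forall>v\<in>tangent_space S p. heis_metric p (\<nu> p) v = 0"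
    unfolding tan \<nu>p unfolding p_def using normal_field_orthogonal[OF s1 \<omega>] by blast
  have ns: "Rev J \<inter> singular_set S \<nu> = {}"
  proof -
    have "fst (\<nu> (x s *\<^sub>R \<omega>', t s)) \<noteq> 0" if "s \<in> J" "norm \<omega>' = 1" for s \<omega>'
      unfolding \<nu>[OF that] using fst_normal_field[of s \<omega>' e] that J(3) by blast
    then show ?thesis unfolding singular_set_eq Rev_def by blast
  qed
  have "has_divergence_along heis_metric (S - singular_set S \<nu>) (horizontal_normal \<nu>) p (- 2 * real n * H)"
  proof -
    have "(S - singular_set S \<nu>) \<inter> U' \<subseteq> Rev (J \<inter> J')" "Rev J \<subseteq> S - singular_set S \<nu>"
      using U'(3) ns J(4) by blast+
    then show ?thesis
      using geo[OF U'(1,2) _ _ J(1,2), of "S - singular_set S \<nu>" "J \<inter> J'" "horizontal_normal \<nu>"] Hn by blast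
  qed
  then show "has_mean_curvature S \<nu> p H" unfolding has_mean_curvature_def card .
qed

lemma Rev_point: "s \<in> J \<Longrightarrow> norm \<omega> = 1 \<Longrightarrow> (x s *\<^sub>R \<omega>, t s) \<in> Rev J"
  unfolding Rev_def by blast

text \<open>Only a short arc is rotated, on which the parameter is recovered by \<open>sf\<close>.
  The chart is therefore embedded even if the whole hypersurface crosses itself.\<close>

lemma regular_chart:
  fixes m :: "real \<times> (complex^'n::finite)"
  defines "M \<equiv> revolution_source I x t" and "F \<equiv> revolution_map I t"
  assumes card: "CARD('n) = n" and m: "m \<in> M" "fst m \<in> I"
  shows "\<exists>V S G. openin (top_of_set M) V \<and> m \<in> V \<and> homeomorphism V S F G \<and>
     C2_hypersurface S \<and> unit_normal heis_metric S (normal_field e \<circ> G) \<and>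
     (\<forall>p \<in> S - singular_set S (normal_field e \<circ> G). has_mean_curvature S (normal_field e \<circ> G) p H)"
proof -
  define s0 where "s0 = fst m"
  have s0: "s0 \<in> I" using m(2) by (simp add: s0_def)
  obtain J and U :: "'n heis set" and sf f :: "'n heis \<Rightarrow> real" where L:
    "open J" "is_interval J" "s0 \<in> J" "J \<subseteq> I" "open U"
    "\<And>s \<omega>. s \<in> J \<Longrightarrow> norm \<omega> = 1 \<Longrightarrow> (x s *\<^sub>R \<omega>, t s) \<in> U \<and> sf (x s *\<^sub>R \<omega>, t s) = s"
    "\<And>q. q \<in> U \<Longrightarrow> sf q \<in> J \<and> (\<exists>D. (sf has_derivative D) (at q))"
    "C2_on U f" "\<forall>q\<in>U. frechet_derivative f (at q) \<noteq> (\<lambda>v. 0)"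
    "\<And>q. q \<in> U \<Longrightarrow> f q = 0 \<longleftrightarrow> norm (fst q) = x (sf q) \<and> snd q = t (sf q)"
    "\<And>q. q \<in> U \<Longrightarrow> fst q \<noteq> 0"
    by (rule local_parameter[OF s0]) blast
  define V where "V = M \<inter> (J \<times> UNIV)"
  define S :: "'n heis set" where "S = Rev J"
  define G where "G q = (sf q, fst q)" for q
  have axis: "a \<notin> I" if "a \<in> axis_ends I x t" for a using that by (auto simp: axis_ends_def)
  have V: "V = {(s, x s *\<^sub>R \<omega>) | s \<omega>. s \<in> J \<and> norm \<omega> = 1}"
    unfolding V_def M_def revolution_source_def using L(4) axis by blast
  have SU: "S \<subseteq> U" unfolding S_def Rev_def using L(6) by blast
  have sf_cont: "continuous_on U sf"
    by (rule continuous_at_imp_continuous_on) (use L(7) has_derivative_continuous in blast)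
  have GRev: "G (x s *\<^sub>R \<omega>, t s) = (s, x s *\<^sub>R \<omega>)" if "s \<in> J" "norm \<omega> = 1" for s \<omega>
    using L(6)[OF that] by (simp add: G_def)
  have FV: "F (s, z) = (z, t s)" if "s \<in> J" for s z
    using that L(4) by (auto simp: F_def revolution_map_def)
  have h1: "homeomorphism V S F G"
  proof (rule homeomorphismI)
    have "continuous_on V (\<lambda>q. (snd q, t (fst q)))"
      by (intro continuous_intros continuous_on_compose2[OF continuous_on_profile(2)])
        (use L(4) in \<open>auto simp: V_def\<close>)
    then show "continuous_on V F"
      by (rule continuous_on_eq) (auto simp: V FV)
    show "continuous_on S G"
      unfolding G_def using continuous_on_subset[OF sf_cont SU] by (intro continuous_intros)
    show "F ` V \<subseteq> S" by (auto simp: V FV S_def intro!: Rev_point)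
    show "G ` S \<subseteq> V" unfolding S_def Rev_def V using GRev by blast
    show "G (F q) = q" if "q \<in> V" for q using that GRev by (auto simp: V FV)
    show "F (G q) = q" if "q \<in> S" for q using that GRev FV by (auto simp: S_def Rev_def)
  qed
  have h2: "openin (top_of_set M) V"
    unfolding V_def by (intro openin_open_Int open_Times L(1) open_UNIV)
  have h3: "m \<in> V" using m(1) L(3) by (auto simp: V_def s0_def mem_Times_iff)
  have h4: "C2_hypersurface S"
    unfolding C2_hypersurface_def
  proof
    fix p assume p: "p \<in> S"
    have eq: "S \<inter> U = {q \<in> U. f q = 0}"
    proof (intro subset_antisym subsetI)
      fix q assume q: "q \<in> S \<inter> U"
      then obtain s \<omega> where "s \<in> J" "norm \<omega> = 1" "q = (x s *\<^sub>R \<omega>, t s)" by (auto simp: S_def Rev_def)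
      then show "q \<in> {q \<in> U. f q = 0}" using q L(6)[of s \<omega>] L(10)[of q] xpos[of s] L(4) by auto
    next
      fix q assume q: "q \<in> {q \<in> U. f q = 0}"
      then have e: "norm (fst q) = x (sf q)" "snd q = t (sf q)" "sf q \<in> J" "fst q \<noteq> 0"
        using L(7)[of q] L(10)[of q] L(11)[of q] by auto
      have "q = (x (sf q) *\<^sub>R sgn (fst q), t (sf q))"
        using e(2,4) unfolding e(1)[symmetric] by (simp add: prod_eq_iff sgn_div_norm)
      then show "q \<in> S \<inter> U" using q e Rev_point[OF e(3), of "sgn (fst q)"] by (auto simp: S_def norm_sgn)
    qed
    show "\<exists>U (f :: 'n heis \<Rightarrow> real). open U \<and> p \<in> U \<and> C2_on U f \<and> (\<forall>q\<in>U. frechet_derivative f (at q) \<noteq> (\<lambda>v. 0)) \<and> S \<inter> U = {q \<in> U. f q = 0}"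
      by (rule exI[of _ U], rule exI[of _ f])
        (intro conjI L(5,8,9) subsetD[OF SU p] eq)
  qed
  have reg: "heis_metric p ((normal_field e \<circ> G) p) ((normal_field e \<circ> G) p) = 1 \<and>
      (\<forall>v\<in>tangent_space S p. heis_metric p ((normal_field e \<circ> G) p) v = 0) \<and>
      has_mean_curvature S (normal_field e \<circ> G) p H" if pS: "p \<in> S" for p
  proof -
    obtain s1 \<omega> where s1: "s1 \<in> J" "norm \<omega> = 1" and p: "p = (x s1 *\<^sub>R \<omega>, t s1)" using pS by (auto simp: S_def Rev_def)
    have loc: "\<exists>U'. open U' \<and> (x s1 *\<^sub>R \<omega>, t s1) \<in> U' \<and> S \<inter> U' \<subseteq> Rev J'"
      if J': "open J'" "s1 \<in> J'" "J' \<subseteq> J" for J'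
    proof (intro exI conjI)
      show "open (U \<inter> sf -` J')" by (rule continuous_open_preimage[OF sf_cont L(5) J'(1)])
      show "(x s1 *\<^sub>R \<omega>, t s1) \<in> U \<inter> sf -` J'" using L(6)[OF s1] J' by simp
      show "S \<inter> (U \<inter> sf -` J') \<subseteq> Rev J'"
      proof
        fix q assume q: "q \<in> S \<inter> (U \<inter> sf -` J')"
        then obtain s \<omega> where "s \<in> J" "norm \<omega> = 1" "q = (x s *\<^sub>R \<omega>, t s)" by (auto simp: S_def Rev_def)
        then show "q \<in> Rev J'" using q L(6)[of s \<omega>] by (auto simp: Rev_def)
      qed
    qed
    have s1I: "s1 \<in> I" using s1 L(4) by blast
    have \<nu>: "(normal_field e \<circ> G) (x s *\<^sub>R \<omega>', t s) = normal_field e (s, x s *\<^sub>R \<omega>')" if "s \<in> J" "norm \<omega>' = 1" for s \<omega>'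
      using GRev[OF that] by simp
    have JS: "Rev J \<subseteq> S" by (simp add: S_def)
    show ?thesis
      unfolding p
      by (intro conjI regular_point[OF s1I s1(2) card L(1) s1(1) L(4) JS loc \<nu>])
  qed
  have h5: "continuous_on S (normal_field e \<circ> G)"
  proof -
    have c: "continuous_on S sf" by (rule continuous_on_subset[OF sf_cont SU])
    have c\<sigma>: "continuous_on S (\<lambda>q. \<sigma> (sf q))"
      by (rule continuous_on_compose2[OF continuous_on_profile(3) c]) (use SU L(4,7) in blast)
    have cr: "continuous_on S (\<lambda>q. rot (fst q))"
      by (intro bounded_linear.continuous_on[OF bounded_linear_rot] continuous_intros)
    have nz: "\<forall>q\<in>S. fst q \<noteq> 0" using SU L(11) by blast
    have "continuous_on S (\<lambda>q. (1 / sqrt (1 + (norm (fst q))\<^sup>2 * (sin (\<sigma> (sf q)))\<^sup>2)) *\<^sub>R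
       (- sin (\<sigma> (sf q)) *\<^sub>R rot (fst q) - cos (\<sigma> (sf q)) *\<^sub>R sgn (fst q), sin (\<sigma> (sf q)) * (1 + (norm (fst q))\<^sup>2)))"
    proof (intro continuous_intros c\<sigma> cr nz)
      show "\<forall>q\<in>S. sqrt (1 + (norm (fst q))\<^sup>2 * (sin (\<sigma> (sf q)))\<^sup>2) \<noteq> 0"
        by (metis add_pos_nonneg less_irrefl mult_nonneg_nonneg real_sqrt_gt_0_iff zero_le_power2 zero_less_one)
    qed
    then show ?thesis
      by (rule continuous_on_eq) (use SU L(4,7) in \<open>auto simp: normal_field_def G_def\<close>)
  qed
  show ?thesis unfolding unit_normal_def
    by (intro exI[of _ V] exI[of _ S] exI[of _ G] conjI ballI h1 h2 h3 h4 h5) (use reg in blast)+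
qed

end

section \<open>Charts at the poles\<close>

context profile
begin

text \<open>The pole at the end \<open>a\<close> of \<open>I\<close>: near it the hypersurface is the graph of
  \<open>z \<mapsto> u0 + k |z|\<close>, where \<open>k' r = \<mu> (r\<^sup>2) r\<^sup>2\<close> with \<open>\<mu>\<close> of class \<open>C\<^sup>1\<close>, whence the graph is \<open>C\<^sup>2\<close>
  at \<open>z = 0\<close>. The sign \<open>\<epsilon>\<close> is that of \<open>x'\<close>.\<close>

lemma pole_chart:
  fixes k \<mu> \<mu>1 \<xi> e :: "real \<Rightarrow> real" and a \<delta> u0 \<epsilon> :: real and O' Jp :: "real set"
  defines "M \<equiv> revolution_source I x t :: (real \<times> (complex^'n::finite)) set" and "F \<equiv> revolution_map I t"
  assumes card: "CARD('n) = n"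
    and a: "a \<in> axis_ends I x t" and O': "open O'" "a \<in> O'" "O' \<inter> I = Jp" "O' \<inter> axis_ends I x t = {a}"
    and \<delta>: "0 < \<delta>" and xJ: "x ` Jp = {0<..<\<delta>}" and \<xi>0: "\<xi> 0 = a" and \<xi>x: "\<And>s. s \<in> Jp \<Longrightarrow> \<xi> (x s) = s"
    and \<xi>c: "continuous_on {0..<\<delta>} \<xi>"
    and \<epsilon>: "\<epsilon> = 1 \<or> \<epsilon> = - 1" and tk: "\<And>s. s \<in> Jp \<Longrightarrow> t s = u0 + k (x s)" and k0: "k 0 = 0"
    and limt: "Lim (at a within I) t = u0"
    and k: "\<And>r. \<bar>r\<bar> < \<delta> \<Longrightarrow> (k has_real_derivative \<mu> (r * r) * r * r) (at r)"
    and \<mu>: "\<And>w. w < \<delta> * \<delta> \<Longrightarrow> (\<mu> has_real_derivative \<mu>1 w) (at w)" "continuous_on {..<\<delta> * \<delta>} \<mu>1"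
    and sin: "\<And>s. s \<in> Jp \<Longrightarrow> sin (\<sigma> s) = \<epsilon> / sqrt (1 + (\<mu> (x s * x s) * x s * x s)\<^sup>2)"
    and cos: "\<And>s. s \<in> Jp \<Longrightarrow> cos (\<sigma> s) = \<epsilon> * (\<mu> (x s * x s) * x s * x s) / sqrt (1 + (\<mu> (x s * x s) * x s * x s)\<^sup>2)"
    and e: "e a = \<epsilon>"
  shows "\<exists>V S G. openin (top_of_set M) V \<and> (a, 0) \<in> V \<and> homeomorphism V S F G \<and>
     C2_hypersurface S \<and> unit_normal heis_metric S (normal_field e \<circ> G) \<and>
     (\<forall>p \<in> S - singular_set S (normal_field e \<circ> G). has_mean_curvature S (normal_field e \<circ> G) p H)"
proof -
  have aI: "a \<notin> I" using a by (simp add: axis_ends_def)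
  have Jp: "open Jp" "Jp \<subseteq> I" using O' I(1) by auto
  have xpos': "0 < x s \<and> x s < \<delta>" if "s \<in> Jp" for s using xJ that by (metis greaterThanLessThan_iff imageI)
  define S :: "'n heis set" where "S = {q. norm (fst q) < \<delta> \<and> snd q = u0 + k (norm (fst q))}"
  define V where "V = M \<inter> (O' \<times> UNIV)"
  define G where "G q = (\<xi> (norm (fst q)), fst q)" for q :: "'n heis"
  have V: "V = {(s, x s *\<^sub>R \<omega>) | s \<omega>. s \<in> Jp \<and> norm \<omega> = 1} \<union> {(a, 0)}"
    unfolding V_def M_def revolution_source_def using O'(2,3,4) a by blast
  have FV: "F q = (snd q, u0 + k (norm (snd q))) \<and> norm (snd q) < \<delta> \<and> \<xi> (norm (snd q)) = fst q" if q: "q \<in> V" for q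
  proof -
    consider s \<omega> where "s \<in> Jp" "norm \<omega> = 1" "q = (s, x s *\<^sub>R \<omega>)" | "q = (a, 0)" using q unfolding V by blast
    then show ?thesis
    proof cases
      case 1
      then show ?thesis using xpos'[of s] Jp(2) tk[of s] \<xi>x[of s] by (auto simp: F_def revolution_map_def)
    next
      case 2
      then show ?thesis using aI limt k0 \<xi>0 \<delta> by (simp add: F_def revolution_map_def)
    qed
  qed
  have rep: "\<exists>s\<in>Jp. norm (fst q) = x s \<and> q = (x s *\<^sub>R sgn (fst q), t s) \<and> norm (sgn (fst q)) = 1"
    if q: "q \<in> S" "fst q \<noteq> 0" for q
  proof -
    have "norm (fst q) \<in> x ` Jp" using q unfolding xJ by (simp add: S_def)
    then obtain s where s: "s \<in> Jp" "norm (fst q) = x s" by blast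
    moreover have "q = (x s *\<^sub>R sgn (fst q), t s)"
      using q s tk[OF s(1)] unfolding s(2)[symmetric] by (simp add: prod_eq_iff sgn_div_norm S_def)
    ultimately show ?thesis using q by (auto simp: norm_sgn)
  qed
  have S0: "q = (0, u0)" if "q \<in> S" "fst q = 0" for q using that k0 by (simp add: S_def prod_eq_iff)
  have RevS: "Rev Jp \<subseteq> S"
  proof
    fix q :: "'n heis" assume "q \<in> Rev Jp"
    then obtain s and \<omega> :: "complex^'n" where s: "s \<in> Jp" "norm \<omega> = 1" "q = (x s *\<^sub>R \<omega>, t s)"
      by (auto simp: Rev_def)
    then have "norm (fst q) = x s" using xpos'[of s] by simp
    then show "q \<in> S" using s xpos'[of s] tk[of s] by (simp add: S_def)
  qed
  have GRev: "G (x s *\<^sub>R \<omega>, t s) = (s, x s *\<^sub>R \<omega>)" if "s \<in> Jp" "norm \<omega> = 1" for s \<omega>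
    using xpos'[OF that(1)] \<xi>x[OF that(1)] that(2) by (simp add: G_def)
  have GV: "G q \<in> V" if "q \<in> S" for q
  proof (cases "fst q = 0")
    case True
    then show ?thesis using \<xi>0 by (simp add: G_def V)
  next
    case False
    from rep[OF that this] obtain s where "s \<in> Jp" "q = (x s *\<^sub>R sgn (fst q), t s)" "norm (sgn (fst q)) = 1" by blast
    then show ?thesis using GRev[of s "sgn (fst q)"] unfolding V by auto
  qed
  have kc: "continuous_on {- \<delta><..<\<delta>} k"
    by (rule has_real_derivative_continuous_on[OF k]) auto
  have h1: "homeomorphism V S F G"
  proof (rule homeomorphismI)
    have "continuous_on V (\<lambda>q. (snd q, u0 + k (norm (snd q))))"
    proof (intro continuous_intros)
      show "continuous_on V (\<lambda>q. k (norm (snd q)))"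
      proof (rule continuous_on_compose2[OF kc])
        show "continuous_on V (\<lambda>q. norm (snd q))" by (intro continuous_intros)
        show "(\<lambda>q. norm (snd q)) ` V \<subseteq> {- \<delta><..<\<delta>}"
        proof (rule image_subsetI)
          fix q assume "q \<in> V"
          from FV[OF this] show "norm (snd q) \<in> {- \<delta><..<\<delta>}"
            using \<delta> norm_ge_zero[of "snd q"] unfolding greaterThanLessThan_iff by linarith
        qed
      qed
    qed
    then show "continuous_on V F" by (rule continuous_on_eq) (use FV in auto)
    have "continuous_on S (\<lambda>q. \<xi> (norm (fst q)))"
      by (rule continuous_on_compose2[OF \<xi>c]) (auto intro!: continuous_intros simp: S_def)
    then show "continuous_on S G" unfolding G_def by (intro continuous_intros)
    show "F ` V \<subseteq> S" using FV by (auto simp: S_def)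
    show "G ` S \<subseteq> V" using GV by blast
    show "G (F q) = q" if "q \<in> V" for q using FV[OF that] by (simp add: G_def prod_eq_iff)
    show "F (G q) = q" if "q \<in> S" for q
      using FV[OF GV[OF that]] that by (simp add: G_def prod_eq_iff S_def)
  qed
  have h2: "openin (top_of_set M) V"
    unfolding V_def by (intro openin_open_Int open_Times O'(1) open_UNIV)
  have h3: "(a, 0) \<in> V" by (simp add: V)
  define f where "f q = snd q - u0 - k (norm (fst q))" for q :: "'n heis"
  define U where "U = {q :: 'n heis. norm (fst q) < \<delta>}"
  note graph = C2_radial_graph(1)[where 'b = "complex^'n", OF k \<mu>]
    C2_radial_graph(2-4)[where 'b = "complex^'n" and ?u0.0 = u0, OF k \<mu>]
  have U: "open U" "C2_on U f" "\<forall>q\<in>U. frechet_derivative f (at q) \<noteq> (\<lambda>v. 0)"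
    and f': "\<forall>q\<in>U. (f has_derivative (\<lambda>v. snd v - \<mu> (fst q \<bullet> fst q) * norm (fst q) * (fst q \<bullet> fst v))) (at q)"
    using graph unfolding U_def f_def[abs_def] by blast+
  have SU: "S \<inter> U = {q \<in> U. f q = 0}" by (auto simp: S_def U_def f_def)
  have h4: "C2_hypersurface S"
    unfolding C2_hypersurface_def
  proof
    fix p assume "p \<in> S"
    then have "p \<in> U" by (simp add: S_def U_def)
    then show "\<exists>U (f :: 'n heis \<Rightarrow> real). open U \<and> p \<in> U \<and> C2_on U f \<and>
        (\<forall>q\<in>U. frechet_derivative f (at q) \<noteq> (\<lambda>v. 0)) \<and> S \<inter> U = {q \<in> U. f q = 0}"
      using U SU by (intro exI[of _ U] exI[of _ f] conjI)
  qed
  have injx: "inj_on x Jp" by (rule inj_on_inverseI[of _ \<xi>]) (rule \<xi>x)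
  have reg: "heis_metric p ((normal_field e \<circ> G) p) ((normal_field e \<circ> G) p) = 1 \<and>
      (\<forall>v\<in>tangent_space S p. heis_metric p ((normal_field e \<circ> G) p) v = 0) \<and>
      has_mean_curvature S (normal_field e \<circ> G) p H" if pS: "p \<in> S" "fst p \<noteq> 0" for p
  proof -
    obtain s1 \<omega> where s1: "s1 \<in> Jp" "norm \<omega> = 1" and p: "p = (x s1 *\<^sub>R \<omega>, t s1)"
      using rep[OF pS] by blast
    have loc: "\<exists>U'. open U' \<and> (x s1 *\<^sub>R \<omega>, t s1) \<in> U' \<and> S \<inter> U' \<subseteq> Rev J'"
      if J': "open J'" "s1 \<in> J'" "J' \<subseteq> Jp" for J'
    proof (intro exI conjI)
      \<comment> \<open>Near the pole the radius is injective on the branch, so a neighbourhood that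
        isolates the parameters \<open>J'\<close> can be cut out by the radii alone; its openness
        comes from invariance of domain.\<close>
      have "continuous_on J' x" using continuous_on_profile(1) J' Jp(2) continuous_on_subset by blast
      moreover have "inj_on x J'" using injx J'(3) by (rule inj_on_subset)
      ultimately have "open (x ` J')" using J'(1) by (simp add: invariance_of_domain)
      then show "open {q :: 'n heis. norm (fst q) \<in> x ` J'}"
        using open_vimage[of "x ` J'" "\<lambda>q :: 'n heis. norm (fst q)"] by (simp add: vimage_def continuous_intros)
      show "(x s1 *\<^sub>R \<omega>, t s1) \<in> {q. norm (fst q) \<in> x ` J'}" using J' s1 xpos'[OF s1(1)] by auto
      show "S \<inter> {q. norm (fst q) \<in> x ` J'} \<subseteq> Rev J'"
      proof
        fix q assume q: "q \<in> S \<inter> {q. norm (fst q) \<in> x ` J'}"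
        then obtain s' where s': "s' \<in> J'" "norm (fst q) = x s'" by blast
        then have "fst q \<noteq> 0" using xpos'[of s'] J' by auto
        then obtain s where s: "s \<in> Jp" "norm (fst q) = x s" "q = (x s *\<^sub>R sgn (fst q), t s)" "norm (sgn (fst q)) = 1"
          using rep[of q] q by blast
        then have "s = s'" using s' J'(3) injx by (metis inj_onD subsetD)
        then show "q \<in> Rev J'" using Rev_point[OF s'(1) s(4)] s(3) by simp
      qed
    qed
    have s1I: "s1 \<in> I" using s1 Jp by blast
    have \<nu>: "(normal_field e \<circ> G) (x s *\<^sub>R \<omega>', t s) = normal_field e (s, x s *\<^sub>R \<omega>')" if "s \<in> Jp" "norm \<omega>' = 1" for s \<omega>'
      using GRev[OF that] by simp
    show ?thesis
      unfolding p
      by (intro conjI regular_point[OF s1I s1(2) card Jp(1) s1(1) Jp(2) RevS loc \<nu>])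
  qed
  have \<nu>0: "(normal_field e \<circ> G) (0, u0) = (0, \<epsilon>)"
    using aI e \<xi>0 by (simp add: G_def normal_field_def)
  have pole: "heis_metric (0, u0) ((normal_field e \<circ> G) (0, u0)) ((normal_field e \<circ> G) (0, u0)) = 1 \<and>
      (\<forall>v\<in>tangent_space S (0, u0). heis_metric (0, u0) ((normal_field e \<circ> G) (0, u0)) v = 0)"
  proof (intro conjI ballI)
    show "heis_metric (0, u0) ((normal_field e \<circ> G) (0, u0)) ((normal_field e \<circ> G) (0, u0)) = 1"
      unfolding \<nu>0 using \<epsilon> by (auto simp: heis_metric_inner T_component_rot)
    fix v assume "v \<in> tangent_space S (0, u0)"
    then obtain c where c: "range c \<subseteq> S" "c 0 = (0, u0)" "(c has_vector_derivative v) (at 0)"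
      unfolding tangent_space_def by blast
    \<comment> \<open>At the pole the derivative of \<open>f\<close> is the projection to the last
      coordinate, while \<open>f\<close> vanishes along every curve in \<open>S\<close>; so tangent
      vectors at the pole have last coordinate 0.\<close>
    have "(0, u0) \<in> U" using \<delta> by (simp add: U_def)
    with f' have "(f has_derivative snd) (at (c 0))" unfolding c(2) by fastforce
    from has_derivative_compose[OF c(3)[unfolded has_vector_derivative_def] this]
    have "((\<lambda>h. f (c h)) has_real_derivative snd v) (at 0)"
      unfolding has_field_derivative_def by (rule has_derivative_eq_rhs) (simp add: fun_eq_iff)
    moreover have "f (c h) = 0" for h
      using subsetD[OF c(1) rangeI, of h] by (simp add: S_def f_def)
    ultimately have "((\<lambda>h. 0 :: real) has_real_derivative snd v) (at 0)" by simp
    then have "snd v = 0" by (rule DERIV_unique[OF _ DERIV_const])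
    then show "heis_metric (0, u0) ((normal_field e \<circ> G) (0, u0)) v = 0"
      unfolding \<nu>0 by (simp add: heis_metric_inner T_component_rot)
  qed
  have h5: "continuous_on S (normal_field e \<circ> G)"
  proof -
    \<comment> \<open>\<open>K\<close> is the slope \<open>k' (norm z)\<close> and \<open>Q\<close>
      stands for \<open>sin \<sigma>\<close>. The term \<open>cos \<sigma> *\<^sub>R sgn z\<close>
      of the normal becomes \<open>Q z * \<mu> (z \<bullet> z) * norm z\<close> times
      \<open>z\<close>, which is continuous at the pole.\<close>
    define K where "K z = \<mu> (z \<bullet> z) * norm z * norm z" for z :: "complex^'n"
    define Q where "Q z = \<epsilon> / sqrt (1 + (K z)\<^sup>2)" for z
    define N where "N z = (1 / sqrt (1 + (norm z)\<^sup>2 * (Q z)\<^sup>2)) *\<^sub>R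
       (- Q z *\<^sub>R rot z - (Q z * \<mu> (z \<bullet> z) * norm z) *\<^sub>R z, Q z * (1 + (norm z)\<^sup>2))" for z
    have sq: "z \<bullet> z < \<delta> * \<delta>" if "norm z < \<delta>" for z :: "complex^'n"
      using that mult_strict_mono[of "norm z" \<delta> "norm z" \<delta>]
      by (cases "z = 0") (auto simp: dot_square_norm power2_eq_square)
    have "continuous_on {z :: complex^'n. norm z < \<delta>} (\<lambda>z. \<mu> (z \<bullet> z))"
      by (rule continuous_on_compose2[OF has_real_derivative_continuous_on[OF \<mu>(1)], of "{..<\<delta> * \<delta>}"])
        (auto intro!: continuous_intros simp: sq)
    note c\<mu> = this
    have cK: "continuous_on {z. norm z < \<delta>} K" unfolding K_def by (intro continuous_intros c\<mu>)
    have p1: "sqrt (1 + r\<^sup>2) \<noteq> 0" for r :: real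
      by (metis add_pos_nonneg less_irrefl real_sqrt_gt_0_iff zero_le_power2 zero_less_one)
    have cQ: "continuous_on {z. norm z < \<delta>} Q" unfolding Q_def
      by (intro continuous_intros cK) (use p1 in blast)
    have p2: "sqrt (1 + r\<^sup>2 * w\<^sup>2) \<noteq> 0" for r w :: real
      by (metis p1 power_mult_distrib)
    have "continuous_on {z. norm z < \<delta>} N" unfolding N_def
      by (intro continuous_intros c\<mu> cQ bounded_linear.continuous_on[OF bounded_linear_rot]) (use p2 in blast)
    then have "continuous_on S (\<lambda>q. N (fst q))"
      by (rule continuous_on_compose2) (auto intro!: continuous_intros simp: S_def)
    moreover have "N (fst q) = (normal_field e \<circ> G) q" if q: "q \<in> S" for q
    proof (cases "fst q = 0")
      case True
      then show ?thesis using S0[OF q True] \<nu>0 by (simp add: N_def Q_def K_def rot_simps)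
    next
      case False
      obtain s where s: "s \<in> Jp" "norm (fst q) = x s" using rep[OF q False] by blast
      have K: "K (fst q) = \<mu> (x s * x s) * x s * x s"
        unfolding K_def s(2) by (simp add: dot_square_norm s(2) power2_eq_square)
      have sQ: "sin (\<sigma> s) = Q (fst q)" using sin[OF s(1)] by (simp add: Q_def K)
      have "cos (\<sigma> s) = Q (fst q) * K (fst q)" using cos[OF s(1)] by (simp add: Q_def K)
      then have cs: "cos (\<sigma> s) *\<^sub>R sgn (fst q) = (Q (fst q) * \<mu> (fst q \<bullet> fst q) * norm (fst q)) *\<^sub>R fst q"
        using False by (simp add: K_def sgn_div_norm)
      have "G q = (s, fst q)" using s \<xi>x by (simp add: G_def)
      then show ?thesis using s Jp(2) by (auto simp: normal_field_def N_def sQ cs)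
    qed
    ultimately show ?thesis by (rule continuous_on_eq)
  qed
  \<comment> \<open>The normal at the pole is vertical, so the pole is singular and the curvature
    condition concerns the other points only.\<close>
  have sing: "fst p \<noteq> 0" if "p \<in> S - singular_set S (normal_field e \<circ> G)" for p
  proof
    assume "fst p = 0"
    then have "p = (0, u0)" using S0 that by blast
    then have "fst ((normal_field e \<circ> G) p) = 0" using \<nu>0 by simp
    then show False using that unfolding singular_set_eq by blast
  qed
  have unit: "heis_metric p ((normal_field e \<circ> G) p) ((normal_field e \<circ> G) p) = 1 \<and>
      (\<forall>v\<in>tangent_space S p. heis_metric p ((normal_field e \<circ> G) p) v = 0)" if "p \<in> S" for p
    using reg[OF that] pole S0[OF that] by (cases "fst p = 0") (blast, blast)
  show ?thesis unfolding unit_normal_def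
  proof (intro exI[of _ V] exI[of _ S] exI[of _ G] conjI ballI h1 h2 h3 h4 h5)
    fix p assume p: "p \<in> S"
    show "heis_metric p ((normal_field e \<circ> G) p) ((normal_field e \<circ> G) p) = 1" using unit[OF p] by blast
    show "heis_metric p ((normal_field e \<circ> G) p) v = 0" if "v \<in> tangent_space S p" for v using unit[OF p] that by blast
  next
    fix p assume p: "p \<in> S - singular_set S (normal_field e \<circ> G)"
    then show "has_mean_curvature S (normal_field e \<circ> G) p H" using reg[of p] sing[OF p] by blast
  qed
qed

end

section \<open>Complete solutions\<close>

text \<open>Used in two ways: with \<open>c > 0\<close> to drive a bounded quantity out of its
  bounds in finite time, and with \<open>c = 0\<close> as weak monotonicity.\<close>

lemma derivative_ge_growth:
  fixes f :: "real \<Rightarrow> real"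
  assumes "a \<le> b" "\<And>s. a \<le> s \<Longrightarrow> s \<le> b \<Longrightarrow> (f has_real_derivative f' s) (at s)"
    "\<And>s. a \<le> s \<Longrightarrow> s \<le> b \<Longrightarrow> c \<le> f' s"
  shows "f a + c * (b - a) \<le> f b"
proof -
  have "f a - c * a \<le> f b - c * b"
  proof (rule DERIV_nonneg_imp_nondecreasing[where f = "\<lambda>s. f s - c * s" and a = a and b = b])
    fix s assume s: "a \<le> s" "s \<le> b"
    have "((\<lambda>s. f s - c * s) has_real_derivative f' s - c) (at s)"
      using assms(2)[OF s] by (auto intro!: derivative_eq_intros)
    then show "\<exists>y. ((\<lambda>s. f s - c * s) has_real_derivative y) (at s) \<and> 0 \<le> y"
      using assms(3)[OF s] by (intro exI[of _ "f' s - c"]) simp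
  qed (rule assms(1))
  then show ?thesis by (simp add: algebra_simps)
qed

lemma continuous_nonzero_sign:
  fixes f :: "real \<Rightarrow> real"
  assumes "continuous_on S f" "is_interval S" "\<And>s. s \<in> S \<Longrightarrow> f s \<noteq> 0" "a \<in> S" "0 < f a" "s \<in> S"
  shows "0 < f s"
proof (rule ccontr)
  assume "\<not> 0 < f s"
  moreover have "connected (f ` S)"
    using connected_continuous_image[OF assms(1)] assms(2) by (simp add: is_interval_connected_1)
  ultimately have "0 \<in> f ` S"
    using connectedD_interval[of "f ` S" "f s" "f a" 0] assms(4-6) by force
  then show False using assms(3) by force
qed

lemma strictly_convex_on_derivative:
  fixes f f' :: "real \<Rightarrow> real"
  assumes A: "is_interval A" and f: "\<And>s. s \<in> A \<Longrightarrow> (f has_real_derivative f' s) (at s)"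
    and mono: "strict_mono_on A f'"
  shows "strictly_convex_on A f"
proof -
  have main: "f ((1 - \<theta>) * u + \<theta> * v) < (1 - \<theta>) * f u + \<theta> * f v"
    if uv: "u \<in> A" "v \<in> A" "u < v" and th: "0 < \<theta>" "\<theta> < 1" for u v \<theta> :: real
  proof -
    define w where "w = (1 - \<theta>) * u + \<theta> * v"
    have w: "w - u = \<theta> * (v - u)" "v - w = (1 - \<theta>) * (v - u)" by (simp_all add: w_def algebra_simps)
    have "0 < w - u" "0 < v - w" unfolding w using uv th by simp_all
    then have wuv: "u < w" "w < v" by simp_all
    have inA: "r \<in> A" if "u \<le> r" "r \<le> v" for r using mem_is_interval_1_I[OF A uv(1,2) that] .
    obtain \<xi>1 where 1: "u < \<xi>1" "\<xi>1 < w" "f w - f u = (w - u) * f' \<xi>1"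
      using MVT2[OF wuv(1), of f f'] f inA wuv by (metis less_eq_real_def order_less_trans order_trans)
    obtain \<xi>2 where 2: "w < \<xi>2" "\<xi>2 < v" "f v - f w = (v - w) * f' \<xi>2"
      using MVT2[OF wuv(2), of f f'] f inA wuv by (metis less_eq_real_def order_less_trans order_trans)
    have "f' \<xi>1 < f' \<xi>2" using mono 1 2 wuv inA by (intro strict_mono_onD[OF mono]) auto
    then have "(\<theta> * (1 - \<theta>) * (v - u)) * f' \<xi>1 < (\<theta> * (1 - \<theta>) * (v - u)) * f' \<xi>2"
      using th uv by (intro mult_strict_left_mono) auto
    then have "(1 - \<theta>) * (f w - f u) < \<theta> * (f v - f w)"
      unfolding 1(3) 2(3) w by (simp add: mult_ac)
    then show ?thesis unfolding w_def[symmetric] by (simp add: algebra_simps)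
  qed
  show ?thesis unfolding strictly_convex_on_def
  proof (intro conjI ballI allI impI)
    show "convex A" using A is_interval_convex by blast
    fix u v \<theta> :: real assume uv: "u \<in> A" "v \<in> A" and th: "u \<noteq> v \<and> 0 < \<theta> \<and> \<theta> < 1"
    show "f ((1 - \<theta>) * u + \<theta> * v) < (1 - \<theta>) * f u + \<theta> * f v"
    proof (cases "u < v")
      case True
      then show ?thesis using main uv th by blast
    next
      case False
      then show ?thesis using main[of v u "1 - \<theta>"] uv th by (simp add: add.commute)
    qed
  qed
qed

lemma axis_ends_UNIV: "axis_ends UNIV x t = {}"
  by (simp add: axis_ends_def)

context profile
begin

section \<open>Bounds on the radius and existence for all parameters\<close>

lemma energy_bound: "s \<in> I \<Longrightarrow> \<bar>E\<bar> \<le> x s ^ (2 * n - 1) * (1 + \<bar>H\<bar> * x s)"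
proof -
  assume s: "s \<in> I"
  have "E = x s ^ (2 * n - 1) * (P s - H * x s)"
    using P_eq[OF s] xpos[OF s] by (simp add: PP_def)
  then have "\<bar>E\<bar> = x s ^ (2 * n - 1) * \<bar>P s - H * x s\<bar>"
    using xpos[OF s] by (simp add: abs_mult)
  also have "\<dots> \<le> x s ^ (2 * n - 1) * (1 + \<bar>H\<bar> * x s)"
  proof (rule mult_left_mono)
    have "\<bar>P s - H * x s\<bar> \<le> \<bar>P s\<bar> + \<bar>H * x s\<bar>" by (rule abs_triangle_ineq4)
    then show "\<bar>P s - H * x s\<bar> \<le> 1 + \<bar>H\<bar> * x s"
      using P_le[OF s] xpos[OF s] by (simp add: abs_mult)
  qed (use xpos[OF s] in simp)
  finally show ?thesis .
qed

text \<open>For radii below 1 one has \<open>x ^ (2 n - 1) \<le> x\<close>, so the energy bound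
  becomes linear: a small radius forces a small energy. The minimum with 1 accounts for the
  remaining radii.\<close>

lemma x_lower: "s \<in> I \<Longrightarrow> min 1 (\<bar>E\<bar> / (1 + \<bar>H\<bar>)) \<le> x s"
proof (cases "x s < 1")
  case True
  assume s: "s \<in> I"
  have "x s ^ (2 * n - 1) \<le> x s ^ 1"
    using xpos[OF s] True n by (intro power_decreasing) auto
  moreover have "1 + \<bar>H\<bar> * x s \<le> 1 + \<bar>H\<bar>" using True by (simp add: mult_left_le)
  ultimately have "x s ^ (2 * n - 1) * (1 + \<bar>H\<bar> * x s) \<le> x s * (1 + \<bar>H\<bar>)"
    using xpos[OF s] by (intro mult_mono) auto
  then have "\<bar>E\<bar> / (1 + \<bar>H\<bar>) \<le> x s" using energy_bound[OF s] by (simp add: field_simps)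
  then show ?thesis by simp
qed simp

text \<open>In \<open>H x = P - E / x ^ (2 n - 1)\<close> both terms on the right are bounded once
  the radius exceeds 1.\<close>

lemma x_upper: "s \<in> I \<Longrightarrow> H \<noteq> 0 \<Longrightarrow> x s \<le> max 1 ((\<bar>E\<bar> + 1) / \<bar>H\<bar>)"
proof (cases "1 < x s")
  case True
  assume s: "s \<in> I" and H: "H \<noteq> 0"
  have "\<bar>E / x s ^ (2 * n - 1)\<bar> \<le> \<bar>E\<bar>"
    using True one_le_power[of "x s" "2 * n - 1"] by (simp add: abs_divide divide_le_eq mult_left_le_one_le mult_le_cancel_left1)
  moreover have "\<bar>E / x s ^ (2 * n - 1) + H * x s\<bar> \<le> 1" using P_le[OF s] P_eq[OF s] by (simp add: PP_def)
  ultimately have "\<bar>H * x s\<bar> \<le> \<bar>E\<bar> + 1" by linarith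
  then have "x s \<le> (\<bar>E\<bar> + 1) / \<bar>H\<bar>" using H True by (simp add: field_simps abs_mult)
  then show ?thesis by simp
qed simp

lemma x_lipschitz: "a \<in> I \<Longrightarrow> b \<in> I \<Longrightarrow> \<bar>x a - x b\<bar> \<le> \<bar>a - b\<bar>"
  using derivative_bound_interval[OF I(2) x', of 1] by simp

text \<open>On a bounded interval \<open>x\<close> stays bounded, having Lipschitz constant 1.
  Together with the lower bound \<open>m\<close> this confines the radius to a compact interval, so
  the continuation step \<open>h\<close> is uniform and passes beyond \<open>Sup I\<close>.\<close>

lemma extends_right:
  assumes s0: "s0 \<in> I" and m: "0 < m" "\<And>s. s \<in> I \<Longrightarrow> s0 \<le> s \<Longrightarrow> m \<le> x s"
  shows "{s0..} \<subseteq> I"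
proof (rule ccontr)
  assume "\<not> {s0..} \<subseteq> I"
  then obtain b where b: "s0 \<le> b" "b \<notin> I" by auto
  have ub: "s < b" if "s \<in> I" for s
    using mem_is_interval_1_I[OF I(2) s0 that b(1)] b by force
  define c where "c = Sup I"
  have bdd: "bdd_above I" by (rule bdd_aboveI[of _ b]) (use ub in force)
  have le_c: "s \<le> c" if "s \<in> I" for s unfolding c_def by (rule cSup_upper[OF that bdd])
  obtain h where h: "0 < h" "\<And>s. s \<in> I \<Longrightarrow> m \<le> x s \<Longrightarrow> x s \<le> x s0 + (b - s0) \<Longrightarrow> {s - h<..<s + h} \<subseteq> I"
    by (rule complete_profile_solution_extend[OF comp m(1), of "x s0 + (b - s0)"]) blast
  have "max s0 (c - h / 2) \<in> I \<or> (\<exists>s\<in>I. c - h / 2 < s \<and> s0 \<le> s)"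
  proof -
    obtain s where s: "s \<in> I" "c - h / 2 < s"
      using less_cSup_iff[OF I(3) bdd, of "c - h / 2"] h(1) by (auto simp: c_def)
    then show ?thesis using s0 le_c[OF s0] by (cases "s0 \<le> s") auto
  qed
  then obtain s where s: "s \<in> I" "c - h / 2 \<le> s" "s0 \<le> s" by force
  have "x s \<le> x s0 + (b - s0)" using x_lipschitz[OF s(1) s0] ub[OF s(1)] s(3) by linarith
  \<comment> \<open>\<open>s\<close> lies within \<open>h / 2\<close> of the supremum
    \<open>c\<close>, so a step of \<open>3 h / 4\<close>, shorter than \<open>h\<close>, overshoots
    \<open>c\<close>.\<close>
  then have "s + h / 2 + h / 4 \<in> I" using h(2)[OF s(1) m(2)[OF s(1,3)]] h(1) by auto
  then show False using le_c s(2) h(1) by fastforce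
qed

lemma extends_left:
  assumes s0: "s0 \<in> I" and m: "0 < m" "\<And>s. s \<in> I \<Longrightarrow> s \<le> s0 \<Longrightarrow> m \<le> x s"
  shows "{..s0} \<subseteq> I"
proof (rule ccontr)
  assume "\<not> {..s0} \<subseteq> I"
  then obtain b where b: "b \<le> s0" "b \<notin> I" by auto
  have lb: "b < s" if "s \<in> I" for s
    using mem_is_interval_1_I[OF I(2) that s0 _ b(1)] b by force
  define c where "c = Inf I"
  have bdd: "bdd_below I" by (rule bdd_belowI[of _ b]) (use lb in force)
  have c_le: "c \<le> s" if "s \<in> I" for s unfolding c_def by (rule cInf_lower[OF that bdd])
  obtain h where h: "0 < h" "\<And>s. s \<in> I \<Longrightarrow> m \<le> x s \<Longrightarrow> x s \<le> x s0 + (s0 - b) \<Longrightarrow> {s - h<..<s + h} \<subseteq> I"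
    by (rule complete_profile_solution_extend[OF comp m(1), of "x s0 + (s0 - b)"]) blast
  have "\<exists>s\<in>I. s \<le> c + h / 2 \<and> s \<le> s0"
  proof -
    obtain s where s: "s \<in> I" "s < c + h / 2"
      using cInf_less_iff[OF I(3) bdd, of "c + h / 2"] h(1) by (auto simp: c_def)
    show ?thesis
    proof (cases "s \<le> s0")
      case True
      then show ?thesis using s by (intro bexI[of _ s]) auto
    next
      case False
      then show ?thesis using s s0 by (intro bexI[of _ s0]) auto
    qed
  qed
  then obtain s where s: "s \<in> I" "s \<le> c + h / 2" "s \<le> s0" by blast
  have "x s \<le> x s0 + (s0 - b)" using x_lipschitz[OF s(1) s0] lb[OF s(1)] s(3) by linarith
  then have "s - h / 2 - h / 4 \<in> I" using h(2)[OF s(1) m(2)[OF s(1,3)]] h(1) by auto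
  then show False using c_le s(2) h(1) by fastforce
qed

lemma nonzero_energy_UNIV:
  assumes "E \<noteq> 0"
  shows "I = UNIV"
proof -
  obtain s0 where s0: "s0 \<in> I" using I(3) by blast
  have m: "0 < min 1 (\<bar>E\<bar> / (1 + \<bar>H\<bar>))"
    using assms by (simp add: divide_pos_pos add_pos_nonneg)
  have "{s0..} \<subseteq> I" "{..s0} \<subseteq> I"
    using extends_right[OF s0 m] extends_left[OF s0 m] x_lower by blast+
  moreover have "UNIV \<subseteq> {..s0} \<union> {s0..}" by auto
  ultimately show ?thesis by blast
qed

section \<open>The image of the immersion and embeddedness of graphs\<close>

lemma generating_curve_nonzero:
  assumes "E \<noteq> 0"
  shows "generating_curve I x t = profile_curve x t ` I"
proof -
  let ?m = "min 1 (\<bar>E\<bar> / (1 + \<bar>H\<bar>))"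
  have m: "0 < ?m" using assms by (simp add: divide_pos_pos add_pos_nonneg)
  have "closed {q :: real \<times> real. ?m \<le> fst q}" by (intro closed_Collect_le continuous_intros)
  moreover have "profile_curve x t ` I \<subseteq> {q. ?m \<le> fst q}" using x_lower by (auto simp: profile_curve_def)
  ultimately have "closure (profile_curve x t ` I) \<subseteq> {q. ?m \<le> fst q}" by (rule closure_minimal[rotated])
  then show ?thesis using m unfolding generating_curve_def by force
qed

text \<open>The generating curve adjoins closure points on the axis, whereas the source adjoins ends
  of \<open>I\<close>. The hypothesis \<open>poles\<close> says that the two yield the same heights;
  for nonzero energy both sides of it are empty.\<close>

lemma image_revolution_source:
  assumes poles: "{u. (0, u) \<in> closure (profile_curve x t ` I)} = (\<lambda>a. Lim (at a within I) t) ` axis_ends I x t"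
  shows "revolution_map I t ` (revolution_source I x t :: (real \<times> (complex^'n::finite)) set)
    = revolve (generating_curve I x t)"
proof -
  let ?M = "revolution_source I x t :: (real \<times> (complex^'n::finite)) set"
  have axis: "a \<notin> I" if "a \<in> axis_ends I x t" for a using that by (auto simp: axis_ends_def)
  obtain \<omega>0 :: "complex^'n" where \<omega>0: "norm \<omega>0 = 1" using vector_choose_size[of 1] by auto
  show ?thesis
  proof (intro subset_antisym subsetI)
    fix q assume "q \<in> revolution_map I t ` ?M"
    then consider s and \<omega> :: "complex^'n" where "s \<in> I" "norm \<omega> = 1" "q = (x s *\<^sub>R \<omega>, t s)"
      | a where "a \<in> axis_ends I x t" "q = (0, Lim (at a within I) t)"
      unfolding revolution_source_def revolution_map_def using axis by fastforce
    then show "q \<in> revolve (generating_curve I x t)"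
    proof cases
      case 1
      then show ?thesis unfolding revolve_def generating_curve_def profile_curve_def by blast
    next
      case 2
      then have "(0, snd q) \<in> generating_curve I x t" using poles unfolding generating_curve_def by auto
      moreover have "q = (0 *\<^sub>R \<omega>0, snd q)" using 2 by simp
      ultimately show ?thesis unfolding revolve_def using \<omega>0 by blast
    qed
  next
    fix q :: "'n heis" assume "q \<in> revolve (generating_curve I x t)"
    then obtain r u and \<omega> :: "complex^'n" where q: "q = (r *\<^sub>R \<omega>, u)" "(r, u) \<in> generating_curve I x t" "norm \<omega> = 1"
      unfolding revolve_def by blast
    from q(2) consider s where "s \<in> I" "r = x s" "u = t s" | "r = 0" "(0, u) \<in> closure (profile_curve x t ` I)"
      unfolding generating_curve_def profile_curve_def by auto
    then show "q \<in> revolution_map I t ` ?M"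
    proof cases
      case 1
      then have "(s, x s *\<^sub>R \<omega>) \<in> ?M" using q(3) unfolding revolution_source_def by blast
      moreover have "q = revolution_map I t (s, x s *\<^sub>R \<omega>)" using q 1 by (simp add: revolution_map_def)
      ultimately show ?thesis by blast
    next
      case 2
      then obtain a where a: "a \<in> axis_ends I x t" "u = Lim (at a within I) t" using poles by blast
      then have "(a, 0) \<in> ?M" unfolding revolution_source_def by blast
      moreover have "q = revolution_map I t (a, 0)" using q 2 a axis[OF a(1)] by (simp add: revolution_map_def)
      ultimately show ?thesis by blast
    qed
  qed
qed

lemma image_nonzero:
  assumes "E \<noteq> 0"
  shows "revolution_map I t ` (revolution_source I x t :: (real \<times> (complex^'n::finite)) set)
    = revolve (generating_curve I x t)"
proof (rule image_revolution_source)
  have "u \<notin> {u. (0, u) \<in> closure (profile_curve x t ` I)}" for u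
  proof
    assume "u \<in> {u. (0, u) \<in> closure (profile_curve x t ` I)}"
    then have "(0, u) \<in> generating_curve I x t" by (simp add: generating_curve_def)
    then obtain s where "s \<in> I" "x s = 0"
      unfolding generating_curve_nonzero[OF assms] profile_curve_def by auto
    then show False using xpos[of s] by simp
  qed
  then show "{u. (0, u) \<in> closure (profile_curve x t ` I)} = (\<lambda>a. Lim (at a within I) t) ` axis_ends I x t"
    using nonzero_energy_UNIV[OF assms] by (auto simp: axis_ends_UNIV)
qed

lemma cmc_immersion_normal_field:
  assumes card: "CARD('n) = n"
    and poles: "\<And>a. a \<in> axis_ends I x t \<Longrightarrow> \<exists>V S G.
     openin (top_of_set (revolution_source I x t :: (real \<times> (complex^'n::finite)) set)) V \<and> (a, 0) \<in> V \<and>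
     homeomorphism V S (revolution_map I t) G \<and>
     C2_hypersurface S \<and> unit_normal heis_metric S (normal_field e \<circ> G) \<and>
     (\<forall>p \<in> S - singular_set S (normal_field e \<circ> G). has_mean_curvature S (normal_field e \<circ> G) p H)"
  shows "cmc_immersion (revolution_source I x t :: (real \<times> (complex^'n)) set) (revolution_map I t) (normal_field e) H"
  unfolding cmc_immersion_def
proof
  fix m :: "real \<times> (complex^'n)" assume m: "m \<in> revolution_source I x t"
  then consider "fst m \<in> I" | a where "a \<in> axis_ends I x t" "m = (a, 0)"
    unfolding revolution_source_def by auto
  then show "\<exists>V S G. openin (top_of_set (revolution_source I x t)) V \<and> m \<in> V \<and>
       homeomorphism V S (revolution_map I t) G \<and> C2_hypersurface S \<and> unit_normal heis_metric S (normal_field e \<circ> G) \<and>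
       (\<forall>p\<in>S - singular_set S (normal_field e \<circ> G). has_mean_curvature S (normal_field e \<circ> G) p H)"
  proof cases
    case 1
    then show ?thesis by (rule regular_chart[OF card m])
  next
    case 2
    then show ?thesis using poles by simp
  qed
qed

text \<open>If the height is an invertible function of the parameter, a point \<open>(z, u)\<close>
  comes from the parameter \<open>g u\<close>, which makes \<open>(g u, z)\<close> a continuous
  inverse.\<close>

lemma embedding_graph:
  assumes "I = UNIV" and g: "continuous_on (range t) g" "\<And>s. g (t s) = s"
  shows "embedding_on (revolution_source I x t :: (real \<times> (complex^'n::finite)) set) (revolution_map I t)"
  unfolding embedding_on_def
proof (rule exI[of _ "\<lambda>q. (g (snd q), fst q)"], rule homeomorphismI)
  let ?M = "revolution_source I x t :: (real \<times> (complex^'n)) set"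
  have F: "revolution_map I t q = (snd q, t (fst q))" for q :: "real \<times> (complex^'n)"
    using assms(1) by (simp add: revolution_map_def case_prod_unfold)
  show "continuous_on ?M (revolution_map I t)"
    unfolding F[abs_def]
    by (intro continuous_intros continuous_on_compose2[OF continuous_on_profile(2)]) (auto simp: assms(1))
  show "continuous_on (revolution_map I t ` ?M) (\<lambda>q. (g (snd q), fst q))"
    by (intro continuous_intros continuous_on_compose2[OF g(1)]) (auto simp: F)
  show "(\<lambda>q. (g (snd q), fst q)) ` revolution_map I t ` ?M \<subseteq> ?M" by (auto simp: F g(2))
qed (use g(2) assms(1) in \<open>auto simp: revolution_map_def\<close>)

lemma y_continuous: "continuous_on I y" and P_continuous: "continuous_on I P"
  by (rule has_real_derivative_continuous_on[OF y'], assumption)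
    (rule has_real_derivative_continuous_on[OF P'], assumption)

lemma y'_PP: "s \<in> I \<Longrightarrow> (y has_real_derivative - (P s * W s * PP' (x s) / x s)) (at s)"
  using y' \<kappa>_eq by (metis (no_types, lifting) mult.assoc mult_minus_left mult_minus_right times_divide_eq_right)

lemma W_ge: "s \<in> I \<Longrightarrow> m \<le> x s \<Longrightarrow> 0 < m \<Longrightarrow> min m 1 \<le> W s"
proof -
  assume s: "s \<in> I" "m \<le> x s" "0 < m"
  have "(min m 1)\<^sup>2 \<le> min (m\<^sup>2) 1"
    using s(3) one_le_power[of m 2] power_le_one[of m 2] by (cases "m \<le> 1") (auto simp: min_def)
  also have "\<dots> \<le> (W s)\<^sup>2"
    using profile_weight_bounds(1)[OF s(3,2) order_refl] W2[OF s(1)] by simp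
  finally show ?thesis using Wpos[OF s(1)] power2_le_imp_le by fastforce
qed

lemma sin_sign: "s \<in> I \<Longrightarrow> 0 < sin (\<sigma> s) \<longleftrightarrow> 0 < y s" "s \<in> I \<Longrightarrow> sin (\<sigma> s) < 0 \<longleftrightarrow> y s < 0"
  "s \<in> I \<Longrightarrow> sin (\<sigma> s) = 0 \<longleftrightarrow> y s = 0"
  using sin_eq xpos Wpos
  by (smt (verit, ccfv_threshold) mult_pos_pos zero_less_mult_pos mult_eq_0_iff mult_neg_pos mult_pos_neg)+

lemma cos_sign: "s \<in> I \<Longrightarrow> 0 < cos (\<sigma> s) \<longleftrightarrow> 0 < P s" "s \<in> I \<Longrightarrow> cos (\<sigma> s) < 0 \<longleftrightarrow> P s < 0"
  using cos_eq[of s] Wpos[of s] by (auto simp: zero_less_mult_iff mult_less_0_iff)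

text \<open>\<open>(y, x P)\<close> is \<open>x / W\<close> times
  \<open>(sin \<sigma>, cos \<sigma>)\<close>, so its length determines the size of the sine without
  reference to \<open>W\<close>.\<close>

lemma sin_squared: "s \<in> I \<Longrightarrow> (sin (\<sigma> s))\<^sup>2 * ((y s)\<^sup>2 + (x s * P s)\<^sup>2) = (y s)\<^sup>2"
proof -
  assume s: "s \<in> I"
  have nz: "W s \<noteq> 0" "x s \<noteq> 0" using Wpos[OF s] xpos[OF s] by auto
  have "(W s)\<^sup>2 * ((y s)\<^sup>2 + (x s * P s)\<^sup>2) = (x s * sin (\<sigma> s))\<^sup>2 + (x s * cos (\<sigma> s))\<^sup>2"
    unfolding sin_eq[OF s] cos_eq[OF s] by (simp add: power_mult_distrib algebra_simps)
  also have "\<dots> = (x s)\<^sup>2" by (simp add: power_mult_distrib distrib_left[symmetric])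
  finally have e: "(W s)\<^sup>2 * ((y s)\<^sup>2 + (x s * P s)\<^sup>2) = (x s)\<^sup>2" .
  have "(x s)\<^sup>2 * ((sin (\<sigma> s))\<^sup>2 * ((y s)\<^sup>2 + (x s * P s)\<^sup>2)) = (x s * sin (\<sigma> s))\<^sup>2 * ((y s)\<^sup>2 + (x s * P s)\<^sup>2)"
    by (simp add: power_mult_distrib)
  also have "\<dots> = (y s)\<^sup>2 * ((W s)\<^sup>2 * ((y s)\<^sup>2 + (x s * P s)\<^sup>2))" unfolding sin_eq[OF s] by (simp add: power_mult_distrib)
  also have "\<dots> = (x s)\<^sup>2 * (y s)\<^sup>2" unfolding e by simp
  finally show ?thesis using nz by simp
qed

text \<open>As long as \<open>cos \<sigma> > 0\<close>, the curve is the graph of a function \<open>f\<close> of \<open>t\<close> with \<open>f' = tan \<sigma>\<close>.\<close>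

lemma graph_function:
  assumes "I = UNIV" and cpos: "\<And>s. 0 < cos (\<sigma> s)"
  obtains g where "strict_mono t" "is_interval (range t)" "\<And>s. g (t s) = s" "\<And>u. u \<in> range t \<Longrightarrow> t (g u) = u"
    "continuous_on (range t) g"
    "\<And>u. u \<in> range t \<Longrightarrow> ((\<lambda>u. x (g u)) has_real_derivative tan (\<sigma> (g u))) (at u)"
    "\<And>u. u \<in> range t \<Longrightarrow> ((\<lambda>u. tan (\<sigma> (g u))) has_real_derivative
       profile_rhs n H (x (g u)) (\<sigma> (g u)) / cos (\<sigma> (g u)) ^ 3) (at u)"
    "continuous_on (range t) (\<lambda>u. profile_rhs n H (x (g u)) (\<sigma> (g u)) / cos (\<sigma> (g u)) ^ 3)"
proof -
  have iI: "s \<in> I" for s using assms(1) by simp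
  note d = x'[OF iI] t'[OF iI] \<sigma>'_rhs[OF iI]
  obtain g where g: "open (range t)" "is_interval (range t)" "\<And>s. s \<in> UNIV \<Longrightarrow> g (t s) = s"
    "\<And>u. u \<in> range t \<Longrightarrow> t (g u) = u" "\<And>u. u \<in> range t \<Longrightarrow> (g has_real_derivative 1 / cos (\<sigma> (g u))) (at u)"
    by (rule increasing_inverse[OF open_UNIV is_interval_univ d(2) cpos]) blast+
  have gc: "continuous_on (range t) g" by (rule has_real_derivative_continuous_on[OF g(5)])
  have 1: "((\<lambda>u. x (g u)) has_real_derivative tan (\<sigma> (g u))) (at u)" if "u \<in> range t" for u
    using DERIV_chain2[OF d(1) g(5)[OF that]] by (simp add: tan_def)
  have 2: "((\<lambda>u. tan (\<sigma> (g u))) has_real_derivative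
       profile_rhs n H (x (g u)) (\<sigma> (g u)) / cos (\<sigma> (g u)) ^ 3) (at u)" if "u \<in> range t" for u
  proof -
    have nz: "cos (\<sigma> (g u)) \<noteq> 0" using cpos[of "g u"] by simp
    show ?thesis
      by (rule DERIV_cong[OF DERIV_chain2[OF DERIV_tan[OF nz] DERIV_chain2[OF d(3) g(5)[OF that]]]])
        (simp add: field_simps power2_eq_square power3_eq_cube)
  qed
  have 3: "continuous_on (range t) (\<lambda>u. profile_rhs n H (x (g u)) (\<sigma> (g u)) / cos (\<sigma> (g u)) ^ 3)"
  proof (intro continuous_intros)
    show "continuous_on (range t) (\<lambda>u. profile_rhs n H (x (g u)) (\<sigma> (g u)))"
      by (rule continuous_on_compose2[OF continuous_on_rhs gc]) (use iI in blast)
    show "continuous_on (range t) (\<lambda>u. \<sigma> (g u))"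
      by (rule continuous_on_compose2[OF continuous_on_profile(3) gc]) (use iI in blast)
    show "\<forall>u\<in>range t. cos (\<sigma> (g u)) ^ 3 \<noteq> 0" using cpos by (metis less_irrefl power_not_zero)
  qed
  have "strict_mono t" using DERIV_pos_imp_increasing d(2) cpos by (metis strict_monoI)
  then show ?thesis using that[of g] g gc 1 2 3 by simp
qed

end

section \<open>Catenoids and unduloids\<close>

context profile
begin

lemma x_mono: "(\<And>r. a \<le> r \<Longrightarrow> r \<le> b \<Longrightarrow> r \<in> I \<and> 0 \<le> sin (\<sigma> r)) \<Longrightarrow> a \<le> b \<Longrightarrow> x a \<le> x b"
  using derivative_ge_growth[of a b x "\<lambda>s. sin (\<sigma> s)" 0] x' by auto

lemma x_antimono: "(\<And>r. a \<le> r \<Longrightarrow> r \<le> b \<Longrightarrow> r \<in> I \<and> sin (\<sigma> r) \<le> 0) \<Longrightarrow> a \<le> b \<Longrightarrow> x b \<le> x a"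
  using derivative_ge_growth[of a b "\<lambda>s. - x s" "\<lambda>s. - sin (\<sigma> s)" 0] x' by (auto intro: DERIV_minus)

lemma PP_deriv: "0 < r \<Longrightarrow> (PP has_real_derivative PP' r) (at r)"
proof -
  assume r: "0 < r"
  define k where "k = 2 * n - 1"
  have k: "2 * n - 1 = k" "2 * n = Suc k" "real k = 2 * real n - 1"
    using n by (auto simp: k_def of_nat_diff)
  have "((\<lambda>r. E / r ^ k + H * r) has_real_derivative H - real k * E / r ^ Suc k) (at r)"
  proof (cases k)
    case (Suc j)
    define q where "q = r ^ j"
    have q: "q \<noteq> 0" "r ^ k = r * q" "r ^ (k - 1) = q" "r ^ Suc k = r * (r * q)"
      using r by (simp_all add: q_def Suc)
    have pw: "((\<lambda>r. r ^ k) has_real_derivative real k * r ^ (k - 1)) (at r)"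
      using DERIV_pow[of k r UNIV] by simp
    have d: "((\<lambda>r. E * inverse (r ^ k) + H * r) has_real_derivative
        E * - (inverse (r ^ k) * (real k * r ^ (k - 1)) * inverse (r ^ k)) + H * 1) (at r)"
      by (intro DERIV_add DERIV_cmult DERIV_inverse'[OF pw] DERIV_ident) (use r in simp)
    have eq: "E * - (inverse (r ^ k) * (real k * r ^ (k - 1)) * inverse (r ^ k)) + H * 1 = H - real k * E / r ^ Suc k"
      unfolding q using q(1) r by (simp add: field_simps)
    have fe: "(\<lambda>r. E / r ^ k + H * r) = (\<lambda>r. E * inverse (r ^ k) + H * r)" by (simp add: divide_inverse)
    show ?thesis unfolding fe by (rule DERIV_cong[OF d eq])
  qed (use k n in auto)
  then show ?thesis unfolding PP_def[abs_def] PP'_def k(1) unfolding k(2) k(3)[symmetric] .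
qed

lemma SS_deriv: "0 < r \<Longrightarrow> (SS has_real_derivative (3 * (PP r)\<^sup>2 + (2 * real n - 2)) * PP' r - 2 * real n * H) (at r)"
  unfolding SS_def[abs_def]
  by (auto intro!: derivative_eq_intros PP_deriv simp: algebra_simps power2_eq_square)

lemma symmetric:
  assumes "I = UNIV" "y s0 = 0"
  shows "x (2 * s0 - s) = x s" "t (2 * s0 - s) = 2 * t s0 - t s" "\<sigma> (2 * s0 - s) = 2 * \<sigma> s0 - \<sigma> s"
  using profile_solution_symmetric[OF sol[unfolded assms(1)], of s0 s] sin_sign(3)[of s0] assms by simp_all

end

section \<open>Catenoids of positive energy\<close>

locale catenoid = profile +
  assumes H0: "H = 0" and E0: "0 < E"
begin

lemma IU: "I = UNIV" and iI: "s \<in> I"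
  using nonzero_energy_UNIV E0 by auto

definition m where "m = min 1 (\<bar>E\<bar> / (1 + \<bar>H\<bar>))"

lemma m: "0 < m" "m \<le> 1" "m \<le> x s"
  using E0 x_lower[OF iI] by (auto simp: m_def divide_pos_pos add_pos_nonneg)

lemma P_val: "P s = E / x s ^ (2 * n - 1)"
  using P_eq[OF iI, of s] unfolding PP_def by (simp add: H0)

lemma P_pos: "0 < P s" and cos_pos: "0 < cos (\<sigma> s)"
proof -
  show p: "0 < P s" using E0 xpos[OF iI, of s] by (simp add: P_val)
  then show "0 < cos (\<sigma> s)" using cos_sign[OF iI] by blast
qed

lemma PP'_neg: "0 < r \<Longrightarrow> PP' r \<le> - E / r ^ (2 * n)"
proof -
  assume r: "0 < r"
  have "1 * E / r ^ (2 * n) \<le> (2 * real n - 1) * E / r ^ (2 * n)"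
    using n E0 r by (intro divide_right_mono mult_right_mono) auto
  then show ?thesis unfolding PP'_def by (simp add: H0)
qed

text \<open>Each of \<open>P\<close>, \<open>W\<close>, \<open>- PP'\<close> and
  \<open>1 / x\<close> is bounded below on the radii up to \<open>X\<close>, so \<open>y\<close>
  increases at a definite rate as long as the radius stays bounded.\<close>

lemma y'_ge:
  assumes "x s \<le> X"
  shows "E / X ^ (2 * n - 1) * m * (E / X ^ (2 * n)) / X \<le> - (P s * W s * PP' (x s) / x s)"
proof -
  have xs: "0 < x s" by (rule xpos[OF iI])
  have "0 \<le> E / x s ^ (2 * n)" using E0 xs by simp
  then have npp: "PP' (x s) \<le> 0" using PP'_neg[OF xs] by linarith
  have "E / X ^ (2 * n - 1) * m * (E / X ^ (2 * n)) / X \<le> P s * W s * (- PP' (x s)) / x s"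
  proof (intro frac_le mult_mono)
    show "E / X ^ (2 * n - 1) \<le> P s"
      unfolding P_val using E0 xs assms by (intro divide_left_mono power_mono mult_pos_pos) auto
    show "m \<le> W s" using W_ge[OF iI m(3) m(1)] m(2) by simp
    have "E / X ^ (2 * n) \<le> E / x s ^ (2 * n)"
      using E0 xs assms by (intro divide_left_mono power_mono mult_pos_pos) auto
    then show "E / X ^ (2 * n) \<le> - PP' (x s)" using PP'_neg[OF xs] by simp
  qed (use E0 xs assms m P_pos[of s] Wpos[OF iI, of s] npp mult_nonneg_nonpos[of "P s * W s" "PP' (x s)"] in \<open>auto intro!: mult_nonneg_nonneg divide_nonneg_nonneg\<close>)
  then show ?thesis by simp
qed

lemma y'_const_pos: "0 < X \<Longrightarrow> 0 < E / X ^ (2 * n - 1) * m * (E / X ^ (2 * n)) / X"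
  using E0 m by simp

lemma y_strict_mono: "a < b \<Longrightarrow> y a < y b"
proof (rule DERIV_pos_imp_increasing[where f = y])
  fix s
  show "\<exists>d. (y has_real_derivative d) (at s) \<and> 0 < d"
    using y'_PP[OF iI, of s] y'_ge[OF order_refl] y'_const_pos[OF xpos[OF iI]] less_le_trans by blast
qed

text \<open>If \<open>y\<close> were positive throughout, \<open>x\<close> would be nondecreasing
  and hence at most \<open>x 0\<close> for negative parameters. There \<open>y\<close> would grow at
  the rate \<open>c\<close>, and over a time \<open>2 / c\<close> it would have to increase by 2
  although its values lie in \<open>(0, 1]\<close>. The negative case is the same forwards in
  time.\<close>

lemma vertex_exists: "\<exists>s0. y s0 = 0"
proof (rule ccontr)
  assume "\<not> ?thesis"
  then have nz: "y s \<noteq> 0" for s by blast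
  define c where "c = E / x 0 ^ (2 * n - 1) * m * (E / x 0 ^ (2 * n)) / x 0"
  have c: "0 < c" unfolding c_def by (rule y'_const_pos[OF xpos[OF iI]])
  have d: "y a + c * (b - a) \<le> y b" if "a \<le> b" "\<And>s. a \<le> s \<Longrightarrow> s \<le> b \<Longrightarrow> x s \<le> x 0" for a b
    using derivative_ge_growth[OF that(1), of y "\<lambda>s. - (P s * W s * PP' (x s) / x s)" c]
      y'_PP[OF iI] y'_ge that(2) unfolding c_def by blast
  have yc: "continuous_on UNIV y" using y_continuous IU by simp
  show False
  proof (cases "0 < y 0")
    case True
    have pos: "0 < y s" for s
      using continuous_nonzero_sign[OF yc is_interval_univ nz, of 0 s] True by simp
    have "x s \<le> x 0" if "s \<le> 0" for s
      by (rule x_mono) (use that pos sin_sign(1)[OF iI] iI in \<open>auto intro: less_imp_le\<close>)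
    then have "y (- (2 / c)) + c * (0 - - (2 / c)) \<le> y 0" using c by (intro d) auto
    then show False using y_le[OF iI, of 0] pos[of "- (2 / c)"] c by simp
  next
    case False
    then have "0 < - y 0" using nz[of 0] by simp
    then have neg: "0 < - y s" for s
      using continuous_nonzero_sign[of UNIV "\<lambda>s. - y s" 0 s] nz yc by (simp add: continuous_on_minus is_interval_univ)
    have "x s \<le> x 0" if "0 \<le> s" for s
    proof (rule x_antimono)
      show "r \<in> I \<and> sin (\<sigma> r) \<le> 0" for r using neg[of r] sin_sign(2)[OF iI, of r] iI by auto
    qed (rule that)
    then have "y 0 + c * (2 / c - 0) \<le> y (2 / c)" using c by (intro d) auto
    then show False using y_le[OF iI, of 0] neg[of "2 / c"] c by simp
  qed
qed

definition s0 where "s0 = (SOME s. y s = 0)"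

lemma s0: "y s0 = 0"
  unfolding s0_def by (rule someI_ex[OF vertex_exists])

lemma y_pos: "s0 < s \<Longrightarrow> 0 < y s"
  using y_strict_mono[of s0 s] s0 by simp

text \<open>Beyond \<open>s0 + 1\<close> the increasing \<open>y\<close> is bounded below, while
  \<open>x P = E / x ^ (2 n - 2)\<close> is at most \<open>B\<close> since \<open>x \<ge> m\<close>.
  By \<open>sin_squared\<close> the sine is then at least \<open>c\<close>, and \<open>x\<close>
  grows linearly.\<close>

lemma sin_growth: obtains c where "0 < c" "\<And>s. s0 + 1 \<le> s \<Longrightarrow> c \<le> sin (\<sigma> s)"
proof -
  define B where "B = E / m ^ (2 * n - 2)"
  define c where "c = y (s0 + 1) / sqrt (1 + B\<^sup>2)"
  have q: "0 < 1 + B\<^sup>2" by (simp add: add_pos_nonneg)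
  have c: "0 < c" using y_pos[of "s0 + 1"] q by (simp add: c_def)
  have "c \<le> sin (\<sigma> s)" if s: "s0 + 1 \<le> s" for s
  proof -
    have y1: "y (s0 + 1) \<le> y s" using y_strict_mono[of "s0 + 1" s] s by (cases "s = s0 + 1") auto
    have e: "x s ^ (2 * n - 1) = x s ^ (2 * n - 2) * x s" using n by (cases n) auto
    have "x s * P s = E / x s ^ (2 * n - 2)" unfolding P_val e using xpos[OF iI, of s] by simp
    also have "\<dots> \<le> B" unfolding B_def using E0 m xpos[OF iI, of s]
      by (intro divide_left_mono power_mono mult_pos_pos) auto
    finally have "(x s * P s)\<^sup>2 \<le> B\<^sup>2" using P_pos[of s] xpos[OF iI, of s] by (intro power_mono) auto
    moreover have "(y s)\<^sup>2 \<le> 1" using y_le[OF iI, of s] by (simp add: abs_square_le_1)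
    ultimately have "(sin (\<sigma> s))\<^sup>2 * ((y s)\<^sup>2 + (x s * P s)\<^sup>2) \<le> (sin (\<sigma> s))\<^sup>2 * (1 + B\<^sup>2)"
      by (intro mult_left_mono) auto
    then have "(y s)\<^sup>2 \<le> (sin (\<sigma> s))\<^sup>2 * (1 + B\<^sup>2)" using sin_squared[OF iI] by simp
    moreover have "(y (s0 + 1))\<^sup>2 \<le> (y s)\<^sup>2" using y1 y_pos[of "s0 + 1"] by (intro power_mono) auto
    ultimately have "c\<^sup>2 \<le> (sin (\<sigma> s))\<^sup>2" using q by (simp add: c_def power_divide field_simps)
    moreover have "0 < sin (\<sigma> s)" using y_pos[of s] s sin_sign(1)[OF iI, of s] by simp
    ultimately show ?thesis using power2_le_imp_le by fastforce
  qed
  then show ?thesis using c that by blast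
qed

lemma x_unbounded: "\<exists>s\<ge>s0. Z \<le> x s"
proof -
  obtain c where c: "0 < c" "\<And>s. s0 + 1 \<le> s \<Longrightarrow> c \<le> sin (\<sigma> s)" by (rule sin_growth) blast
  define s where "s = s0 + 1 + \<bar>Z\<bar> / c"
  have s: "s0 + 1 \<le> s" using c(1) by (simp add: s_def)
  have "x (s0 + 1) + c * (s - (s0 + 1)) \<le> x s"
    by (rule derivative_ge_growth[OF s]) (use x'[OF iI] c(2) in auto)
  moreover have "c * (s - (s0 + 1)) = \<bar>Z\<bar>" using c(1) by (simp add: s_def)
  ultimately have "Z \<le> x s" using xpos[OF iI, of "s0 + 1"] by linarith
  then show ?thesis using s by (intro exI[of _ s]) auto
qed

lemma x_increasing: "s0 \<le> a \<Longrightarrow> a \<le> b \<Longrightarrow> x a \<le> x b"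
proof (rule x_mono)
  fix r assume "s0 \<le> a" "a \<le> r"
  then have "0 \<le> y r" using y_pos[of r] s0 by (cases "r = s0") (auto intro: less_imp_le)
  then show "r \<in> I \<and> 0 \<le> sin (\<sigma> r)" using sin_sign(2)[OF iI, of r] iI by auto
qed

lemma SS_pos: "0 < SS (x s)"
proof -
  have "0 < P s ^ 3" using P_pos by simp
  moreover have "0 \<le> (2 * real n - 2) * P s" using n P_pos[of s] by (intro mult_nonneg_nonneg) auto
  moreover have "SS (x s) = P s ^ 3 + (2 * real n - 2) * P s"
    unfolding SS_def P_eq[OF iI, of s, symmetric] by (simp add: H0)
  ultimately show ?thesis by linarith
qed

lemma rhs_pos: "0 < profile_rhs n H (x s) (\<sigma> s)"
proof -
  have "profile_rhs n H (x s) (\<sigma> s) = (W s / x s) ^ 3 * SS (x s)"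
    by (rule DERIV_unique[OF \<sigma>'_rhs[OF iI] \<sigma>'[OF iI]])
  then show ?thesis using SS_pos Wpos[OF iI, of s] xpos[OF iI, of s] by simp
qed

lemma catenoidal: "catenoidal_curve (profile_curve x t ` I)"
  and embedded: "embedding_on (revolution_source I x t :: (real \<times> (complex^'n::finite)) set) (revolution_map I t)"
proof -
  obtain g where g: "strict_mono t" "is_interval (range t)" "\<And>s. g (t s) = s" "\<And>u. u \<in> range t \<Longrightarrow> t (g u) = u"
    "continuous_on (range t) g"
    "\<And>u. u \<in> range t \<Longrightarrow> ((\<lambda>u. x (g u)) has_real_derivative tan (\<sigma> (g u))) (at u)"
    "\<And>u. u \<in> range t \<Longrightarrow> ((\<lambda>u. tan (\<sigma> (g u))) has_real_derivative
       profile_rhs n H (x (g u)) (\<sigma> (g u)) / cos (\<sigma> (g u)) ^ 3) (at u)"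
    "continuous_on (range t) (\<lambda>u. profile_rhs n H (x (g u)) (\<sigma> (g u)) / cos (\<sigma> (g u)) ^ 3)"
    by (rule graph_function[OF IU cos_pos]) blast
  show "embedding_on (revolution_source I x t :: (real \<times> (complex^'n)) set) (revolution_map I t)"
    by (rule embedding_graph[OF IU g(5,3)])
  define t0 where "t0 = t s0"
  \<comment> \<open>The half-width of the range of \<open>t\<close> about the vertex, possibly
    infinite. By the reflection about \<open>s0\<close> the range extends equally far
    downwards.\<close>
  define a where "a = (SUP s. ereal (t s - t0))"
  define f where "f u = x (g (t0 + u))" for u
  define f1 where "f1 u = tan (\<sigma> (g (t0 + u)))" for u
  define f2 where "f2 u = profile_rhs n H (x (g (t0 + u))) (\<sigma> (g (t0 + u))) / cos (\<sigma> (g (t0 + u))) ^ 3" for u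
  have tsym: "t (2 * s0 - s) - t0 = - (t s - t0)" for s using symmetric(2)[OF IU s0, of s] by (simp add: t0_def)
  have less_a: "ereal u < a \<longleftrightarrow> (\<exists>s. u < t s - t0)" for u by (simp add: a_def less_SUP_iff)
  have a_less: "- a < ereal u \<longleftrightarrow> (\<exists>s. t s - t0 < u)" for u
  proof -
    have "- a < ereal u \<longleftrightarrow> ereal (- u) < a"
      using ereal_uminus_less_reorder[of a "ereal u"] by simp
    also have "\<dots> \<longleftrightarrow> (\<exists>s. - u < t s - t0)" by (rule less_a)
    also have "\<dots> \<longleftrightarrow> (\<exists>s. t s - t0 < u)"
    proof
      assume "\<exists>s. - u < t s - t0"
      then obtain s where "- u < t s - t0" by blast
      then have "t (2 * s0 - s) - t0 < u" using tsym[of s] by linarith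
      then show "\<exists>s. t s - t0 < u" by blast
    next
      assume "\<exists>s. t s - t0 < u"
      then obtain s where "t s - t0 < u" by blast
      then have "- u < t (2 * s0 - s) - t0" using tsym[of s] by linarith
      then show "\<exists>s. - u < t s - t0" by blast
    qed
    finally show ?thesis .
  qed
  have dom: "u \<in> einterval (- a) a \<longleftrightarrow> t0 + u \<in> range t" for u
  proof
    assume "u \<in> einterval (- a) a"
    then obtain s s' where "t s < t0 + u" "t0 + u < t s'"
      unfolding einterval_iff less_a a_less by (auto simp: algebra_simps)
    then show "t0 + u \<in> range t" using mem_is_interval_1_I[OF g(2), of "t s" "t s'" "t0 + u"] by simp
  next
    assume "t0 + u \<in> range t"
    then obtain s where "t0 + u = t s" by blast
    then have "t (s - 1) - t0 < u" "u < t (s + 1) - t0" using g(1) by (auto simp: strict_mono_def algebra_simps)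
    then show "u \<in> einterval (- a) a" unfolding einterval_iff less_a a_less by blast
  qed
  have a0: "0 < a"
    using less_a[of 0] g(1) by (auto simp: t0_def strict_mono_def zero_ereal_def intro!: exI[of _ "s0 + 1"])
  have A: "is_interval (einterval (- a) a)"
    unfolding is_interval_1
  proof (intro ballI allI impI)
    fix u v w assume uv: "u \<in> einterval (- a) a" "v \<in> einterval (- a) a" "u \<le> w \<and> w \<le> v"
    then have "- a < ereal u" "ereal u \<le> ereal w" "ereal w \<le> ereal v" "ereal v < a"
      by (simp_all add: einterval_iff)
    then show "w \<in> einterval (- a) a"
      unfolding einterval_iff using less_le_trans le_less_trans by blast
  qed
  have sh: "((\<lambda>u. t0 + u) has_real_derivative 1) (at u)" for u by (auto intro!: derivative_eq_intros)
  have f1: "(f has_real_derivative f1 u) (at u)" if "u \<in> einterval (- a) a" for u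
    using DERIV_chain2[OF g(6) sh, of u] that unfolding dom f_def[abs_def] f1_def by simp
  have f2: "(f1 has_real_derivative f2 u) (at u)" if "u \<in> einterval (- a) a" for u
    using DERIV_chain2[OF g(7) sh, of u] that unfolding dom f1_def[abs_def] f2_def by simp
  have f2c: "continuous_on (einterval (- a) a) f2"
    unfolding f2_def[abs_def]
    by (rule continuous_on_compose2[OF g(8), of _ "\<lambda>u. t0 + u"]) (auto intro!: continuous_intros simp: dom)
  have f2pos: "0 < f2 u" for u using rhs_pos cos_pos by (simp add: f2_def)
  have even: "f (- u) = f u" if "u \<in> einterval (- a) a" for u
  proof -
    obtain s where s: "t0 + u = t s" using \<open>u \<in> einterval (- a) a\<close> dom by blast
    then have "t0 - u = t (2 * s0 - s)" using tsym[of s] by simp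
    then show ?thesis using s g(3) symmetric(1)[OF IU s0, of s] by (simp add: f_def)
  qed
  have large: "\<exists>b. ereal b < a \<and> 0 \<le> b \<and> (\<forall>u. b < u \<longrightarrow> ereal u < a \<longrightarrow> Z \<le> f u)" for Z
  proof -
    obtain s where s: "s0 \<le> s" "Z \<le> x s" using x_unbounded by blast
    have "Z \<le> f u" if u: "t s - t0 < u" "ereal u < a" for u
    proof -
      have "t0 + u \<in> range t" using u unfolding dom[symmetric] einterval_iff a_less by blast
      then obtain r where r: "t0 + u = t r" by blast
      then have "t s < t r" using u by simp
      then have "s \<le> r" using strict_mono_less[OF g(1), of s r] by simp
      then have "Z \<le> x r" using x_increasing[OF s(1)] s(2) order_trans by blast
      then show ?thesis using r g(3) by (simp add: f_def)
    qed
    moreover have "ereal (t s - t0) < a" unfolding less_a using g(1) by (intro exI[of _ "s + 1"]) (simp add: strict_mono_def)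
    moreover have "0 \<le> t s - t0" using s(1) g(1) by (simp add: t0_def strict_mono_less_eq)
    ultimately show ?thesis by (intro exI[of _ "t s - t0"]) blast
  qed
  have real_between: "\<exists>u. e = ereal u" if "ereal b < e" "e < a" for e b using that by (cases e) auto
  have lim1: "filterlim (f \<circ> real_of_ereal) at_top (at_left a)"
    unfolding filterlim_at_top
  proof
    fix Z
    obtain b where b: "ereal b < a" "\<And>u. b < u \<Longrightarrow> ereal u < a \<Longrightarrow> Z \<le> f u" using large by blast
    show "eventually (\<lambda>e. Z \<le> (f \<circ> real_of_ereal) e) (at_left a)"
      unfolding eventually_at_left[OF b(1)]
      by (intro exI[of _ "ereal b"] conjI b(1) allI impI) (use b(2) real_between in force)
  qed
  have lim2: "filterlim (f \<circ> real_of_ereal) at_top (at_right (- a))"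
    unfolding filterlim_at_top
  proof
    fix Z
    obtain b where b: "ereal b < a" "0 \<le> b" "\<And>u. b < u \<Longrightarrow> ereal u < a \<Longrightarrow> Z \<le> f u" using large by blast
    have b': "- a < ereal (- b)" using b(1) ereal_uminus_less_reorder[of a "ereal (- b)"] by simp
    show "eventually (\<lambda>e. Z \<le> (f \<circ> real_of_ereal) e) (at_right (- a))"
      unfolding eventually_at_right[OF b']
    proof (intro exI[of _ "ereal (- b)"] conjI b' allI impI)
      fix e assume e: "- a < e" "e < ereal (- b)"
      then obtain u where u: "e = ereal u" by (cases e) auto
      have v: "b < - u" "ereal (- u) < a"
        using e u ereal_uminus_less_reorder[of a "ereal u"] by simp_all
      then have "- u \<in> einterval (- a) a"
        using b b' unfolding einterval_iff by (auto intro: less_trans[OF b'])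
      then show "Z \<le> (f \<circ> real_of_ereal) e" using b(3)[OF v] even[of "- u"] u by simp
    qed
  qed
  have C: "profile_curve x t ` I = {(f u, t0 + u) | u. u \<in> einterval (- a) a}"
  proof (intro subset_antisym subsetI)
    fix q assume "q \<in> profile_curve x t ` I"
    then obtain s where "q = (x s, t s)" by (auto simp: profile_curve_def)
    then have "q = (f (t s - t0), t0 + (t s - t0)) \<and> t s - t0 \<in> einterval (- a) a"
      unfolding dom by (simp add: f_def g(3))
    then show "q \<in> {(f u, t0 + u) | u. u \<in> einterval (- a) a}" by blast
  next
    fix q assume "q \<in> {(f u, t0 + u) | u. u \<in> einterval (- a) a}"
    then obtain u where u: "q = (f u, t0 + u)" "t0 + u \<in> range t" unfolding dom by blast
    then obtain s where "t0 + u = t s" by blast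
    then show "q \<in> profile_curve x t ` I" using u g(3) iI by (auto simp: profile_curve_def f_def)
  qed
  show "catenoidal_curve (profile_curve x t ` I)"
    unfolding catenoidal_curve_def
  proof (intro exI[of _ t0] exI[of _ a] exI[of _ f] conjI a0 lim1 lim2 C)
    show "C2_on (einterval (- a) a) f" by (rule C2_on_realI[OF f1 f2 f2c])
    show "\<forall>u\<in>einterval (- a) a. 0 < f u \<and> f (- u) = f u"
      using even xpos[OF iI] by (auto simp: f_def)
    show "strictly_convex_on (einterval (- a) a) f"
      by (rule strictly_convex_on_derivative[OF A f1 positive_derivative_strict_mono_on[OF A f2 f2pos]])
  qed
qed

text \<open>From \<open>cos \<sigma> = E sin \<sigma> / (x ^ (2 n - 2) y)\<close> and
  \<open>n \<ge> 2\<close>, one factor \<open>x^2\<close> can be kept while the rest is bounded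
  below by \<open>m ^ (2 n - 4)\<close>. This gives
  \<open>cos \<sigma> \<le> K sin \<sigma> / x^2\<close> past \<open>s1\<close>, so that
  \<open>t + K / x\<close> is nonincreasing and \<open>t\<close> is bounded above; the reflection
  bounds it below. The shift \<open>s1 = s0 + 1\<close> keeps \<open>y\<close> away from 0.\<close>

lemma slab:
  assumes n2: "2 \<le> n"
  shows "\<exists>a b. \<forall>s. a < t s \<and> t s < b"
proof -
  define s1 where "s1 = s0 + 1"
  have y1: "0 < y s1" using y_pos[of s1] by (simp add: s1_def)
  define K where "K = E / (m ^ (2 * n - 4) * y s1)"
  have mono_t: "t a \<le> t b" if "a \<le> b" for a b
    using derivative_ge_growth[OF that, of t "\<lambda>s. cos (\<sigma> s)" 0] t'[OF iI] cos_pos by (auto intro: less_imp_le)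
  have "t s \<le> t s1 + K / x s1" if s: "s1 \<le> s" for s
  proof -
    have "- (t s1 + K / x s1) + 0 * (s - s1) \<le> - (t s + K / x s)"
    proof (rule derivative_ge_growth[OF s, where f = "\<lambda>s. - (t s + K / x s)"])
      fix r assume r: "s1 \<le> r" "r \<le> s"
      have xr: "0 < x r" by (rule xpos[OF iI])
      show "((\<lambda>s. - (t s + K / x s)) has_real_derivative (K * sin (\<sigma> r) / (x r)\<^sup>2 - cos (\<sigma> r))) (at r)"
        using xr by (auto intro!: derivative_eq_intros x'[OF iI] t'[OF iI] simp: power2_eq_square)
      have yr: "y s1 \<le> y r" using y_strict_mono[of s1 r] r by (cases "s1 = r") auto
      have sr: "0 < sin (\<sigma> r)" using yr y1 sin_sign(1)[OF iI, of r] by simp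
      obtain j where j: "n = Suc (Suc j)" using n2 by (metis Suc_le_D numeral_2_eq_2 le_Suc_eq not_less_eq_eq Suc_le_mono)
      have "cos (\<sigma> r) * y r = P r * (W r * y r)" using cos_eq[OF iI, of r] by simp
      also have "\<dots> = P r * (x r * sin (\<sigma> r))" using sin_eq[OF iI, of r] by simp
      also have "\<dots> = E * sin (\<sigma> r) / ((x r)\<^sup>2 * x r ^ (2 * j))"
        unfolding P_val j using xr by (simp add: power2_eq_square field_simps)
      also have "\<dots> \<le> E * sin (\<sigma> r) / ((x r)\<^sup>2 * m ^ (2 * j))"
        using E0 sr xr m by (intro divide_left_mono mult_left_mono power_mono mult_pos_pos) auto
      finally have "cos (\<sigma> r) * y r \<le> E * sin (\<sigma> r) / ((x r)\<^sup>2 * m ^ (2 * j))" .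
      moreover have "cos (\<sigma> r) * y s1 \<le> cos (\<sigma> r) * y r" using yr cos_pos[of r] by (intro mult_left_mono) auto
      ultimately have "cos (\<sigma> r) * y s1 \<le> E * sin (\<sigma> r) / ((x r)\<^sup>2 * m ^ (2 * j))" by linarith
      then have "cos (\<sigma> r) \<le> E * sin (\<sigma> r) / ((x r)\<^sup>2 * m ^ (2 * j)) / y s1"
        by (rule mult_imp_le_div_pos[OF y1])
      also have "\<dots> = K * sin (\<sigma> r) / (x r)\<^sup>2" by (simp add: K_def j)
      finally show "0 \<le> K * sin (\<sigma> r) / (x r)\<^sup>2 - cos (\<sigma> r)" by simp
    qed
    moreover have "0 \<le> K / x s" using E0 m y1 xpos[OF iI, of s] by (simp add: K_def)
    ultimately show ?thesis by simp
  qed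
  moreover have "t s \<le> t s1 + K / x s1" if "s \<le> s1" for s
    using mono_t[OF that] E0 m y1 xpos[OF iI, of s1] by (simp add: K_def add_increasing2)
  ultimately have ub: "t s < t s1 + K / x s1 + 1" for s by (cases "s1 \<le> s") (smt (verit))+
  have "2 * t s0 - (t s1 + K / x s1 + 1) < t s" for s
    using ub[of "2 * s0 - s"] symmetric(2)[OF IU s0, of s] by linarith
  then show ?thesis using ub by blast
qed

end

lemma first_zero:
  fixes f :: "real \<Rightarrow> real"
  assumes "continuous_on UNIV f" "a \<le> b" "f b = 0"
  obtains z where "a \<le> z" "f z = 0" "\<And>s. a \<le> s \<Longrightarrow> s < z \<Longrightarrow> f s \<noteq> 0"
proof -
  define Z where "Z = {s. a \<le> s \<and> f s = 0}"
  have "closed Z" unfolding Z_def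
    by (intro closed_Collect_conj closed_Collect_le closed_Collect_eq continuous_intros assms(1))
  moreover have "bdd_below Z" by (rule bdd_belowI[of _ a]) (simp add: Z_def)
  moreover have "Z \<noteq> {}" using assms by (auto simp: Z_def)
  ultimately have in_Z: "Inf Z \<in> Z" by (intro closed_contains_Inf)
  show ?thesis
  proof (rule that[of "Inf Z"])
    show "a \<le> Inf Z" "f (Inf Z) = 0" using in_Z by (auto simp: Z_def)
    show "f s \<noteq> 0" if "a \<le> s" "s < Inf Z" for s
      using cInf_lower[of s Z] \<open>bdd_below Z\<close> that by (auto simp: Z_def)
  qed
qed

lemma positive_growth_range:
  fixes f f' :: "real \<Rightarrow> real"
  assumes f: "\<And>s. (f has_real_derivative f' s) (at s)" "\<And>s. c \<le> f' s" and c: "0 < c"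
  shows "range f = UNIV"
proof -
  have int: "is_interval (range f)"
    using connected_continuous_image[OF has_real_derivative_continuous_on[OF f(1)], of UNIV]
    by (simp add: is_interval_connected_1)
  have "u \<in> range f" for u
  proof -
    define a where "a = \<bar>u - f 0\<bar> / c"
    have a: "0 \<le> a" "c * a = \<bar>u - f 0\<bar>" using c by (simp_all add: a_def)
    have "f 0 + c * (a - 0) \<le> f a" by (rule derivative_ge_growth[OF a(1) f])
    moreover have "f (- a) + c * (0 - - a) \<le> f 0" by (rule derivative_ge_growth[OF _ f]) (use a in simp)
    ultimately have "f (- a) \<le> u" "u \<le> f a" using a by (auto simp: abs_le_iff)
    then show ?thesis using mem_is_interval_1_I[OF int, of "f (- a)" "f a" u] by simp
  qed
  then show ?thesis by blast
qed

section \<open>Nonzero energy with positive mean curvature: bounds and periods\<close>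

locale periodic_profile = profile +
  assumes Hpos: "0 < H" and Enz: "E \<noteq> 0"
begin

lemma IU: "I = UNIV" and iI: "s \<in> I"
  using nonzero_energy_UNIV Enz by auto

definition m where "m = min 1 (\<bar>E\<bar> / (1 + \<bar>H\<bar>))"
definition M where "M = max 1 ((\<bar>E\<bar> + 1) / \<bar>H\<bar>)"

lemma mM: "0 < m" "m \<le> 1" "m \<le> x s" "x s \<le> M" "0 < M"
  using Enz x_lower[OF iI] x_upper[OF iI, of s] Hpos by (auto simp: m_def M_def divide_pos_pos add_pos_nonneg)

lemma xpos': "0 < x s" by (rule xpos[OF iI])

lemma W_ge_m: "m \<le> W s"
  using W_ge[OF iI mM(3,1), of s] mM(2) by simp

lemma yc: "continuous_on UNIV y"
  using y_continuous IU by simp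

lemma symm: "y s0 = 0 \<Longrightarrow> x (2 * s0 - s) = x s" "y s0 = 0 \<Longrightarrow> t (2 * s0 - s) = 2 * t s0 - t s"
  "y s0 = 0 \<Longrightarrow> \<sigma> (2 * s0 - s) = 2 * \<sigma> s0 - \<sigma> s"
  using symmetric[OF IU] by blast+

text \<open>Two successive reflections, about \<open>s0\<close> and about \<open>s1\<close>, compose
  to a translation of the parameter by twice the distance.\<close>

lemma period:
  assumes "y s0 = 0" "y s1 = 0"
  shows "x (s + 2 * (s1 - s0)) = x s" "t (s + 2 * (s1 - s0)) = t s + 2 * (t s1 - t s0)"
proof -
  have e: "s + 2 * (s1 - s0) = 2 * s1 - (2 * s0 - s)" by simp
  show "x (s + 2 * (s1 - s0)) = x s" unfolding e symm(1)[OF assms(2)] symm(1)[OF assms(1)] ..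
  show "t (s + 2 * (s1 - s0)) = t s + 2 * (t s1 - t s0)"
    unfolding e symm(2)[OF assms(2)] symm(2)[OF assms(1)] by simp
qed

end

section \<open>Unduloids of positive energy and positive mean curvature\<close>

locale unduloid = periodic_profile +
  assumes Epos: "0 < E"
begin

lemma P_lower: "H * m \<le> P s" and P_pos: "0 < P s" and cos_pos: "0 < cos (\<sigma> s)"
proof -
  have "H * m \<le> H * x s" using Hpos mM(3) by simp
  also have "\<dots> \<le> P s" using P_eq[OF iI, of s] Epos xpos'[of s] by (simp add: PP_def)
  finally show p: "H * m \<le> P s" .
  moreover have "0 < H * m" using Hpos mM(1) by simp
  ultimately show "0 < P s" by linarith
  then show "0 < cos (\<sigma> s)" using cos_sign[OF iI] by blast
qed

lemma PP'_mono: "0 < a \<Longrightarrow> a \<le> b \<Longrightarrow> PP' a \<le> PP' b"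
proof -
  assume ab: "0 < a" "a \<le> b"
  have "(2 * real n - 1) * E / b ^ (2 * n) \<le> (2 * real n - 1) * E / a ^ (2 * n)"
    using ab n Epos by (intro divide_left_mono power_mono mult_pos_pos mult_nonneg_nonneg) auto
  then show ?thesis by (simp add: PP'_def)
qed

lemma y'_d: "(y has_real_derivative - (P s * W s * PP' (x s) / x s)) (at s)"
  by (rule y'_PP[OF iI])

lemma P'_d: "(P has_real_derivative y s * W s * PP' (x s) / x s) (at s)"
  by (rule DERIV_cong[OF P'[OF iI]]) (simp add: \<kappa>_eq[OF iI])

lemma x'_y: "(x has_real_derivative W s * y s / x s) (at s)"
  by (rule DERIV_cong[OF x'[OF iI]]) (use sin_eq[OF iI, of s] xpos'[of s] in \<open>simp add: field_simps\<close>)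

text \<open>If \<open>y\<close> has no zero after \<open>s0\<close>, then \<open>\<epsilon> PP' (x s)\<close>, where \<open>\<epsilon>\<close> is the sign of \<open>y\<close>, is
  nondecreasing. Either it becomes positive, and \<open>\<epsilon> y\<close> decreases at a definite rate, or \<open>P\<close>
  is nonincreasing, so that \<open>\<epsilon> y\<close> stays away from \<open>0\<close> and \<open>x\<close> is unbounded.\<close>

lemma zero_forward: "\<exists>s\<ge>s0. y s = 0"
proof (rule ccontr)
  assume no: "\<not> ?thesis"
  define e :: real where "e = sgn (y s0)"
  have e: "e * e = 1" "\<bar>e\<bar> = 1" using no by (auto simp: e_def sgn_if)
  have ey: "0 < e * y s" if "s0 \<le> s" for s
  proof (rule continuous_nonzero_sign[where f = "\<lambda>s. e * y s" and S = "{s0..}" and a = s0])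
    show "continuous_on {s0..} (\<lambda>s. e * y s)" by (intro continuous_intros continuous_on_subset[OF yc]) auto
    show "e * y s \<noteq> 0" if "s \<in> {s0..}" for s using that no e by auto
    show "0 < e * y s0" using no by (auto simp: e_def sgn_if)
  qed (use that is_interval_ci in auto)
  have ex': "((\<lambda>s. e * x s) has_real_derivative W s * (e * y s) / x s) (at s)" for s
    by (rule DERIV_cong[OF DERIV_cmult[OF x'_y]]) simp
  have ex'_pos: "0 \<le> W s * (e * y s) / x s" if "s0 \<le> s" for s
    using Wpos[OF iI, of s] ey[OF that] xpos'[of s] by simp
  have ex_mono: "e * x a \<le> e * x b" if "s0 \<le> a" "a \<le> b" for a b
    using derivative_ge_growth[OF that(2), of "\<lambda>s. e * x s" "\<lambda>s. W s * (e * y s) / x s" 0] ex' ex'_pos that by auto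
  have ePP: "e * PP' (x a) \<le> e * PP' (x b)" if "s0 \<le> a" "a \<le> b" for a b
  proof (cases "e = 1")
    case True
    then show ?thesis using ex_mono[OF that] PP'_mono[OF xpos'] by simp
  next
    case False
    then have "e = - 1" using e(2) by (auto simp: abs_if split: if_splits)
    then show ?thesis using ex_mono[OF that] PP'_mono[OF xpos'] by simp
  qed
  show False
  proof (cases "\<exists>s1\<ge>s0. 0 < e * PP' (x s1)")
    case True
    then obtain s1 where s1: "s0 \<le> s1" "0 < e * PP' (x s1)" by blast
    \<comment> \<open>Here \<open>P \<ge> H m\<close>, \<open>W \<ge> m\<close>,
      \<open>x \<le> M\<close>, and \<open>e PP'\<close> is at least its value at \<open>s1\<close>.
      At this rate \<open>e y\<close>, which is at most 1, drops by 2 within the time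
      \<open>2 / c\<close> and becomes negative.\<close>
    define c where "c = H * m * m * (e * PP' (x s1)) / M"
    have c: "0 < c" using s1 Hpos mM by (simp add: c_def)
    define b where "b = s1 + 2 / c"
    have "- (e * y s1) + c * (b - s1) \<le> - (e * y b)"
    proof (rule derivative_ge_growth[where f = "\<lambda>s. - (e * y s)" and a = s1 and b = b
          and f' = "\<lambda>s. P s * W s * (e * PP' (x s)) / x s"])
      show "s1 \<le> b" using c by (simp add: b_def)
      fix s assume s: "s1 \<le> s"
      show "((\<lambda>s. - (e * y s)) has_real_derivative P s * W s * (e * PP' (x s)) / x s) (at s)"
        by (rule DERIV_cong[OF DERIV_minus[OF DERIV_cmult[OF y'_d]]]) simp
      have i: "e * PP' (x s1) \<le> e * PP' (x s)" using ePP s1 s by simp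
      show "c \<le> P s * W s * (e * PP' (x s)) / x s" unfolding c_def
        by (intro frac_le mult_mono P_lower W_ge_m i)
          (use Hpos mM xpos'[of s] P_pos[of s] Wpos[OF iI, of s] s1 i in \<open>auto intro!: mult_nonneg_nonneg\<close>)
    qed
    moreover have "c * (b - s1) = 2" using c by (simp add: b_def)
    moreover have "0 < e * y b"
    proof (rule ey)
      have "0 < 2 / c" using c by simp
      then show "s0 \<le> b" using s1(1) unfolding b_def by linarith
    qed
    moreover have "e * y s1 \<le> 1" using y_le[OF iI, of s1] e(2) by (metis abs_le_D1 abs_mult mult_1)
    ultimately show False by linarith
  next
    case False
    then have neg: "e * PP' (x s) \<le> 0" if "s0 \<le> s" for s using that by force
    have P_mono: "P s \<le> P s0" if s: "s0 \<le> s" for s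
    proof -
      have "- P s0 + 0 * (s - s0) \<le> - P s"
      proof (rule derivative_ge_growth[OF s, where f = "\<lambda>s. - P s" and f' = "\<lambda>s. - ((e * y s) * (e * PP' (x s)) * W s / x s)"])
        fix r assume r: "s0 \<le> r"
        have "y r * W r * PP' (x r) / x r = (e * e) * (y r * W r * PP' (x r) / x r)" using e by simp
        also have "\<dots> = (e * y r) * (e * PP' (x r)) * W r / x r" by simp
        finally have eq: "y r * W r * PP' (x r) / x r = (e * y r) * (e * PP' (x r)) * W r / x r" .
        show "((\<lambda>s. - P s) has_real_derivative - ((e * y r) * (e * PP' (x r)) * W r / x r)) (at r)"
          unfolding eq[symmetric] by (rule DERIV_minus[OF P'_d])
        have "(e * y r) * (e * PP' (x r)) \<le> 0" using ey[OF r] neg[OF r] by (simp add: mult_nonneg_nonpos)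
        then show "0 \<le> - ((e * y r) * (e * PP' (x r)) * W r / x r)"
          using Wpos[OF iI, of r] xpos'[of r] by (simp add: divide_nonpos_pos mult_nonpos_nonneg)
      qed
      then show ?thesis by simp
    qed
    have y_ge: "e * y s0 \<le> e * y s" if s: "s0 \<le> s" for s
    proof -
      have "(P s)\<^sup>2 \<le> (P s0)\<^sup>2" using P_mono[OF s] P_pos[of s] by (intro power_mono) auto
      then have "(y s0)\<^sup>2 \<le> (y s)\<^sup>2" using Py[OF iI, of s] Py[OF iI, of s0] by linarith
      moreover have "e\<^sup>2 = 1" using e(1) by (simp add: power2_eq_square)
      ultimately have "(e * y s0)\<^sup>2 \<le> (e * y s)\<^sup>2" by (simp add: power_mult_distrib)
      then show ?thesis using ey[OF s] power2_le_imp_le less_imp_le by blast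
    qed
    define c where "c = m * (e * y s0) / M"
    have c: "0 < c" using ey[of s0] mM by (simp add: c_def)
    \<comment> \<open>Within this time \<open>e x\<close> would grow by \<open>2 M\<close>. As
      \<open>\<bar>e x\<bar> \<le> M\<close>, it would have to run from \<open>- M\<close> to
      \<open>M\<close>, which is impossible because \<open>x\<close> is positive at both
      ends.\<close>
    define b where "b = s0 + 2 * M / c"
    have b: "s0 \<le> b" using c mM by (simp add: b_def)
    have "e * x s0 + c * (b - s0) \<le> e * x b"
    proof (rule derivative_ge_growth[OF b ex'])
      fix s assume s: "s0 \<le> s"
      show "c \<le> W s * (e * y s) / x s" unfolding c_def
        by (intro frac_le mult_mono W_ge_m y_ge s)
          (use mM xpos'[of s] Wpos[OF iI, of s] ey[of s0] ey[OF s] in auto)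
    qed
    moreover have "c * (b - s0) = 2 * M" using c by (simp add: b_def)
    moreover have "\<bar>e * x s0\<bar> \<le> M" "\<bar>e * x b\<bar> \<le> M"
      using e mM xpos'[of s0] xpos'[of b] by (simp_all add: abs_mult)
    moreover have "0 < \<bar>e * x b\<bar> + (M - e * x b)" using e xpos'[of b] mM(5) by (simp add: abs_mult) (use calculation(4) in linarith)
    ultimately have "e * x b = M" "e * x s0 = - M" by linarith+
    then have "e * x b * (e * x s0) < 0" using mM(5) by simp
    moreover have "e * x b * (e * x s0) = x b * x s0" using e(1) by (simp add: mult.assoc mult.left_commute)
    ultimately show False using xpos'[of b] xpos'[of s0] by (metis mult_pos_pos less_asym)
  qed
qed

lemma P_at_zero: "y s = 0 \<Longrightarrow> P s = 1"
  using Py[OF iI, of s] P_pos[of s] by (simp add: power2_eq_1_iff)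

text \<open>At a zero of \<open>y\<close> one has \<open>P = 1\<close>, and both sides equal
  \<open>(2 n - 1) - 2 n H x\<close>. So the sign of \<open>PP'\<close> decides whether the curve
  bends away from the axis or towards it there.\<close>

lemma SS_at_zero: "y s = 0 \<Longrightarrow> SS (x s) = - (x s * PP' (x s))"
proof -
  assume "y s = 0"
  then have P1: "PP (x s) = 1" using P_at_zero P_eq[OF iI, of s] by simp
  have "x s ^ (2 * n) = x s ^ (2 * n - 1) * x s" using n by (cases n) auto
  then have "x s * PP' (x s) = H * x s - (2 * real n - 1) * (E / x s ^ (2 * n - 1))"
    using xpos'[of s] by (simp add: PP'_def field_simps)
  also have "E / x s ^ (2 * n - 1) = 1 - H * x s" using P1 by (simp add: PP_def)
  finally show ?thesis by (simp add: SS_def P1 algebra_simps)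
qed

text \<open>By \<open>SS_at_zero\<close> the angle is stationary at \<open>z\<close>; the line
  parallel to the axis through this point is then a solution with the same data, and uniqueness
  applies.\<close>

lemma cylinder:
  assumes z: "y z = 0" "PP' (x z) = 0"
  shows "x s = x z" "t s = t z + (s - z)"
proof -
  have sz: "sin (\<sigma> z) = 0" using z(1) sin_sign(3)[OF iI] by blast
  have cz: "cos (\<sigma> z) = 1"
    using sz cos_pos[of z] sin_cos_squared_add[of "\<sigma> z"] by (simp add: power2_eq_1_iff)
  have rhs: "profile_rhs n H (x z) (\<sigma> z) = 0"
    using DERIV_unique[OF \<sigma>'_rhs[OF iI] \<sigma>'[OF iI]] SS_at_zero[OF z(1)] z(2) by simp
  have "profile_solution n H UNIV (\<lambda>s. x z) (\<lambda>s. t z + (s - z)) (\<lambda>s. \<sigma> z)"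
    unfolding profile_solution_iff rhs sz cz using xpos'[of z]
    by (auto intro!: derivative_eq_intros)
  from profile_solution_unique[OF sol[unfolded IU] this, of z s]
  show "x s = x z" "t s = t z + (s - z)" by simp_all
qed

lemma t_range: "range t = UNIV"
proof (rule positive_growth_range[OF t'[OF iI]])
  show "m * (H * m) \<le> cos (\<sigma> s)" for s
    unfolding cos_eq[OF iI] using W_ge_m P_lower mM(1) Hpos Wpos[OF iI, of s] by (intro mult_mono) auto
qed (use mM Hpos in simp)

text \<open>With \<open>e\<close> opposite to the sign of \<open>PP'\<close> at \<open>z\<close>,
  the derivative of \<open>e y\<close> at \<open>z\<close> is positive, so \<open>e y\<close> leaves
  0 upwards and keeps its sign until the next zero. If \<open>e PP'\<close> had not become positive
  there, \<open>P\<close> would decrease strictly in between, while \<open>P = 1\<close> at both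
  zeros.\<close>

lemma next_zero:
  assumes z: "y z = 0" and nz: "PP' (x z) \<noteq> 0"
  obtains z' where "z < z'" "y z' = 0" "\<And>s. z < s \<Longrightarrow> s < z' \<Longrightarrow> 0 < - sgn (PP' (x z)) * y s"
    "0 < - sgn (PP' (x z)) * PP' (x z')"
proof -
  define e where "e = - sgn (PP' (x z))"
  have e: "e * e = 1" "\<bar>e\<bar> = 1" "e * PP' (x z) < 0" using nz by (auto simp: e_def sgn_if)
  have d: "((\<lambda>s. e * y s) has_real_derivative - (P z * W z * (e * PP' (x z)) / x z)) (at z)"
    by (rule DERIV_cong[OF DERIV_cmult[OF y'_d]]) simp
  have "P z * W z * (e * PP' (x z)) / x z < 0"
    using P_pos[of z] Wpos[OF iI, of z] xpos'[of z] e(3) by (simp add: mult_pos_neg divide_neg_pos)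
  then obtain \<delta> where \<delta>: "0 < \<delta>" "\<And>h. 0 < h \<Longrightarrow> h < \<delta> \<Longrightarrow> e * y z < e * y (z + h)"
    using DERIV_pos_inc_right[OF d] by auto
  \<comment> \<open>The search for the next zero starts at \<open>z + \<delta> / 2\<close> in order
    to skip \<open>z\<close> itself; up to \<open>z + \<delta>\<close> the sign is already
    known.\<close>
  obtain b where b: "z + \<delta> / 2 \<le> b" "y b = 0" using zero_forward by blast
  obtain z' where z': "z + \<delta> / 2 \<le> z'" "y z' = 0" "\<And>s. z + \<delta> / 2 \<le> s \<Longrightarrow> s < z' \<Longrightarrow> y s \<noteq> 0"
    by (rule first_zero[OF yc b]) blast
  have near: "0 < e * y s" if "z < s" "s < z + \<delta>" for s
    using \<delta>(2)[of "s - z"] that z by simp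
  have pos: "0 < e * y s" if s: "z < s" "s < z'" for s
  proof (cases "s < z + \<delta>")
    case False
    have mid: "0 < e * y (z + \<delta> / 2)" using near \<delta>(1) by simp
    show ?thesis
    proof (rule continuous_nonzero_sign[where f = "\<lambda>s. e * y s" and S = "{z + \<delta> / 2..<z'}" and a = "z + \<delta> / 2"])
      show "continuous_on {z + \<delta> / 2..<z'} (\<lambda>s. e * y s)" by (intro continuous_intros continuous_on_subset[OF yc]) auto
      show "is_interval {z + \<delta> / 2..<z'}" by (rule is_interval_co)
      show "e * y s \<noteq> 0" if "s \<in> {z + \<delta> / 2..<z'}" for s using that z'(3)[of s] e by auto
    qed (use mid s False \<delta> in auto)
  qed (use near s in auto)
  have zz: "z < z'" using z'(1) \<delta>(1) by linarith
  have "0 < e * PP' (x z')"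
  proof (rule ccontr)
    assume "\<not> ?thesis"
    then have le: "e * PP' (x z') \<le> 0" by simp
    have exm0: "e * x a + 0 * (b - a) \<le> e * x b" if "z \<le> a" "a \<le> b" "b \<le> z'" for a b
    proof (rule derivative_ge_growth[OF that(2), of "\<lambda>s. e * x s" "\<lambda>s. W s * (e * y s) / x s" 0])
      fix s assume s: "a \<le> s" "s \<le> b"
      show "((\<lambda>s. e * x s) has_real_derivative W s * (e * y s) / x s) (at s)"
        by (rule DERIV_cong[OF DERIV_cmult[OF x'_y]]) simp
      have "0 \<le> e * y s"
        using pos[of s] s that z z'(2) by (cases "s = z \<or> s = z'") auto
      then show "0 \<le> W s * (e * y s) / x s" using Wpos[OF iI, of s] xpos'[of s] by simp
    qed
    have exm: "e * x a \<le> e * x b" if "z \<le> a" "a \<le> b" "b \<le> z'" for a b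
      using exm0[OF that] by simp
    have exs: "e * x a < e * x b" if "z \<le> a" "a < b" "b \<le> z'" for a b
    proof -
      \<comment> \<open>The derivative of \<open>e x\<close> vanishes at the ends \<open>z\<close>
        and \<open>z'\<close>, so strictness is taken from an interior point, where it is
        positive.\<close>
      define c where "c = (a + b) / 2"
      have c: "a < c" "c < b" using that by (auto simp: c_def)
      have "((\<lambda>s. e * x s) has_real_derivative W c * (e * y c) / x c) (at c)"
        by (rule DERIV_cong[OF DERIV_cmult[OF x'_y]]) simp
      moreover have "0 < W c * (e * y c) / x c"
        using Wpos[OF iI, of c] xpos'[of c] pos[of c] c that by simp
      ultimately obtain \<eta> where \<eta>: "0 < \<eta>" "\<And>h. 0 < h \<Longrightarrow> h < \<eta> \<Longrightarrow> e * x c < e * x (c + h)"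
        using DERIV_pos_inc_right by blast
      define h where "h = min (\<eta> / 2) (b - c)"
      have "e * x a \<le> e * x c" using exm c that by simp
      also have "\<dots> < e * x (c + h)" using \<eta> c by (auto simp: h_def)
      also have "\<dots> \<le> e * x b" using exm[of "c + h" b] c that \<eta>(1) by (auto simp: h_def)
      finally show ?thesis .
    qed
    \<comment> \<open>For either sign \<open>e\<close>, the value \<open>e PP'\<close> is strictly
      increasing in \<open>e x\<close>, and \<open>e x\<close> is strictly below its value at
      \<open>z'\<close>, where \<open>e PP'\<close> is at most 0.\<close>
    have PPs: "e * PP' (x s) < 0" if s: "z \<le> s" "s < z'" for s
    proof -
      have sl: "e * x s < e * x z'" using exs[of s z'] s by simp
      have strict: "PP' a < PP' b" if "0 < a" "a < b" for a b
      proof -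
        have "(2 * real n - 1) * E / b ^ (2 * n) < (2 * real n - 1) * E / a ^ (2 * n)"
          using that n Epos by (intro divide_strict_left_mono power_strict_mono mult_pos_pos) auto
        then show ?thesis by (simp add: PP'_def)
      qed
      show ?thesis
      proof (cases "e = 1")
        case True
        then show ?thesis using strict[OF xpos', of s "x z'"] sl le by simp
      next
        case False
        then have "e = - 1" using e(2) by (auto simp: abs_if split: if_splits)
        then show ?thesis using strict[OF xpos', of z' "x s"] sl le by simp
      qed
    qed
    have "- P z < - P z'"
    proof (rule DERIV_pos_imp_increasing_open[OF zz, of "\<lambda>s. - P s"])
      fix s assume s: "z < s" "s < z'"
      have "y s * W s * PP' (x s) / x s = (e * e) * (y s * W s * PP' (x s) / x s)" using e by simp
      also have "\<dots> = (e * y s) * (e * PP' (x s)) * W s / x s" by simp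
      finally have eq: "y s * W s * PP' (x s) / x s = (e * y s) * (e * PP' (x s)) * W s / x s" .
      have "((\<lambda>s. - P s) has_real_derivative - ((e * y s) * (e * PP' (x s)) * W s / x s)) (at s)"
        unfolding eq[symmetric] by (rule DERIV_minus[OF P'_d])
      moreover have "(e * y s) * (e * PP' (x s)) * W s / x s < 0"
        using pos[OF s] PPs[of s] s Wpos[OF iI, of s] xpos'[of s] by (simp add: mult_pos_neg mult_neg_pos divide_neg_pos)
      ultimately show "\<exists>d. ((\<lambda>s. - P s) has_real_derivative d) (at s) \<and> 0 < d" by (intro exI conjI) auto
    next
      show "continuous_on {z..z'} (\<lambda>s. - P s)"
        using P_continuous IU by (intro continuous_intros) (auto intro: continuous_on_subset)
    qed
    then show False using P_at_zero z z'(2) by simp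
  qed
  then show ?thesis using that[OF zz z'(2)] pos unfolding e_def by blast
qed

text \<open>By \<open>next_zero\<close> the sign of \<open>PP'\<close> alternates between
  consecutive zeros of \<open>y\<close>, so after a maximum of \<open>x\<close> the next zero is a
  minimum.\<close>

lemma vertex_minimum:
  assumes "\<And>z. y z = 0 \<Longrightarrow> PP' (x z) \<noteq> 0"
  obtains z where "y z = 0" "PP' (x z) < 0"
proof -
  obtain z0 where z0: "y z0 = 0" using zero_forward by blast
  show ?thesis
  proof (cases "PP' (x z0) < 0")
    case True
    then show ?thesis using that z0 by blast
  next
    case False
    then have p: "0 < PP' (x z0)" using assms[OF z0] by simp
    obtain z' where "y z' = 0" "0 < - sgn (PP' (x z0)) * PP' (x z')"
      by (rule next_zero[OF z0 assms[OF z0]]) blast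
    then show ?thesis using that p by simp
  qed
qed

end

context periodic_profile
begin

lemma rhs_SS: "profile_rhs n H (x s) (\<sigma> s) = (W s / x s) ^ 3 * SS (x s)"
  by (rule DERIV_unique[OF \<sigma>'_rhs[OF iI] \<sigma>'[OF iI]])

lemma x_PP': "x s * PP' (x s) = H * x s - (2 * real n - 1) * (E / x s ^ (2 * n - 1))"
proof -
  have "x s ^ (2 * n) = x s ^ (2 * n - 1) * x s" using n by (cases n) auto
  then show ?thesis using xpos'[of s] by (simp add: PP'_def field_simps)
qed

lemma PP_split: "P s = E / x s ^ (2 * n - 1) + H * x s" "PP (x s) = P s"
  using P_eq[OF iI, of s] by (simp_all add: PP_def)

end

context unduloid
begin

text \<open>Away from the zeros of \<open>y\<close> one has \<open>0 < P < 1\<close>, hence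
  \<open>P ^ 3 < P\<close>. Replacing the cube by \<open>P\<close> in \<open>SS\<close> gives
  exactly \<open>- x PP'\<close>, which is at most 0.\<close>

lemma SS_neg:
  assumes "0 \<le> PP' (x s)" "y s \<noteq> 0"
  shows "SS (x s) < 0"
proof -
  have "0 < (y s)\<^sup>2" using assms(2) by simp
  then have "(P s)\<^sup>2 < 1\<^sup>2" using Py[OF iI, of s] unfolding power_one by linarith
  then have P1: "P s < 1" by (rule power2_less_imp_less) simp
  have P3: "P s ^ 3 < P s ^ 1" using P_pos[of s] P1 by (intro power_strict_decreasing) auto
  define e where "e = E / x s ^ (2 * n - 1)"
  have e: "P s = e + H * x s" unfolding e_def by (rule PP_split(1))
  from P3 have "SS (x s) < P s + (2 * real n - 2) * P s - 2 * real n * H * x s"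
    by (simp add: SS_def PP_split(2))
  also have "\<dots> = (2 * real n - 1) * e - H * x s" unfolding e by (simp add: algebra_simps)
  also have "\<dots> = - (x s * PP' (x s))" by (simp add: x_PP' e_def)
  also have "\<dots> \<le> 0" using assms(1) xpos'[of s] by simp
  finally show ?thesis .
qed

text \<open>Together with \<open>SS_neg\<close> this makes the inflection unique: as the radius
  increases from a minimum to a maximum, \<open>SS\<close> decreases while \<open>PP'\<close> is
  negative, and is already negative afterwards.\<close>

lemma SS_decreasing:
  assumes "0 < a" "a < b" "PP' b < 0"
  shows "SS b < SS a"
proof (rule DERIV_neg_imp_decreasing[where f = SS and a = a and b = b, OF assms(2)])
  fix r assume r: "a \<le> r" "r \<le> b"
  have "PP' r < 0" using PP'_mono[of r b] r assms by simp
  then have "(3 * (PP r)\<^sup>2 + (2 * real n - 2)) * PP' r \<le> 0"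
    using n by (intro mult_nonneg_nonpos add_nonneg_nonneg) auto
  moreover have "0 < 2 * real n * H" using n Hpos by simp
  ultimately have "(3 * (PP r)\<^sup>2 + (2 * real n - 2)) * PP' r - 2 * real n * H < 0" by linarith
  moreover have "0 < r" using r assms(1) by simp
  ultimately show "\<exists>d. (SS has_real_derivative d) (at r) \<and> d < 0"
    using SS_deriv by blast
qed

lemma unduloid_type:
  "periodic_graph (profile_curve x t ` I)"
  "cylinder_curve (profile_curve x t ` I) \<or>
   embedding_on (revolution_source I x t :: (real \<times> (complex^'n::finite)) set) (revolution_map I t) \<and>
   unduloid_curve (profile_curve x t ` I)"
proof -
  obtain g where g: "strict_mono t" "is_interval (range t)" "\<And>s. g (t s) = s" "\<And>u. u \<in> range t \<Longrightarrow> t (g u) = u"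
    "continuous_on (range t) g"
    "\<And>u. u \<in> range t \<Longrightarrow> ((\<lambda>u. x (g u)) has_real_derivative tan (\<sigma> (g u))) (at u)"
    "\<And>u. u \<in> range t \<Longrightarrow> ((\<lambda>u. tan (\<sigma> (g u))) has_real_derivative
       profile_rhs n H (x (g u)) (\<sigma> (g u)) / cos (\<sigma> (g u)) ^ 3) (at u)"
    "continuous_on (range t) (\<lambda>u. profile_rhs n H (x (g u)) (\<sigma> (g u)) / cos (\<sigma> (g u)) ^ 3)"
    by (rule graph_function[OF IU cos_pos]) blast
  have tg: "t (g u) = u" for u using g(4) t_range by simp
  have C: "profile_curve x t ` I = {(x (g u), u) | u. True}"
  proof (intro subset_antisym subsetI)
    fix q assume "q \<in> profile_curve x t ` I"
    then obtain s where "q = (x s, t s)" by (auto simp: profile_curve_def)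
    then show "q \<in> {(x (g u), u) | u. True}" using g(3)[of s] by force
  next
    fix q assume "q \<in> {(x (g u), u) | u. True}"
    then obtain u where "q = (x (g u), t (g u))" using tg by auto
    then show "q \<in> profile_curve x t ` I" using iI by (auto simp: profile_curve_def)
  qed
  have emb: "embedding_on (revolution_source I x t :: (real \<times> (complex^'n)) set) (revolution_map I t)"
    by (rule embedding_graph[OF IU g(5,3)])
  have main: "periodic_graph (profile_curve x t ` I) \<and>
    (cylinder_curve (profile_curve x t ` I) \<or> unduloid_curve (profile_curve x t ` I))"
  proof (cases "\<exists>z. y z = 0 \<and> PP' (x z) = 0")
    case True
    then obtain z where z: "y z = 0" "PP' (x z) = 0" by blast
    have "x (g u) = x z" for u by (rule cylinder(1)[OF z])
    then have "profile_curve x t ` I = {(x z, u) | u. True}" unfolding C by (simp only:)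
    then show ?thesis using xpos'[of z]
      unfolding periodic_graph_def cylinder_curve_def
      by (intro conjI disjI1) (rule exI[of _ 1], auto)
  next
    case False
    then obtain z0 where z0: "y z0 = 0" "PP' (x z0) < 0" using vertex_minimum by blast
    have nz: "PP' (x z0) \<noteq> 0" using z0(2) by simp
    obtain z1 where z1: "z0 < z1" "y z1 = 0" and pos0: "\<And>s. z0 < s \<Longrightarrow> s < z1 \<Longrightarrow> 0 < - sgn (PP' (x z0)) * y s"
      and "0 < - sgn (PP' (x z0)) * PP' (x z1)"
      by (rule next_zero[OF z0(1) nz]) blast
    then have PP1: "0 < PP' (x z1)" using z0(2) by simp
    have ypos: "0 < y s" if "z0 < s" "s < z1" for s using pos0[OF that] z0(2) by simp
    have sinpos: "0 < sin (\<sigma> s)" if "z0 < s" "s < z1" for s using sin_sign(1)[OF iI] ypos[OF that] by blast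
    have xc: "continuous_on S x" for S using continuous_on_profile(1) IU continuous_on_subset by blast
    have x_less: "x a < x b" if "z0 \<le> a" "a < b" "b \<le> z1" for a b
    proof (rule DERIV_pos_imp_increasing_open[OF that(2) _ xc])
      show "\<exists>d. (x has_real_derivative d) (at s) \<and> 0 < d" if "a < s" "s < b" for s
        using x'[OF iI, of s] sinpos[of s] that \<open>z0 \<le> a\<close> \<open>b \<le> z1\<close>
        by (intro exI[of _ "sin (\<sigma> s)"]) auto
    qed
    define t0 where "t0 = t z0"
    \<comment> \<open>Half of the period: the height gained from the minimum at \<open>z0\<close> to
      the next maximum at \<open>z1\<close>.\<close>
    define \<tau> where "\<tau> = t z1 - t z0"
    have \<tau>: "0 < \<tau>" using g(1) z1(1) by (simp add: \<tau>_def strict_mono_def)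
    define f where "f u = x (g (t0 + u))" for u
    define f1 where "f1 u = tan (\<sigma> (g (t0 + u)))" for u
    define f2 where "f2 u = profile_rhs n H (x (g (t0 + u))) (\<sigma> (g (t0 + u))) / cos (\<sigma> (g (t0 + u))) ^ 3" for u
    have sh: "((\<lambda>u. t0 + u) has_real_derivative 1) (at u)" for u by (auto intro!: derivative_eq_intros)
    have f1: "(f has_real_derivative f1 u) (at u)" for u
      using DERIV_chain2[OF g(6) sh, of u] unfolding f_def[abs_def] f1_def t_range by simp
    have f2: "(f1 has_real_derivative f2 u) (at u)" for u
      using DERIV_chain2[OF g(7) sh, of u] unfolding f1_def[abs_def] f2_def t_range by simp
    have f2c: "continuous_on UNIV f2"
      unfolding f2_def[abs_def]
      by (rule continuous_on_compose2[OF g(8), of _ "\<lambda>u. t0 + u"]) (auto intro!: continuous_intros simp: t_range)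
    have f2sgn: "0 < f2 u \<longleftrightarrow> 0 < SS (f u)" "f2 u < 0 \<longleftrightarrow> SS (f u) < 0" for u
    proof -
      define s where "s = g (t0 + u)"
      define q where "q = (W s / x s) ^ 3 / cos (\<sigma> s) ^ 3"
      have "f2 u = q * SS (f u)"
        unfolding f2_def s_def[symmetric] rhs_SS f_def q_def by simp
      moreover have "0 < q"
        unfolding q_def using Wpos[OF iI, of s] xpos'[of s] cos_pos[of s] by simp
      ultimately show "0 < f2 u \<longleftrightarrow> 0 < SS (f u)" "f2 u < 0 \<longleftrightarrow> SS (f u) < 0"
        by (simp_all add: zero_less_mult_iff mult_less_0_iff)
    qed
    have gb: "z0 < g (t0 + u) \<longleftrightarrow> 0 < u" "g (t0 + u) < s \<longleftrightarrow> u < t s - t0" "s < g (t0 + u) \<longleftrightarrow> t s - t0 < u" for u s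
    proof -
      show "z0 < g (t0 + u) \<longleftrightarrow> 0 < u"
        using strict_mono_less[OF g(1), of z0 "g (t0 + u)"] unfolding tg t0_def by linarith
      show "g (t0 + u) < s \<longleftrightarrow> u < t s - t0"
        using strict_mono_less[OF g(1), of "g (t0 + u)" s] unfolding tg by linarith
      show "s < g (t0 + u) \<longleftrightarrow> t s - t0 < u"
        using strict_mono_less[OF g(1), of s "g (t0 + u)"] unfolding tg by linarith
    qed
    have even: "f (- u) = f u" for u
    proof -
      have "t (2 * z0 - g (t0 + u)) = t0 - u" using symm(2)[OF z0(1)] by (simp add: tg t0_def)
      then have "g (t0 - u) = 2 * z0 - g (t0 + u)" using g(3) by metis
      then show ?thesis using symm(1)[OF z0(1)] by (simp add: f_def)
    qed
    have per: "x (g (u + 2 * \<tau>)) = x (g u)" for u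
    proof -
      have "t (g u + 2 * (z1 - z0)) = u + 2 * \<tau>" using period(2)[OF z0(1) z1(2)] by (simp add: tg \<tau>_def)
      then have "g (u + 2 * \<tau>) = g u + 2 * (z1 - z0)" using g(3) by metis
      then show ?thesis using period(1)[OF z0(1) z1(2)] by simp
    qed
    have per_f: "f (u + 2 * \<tau>) = f u" for u using per[of "t0 + u"] by (simp add: f_def add.assoc)
    have f_mono: "strict_mono_on {0<..<\<tau>} f"
    proof (rule positive_derivative_strict_mono_on[OF is_interval_oo f1])
      fix u assume "u \<in> {0<..<\<tau>}"
      then have "z0 < g (t0 + u)" "g (t0 + u) < z1" using gb by (auto simp: \<tau>_def t0_def)
      from sinpos[OF this] cos_pos show "0 < f1 u" by (simp add: f1_def tan_def)
    qed
    have SS0: "0 < SS (x z0)" using SS_at_zero[OF z0(1)] z0(2) xpos'[of z0] by (simp add: mult_pos_neg)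
    have SS1: "SS (x z1) < 0" using SS_at_zero[OF z1(2)] PP1 xpos'[of z1] by simp
    have SSc: "continuous_on {z0..z1} (\<lambda>s. SS (x s))"
      by (rule has_real_derivative_continuous_on[OF DERIV_chain2[OF SS_deriv[OF xpos'] x'[OF iI]]])
    \<comment> \<open>The inflection point: by \<open>SS_at_zero\<close> the factor
      \<open>SS\<close> is positive at the minimum and negative at the maximum.\<close>
    obtain s1 where s1: "z0 \<le> s1" "s1 \<le> z1" "SS (x s1) = 0"
      using IVT2'[of "\<lambda>s. SS (x s)" z1 0 z0] SS0 SS1 SSc z1(1) by auto
    have s1': "z0 < s1" "s1 < z1" using s1 SS0 SS1 by (metis less_irrefl less_eq_real_def)+
    have PPs1: "PP' (x s1) < 0"
    proof (rule ccontr)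
      assume "\<not> ?thesis"
      then have "SS (x s1) < 0" using SS_neg[of s1] ypos[OF s1'] by simp
      then show False using s1(3) by simp
    qed
    have before: "0 < SS (x s)" if "z0 < s" "s < s1" for s
      using SS_decreasing[OF xpos' x_less PPs1, of s] that s1 by simp
    have after: "SS (x s) < 0" if "s1 < s" "s < z1" for s
    proof (cases "PP' (x s) < 0")
      case True
      then show ?thesis using SS_decreasing[OF xpos' x_less True, of s1] that s1' s1(3) by simp
    next
      case False
      then show ?thesis using SS_neg[of s] ypos[of s] that s1' by simp
    qed
    define t1 where "t1 = t s1 - t0"
    have t1: "0 < t1" "t1 < \<tau>" using s1' g(1) by (simp_all add: t1_def t0_def \<tau>_def strict_mono_def)
    have "strictly_convex_on {0<..<t1} f"
    proof (rule strictly_convex_on_derivative[OF is_interval_oo f1 positive_derivative_strict_mono_on[OF is_interval_oo f2]])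
      fix u assume "u \<in> {0<..<t1}"
      then have "z0 < g (t0 + u)" "g (t0 + u) < s1" using gb by (auto simp: t1_def)
      from before[OF this] show "0 < f2 u" unfolding f2sgn by (simp add: f_def)
    qed
    moreover have "strictly_concave_on {t1<..<\<tau>} f"
      unfolding strictly_concave_on_def
    proof (rule strictly_convex_on_derivative[OF is_interval_oo DERIV_minus[OF f1]
          positive_derivative_strict_mono_on[OF is_interval_oo DERIV_minus[OF f2]]])
      fix u assume "u \<in> {t1<..<\<tau>}"
      then have "s1 < g (t0 + u)" "g (t0 + u) < z1" using gb by (auto simp: t1_def \<tau>_def t0_def)
      from after[OF this] have "f2 u < 0" unfolding f2sgn by (simp add: f_def)
      then show "0 < - f2 u" by simp
    qed
    moreover have "\<not> f constant_on UNIV"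
    proof
      assume "f constant_on UNIV"
      then have "f (\<tau> / 3) = f (\<tau> / 2)" unfolding constant_on_def by (metis UNIV_I)
      moreover have "f (\<tau> / 3) < f (\<tau> / 2)" using \<tau> by (intro strict_mono_onD[OF f_mono]) auto
      ultimately show False by simp
    qed
    moreover have "C2_on UNIV f" by (rule C2_on_realI[OF f1 f2 f2c])
    moreover have "\<forall>u. 0 < f u \<and> f (- u) = f u \<and> f (u + 2 * \<tau>) = f u"
      using xpos' even per_f by (simp add: f_def)
    moreover have "profile_curve x t ` I = {(f u, t0 + u) | u. True}"
    proof -
      have "(x (g u), u) = (f (u - t0), t0 + (u - t0))" for u by (simp add: f_def)
      moreover have "(f u, t0 + u) = (x (g (t0 + u)), t0 + u)" for u by (simp add: f_def)
      ultimately show ?thesis unfolding C by blast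
    qed
    ultimately have "unduloid_curve (profile_curve x t ` I)"
      unfolding unduloid_curve_def using \<tau> t1 f_mono by blast
    moreover have "periodic_graph (profile_curve x t ` I)"
      unfolding periodic_graph_def
      by (intro exI[of _ "2 * \<tau>"] conjI exI[of _ "\<lambda>u. x (g u)"] allI per C) (use \<tau> in simp)
    ultimately show ?thesis by blast
  qed
  then show "periodic_graph (profile_curve x t ` I)" by blast
  show "cylinder_curve (profile_curve x t ` I) \<or>
   embedding_on (revolution_source I x t :: (real \<times> (complex^'n::finite)) set) (revolution_map I t) \<and>
   unduloid_curve (profile_curve x t ` I)"
    using main emb by blast
qed

end

section \<open>Nodoids\<close>

locale nodoid = periodic_profile +
  assumes Eneg: "E < 0"
begin

text \<open>Negative energy means \<open>P < H x\<close>, and \<open>\<bar>P\<bar> \<le> 1\<close>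
  gives \<open>P ^ 3 \<le> H x\<close>. The energy term of \<open>SS\<close> has the right sign, so
  \<open>SS \<le> H x - 2 H x\<close>. This uniform bound makes the tangent turn at a definite
  rate.\<close>

lemma SS_le: "SS (x s) \<le> - (H * m)"
proof -
  have h: "H * m \<le> H * x s" using Hpos mM(3) by simp
  have Hm: "0 < H * m" using Hpos mM(1) by simp
  have e: "E / x s ^ (2 * n - 1) < 0" using Eneg xpos'[of s] by (simp add: divide_neg_pos)
  have S: "SS (x s) = P s ^ 3 + (2 * real n - 2) * (E / x s ^ (2 * n - 1)) - 2 * (H * x s)"
    unfolding SS_def PP_split(2) by (simp add: PP_split(1) algebra_simps)
  have "(2 * real n - 2) * (E / x s ^ (2 * n - 1)) \<le> 0" using n e by (intro mult_nonneg_nonpos) auto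
  moreover have "P s ^ 3 \<le> H * x s"
  proof (cases "P s \<le> 0")
    case True
    then have "P s ^ 3 \<le> 0" by (simp add: power_le_zero_eq)
    then show ?thesis using h Hm by linarith
  next
    case False
    then have "P s ^ 3 \<le> P s ^ 1" using P_le[OF iI, of s] by (intro power_decreasing) auto
    then show ?thesis using e PP_split(1)[of s] by simp
  qed
  ultimately show ?thesis using S h by linarith
qed

lemma \<sigma>'_le: "(W s / x s) ^ 3 * SS (x s) \<le> - ((m / M) ^ 3 * (H * m))"
proof -
  have "(m / M) ^ 3 * (H * m) \<le> (W s / x s) ^ 3 * (- SS (x s))"
  proof (intro mult_mono power_mono frac_le W_ge_m)
    show "H * m \<le> - SS (x s)" using SS_le[of s] by simp
  qed (use mM xpos'[of s] Wpos[OF iI, of s] Hpos in auto)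
  then show ?thesis by simp
qed

lemma rate_pos: "0 < (m / M) ^ 3 * (H * m)"
  using mM Hpos by simp

lemma \<sigma>_decreasing: "a < b \<Longrightarrow> \<sigma> b < \<sigma> a"
proof (rule DERIV_neg_imp_decreasing[where f = \<sigma> and a = a and b = b])
  fix s
  show "\<exists>d. (\<sigma> has_real_derivative d) (at s) \<and> d < 0"
    using \<sigma>'[OF iI, of s] \<sigma>'_le[of s] rate_pos
    by (intro exI[of _ "(W s / x s) ^ 3 * SS (x s)"]) linarith
qed

lemma \<sigma>_less: "\<sigma> a < \<sigma> b \<longleftrightarrow> b < a"
  using \<sigma>_decreasing[of a b] \<sigma>_decreasing[of b a] by (metis less_asym linorder_less_linear)

lemma \<sigma>_attains: obtains s where "\<sigma> s = v"
proof -
  have "range (\<lambda>s. - \<sigma> s) = UNIV"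
    by (rule positive_growth_range[OF DERIV_minus[OF \<sigma>'[OF iI]] _ rate_pos]) (use \<sigma>'_le in \<open>simp add: le_minus_iff\<close>)
  then obtain s where "- v = - \<sigma> s" by (metis UNIV_I imageE)
  then show ?thesis using that[of s] by simp
qed

text \<open>These three parameters span half a turn of the tangent: the radius is largest over this
  half turn at \<open>s0\<close>, where the height increases, and smallest at \<open>s1\<close>,
  where the height decreases; at \<open>sh\<close> the height turns back.\<close>

definition s0 where "s0 = (SOME s. \<sigma> s = 0)"
definition sh where "sh = (SOME s. \<sigma> s = - (pi / 2))"
definition s1 where "s1 = (SOME s. \<sigma> s = - pi)"

lemma marks: "\<sigma> s0 = 0" "\<sigma> sh = - (pi / 2)" "\<sigma> s1 = - pi"
  unfolding s0_def sh_def s1_def by (rule someI_ex, rule \<sigma>_attains, rule exI, assumption)+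

lemma mark_order: "s0 < sh" "sh < s1"
  using \<sigma>_less[of sh s0] \<sigma>_less[of s1 sh] marks pi_gt_zero by auto

lemma y_marks: "y s0 = 0" "y s1 = 0"
  using sin_sign(3)[OF iI, of s0] sin_sign(3)[OF iI, of s1] marks by simp_all

lemma cos_first: "s0 \<le> s \<Longrightarrow> s < sh \<Longrightarrow> 0 < cos (\<sigma> s)"
  using \<sigma>_less[of s s0] \<sigma>_less[of s0 s] \<sigma>_less[of sh s] marks pi_gt_zero
  by (intro cos_gt_zero_pi) (auto simp: not_less)

lemma cos_second: "sh < s \<Longrightarrow> s \<le> s1 \<Longrightarrow> cos (\<sigma> s) < 0"
proof -
  assume s: "sh < s" "s \<le> s1"
  have "- (pi / 2) < \<sigma> s + pi" "\<sigma> s + pi < pi / 2"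
    using s \<sigma>_less[of s sh] \<sigma>_less[of s s1] marks pi_gt_zero by auto
  then have "0 < cos (\<sigma> s + pi)" by (rule cos_gt_zero_pi)
  then show ?thesis by simp
qed

lemma sin_between: "s0 < s \<Longrightarrow> s < s1 \<Longrightarrow> sin (\<sigma> s) < 0"
  using \<sigma>_less[of s s0] \<sigma>_less[of s1 s] marks sin_gt_zero[of "- \<sigma> s"] by simp

lemma cont: "continuous_on S x" "continuous_on S t" "continuous_on S y"
  by (rule continuous_on_subset[OF continuous_on_profile(1)] continuous_on_subset[OF continuous_on_profile(2)]
      continuous_on_subset[OF y_continuous], simp add: IU)+

lemma x_less: "s0 \<le> a \<Longrightarrow> a < b \<Longrightarrow> b \<le> s1 \<Longrightarrow> x b < x a"
proof -
  assume ab: "s0 \<le> a" "a < b" "b \<le> s1"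
  show ?thesis
  proof (rule DERIV_neg_imp_decreasing_open[where f = x and a = a and b = b, OF ab(2)])
    show "\<exists>d. (x has_real_derivative d) (at s) \<and> d < 0" if "a < s" "s < b" for s
      using x'[OF iI, of s] sin_between[of s] that ab by (intro exI[of _ "sin (\<sigma> s)"]) auto
  qed (rule cont)
qed

text \<open>The weight \<open>K\<close> is chosen so that \<open>(t + K y)' = cos \<sigma> (1 - K PP' (x s) / x s)\<close> is nonnegative: both
  factors change sign at \<open>sh\<close>, since \<open>x\<close> is decreasing. As \<open>y\<close> vanishes at both ends, the
  curve advances along the axis.\<close>

lemma advance: "t s0 < t s1"
proof -
  define K where "K = x sh / PP' (x sh)"
  define T where "T s = t s + K * y s" for s
  have e: "0 < - ((2 * real n - 1) * E)" using n Eneg by (simp add: mult_pos_neg)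
  have PP'r: "PP' r = H + - ((2 * real n - 1) * E) / r ^ (2 * n)" for r by (simp add: PP'_def)
  have PPpos: "0 < PP' r" if "0 < r" for r
  proof -
    have "0 < - ((2 * real n - 1) * E) / r ^ (2 * n)" by (rule divide_pos_pos[OF e]) (use that in simp)
    then show ?thesis unfolding PP'r using Hpos by linarith
  qed
  \<comment> \<open>With negative energy \<open>PP'\<close> is positive and decreasing in the
    radius, and dividing by the radius preserves this.\<close>
  have ratio: "PP' b / b < PP' a / a" if "0 < a" "a < b" for a b
  proof (rule frac_less)
    show "0 \<le> PP' b" using PPpos[of b] that by simp
    show "PP' b < PP' a" unfolding PP'r using e that n
      by (intro add_strict_left_mono divide_strict_left_mono power_strict_mono mult_pos_pos) auto
  qed (use that in auto)
  have K: "0 < K" using PPpos xpos' by (simp add: K_def)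
  have Kx: "K * (PP' (x sh) / x sh) = 1" using PPpos[OF xpos', of sh] xpos'[of sh] by (simp add: K_def)
  have T': "(T has_real_derivative cos (\<sigma> s) * (1 - K * (PP' (x s) / x s))) (at s)" for s
  proof -
    have "(T has_real_derivative cos (\<sigma> s) + K * - (P s * W s * PP' (x s) / x s)) (at s)"
      unfolding T_def[abs_def] by (intro DERIV_add t'[OF iI] DERIV_cmult y'_PP[OF iI])
    then show ?thesis by (rule DERIV_cong) (simp add: cos_eq[OF iI] algebra_simps)
  qed
  have Tc: "continuous_on S T" for S by (rule has_real_derivative_continuous_on[OF T'])
  have "T s0 < T sh"
  proof (rule DERIV_pos_imp_increasing_open[OF mark_order(1) _ Tc])
    fix s assume s: "s0 < s" "s < sh"
    have "x sh < x s" using x_less[of s sh] s mark_order by simp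
    then have "K * (PP' (x s) / x s) < K * (PP' (x sh) / x sh)"
      using ratio[OF xpos'] K by (intro mult_strict_left_mono) auto
    then have "0 < cos (\<sigma> s) * (1 - K * (PP' (x s) / x s))" using Kx cos_first[of s] s by simp
    then show "\<exists>d. (T has_real_derivative d) (at s) \<and> 0 < d" using T' by blast
  qed
  also have "T sh < T s1"
  proof (rule DERIV_pos_imp_increasing_open[OF mark_order(2) _ Tc])
    fix s assume s: "sh < s" "s < s1"
    have "x s < x sh" using x_less[of sh s] s mark_order by simp
    then have "K * (PP' (x sh) / x sh) < K * (PP' (x s) / x s)"
      using ratio[OF xpos'] K by (intro mult_strict_left_mono) auto
    then have "0 < cos (\<sigma> s) * (1 - K * (PP' (x s) / x s))"
      using Kx cos_second[of s] s by (intro mult_neg_neg) auto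
    then show "\<exists>d. (T has_real_derivative d) (at s) \<and> 0 < d" using T' by blast
  qed
  finally show ?thesis by (simp add: T_def y_marks)
qed

text \<open>The height falls from \<open>sh\<close> to \<open>s1\<close>, but by
  \<open>advance\<close> not down to its value at \<open>s0\<close>, so some \<open>a\<close>
  between \<open>s0\<close> and \<open>sh\<close> already has the height of \<open>s1\<close>. The
  reflection about \<open>s1\<close> keeps radii and fixes this height; it sends \<open>a\<close> to
  another parameter with the same point.\<close>

lemma self_intersection: obtains a b where "a \<noteq> b" "x a = x b" "t a = t b"
proof -
  have "t s1 < t sh"
  proof (rule DERIV_neg_imp_decreasing_open[where f = t and a = sh and b = s1])
    show "\<exists>d. (t has_real_derivative d) (at s) \<and> d < 0" if "sh < s" "s < s1" for s
    proof (intro exI conjI)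
      show "(t has_real_derivative cos (\<sigma> s)) (at s)" by (rule t'[OF iI])
      show "cos (\<sigma> s) < 0" using cos_second[of s] that by simp
    qed
  qed (rule mark_order cont)+
  then obtain a where a: "s0 \<le> a" "a \<le> sh" "t a = t s1"
    using IVT'[of t s0 "t s1" sh] advance mark_order cont(2) by auto
  have "x (2 * s1 - a) = x a" "t (2 * s1 - a) = t a"
    using symm(1,2)[OF y_marks(2), of a] a(3) by simp_all
  moreover have "a \<noteq> 2 * s1 - a" using a(2) mark_order by simp
  ultimately show ?thesis using that by metis
qed

text \<open>On an interval where \<sigma> varies by less than \<open>pi\<close>, every tangent line
  supports the arc: the product with the normal at \<open>r\<close> has derivative
  \<open>sin (\<sigma> b - \<sigma> r)\<close>, nonnegative before \<open>r\<close> and nonpositive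
  after, as \<sigma> decreases. The convex set is the intersection of the supporting
  half-planes.\<close>

lemma locally_convex: "locally_convex_curve UNIV (profile_curve x t)"
  unfolding locally_convex_curve_def
proof
  fix s :: real
  have "isCont \<sigma> s" by (rule DERIV_isCont[OF \<sigma>'[OF iI]])
  then have "\<exists>d>0. \<forall>r. \<bar>r - s\<bar> < d \<longrightarrow> \<bar>\<sigma> r - \<sigma> s\<bar> < 1"
    unfolding continuous_at_real_range by (drule_tac x = 1 in spec) simp
  then obtain d where d: "0 < d" "\<And>r. \<bar>r - s\<bar> < d \<Longrightarrow> \<bar>\<sigma> r - \<sigma> s\<bar> < 1" by blast
  define J where "J = {s - d<..<s + d}"
  define \<nu> where "\<nu> r = (cos (\<sigma> r), - sin (\<sigma> r))" for r
  define K where "K = (\<Inter>r\<in>J. {p. \<nu> r \<bullet> p \<le> \<nu> r \<bullet> (x r, t r)})"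
  have var: "\<bar>\<sigma> a - \<sigma> b\<bar> < pi" if "a \<in> J" "b \<in> J" for a b
    using d(2)[of a] d(2)[of b] that pi_gt3 by (auto simp: J_def abs_less_iff)
  have supp: "\<nu> r \<bullet> (x a, t a) \<le> \<nu> r \<bullet> (x r, t r)" if "a \<in> J" "r \<in> J" for a r
  proof -
    define h where "h b = cos (\<sigma> r) * x b - sin (\<sigma> r) * t b" for b
    have h': "(h has_real_derivative sin (\<sigma> b - \<sigma> r)) (at b)" for b
      unfolding h_def[abs_def]
      by (auto intro!: derivative_eq_intros x'[OF iI] t'[OF iI] simp: sin_diff)
    have J: "b \<in> J" if "min a r \<le> b" "b \<le> max a r" for b
      using that \<open>a \<in> J\<close> \<open>r \<in> J\<close> by (auto simp: J_def min_def max_def split: if_splits)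
    have "h a \<le> h r"
    proof (cases "a \<le> r")
      case True
      have "h a + 0 * (r - a) \<le> h r"
      proof (rule derivative_ge_growth[OF True h'])
        fix b assume b: "a \<le> b" "b \<le> r"
        have "b \<in> J" using J b True by auto
        then show "0 \<le> sin (\<sigma> b - \<sigma> r)"
          using var[of b r] \<open>r \<in> J\<close> b \<sigma>_less[of b r] by (intro sin_ge_zero) (auto simp: abs_less_iff)
      qed
      then show ?thesis by simp
    next
      case False
      have "- h r + 0 * (a - r) \<le> - h a"
      proof (rule derivative_ge_growth[where f = "\<lambda>b. - h b" and a = r and b = a, OF _ DERIV_minus[OF h']])
        fix b assume b: "r \<le> b" "b \<le> a"
        have "b \<in> J" using J b False by auto
        then have "0 \<le> sin (\<sigma> r - \<sigma> b)"
          using var[of r b] \<open>r \<in> J\<close> b \<sigma>_less[of r b] by (intro sin_ge_zero) (auto simp: abs_less_iff)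
        then show "0 \<le> - sin (\<sigma> b - \<sigma> r)" by (simp add: sin_diff mult.commute)
      qed (use False in simp)
      then show ?thesis by simp
    qed
    then show ?thesis by (simp add: \<nu>_def h_def)
  qed
  have "convex K" unfolding K_def by (intro convex_INT convex_halfspace_le)
  moreover have "profile_curve x t r \<in> frontier K" if r: "r \<in> J" for r
  proof -
    have in_K: "(x r, t r) \<in> K" unfolding K_def using supp[OF r] by blast
    have nn: "\<nu> r \<bullet> \<nu> r = 1" by (simp add: \<nu>_def power2_eq_square[symmetric])
    have "(x r, t r) \<notin> interior K"
    proof
      assume "(x r, t r) \<in> interior K"
      then obtain \<epsilon> where \<epsilon>: "0 < \<epsilon>" "ball (x r, t r) \<epsilon> \<subseteq> K" by (auto simp: mem_interior)
      have "norm (\<nu> r) = 1" using nn by (simp add: norm_eq_sqrt_inner)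
      then have "(x r, t r) + (\<epsilon> / 2) *\<^sub>R \<nu> r \<in> ball (x r, t r) \<epsilon>" using \<epsilon>(1) by (simp add: dist_norm del: add_Pair)
      then have "\<nu> r \<bullet> ((x r, t r) + (\<epsilon> / 2) *\<^sub>R \<nu> r) \<le> \<nu> r \<bullet> (x r, t r)" using \<epsilon>(2) r unfolding K_def by blast
      then show False using \<epsilon>(1) nn by (simp only: inner_add_right inner_scaleR_right)
    qed
    then show ?thesis using in_K closure_subset unfolding frontier_def profile_curve_def by blast
  qed
  moreover have "open J" "s \<in> J" using d(1) by (auto simp: J_def)
  ultimately show "\<exists>J K. open J \<and> s \<in> J \<and> convex K \<and> profile_curve x t ` (UNIV \<inter> J) \<subseteq> frontier K"
    by (intro exI[of _ J] exI[of _ K]) auto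
qed

lemma nodoid_type: "nodoid_curve I x t \<sigma>"
  unfolding nodoid_curve_def
proof (intro conjI)
  show "I = UNIV" by (rule IU)
  show "locally_convex_curve UNIV (profile_curve x t)" by (rule locally_convex)
  show "strict_mono \<sigma> \<or> strict_mono (\<lambda>s. - \<sigma> s)" using \<sigma>_decreasing by (auto simp: strict_mono_def)
  show "\<exists>m M. 0 < m \<and> (\<forall>s. m \<le> x s \<and> x s \<le> M)" using mM by blast
  define d where "d = 2 * (t s1 - t s0)"
  define p where "p = 2 * (s1 - s0)"
  have sh: "x (s + p) = x s" "t (s + p) = t s + d" for s
    using period[OF y_marks, of s] by (simp_all add: d_def p_def)
  have "(\<lambda>(r, u). (r, u + d)) ` range (profile_curve x t) = range (\<lambda>s. profile_curve x t (s + p))"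
    by (auto simp: profile_curve_def sh)
  also have "\<dots> = range (profile_curve x t)"
  proof -
    have "profile_curve x t s = profile_curve x t ((s - p) + p)" for s by simp
    then show ?thesis by blast
  qed
  finally show "\<exists>d. d \<noteq> 0 \<and> (\<lambda>(r, u). (r, u + d)) ` range (profile_curve x t) = range (profile_curve x t)"
    using advance by (intro exI[of _ d]) (simp add: d_def)
  show "\<forall>s0. deriv x s0 = 0 \<longrightarrow> (\<lambda>(r, u). (r, 2 * t s0 - u)) ` range (profile_curve x t) = range (profile_curve x t)"
  proof (intro allI impI)
    fix c assume "deriv x c = 0"
    then have "sin (\<sigma> c) = 0" using DERIV_imp_deriv[OF x'[OF iI]] by simp
    then have "y c = 0" using sin_sign(3)[OF iI] by blast
    note sy = symm(1,2)[OF this]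
    have "(\<lambda>(r, u). (r, 2 * t c - u)) ` range (profile_curve x t) = range (\<lambda>s. profile_curve x t (2 * c - s))"
      by (auto simp: profile_curve_def sy)
    also have "\<dots> = range (profile_curve x t)"
    proof -
      have "profile_curve x t s = profile_curve x t (2 * c - (2 * c - s))" for s by simp
      then show ?thesis by blast
    qed
    finally show "(\<lambda>(r, u). (r, 2 * t c - u)) ` range (profile_curve x t) = range (profile_curve x t)" .
  qed
  show "\<not> embedding_on UNIV (profile_curve x t)"
  proof
    assume "embedding_on UNIV (profile_curve x t)"
    then obtain G where G: "\<And>s. G (profile_curve x t s) = s"
      unfolding embedding_on_def homeomorphism_def by blast
    obtain a b where "a \<noteq> b" "x a = x b" "t a = t b" by (rule self_intersection)
    then show False using G[of a] G[of b] by (simp add: profile_curve_def)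
  qed
qed

lemma not_injective:
  "\<not> inj_on (revolution_map I t) (revolution_source I x t :: (real \<times> (complex^'n::finite)) set)"
proof (rule notI)
  assume inj: "inj_on (revolution_map I t) (revolution_source I x t :: (real \<times> (complex^'n)) set)"
  obtain a b where ab: "a \<noteq> b" "x a = x b" "t a = t b" by (rule self_intersection)
  obtain \<omega> :: "complex^'n" where \<omega>: "norm \<omega> = 1" using vector_choose_size[of 1] by auto
  have M: "(s, x s *\<^sub>R \<omega>) \<in> revolution_source I x t" for s
    unfolding revolution_source_def
    by (rule UnI1, rule CollectI) (intro exI[of _ s] exI[of _ \<omega>] conjI refl iI \<omega>)
  have "revolution_map I t (a, x a *\<^sub>R \<omega>) = revolution_map I t (b, x b *\<^sub>R \<omega>)"
    using ab(2,3) iI by (simp add: revolution_map_def)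
  from inj_onD[OF inj this M M] show False using ab(1) by simp
qed

end

section \<open>Zero energy\<close>

locale zero_energy = profile +
  assumes E0: "E = 0"
begin

lemma P_H: "s \<in> I \<Longrightarrow> P s = H * x s"
  unfolding P_eq PP_def using E0 by simp

text \<open>\<open>q\<close> is the slope \<open>dt / dx\<close> of the curve, that is the cotangent
  of \<sigma>. It fixes the sine and the cosine up to a common sign, and \<epsilon> fixes this sign
  because the sine has the sign of \<open>y\<close>.\<close>

lemma polar_angle:
  assumes s: "s \<in> I" and \<epsilon>: "\<epsilon> = 1 \<or> \<epsilon> = - 1" and pos: "0 < \<epsilon> * y s" and q: "q = x s * P s / y s"
  shows "sin (\<sigma> s) = \<epsilon> / sqrt (1 + q\<^sup>2)" "cos (\<sigma> s) = \<epsilon> * q / sqrt (1 + q\<^sup>2)"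
proof -
  have y: "y s \<noteq> 0" using pos by auto
  define R where "R = sqrt (1 + q\<^sup>2)"
  have R: "0 < R" "R\<^sup>2 = 1 + q\<^sup>2" by (simp_all add: R_def add_pos_nonneg)
  have "(y s)\<^sup>2 + (x s * P s)\<^sup>2 = (y s)\<^sup>2 * R\<^sup>2" using y by (simp add: R(2) q power_divide algebra_simps)
  then have "(y s)\<^sup>2 * ((sin (\<sigma> s))\<^sup>2 * R\<^sup>2) = (y s)\<^sup>2 * 1"
    using sin_squared[OF s] by (simp add: mult.assoc mult.commute mult.left_commute)
  then have "(sin (\<sigma> s))\<^sup>2 * R\<^sup>2 = 1" using y by simp
  moreover have "\<epsilon>\<^sup>2 = 1" using \<epsilon> by auto
  ultimately have "(\<epsilon> * sin (\<sigma> s) * R)\<^sup>2 = 1" by (simp add: power_mult_distrib)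
  moreover have "0 < \<epsilon> * sin (\<sigma> s)" using \<epsilon> pos sin_sign(1,2)[OF s] by auto
  then have "0 < \<epsilon> * sin (\<sigma> s) * R" using R(1) by simp
  ultimately have "\<epsilon> * sin (\<sigma> s) * R = 1" unfolding power2_eq_1_iff by linarith
  then have "\<epsilon> * sin (\<sigma> s) = 1 / R" using R(1) by (simp add: field_simps)
  then have sn: "sin (\<sigma> s) = \<epsilon> / R" using \<epsilon> by auto
  then show "sin (\<sigma> s) = \<epsilon> / sqrt (1 + q\<^sup>2)" by (simp add: R_def)
  have "y s * cos (\<sigma> s) = P s * (W s * y s)" by (simp add: cos_eq[OF s])
  also have "\<dots> = P s * (x s * sin (\<sigma> s))" by (simp add: sin_eq[OF s])
  finally have "cos (\<sigma> s) = q * sin (\<sigma> s)" using y by (simp add: q field_simps)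
  then show "cos (\<sigma> s) = \<epsilon> * q / sqrt (1 + q\<^sup>2)" by (simp add: sn R_def mult.commute)
qed

end

text \<open>A monotone function onto the whole line cannot jump. This gives continuity of the
  extension \<open>Y\<close> at the two ends of \<open>I\<close>, and of its inverse, without
  computing limits.\<close>

lemma decreasing_surjection_continuous:
  fixes f :: "real \<Rightarrow> real"
  assumes "\<And>a b. a < b \<Longrightarrow> f b < f a" "range f = UNIV"
  shows "continuous_on UNIV f"
proof -
  have surj: "\<exists>s. v = - f s" for v :: real
  proof -
    have "- v \<in> range f" by (simp add: assms(2))
    then obtain s where "- v = f s" by blast
    then have "v = - f s" by simp
    then show ?thesis ..
  qed
  have "continuous_on UNIV (\<lambda>s. - f s)"
  proof (rule continuous_onI_mono)
    show "open (range (\<lambda>s. - f s))" using surj by (metis open_UNIV surj_def)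
    show "- f a \<le> - f b" if "a \<le> b" for a b
      using assms(1)[of a b] that by (cases "a = b") auto
  qed
  then show ?thesis using continuous_on_minus by fastforce
qed

subsection \<open>Hyperplanes\<close>

locale hyperplane = zero_energy +
  assumes H0: "H = 0"
begin

lemma cos0: "s \<in> I \<Longrightarrow> cos (\<sigma> s) = 0"
  using cos_eq P_H H0 by simp

lemma \<sigma>_const: "s \<in> I \<Longrightarrow> s' \<in> I \<Longrightarrow> \<sigma> s = \<sigma> s'"
proof -
  have "profile_rhs n H (x r) (\<sigma> r) = 0" if "r \<in> I" for r
    using cos0[OF that] by (simp add: profile_rhs_def H0)
  then have "(\<sigma> has_real_derivative 0) (at r)" if "r \<in> I" for r using \<sigma>'_rhs that by metis
  then show "s \<in> I \<Longrightarrow> s' \<in> I \<Longrightarrow> \<sigma> s = \<sigma> s'"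
    using derivative_bound_interval[OF I(2), of \<sigma> "\<lambda>_. 0" 0 s s'] by simp
qed

text \<open>Here \<open>P = H x = 0\<close>, so the cosine vanishes, \<sigma> is constant and
  \<open>x\<close> is affine with slope \<epsilon>. The explicit half-line solves the system on all
  of \<open>J\<close>, and maximality forces \<open>I = J\<close>, so the curve runs down to the
  axis.\<close>

lemma line: obtains \<epsilon> a c where "\<epsilon> = 1 \<or> \<epsilon> = - 1" "I = {s. 0 < \<epsilon> * (s - a)}"
    "\<And>s. s \<in> I \<Longrightarrow> x s = \<epsilon> * (s - a)" "\<And>s. s \<in> I \<Longrightarrow> t s = c" "\<And>s. s \<in> I \<Longrightarrow> sin (\<sigma> s) = \<epsilon>"
proof -
  obtain s0 where s0: "s0 \<in> I" using I(3) by blast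
  define \<epsilon> where "\<epsilon> = sin (\<sigma> s0)"
  define a where "a = s0 - \<epsilon> * x s0"
  have "\<epsilon>\<^sup>2 = 1" using sin_cos_squared_add[of "\<sigma> s0"] cos0[OF s0] by (simp add: \<epsilon>_def)
  then have \<epsilon>: "\<epsilon> = 1 \<or> \<epsilon> = - 1" by (simp add: power2_eq_1_iff)
  then have \<epsilon>2: "\<epsilon> * \<epsilon> = 1" by auto
  have sn: "sin (\<sigma> s) = \<epsilon>" if "s \<in> I" for s using \<sigma>_const[OF that s0] by (simp add: \<epsilon>_def)
  have "((\<lambda>s. x s - \<epsilon> * s) has_real_derivative 0) (at s)" if "s \<in> I" for s
    using x'[OF that] sn[OF that] by (auto intro!: derivative_eq_intros)
  then have "x s - \<epsilon> * s = x s0 - \<epsilon> * s0" if "s \<in> I" for s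
    using derivative_bound_interval[OF I(2), of "\<lambda>s. x s - \<epsilon> * s" "\<lambda>_. 0" 0 s s0] that s0 by simp
  then have x: "x s = \<epsilon> * (s - a)" if "s \<in> I" for s
    using that \<epsilon>2 by (simp add: a_def algebra_simps)
  have "(t has_real_derivative 0) (at s)" if "s \<in> I" for s using t'[OF that] cos0[OF that] by simp
  then have t: "t s = t s0" if "s \<in> I" for s
    using derivative_bound_interval[OF I(2), of t "\<lambda>_. 0" 0 s s0] that s0 by simp
  define J where "J = {s. 0 < \<epsilon> * (s - a)}"
  have "J = {a<..} \<or> J = {..<a}" using \<epsilon> by (auto simp: J_def)
  then have J: "open J" "is_interval J" by auto
  have IJ: "I \<subseteq> J" using x xpos by (auto simp: J_def)
  have "profile_solution n H J (\<lambda>s. \<epsilon> * (s - a)) (\<lambda>_. t s0) (\<lambda>_. \<sigma> s0)"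
    unfolding profile_solution_iff
  proof (intro conjI ballI J)
    show "J \<noteq> {}" using IJ s0 by blast
    fix s assume "s \<in> J"
    then show "0 < \<epsilon> * (s - a)" by (simp add: J_def)
    show "((\<lambda>s. \<epsilon> * (s - a)) has_real_derivative sin (\<sigma> s0)) (at s)"
      by (auto intro!: derivative_eq_intros simp: \<epsilon>_def)
    show "((\<lambda>_. t s0) has_real_derivative cos (\<sigma> s0)) (at s)" by (simp add: cos0[OF s0])
    show "((\<lambda>_. \<sigma> s0) has_real_derivative profile_rhs n H (\<epsilon> * (s - a)) (\<sigma> s0)) (at s)"
      by (simp add: profile_rhs_def cos0[OF s0] H0)
  qed
  moreover have "\<forall>s\<in>I. \<epsilon> * (s - a) = x s \<and> t s0 = t s \<and> \<sigma> s0 = \<sigma> s" using x t \<sigma>_const s0 by metis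
  ultimately have "J = I" using comp IJ unfolding complete_profile_solution_def by blast
  then show ?thesis using that[of \<epsilon> a "t s0"] \<epsilon> x t sn by (simp add: J_def)
qed

lemma hyperplane:
  assumes card: "CARD('n::finite) = n"
  shows "revolution_map I t ` (revolution_source I x t :: (real \<times> (complex^'n)) set) = revolve (generating_curve I x t)"
    "\<exists>e. cmc_immersion (revolution_source I x t :: (real \<times> (complex^'n)) set) (revolution_map I t) (normal_field e) H"
    "\<exists>c. generating_curve I x t = {(r, u). 0 \<le> r \<and> u = c}"
    "\<exists>a b. a \<noteq> 0 \<and> (revolve (generating_curve I x t) :: 'n heis set) = {p. a \<bullet> p = b}"
proof -
  obtain \<epsilon> a c where \<epsilon>: "\<epsilon> = 1 \<or> \<epsilon> = - 1" and Ie: "I = {s. 0 < \<epsilon> * (s - a)}"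
    and xe: "\<And>s. s \<in> I \<Longrightarrow> x s = \<epsilon> * (s - a)" and te: "\<And>s. s \<in> I \<Longrightarrow> t s = c"
    and sn: "\<And>s. s \<in> I \<Longrightarrow> sin (\<sigma> s) = \<epsilon>"
    by (rule line) blast
  have \<epsilon>2: "\<epsilon> * \<epsilon> = 1" using \<epsilon> by auto
  have at: "a + \<epsilon> * r \<in> I \<and> x (a + \<epsilon> * r) = r" if "0 < r" for r
  proof -
    have e: "\<epsilon> * (a + \<epsilon> * r - a) = r" by (simp add: mult.assoc[symmetric] \<epsilon>2)
    then have "a + \<epsilon> * r \<in> I" using that e by (simp only: Ie mem_Collect_eq)
    then show ?thesis using xe e by simp
  qed
  have curve: "profile_curve x t ` I = {0<..} \<times> {c}"
  proof (intro subset_antisym subsetI)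
    fix q assume "q \<in> profile_curve x t ` I"
    then show "q \<in> {0<..} \<times> {c}" using xpos te by (auto simp: profile_curve_def)
  next
    fix q :: "real \<times> real" assume "q \<in> {0<..} \<times> {c}"
    then have "q = profile_curve x t (a + \<epsilon> * fst q)" "a + \<epsilon> * fst q \<in> I"
      using at[of "fst q"] te[of "a + \<epsilon> * fst q"] by (auto simp: profile_curve_def)
    then show "q \<in> profile_curve x t ` I" by blast
  qed
  have cl: "closure (profile_curve x t ` I) = {0..} \<times> {c}" unfolding curve by (simp add: closure_Times)
  show C: "\<exists>c. generating_curve I x t = {(r, u). 0 \<le> r \<and> u = c}"
    unfolding generating_curve_def cl unfolding curve by (rule exI[of _ c]) auto
  have C': "generating_curve I x t = {(r, u). 0 \<le> r \<and> u = c}"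
    unfolding generating_curve_def cl unfolding curve by auto
  have "revolve (generating_curve I x t) = {p :: 'n heis. (0, 1) \<bullet> p = c}"
  proof (intro subset_antisym subsetI)
    fix p :: "'n heis" assume "p \<in> revolve (generating_curve I x t)"
    then show "p \<in> {p. (0, 1) \<bullet> p = c}" unfolding revolve_def C' by (auto simp: inner_prod_def)
  next
    fix p :: "'n heis" assume "p \<in> {p. (0, 1) \<bullet> p = c}"
    then have p: "snd p = c" by (simp add: inner_prod_def)
    obtain \<omega>0 :: "complex^'n" where \<omega>0: "norm \<omega>0 = 1" using vector_choose_size[of 1] by auto
    define \<omega> where "\<omega> = (if fst p = 0 then \<omega>0 else sgn (fst p))"
    have "norm \<omega> = 1" "p = (norm (fst p) *\<^sub>R \<omega>, c)"
      using \<omega>0 p by (auto simp: \<omega>_def norm_sgn sgn_div_norm prod_eq_iff)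
    then show "p \<in> revolve (generating_curve I x t)" unfolding revolve_def C' by fastforce
  qed
  then show "\<exists>a b. a \<noteq> 0 \<and> (revolve (generating_curve I x t) :: 'n heis set) = {p. a \<bullet> p = b}"
    by (intro exI[of _ "(0, 1)"] exI[of _ c]) (simp add: zero_prod_def)
  have "I = {a<..} \<or> I = {..<a}" using \<epsilon> by (auto simp: Ie)
  then have clI: "closure I = I \<union> {a}" "a \<notin> I" by (auto simp: closure_greaterThan closure_lessThan)
  then have nb: "at a within I \<noteq> bot" by (simp add: at_within_eq_bot_iff)
  have t_lim: "(t \<longlongrightarrow> c) (at a within I)"
    by (rule Lim_transform_within[OF tendsto_const zero_less_one]) (simp add: te)
  have "((\<lambda>s. \<epsilon> * (s - a)) \<longlongrightarrow> \<epsilon> * (a - a)) (at a within I)" by (intro tendsto_intros)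
  then have x_lim: "(x \<longlongrightarrow> 0) (at a within I)"
    using Lim_transform_within[OF _ zero_less_one, of "\<lambda>s. \<epsilon> * (s - a)" "\<epsilon> * (a - a)" a I x] xe by simp
  have ends: "axis_ends I x t = {a}"
    unfolding axis_ends_def clI(1) profile_curve_def[abs_def]
    using clI(2) tendsto_Pair[OF x_lim t_lim] by auto
  have Lim: "Lim (at a within I) t = c" by (rule tendsto_Lim[OF nb t_lim])
  show "revolution_map I t ` (revolution_source I x t :: (real \<times> (complex^'n)) set) = revolve (generating_curve I x t)"
    by (rule image_revolution_source) (simp add: cl ends Lim)
  define Jp where "Jp = {s \<in> I. x s < 1}"
  have "\<exists>V S G. openin (top_of_set (revolution_source I x t :: (real \<times> (complex^'n)) set)) V \<and> (a, 0) \<in> V \<and>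
     homeomorphism V S (revolution_map I t) G \<and>
     C2_hypersurface S \<and> unit_normal heis_metric S (normal_field (\<lambda>_. \<epsilon>) \<circ> G) \<and>
     (\<forall>p \<in> S - singular_set S (normal_field (\<lambda>_. \<epsilon>) \<circ> G). has_mean_curvature S (normal_field (\<lambda>_. \<epsilon>) \<circ> G) p H)"
  \<comment> \<open>The graph is flat, so \<open>k\<close> and \<mu> vanish; the radius 1 of the
    chart is an arbitrary choice.\<close>
  proof (rule pole_chart[where \<epsilon> = \<epsilon> and \<delta> = 1 and k = "\<lambda>_. 0" and \<mu> = "\<lambda>_. 0" and ?\<mu>1.0 = "\<lambda>_. 0"
        and O' = "ball a 1" and Jp = Jp and \<xi> = "\<lambda>r. a + \<epsilon> * r" and ?u0.0 = c, OF card])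
    show "ball a 1 \<inter> I = Jp"
    proof -
      have "dist a s = \<epsilon> * (s - a)" if "s \<in> I" for s using that \<epsilon> by (auto simp: Ie dist_real_def)
      then show ?thesis by (auto simp: Jp_def xe)
    qed
    show "x ` Jp = {0<..<1}"
    proof (intro subset_antisym subsetI)
      fix r assume "r \<in> x ` Jp"
      then show "r \<in> {0<..<1}" using xpos by (auto simp: Jp_def)
    next
      fix r :: real assume "r \<in> {0<..<1}"
      then have "a + \<epsilon> * r \<in> Jp" "r = x (a + \<epsilon> * r)" using at[of r] by (auto simp: Jp_def)
      then show "r \<in> x ` Jp" by blast
    qed
    show "a + \<epsilon> * x s = s" if "s \<in> Jp" for s
      using that xe[of s] by (simp add: Jp_def mult.assoc[symmetric] \<epsilon>2)
    show "sin (\<sigma> s) = \<epsilon> / sqrt (1 + (0 * x s * x s)\<^sup>2)"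
      "cos (\<sigma> s) = \<epsilon> * (0 * x s * x s) / sqrt (1 + (0 * x s * x s)\<^sup>2)" if "s \<in> Jp" for s
      using that sn[of s] cos0[of s] by (simp_all add: Jp_def)
    show "continuous_on {0..<1} (\<lambda>r. a + \<epsilon> * r)" by (intro continuous_intros)
  qed (use \<epsilon> ends Lim te in \<open>auto simp: Jp_def\<close>)
  then have "cmc_immersion (revolution_source I x t :: (real \<times> (complex^'n)) set) (revolution_map I t)
      (normal_field (\<lambda>_. \<epsilon>)) H"
    by (intro cmc_immersion_normal_field[OF card]) (simp add: ends)
  then show "\<exists>e. cmc_immersion (revolution_source I x t :: (real \<times> (complex^'n)) set) (revolution_map I t) (normal_field e) H"
    by blast
qed

end

subsection \<open>Spheres\<close>

locale spherical = zero_energy +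
  assumes Hnz: "H \<noteq> 0"
begin

text \<open>With \<open>E = 0\<close> and \<open>H \<noteq> 0\<close>, the curve is parametrised by \<open>y \<in> {-1<..<1}\<close>:
  \<open>x = sqrt (1 - y\<^sup>2) / \<bar>H\<bar>\<close> and \<open>t = c - sgn H * B y / (2 * H\<^sup>2)\<close>.\<close>

definition B :: "real \<Rightarrow> real" where "B v = arcsin v + v * sqrt (1 - v\<^sup>2)"

lemma B_deriv:
  assumes "-1 < v" "v < 1"
  shows "(B has_real_derivative 2 * sqrt (1 - v\<^sup>2)) (at v)"
proof -
  have "v\<^sup>2 < 1" using assms by (simp add: abs_square_less_1 abs_less_iff)
  then have q: "0 < sqrt (1 - v\<^sup>2)" "(sqrt (1 - v\<^sup>2))\<^sup>2 = 1 - v\<^sup>2" by simp_all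
  have "((\<lambda>v. sqrt (1 - v\<^sup>2)) has_real_derivative inverse (sqrt (1 - v\<^sup>2)) / 2 * (- (2 * v))) (at v)"
    by (rule DERIV_chain2[OF DERIV_real_sqrt]) (use \<open>v\<^sup>2 < 1\<close> in \<open>auto intro!: derivative_eq_intros\<close>)
  from DERIV_add[OF DERIV_arcsin[OF assms] DERIV_mult[OF DERIV_ident this]]
  have "(B has_real_derivative inverse (sqrt (1 - v\<^sup>2)) +
      (1 * sqrt (1 - v\<^sup>2) + inverse (sqrt (1 - v\<^sup>2)) / 2 * (- (2 * v)) * v)) (at v)"
    unfolding B_def[abs_def] .
  moreover have "inverse r + (1 * r + inverse r / 2 * (- (2 * v)) * v) = 2 * r"
    if "0 < r" "r\<^sup>2 = 1 - v\<^sup>2" for r :: real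
  proof -
    have "inverse r + (1 * r + inverse r / 2 * (- (2 * v)) * v) = (1 - v\<^sup>2 + r\<^sup>2) / r"
      using that(1) by (simp add: field_simps power2_eq_square)
    also have "\<dots> = 2 * r" unfolding that(2)[symmetric] using that(1) by (simp add: power2_eq_square)
    finally show ?thesis .
  qed
  ultimately show ?thesis using q by metis
qed

lemma B_continuous: "continuous_on {-1..1} B"
  unfolding B_def[abs_def] by (intro continuous_intros continuous_on_arcsin) auto

lemma B_less:
  assumes "-1 \<le> u" "u < v" "v \<le> 1"
  shows "B u < B v"
proof (rule DERIV_pos_imp_increasing_open[where f = B and a = u and b = v, OF assms(2)])
  fix w assume w: "u < w" "w < v"
  then have "w\<^sup>2 < 1" using assms by (simp add: abs_square_less_1 abs_less_iff)
  then show "\<exists>d. (B has_real_derivative d) (at w) \<and> 0 < d"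
    using B_deriv[of w] w assms by (intro exI[of _ "2 * sqrt (1 - w\<^sup>2)"]) simp
qed (rule continuous_on_subset[OF B_continuous], use assms in auto)

lemma Hx_y: "s \<in> I \<Longrightarrow> (H * x s)\<^sup>2 + (y s)\<^sup>2 = 1"
  using Py[of s] P_H[of s] by simp

lemma y_bounds: assumes "s \<in> I" shows "- 1 < y s" "y s < 1"
proof -
  have "0 < (H * x s)\<^sup>2" using xpos[OF assms] Hnz by simp
  then have "(y s)\<^sup>2 < 1" using Hx_y[OF assms] by linarith
  then show "- 1 < y s" "y s < 1" by (simp_all add: abs_square_less_1 abs_less_iff)
qed

lemma sqrt_y: "s \<in> I \<Longrightarrow> sqrt (1 - (y s)\<^sup>2) = \<bar>H\<bar> * x s"
proof -
  assume s: "s \<in> I"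
  have "1 - (y s)\<^sup>2 = (\<bar>H\<bar> * x s)\<^sup>2" using Hx_y[OF s] by (simp add: power_mult_distrib)
  then show ?thesis using xpos[OF s] by simp
qed

lemma x_y: "s \<in> I \<Longrightarrow> x s = sqrt (1 - (y s)\<^sup>2) / \<bar>H\<bar>"
  using sqrt_y Hnz by simp

lemma y'_W: assumes "s \<in> I" shows "(y has_real_derivative - (W s * H\<^sup>2)) (at s)"
proof -
  have "PP' (x s) = H" unfolding PP'_def using E0 by simp
  then have "P s * W s * PP' (x s) / x s = W s * H\<^sup>2"
    using xpos[OF assms] by (simp add: P_H[OF assms] power2_eq_square)
  then show ?thesis using y'_PP[OF assms] by simp
qed

lemma y_less: assumes "a \<in> I" "b \<in> I" "a < b" shows "y b < y a"
proof (rule DERIV_neg_imp_decreasing[where f = y and a = a and b = b, OF assms(3)])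
  fix s assume "a \<le> s" "s \<le> b"
  then have s: "s \<in> I" using mem_is_interval_1_I[OF I(2) assms(1,2)] by blast
  have "0 < W s * H\<^sup>2" using Wpos[OF s] Hnz by simp
  then show "\<exists>d. (y has_real_derivative d) (at s) \<and> d < 0"
    using y'_W[OF s] by (intro exI[of _ "- (W s * H\<^sup>2)"]) simp
qed

text \<open>Dividing \<open>t' = W H x\<close> by \<open>y' = - W H^2\<close> gives
  \<open>dt / dy = - x / H\<close>, and \<open>x = sqrt (1 - y^2) / \<bar>H\<bar>\<close>. As
  \<open>B\<close> has derivative \<open>2 sqrt (1 - y^2)\<close>, the factor 2 reappears in the
  denominator.\<close>

lemma t_B: "\<exists>c. \<forall>s\<in>I. t s = c - sgn H * B (y s) / (2 * H\<^sup>2)"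
proof -
  define f where "f s = t s + sgn H / (2 * H\<^sup>2) * B (y s)" for s
  have "(f has_real_derivative 0) (at s)" if s: "s \<in> I" for s
  proof -
    have "(f has_real_derivative cos (\<sigma> s) + sgn H / (2 * H\<^sup>2) * (2 * sqrt (1 - (y s)\<^sup>2) * - (W s * H\<^sup>2))) (at s)"
      unfolding f_def[abs_def]
      by (intro DERIV_add t'[OF s] DERIV_cmult DERIV_chain2[OF B_deriv y'_W[OF s]] y_bounds[OF s])
    moreover have "cos (\<sigma> s) + sgn H / (2 * H\<^sup>2) * (2 * sqrt (1 - (y s)\<^sup>2) * - (W s * H\<^sup>2)) = 0"
      unfolding sqrt_y[OF s] cos_eq[OF s] P_H[OF s] using Hnz
      by (simp add: sgn_mult_abs[symmetric] field_simps) (simp add: sgn_if)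
    ultimately show ?thesis by simp
  qed
  then have "f s = f s'" if "s \<in> I" "s' \<in> I" for s s'
    using derivative_bound_interval[OF I(2), of f "\<lambda>_. 0" 0 s s'] that by simp
  then obtain c where "\<forall>s\<in>I. f s = c" by metis
  then have "\<forall>s\<in>I. t s = c - sgn H * B (y s) / (2 * H\<^sup>2)" by (auto simp: f_def)
  then show ?thesis ..
qed

text \<open>The smallest value of \<open>sqrt (1 - y^2) / \<bar>H\<bar>\<close>, the radius on the
  sphere, for \<open>y\<close> between \<open>v\<close> and \<open>w\<close>.\<close>

definition depth where "depth v w = sqrt (1 - max (v\<^sup>2) (w\<^sup>2)) / \<bar>H\<bar>"

lemma depth:
  assumes "-1 < v" "v < 1" "-1 < w" "w < 1"
  shows "0 < depth v w" "s \<in> I \<Longrightarrow> v \<le> y s \<Longrightarrow> y s \<le> w \<Longrightarrow> depth v w \<le> x s"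
proof -
  have "v\<^sup>2 < 1" "w\<^sup>2 < 1" using assms by (simp_all add: abs_square_less_1 abs_less_iff)
  then show "0 < depth v w" using Hnz by (simp add: depth_def)
  assume s: "s \<in> I" "v \<le> y s" "y s \<le> w"
  have "(y s)\<^sup>2 \<le> max (v\<^sup>2) (w\<^sup>2)"
  proof (cases "0 \<le> y s")
    case True
    then have "(y s)\<^sup>2 \<le> w\<^sup>2" using s(3) by (intro power_mono) auto
    then show ?thesis by simp
  next
    case False
    then have "(- y s)\<^sup>2 \<le> (- v)\<^sup>2" using s(2) by (intro power_mono) auto
    then show ?thesis by simp
  qed
  then show "depth v w \<le> x s" unfolding x_y[OF s(1)] depth_def using Hnz
    by (intro divide_right_mono real_sqrt_le_mono) auto
qed

lemma y_rate: "s \<in> I \<Longrightarrow> 0 < m \<Longrightarrow> m \<le> x s \<Longrightarrow> min m 1 * H\<^sup>2 \<le> W s * H\<^sup>2"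
  by (intro mult_right_mono W_ge) auto

text \<open>If \<open>y\<close> stayed above \<open>v\<close>, \<open>depth\<close> would bound the
  radius below and the solution would exist for all later parameters. Then \<open>y\<close> would
  decrease at a fixed rate forever, in contradiction to \<open>y > - 1\<close>.\<close>

lemma reach_below:
  assumes s0: "s0 \<in> I" and v: "-1 < v"
  shows "\<exists>s\<in>I. s0 \<le> s \<and> y s \<le> v"
proof (rule ccontr)
  assume "\<not> ?thesis"
  then have ge: "v < y s" if "s \<in> I" "s0 \<le> s" for s using that by force
  have le: "y s \<le> y s0" if "s \<in> I" "s0 \<le> s" for s
    using y_less[OF s0 that(1)] that(2) by (cases "s = s0") auto
  have v1: "v < 1" using ge[OF s0] y_bounds[OF s0] by simp
  define m where "m = depth v (y s0)"
  have m: "0 < m" "\<And>s. s \<in> I \<Longrightarrow> s0 \<le> s \<Longrightarrow> m \<le> x s"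
    using depth[OF v v1 y_bounds[OF s0]] ge le less_imp_le unfolding m_def by blast+
  have inI: "s \<in> I" if "s0 \<le> s" for s using extends_right[OF s0 m] that by blast
  define r where "r = min m 1 * H\<^sup>2"
  have r: "0 < r" using m(1) Hnz by (simp add: r_def)
  have "- y s0 + r * (s0 + 2 / r - s0) \<le> - y (s0 + 2 / r)"
  proof (rule derivative_ge_growth[where f = "\<lambda>s. - y s" and a = s0 and b = "s0 + 2 / r" and f' = "\<lambda>s. W s * H\<^sup>2"])
    show "((\<lambda>s. - y s) has_real_derivative W s * H\<^sup>2) (at s)" if "s0 \<le> s" for s
      using DERIV_minus[OF y'_W[OF inI[OF that]]] by simp
    show "r \<le> W s * H\<^sup>2" if "s0 \<le> s" for s
      unfolding r_def by (rule y_rate[OF inI[OF that] m(1) m(2)[OF inI[OF that] that]])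
  qed (use r in simp)
  then show False using r y_bounds[OF s0] y_bounds[OF inI, of "s0 + 2 / r"] by simp
qed

lemma reach_above:
  assumes s0: "s0 \<in> I" and v: "v < 1"
  shows "\<exists>s\<in>I. s \<le> s0 \<and> v \<le> y s"
proof (rule ccontr)
  assume "\<not> ?thesis"
  then have ge: "y s < v" if "s \<in> I" "s \<le> s0" for s using that by force
  have le: "y s0 \<le> y s" if "s \<in> I" "s \<le> s0" for s
    using y_less[OF that(1) s0] that(2) by (cases "s = s0") auto
  have v1: "-1 < v" using ge[OF s0] y_bounds[OF s0] by simp
  define m where "m = depth (y s0) v"
  have m: "0 < m" "\<And>s. s \<in> I \<Longrightarrow> s \<le> s0 \<Longrightarrow> m \<le> x s"
    using depth[OF y_bounds[OF s0] v1 v] ge le less_imp_le unfolding m_def by blast+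
  have inI: "s \<in> I" if "s \<le> s0" for s using extends_left[OF s0 m] that by blast
  define r where "r = min m 1 * H\<^sup>2"
  have r: "0 < r" using m(1) Hnz by (simp add: r_def)
  have "- y (s0 - 2 / r) + r * (s0 - (s0 - 2 / r)) \<le> - y s0"
  proof (rule derivative_ge_growth[where f = "\<lambda>s. - y s" and a = "s0 - 2 / r" and b = s0 and f' = "\<lambda>s. W s * H\<^sup>2"])
    show "((\<lambda>s. - y s) has_real_derivative W s * H\<^sup>2) (at s)" if "s \<le> s0" for s
      using DERIV_minus[OF y'_W[OF inI[OF that]]] by simp
    show "r \<le> W s * H\<^sup>2" if "s \<le> s0" for s
      unfolding r_def by (rule y_rate[OF inI[OF that] m(1) m(2)[OF inI[OF that] that]])
  qed (use r in simp)
  then show False using r y_bounds[OF s0] y_bounds[OF inI, of "s0 - 2 / r"] by simp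
qed

definition slope where "slope = 1 / (4 * (1 + 1 / H\<^sup>2))"

lemma slope_pos: "0 < slope"
  by (simp add: slope_def add_pos_nonneg)

text \<open>\<open>x P = (H x)^2 / H\<close> is at most \<open>1 / \<bar>H\<bar>\<close> in size, so
  \<open>sin_squared\<close> and \<open>y^2 \<ge> 1 / 4\<close> bound the square of the sine below
  by \<open>slope\<close>. The sine itself is at least its square in absolute value.\<close>

lemma steep:
  assumes s: "s \<in> I" and y: "1 / 2 \<le> \<bar>y s\<bar>"
  shows "slope \<le> \<bar>sin (\<sigma> s)\<bar>"
proof -
  have Hx1: "(H * x s)\<^sup>2 \<le> 1" using Hx_y[OF s] zero_le_power2[of "y s"] by linarith
  have "x s * P s = (H * x s)\<^sup>2 / H" using Hnz by (simp add: P_H[OF s] power2_eq_square)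
  then have "(x s * P s)\<^sup>2 = ((H * x s)\<^sup>2)\<^sup>2 / H\<^sup>2" by (simp only: power_divide)
  also have "\<dots> \<le> 1 / H\<^sup>2" by (intro divide_right_mono power_le_one Hx1) simp_all
  finally have "(y s)\<^sup>2 + (x s * P s)\<^sup>2 \<le> 1 + 1 / H\<^sup>2"
    using Hx_y[OF s] zero_le_power2[of "H * x s"] by linarith
  then have "(sin (\<sigma> s))\<^sup>2 * ((y s)\<^sup>2 + (x s * P s)\<^sup>2) \<le> (sin (\<sigma> s))\<^sup>2 * (1 + 1 / H\<^sup>2)"
    by (intro mult_left_mono) auto
  then have "(y s)\<^sup>2 \<le> (sin (\<sigma> s))\<^sup>2 * (1 + 1 / H\<^sup>2)" unfolding sin_squared[OF s] .
  moreover have "(1 / 2)\<^sup>2 \<le> \<bar>y s\<bar>\<^sup>2" using y by (intro power_mono) auto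
  then have "1 / 4 \<le> (y s)\<^sup>2" by (simp add: power_divide)
  ultimately have "1 / 4 \<le> (sin (\<sigma> s))\<^sup>2 * (1 + 1 / H\<^sup>2)" by linarith
  moreover have "1 / (4 * D) \<le> S" if "0 < D" "1 / 4 \<le> S * D" for S D :: real
    using that by (simp add: pos_divide_le_eq)
  moreover have "0 < 1 + 1 / H\<^sup>2" by (simp add: add_pos_nonneg)
  ultimately have "slope \<le> (sin (\<sigma> s))\<^sup>2" unfolding slope_def by blast
  also have "\<dots> = \<bar>sin (\<sigma> s)\<bar> * \<bar>sin (\<sigma> s)\<bar>" by (simp add: power2_eq_square)
  also have "\<dots> \<le> \<bar>sin (\<sigma> s)\<bar> * 1" by (rule mult_left_mono) simp_all
  finally show ?thesis by simp
qed

text \<open>Once \<open>y\<close> has passed \<open>- 1 / 2\<close> it stays below, and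
  \<open>x\<close> decreases at least at the rate \<open>slope\<close>; a positive radius allows
  this only for a finite time. The other end is symmetric.\<close>

lemma bounded: "bdd_above I" "bdd_below I"
proof -
  obtain s0 where s0: "s0 \<in> I" using I(3) by blast
  obtain p where p: "p \<in> I" "y p \<le> - 1 / 2" using reach_below[OF s0, of "- 1 / 2"] by auto
  have "s \<le> p + x p / slope" if s: "s \<in> I" for s
  proof (cases "p \<le> s")
    case True
    have "- x p + slope * (s - p) \<le> - x s"
    proof (rule derivative_ge_growth[where f = "\<lambda>s. - x s" and a = p and b = s and f' = "\<lambda>s. - sin (\<sigma> s)", OF True])
      fix r assume r: "p \<le> r" "r \<le> s"
      then have rI: "r \<in> I" using mem_is_interval_1_I[OF I(2) p(1) s] by blast
      show "((\<lambda>s. - x s) has_real_derivative - sin (\<sigma> r)) (at r)" by (rule DERIV_minus[OF x'[OF rI]])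
      have yr: "y r \<le> - 1 / 2" using y_less[OF p(1) rI] r p(2) by (cases "r = p") auto
      then have "sin (\<sigma> r) < 0" using sin_sign(2)[OF rI] by simp
      then show "slope \<le> - sin (\<sigma> r)" using steep[OF rI] yr by simp
    qed
    then have "slope * (s - p) \<le> x p" using xpos[OF s] by simp
    then show ?thesis using slope_pos by (simp add: field_simps)
  next
    case False
    have "0 < x p / slope" using xpos[OF p(1)] slope_pos by simp
    then show ?thesis using False by linarith
  qed
  then show "bdd_above I" by (rule bdd_aboveI)
  obtain q where q: "q \<in> I" "1 / 2 \<le> y q" using reach_above[OF s0, of "1 / 2"] by auto
  have "q - x q / slope \<le> s" if s: "s \<in> I" for s
  proof (cases "s \<le> q")
    case True
    have "x s + slope * (q - s) \<le> x q"
    proof (rule derivative_ge_growth[where f = x and a = s and b = q and f' = "\<lambda>s. sin (\<sigma> s)", OF True])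
      fix r assume r: "s \<le> r" "r \<le> q"
      then have rI: "r \<in> I" using mem_is_interval_1_I[OF I(2) s q(1)] by blast
      show "(x has_real_derivative sin (\<sigma> r)) (at r)" by (rule x'[OF rI])
      have yr: "1 / 2 \<le> y r" using y_less[OF rI q(1)] r q(2) by (cases "r = q") auto
      then have "0 < sin (\<sigma> r)" using sin_sign(1)[OF rI] by simp
      then show "slope \<le> sin (\<sigma> r)" using steep[OF rI] yr by simp
    qed
    then have "slope * (q - s) \<le> x q" using xpos[OF s] by simp
    then show ?thesis using slope_pos by (simp add: field_simps)
  next
    case False
    have "0 < x q / slope" using xpos[OF q(1)] slope_pos by simp
    then show ?thesis using False by linarith
  qed
  then show "bdd_below I" by (rule bdd_belowI)
qed

end

section \<open>Extension of the spherical curve to its two poles\<close>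

context spherical
begin

definition c where "c = (SOME c. \<forall>s\<in>I. t s = c - sgn H * B (y s) / (2 * H\<^sup>2))"
definition lo where "lo = Inf I"
definition hi where "hi = Sup I"

lemma t_y: "s \<in> I \<Longrightarrow> t s = c - sgn H * B (y s) / (2 * H\<^sup>2)"
  using someI_ex[OF t_B] unfolding c_def by blast

lemma I_eq: "I = {lo<..<hi}"
proof (intro subset_antisym subsetI)
  fix s assume s: "s \<in> I"
  obtain e where e: "0 < e" "ball s e \<subseteq> I" using I(1) s open_contains_ball by blast
  have "s - e / 2 \<in> I" "s + e / 2 \<in> I" using e by (auto simp: dist_real_def subset_eq)
  then have "lo \<le> s - e / 2" "s + e / 2 \<le> hi" unfolding lo_def hi_def
    using cInf_lower[OF _ bounded(2)] cSup_upper[OF _ bounded(1)] by blast+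
  then show "s \<in> {lo<..<hi}" using e(1) by simp
next
  fix s assume "s \<in> {lo<..<hi}"
  then obtain p q where "p \<in> I" "p < s" "q \<in> I" "s < q"
    unfolding lo_def hi_def using cInf_less_iff[OF I(3) bounded(2), of s] less_cSup_iff[OF I(3) bounded(1), of s] by auto
  then show "s \<in> I" using mem_is_interval_1_I[OF I(2), of p q s] by simp
qed

lemma I_iff: "s \<in> I \<longleftrightarrow> lo < s \<and> s < hi"
  using arg_cong[OF I_eq, of "\<lambda>S. s \<in> S"] by (simp only: greaterThanLessThan_iff)

lemma lo_hi: "lo < hi"
  using I(3) I_iff less_trans by blast

lemma closure_I: "closure I = {lo..hi}"
proof -
  have "closure {lo<..<hi} = {lo..hi}" using lo_hi by simp
  then show ?thesis by (simp only: I_eq[symmetric])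
qed

text \<open>The extension of \<open>y\<close> to a decreasing bijection of the real line.\<close>

definition Y where "Y s = (if s \<le> lo then 1 + (lo - s) else if s < hi then y s else - 1 - (s - hi))"

lemma Y_I: "s \<in> I \<Longrightarrow> Y s = y s"
  by (simp add: Y_def I_iff)

lemma Y_ends: "Y lo = 1" "Y hi = - 1"
  using lo_hi by (simp_all add: Y_def)

lemma Y_less: assumes "a < b" shows "Y b < Y a"
proof -
  have "a \<le> lo \<or> hi \<le> a \<or> a \<in> I" "b \<le> lo \<or> hi \<le> b \<or> b \<in> I" by (auto simp: I_iff)
  then show ?thesis
    using assms y_less[of a b] y_bounds[of a] y_bounds[of b] lo_hi Y_I
    by (auto simp: Y_def I_iff)
qed

lemma Y_surj: "range Y = UNIV"
proof -
  have "v \<in> range Y" for v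
  proof -
    consider "1 \<le> v" | "v \<le> - 1" | "- 1 < v" "v < 1" by linarith
    then show ?thesis
    proof cases
      case 1
      then have "Y (lo - (v - 1)) = v" by (simp add: Y_def)
      then show ?thesis by (metis rangeI)
    next
      case 2
      then have "Y (hi + (- 1 - v)) = v" using lo_hi by (simp add: Y_def)
      then show ?thesis by (metis rangeI)
    next
      case 3
      obtain s0 where s0: "s0 \<in> I" using I(3) by blast
      obtain p where p: "p \<in> I" "y p \<le> v" using reach_below[OF s0 3(1)] by blast
      obtain q where q: "q \<in> I" "v \<le> y q" using reach_above[OF s0 3(2)] by blast
      have "connected (y ` I)"
        using connected_continuous_image[OF y_continuous] I(2) by (simp add: is_interval_connected_1)
      then have "v \<in> y ` I" using connectedD_interval[of "y ` I" "y p" "y q" v] p q by blast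
      then obtain s where "s \<in> I" "v = y s" by blast
      then have "v = Y s" by (simp add: Y_I)
      then show ?thesis by simp
    qed
  qed
  then show ?thesis by blast
qed

lemma Y_continuous: "continuous_on UNIV Y"
  by (rule decreasing_surjection_continuous[OF Y_less Y_surj])

lemma Y_inj: "inj Y"
  by (rule injI) (metis Y_less less_irrefl linorder_less_linear)

definition G where "G = inv Y"

lemma G_Y: "G (Y s) = s" and Y_G: "Y (G v) = v"
  using inv_f_f[OF Y_inj] f_inv_into_f[of _ Y UNIV] Y_surj by (auto simp: G_def)

lemma Y_iff: "Y a < Y b \<longleftrightarrow> b < a" "Y a \<le> Y b \<longleftrightarrow> b \<le> a"
  using Y_less[of a b] Y_less[of b a] by (cases a b rule: linorder_cases; simp)+

lemma G_continuous: "continuous_on UNIV G"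
proof (rule decreasing_surjection_continuous)
  show "G b < G a" if "a < b" for a b using Y_iff(1)[of "G a" "G b"] that by (simp add: Y_G)
  show "range G = UNIV" by (metis G_Y surj_def)
qed

lemma Y_closed: "s \<in> {lo..hi} \<longleftrightarrow> - 1 \<le> Y s \<and> Y s \<le> 1"
  using Y_iff(2)[of hi s] Y_iff(2)[of s lo] by (auto simp: Y_ends)

text \<open>The closed formulas for \<open>x\<close> and \<open>t\<close> in terms of
  \<open>y\<close>, with \<open>Y\<close> in place of \<open>y\<close>: they prescribe values at the
  two ends, where the solution itself is not defined.\<close>

definition xe where "xe s = sqrt (1 - (Y s)\<^sup>2) / \<bar>H\<bar>"
definition te where "te s = c - sgn H * B (Y s) / (2 * H\<^sup>2)"

lemma extended: "s \<in> I \<Longrightarrow> xe s = x s" "s \<in> I \<Longrightarrow> te s = t s"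
  using x_y t_y by (simp_all add: xe_def te_def Y_I)

lemma extended_continuous: "continuous_on {lo..hi} xe" "continuous_on {lo..hi} te"
proof -
  have Yc: "continuous_on {lo..hi} Y" using Y_continuous continuous_on_subset by blast
  then show "continuous_on {lo..hi} xe" unfolding xe_def[abs_def] using Hnz by (intro continuous_intros) auto
  have "continuous_on {lo..hi} (\<lambda>s. B (Y s))"
    by (rule continuous_on_compose2[OF B_continuous Yc]) (use Y_closed in auto)
  then show "continuous_on {lo..hi} te" unfolding te_def[abs_def] using Hnz by (intro continuous_intros) auto
qed

lemma xe_zero: "s \<in> {lo..hi} \<Longrightarrow> xe s = 0 \<longleftrightarrow> s = lo \<or> s = hi"
proof -
  assume "s \<in> {lo..hi}"
  have "xe s = 0 \<longleftrightarrow> (Y s)\<^sup>2 = 1" using Hnz by (simp add: xe_def)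
  also have "\<dots> \<longleftrightarrow> Y s = Y lo \<or> Y s = Y hi" unfolding power2_eq_1_iff Y_ends ..
  also have "\<dots> \<longleftrightarrow> s = lo \<or> s = hi" using inj_eq[OF Y_inj] by blast
  finally show ?thesis .
qed

lemma limits:
  assumes "e \<in> {lo, hi}"
  shows "(x \<longlongrightarrow> 0) (at e within I)" "(t \<longlongrightarrow> te e) (at e within I)" "at e within I \<noteq> bot"
proof -
  have e: "e \<in> {lo..hi}" "xe e = 0" using assms lo_hi xe_zero by auto
  have sub: "I \<subseteq> {lo..hi}" by (auto simp: I_iff)
  have "(xe \<longlongrightarrow> 0) (at e within I)" "(te \<longlongrightarrow> te e) (at e within I)"
    using extended_continuous e sub unfolding continuous_on_def by (metis tendsto_within_subset)+
  then show "(x \<longlongrightarrow> 0) (at e within I)" "(t \<longlongrightarrow> te e) (at e within I)"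
    using Lim_transform_within[OF _ zero_less_one] extended by metis+
  have "e \<notin> I" using assms by (auto simp: I_iff)
  then show "at e within I \<noteq> bot" using e(1) by (simp add: at_within_eq_bot_iff closure_I)
qed

lemma ends: "axis_ends I x t = {lo, hi}"
proof -
  have "closure I - I = {lo, hi}" unfolding closure_I using lo_hi by (auto simp: I_iff)
  moreover have "\<exists>u. (profile_curve x t \<longlongrightarrow> (0, u)) (at e within I)" if "e \<in> {lo, hi}" for e
    unfolding profile_curve_def[abs_def] using tendsto_Pair[OF limits(1,2)[OF that]] by blast
  ultimately show ?thesis unfolding axis_ends_def by blast
qed

lemma Lim_t: "e \<in> {lo, hi} \<Longrightarrow> Lim (at e within I) t = te e"
  by (rule tendsto_Lim[OF limits(3,2)])

lemma curve_closure: "closure (profile_curve x t ` I) = (\<lambda>s. (xe s, te s)) ` {lo..hi}" (is "?L = ?R")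
proof
  have "compact ?R"
    by (intro compact_continuous_image continuous_intros extended_continuous compact_Icc)
  moreover have "profile_curve x t ` I \<subseteq> ?R"
  proof
    fix q assume "q \<in> profile_curve x t ` I"
    then obtain s where s: "s \<in> I" "q = (xe s, te s)" using extended by (auto simp: profile_curve_def)
    then show "q \<in> ?R" by (auto simp: I_iff)
  qed
  ultimately show "?L \<subseteq> ?R" by (intro closure_minimal compact_imp_closed)
  show "?R \<subseteq> ?L"
  proof
    fix q assume "q \<in> ?R"
    then obtain s where s: "s \<in> {lo..hi}" "q = (xe s, te s)" by blast
    show "q \<in> ?L"
    proof (cases "s \<in> I")
      case True
      then have "q \<in> profile_curve x t ` I" using s extended by (auto simp: profile_curve_def)
      then show ?thesis by (rule subsetD[OF closure_subset])
    next
      case False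
      then have e: "s \<in> {lo, hi}" using s(1) by (auto simp: I_iff)
      then have "xe s = 0" using s(1) xe_zero by auto
      then have "(profile_curve x t \<longlongrightarrow> q) (at s within I)"
        unfolding profile_curve_def[abs_def] s(2) using tendsto_Pair[OF limits(1,2)[OF e]] by simp
      moreover have "\<forall>\<^sub>F r in at s within I. profile_curve x t r \<in> ?L"
        unfolding eventually_at_filter
        by (intro always_eventually allI impI subsetD[OF closure_subset] imageI)
      ultimately show ?thesis using Lim_in_closed_set[OF closed_closure _ limits(3)[OF e]] by blast
    qed
  qed
qed

lemma generating_curve_spherical: "generating_curve I x t = (\<lambda>s. (xe s, te s)) ` {lo..hi}"
proof -
  have "s \<in> I \<or> xe s = 0" if "s \<in> {lo..hi}" for s using that xe_zero[OF that] by (auto simp: I_iff)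
  then have "(xe s, te s) \<in> generating_curve I x t" if "s \<in> {lo..hi}" for s
    using that extended[of s] unfolding generating_curve_def curve_closure
    by (fastforce simp: profile_curve_def)
  moreover have "generating_curve I x t \<subseteq> closure (profile_curve x t ` I)"
    unfolding generating_curve_def using closure_subset[of "profile_curve x t ` I"] by auto
  ultimately show ?thesis unfolding curve_closure by blast
qed

lemma image_spherical:
  "revolution_map I t ` (revolution_source I x t :: (real \<times> (complex^'n::finite)) set) = revolve (generating_curve I x t)"
proof (rule image_revolution_source)
  have "{u. (0, u) \<in> closure (profile_curve x t ` I)} = te ` {lo, hi}"
    unfolding curve_closure
  proof (intro subset_antisym subsetI)
    fix u assume "u \<in> {u. (0, u) \<in> (\<lambda>s. (xe s, te s)) ` {lo..hi}}"
    then obtain s where s: "s \<in> {lo..hi}" "xe s = 0" "u = te s" by auto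
    then have "s \<in> {lo, hi}" using xe_zero[OF s(1)] by simp
    then show "u \<in> te ` {lo, hi}" unfolding s(3) by (rule imageI)
  next
    fix u assume "u \<in> te ` {lo, hi}"
    then obtain e where e: "e \<in> {lo, hi}" "u = te e" by blast
    then have e': "e \<in> {lo..hi}" using lo_hi by auto
    then have "(0, u) = (xe e, te e)" using e xe_zero[OF e'] by simp
    then have "(0, u) \<in> (\<lambda>s. (xe s, te s)) ` {lo..hi}" using e' by (rule image_eqI)
    then show "u \<in> {u. (0, u) \<in> (\<lambda>s. (xe s, te s)) ` {lo..hi}}" by simp
  qed
  also have "\<dots> = (\<lambda>a. Lim (at a within I) t) ` {lo, hi}" by (simp add: Lim_t)
  finally show "{u. (0, u) \<in> closure (profile_curve x t ` I)} = (\<lambda>a. Lim (at a within I) t) ` axis_ends I x t"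
    unfolding ends .
qed

text \<open>The value \<open>h = Y s\<close> serves as the height coordinate on the unit sphere: a
  point \<open>(z, h)\<close> of it has \<open>norm z = sqrt (1 - h^2)\<close>, which is
  \<open>\<bar>H\<bar>\<close> times the radius of the curve at \<open>s\<close>. Only the height
  has to be distorted, through the strictly monotone \<open>B\<close>.\<close>

lemma sphere_image:
  "revolve (generating_curve I x t) =
    (\<lambda>p. ((1 / \<bar>H\<bar>) *\<^sub>R fst p, c - sgn H * B (snd p) / (2 * H\<^sup>2))) ` sphere (0 :: 'n::finite heis) 1"
  (is "_ = ?\<Psi> ` _")
proof (intro subset_antisym subsetI)
  fix p :: "'n heis" assume "p \<in> revolve (generating_curve I x t)"
  then obtain s \<omega> where s: "s \<in> {lo..hi}" "norm \<omega> = 1" "p = (xe s *\<^sub>R \<omega>, te s)"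
    unfolding revolve_def generating_curve_spherical by blast
  have Y2: "0 \<le> 1 - (Y s)\<^sup>2" using s(1) unfolding Y_closed by (simp add: abs_square_le_1 abs_le_iff)
  have "p = ?\<Psi> (sqrt (1 - (Y s)\<^sup>2) *\<^sub>R \<omega>, Y s)" unfolding s(3) by (simp add: xe_def te_def)
  moreover have "(sqrt (1 - (Y s)\<^sup>2) *\<^sub>R \<omega>, Y s) \<in> sphere 0 1"
    using s(2) Y2 by (simp add: norm_Pair)
  ultimately show "p \<in> ?\<Psi> ` sphere 0 1" by blast
next
  fix p :: "'n heis" assume "p \<in> ?\<Psi> ` sphere 0 1"
  then obtain z h where zh: "norm (z, h) = 1" "p = ?\<Psi> (z, h)" by force
  have sq: "(norm z)\<^sup>2 + h\<^sup>2 = 1" using zh(1) by (simp add: norm_Pair)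
  then have "h\<^sup>2 \<le> 1" using zero_le_power2[of "norm z"] by linarith
  then have "- 1 \<le> h \<and> h \<le> 1" by (simp add: abs_square_le_1 abs_le_iff)
  then have G: "G h \<in> {lo..hi}" unfolding Y_closed Y_G .
  have "sqrt (1 - h\<^sup>2) = norm z" using sq by (intro real_sqrt_unique) auto
  then have x: "xe (G h) = norm z / \<bar>H\<bar>" by (simp add: xe_def Y_G)
  obtain \<omega>0 :: "complex^'n" where \<omega>0: "norm \<omega>0 = 1" using vector_choose_size[of 1] by auto
  define \<omega> where "\<omega> = (if z = 0 then \<omega>0 else sgn z)"
  have \<omega>: "norm \<omega> = 1" using \<omega>0 by (simp add: \<omega>_def norm_sgn)
  have "norm z *\<^sub>R \<omega> = z" by (simp add: \<omega>_def sgn_div_norm)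
  then have "(1 / \<bar>H\<bar>) *\<^sub>R z = (1 / \<bar>H\<bar>) *\<^sub>R (norm z *\<^sub>R \<omega>)" by simp
  then have "p = (xe (G h) *\<^sub>R \<omega>, te (G h))" unfolding x zh(2) by (simp add: te_def Y_G)
  then show "p \<in> revolve (generating_curve I x t)"
    unfolding revolve_def generating_curve_spherical using G \<omega> by blast
qed

lemma sphere:
  "compact (revolve (generating_curve I x t) :: 'n::finite heis set)"
  "(revolve (generating_curve I x t) :: 'n heis set) homeomorphic sphere (0 :: 'n heis) 1"
proof -
  let ?\<Psi> = "\<lambda>p :: 'n heis. ((1 / \<bar>H\<bar>) *\<^sub>R fst p, c - sgn H * B (snd p) / (2 * H\<^sup>2))"
  have h: "- 1 \<le> snd p \<and> snd p \<le> 1" if "p \<in> sphere (0 :: 'n heis) 1" for p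
    using norm_snd_le[of "snd p" "fst p"] that by (simp add: abs_le_iff)
  have "continuous_on (sphere (0 :: 'n heis) 1) (\<lambda>p. B (snd p))"
    by (rule continuous_on_compose2[OF B_continuous]) (use h in \<open>auto intro!: continuous_intros\<close>)
  then have cont: "continuous_on (sphere 0 1) ?\<Psi>" using Hnz by (intro continuous_intros) auto
  have inj: "inj_on ?\<Psi> (sphere 0 1)"
  proof (rule inj_onI)
    fix p q assume pq: "p \<in> sphere (0 :: 'n heis) 1" "q \<in> sphere (0 :: 'n heis) 1" "?\<Psi> p = ?\<Psi> q"
    then have "fst p = fst q" "B (snd p) = B (snd q)" using Hnz by (simp_all add: sgn_zero_iff)
    moreover have "snd p = snd q"
      using B_less[of "snd p" "snd q"] B_less[of "snd q" "snd p"] h[OF pq(1)] h[OF pq(2)] calculation(2)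
      by (metis less_irrefl linorder_less_linear)
    ultimately show "p = q" by (simp add: prod_eq_iff)
  qed
  show "compact (revolve (generating_curve I x t) :: 'n heis set)"
    unfolding sphere_image by (rule compact_continuous_image[OF cont compact_sphere])
  have "sphere (0 :: 'n heis) 1 homeomorphic (revolve (generating_curve I x t) :: 'n heis set)"
    unfolding sphere_image by (rule homeomorphic_compact[OF compact_sphere cont refl inj])
  then show "(revolve (generating_curve I x t) :: 'n heis set) homeomorphic sphere (0 :: 'n heis) 1"
    by (rule homeomorphic_sym[THEN iffD1])
qed

end

section \<open>The hypersurface near the poles of the sphere\<close>

context spherical
begin

lemma B_one: "B 1 = pi / 2"
  by (simp add: B_def)

lemma B_minus: "\<bar>v\<bar> \<le> 1 \<Longrightarrow> B (- v) = - B v"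
  by (simp add: B_def arcsin_minus abs_le_iff)

text \<open>Exchanging \<open>v\<close> and \<open>sqrt (1 - v^2)\<close> leaves the product in
  \<open>B\<close> unchanged and turns the arcsine into its complement to \<open>pi / 2\<close>.
  With \<open>v = \<bar>H\<bar> x\<close> this rewrites the height, given in terms of
  \<open>y\<close>, as a function of the radius.\<close>

lemma B_complement:
  assumes v: "0 \<le> v" "v \<le> 1"
  shows "B (sqrt (1 - v\<^sup>2)) = B 1 - (2 * arcsin v - B v)"
proof -
  have "v\<^sup>2 \<le> 1" using v by (simp add: power_le_one)
  have "arcsin (sqrt (1 - v\<^sup>2)) = arccos v"
  proof -
    have "sin (arccos v) = sqrt (1 - v\<^sup>2)" using v by (intro sin_arccos) auto
    moreover have "0 \<le> arccos v" "arccos v \<le> pi / 2" using v arccos_le_pi2[of v] arccos_lbound[of v] by auto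
    ultimately show ?thesis using arcsin_sin[of "arccos v"] by (metis minus_divide_left neg_le_0_iff_le order_trans pi_half_ge_zero)
  qed
  also have "arccos v = pi / 2 - arcsin v" using v arcsin_arccos_eq[of v] by simp
  finally have a: "arcsin (sqrt (1 - v\<^sup>2)) = pi / 2 - arcsin v" .
  have "sqrt (1 - (sqrt (1 - v\<^sup>2))\<^sup>2) = v" using v \<open>v\<^sup>2 \<le> 1\<close> by simp
  then show ?thesis unfolding B_one by (simp add: B_def a)
qed

text \<open>With \<open>q = sqrt (1 - (H r)^2)\<close> the derivatives of the arcsine and of
  \<open>B\<close> combine to \<open>2 / q - 2 q = 2 (H r)^2 / q\<close>. This supplies the factor
  \<open>r * r\<close> that the pole chart requires.\<close>

lemma k_deriv:
  assumes r: "(H * r)\<^sup>2 < 1"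
  shows "((\<lambda>r. \<epsilon> * (2 * arcsin (H * r) - B (H * r)) / (2 * H\<^sup>2)) has_real_derivative
    \<epsilon> * H / sqrt (1 - H\<^sup>2 * (r * r)) * r * r) (at r)"
proof -
  have b: "- 1 < H * r" "H * r < 1" using r by (simp_all add: abs_square_less_1 abs_less_iff)
  define q where "q = sqrt (1 - (H * r)\<^sup>2)"
  have q: "0 < q" "q\<^sup>2 = 1 - (H * r)\<^sup>2" using r by (simp_all add: q_def)
  have "((\<lambda>v. 2 * arcsin v - B v) has_real_derivative 2 * inverse q - 2 * q) (at (H * r))"
    unfolding q_def by (intro DERIV_diff DERIV_cmult DERIV_arcsin B_deriv b)
  moreover have "((\<lambda>r. H * r) has_real_derivative H) (at r)" by (auto intro!: derivative_eq_intros)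
  ultimately have "((\<lambda>r. 2 * arcsin (H * r) - B (H * r)) has_real_derivative (2 * inverse q - 2 * q) * H) (at r)"
    by (rule DERIV_chain2)
  from DERIV_cmult[OF this, of "\<epsilon> / (2 * H\<^sup>2)"]
  have "((\<lambda>r. \<epsilon> * (2 * arcsin (H * r) - B (H * r)) / (2 * H\<^sup>2)) has_real_derivative
    \<epsilon> / (2 * H\<^sup>2) * ((2 * inverse q - 2 * q) * H)) (at r)" by simp
  moreover have "\<epsilon> / (2 * H\<^sup>2) * ((2 * inverse q - 2 * q) * H) = \<epsilon> * H / q * r * r"
  proof -
    have "2 * inverse q - 2 * q = 2 * (1 - q\<^sup>2) / q" using q(1) by (simp add: field_simps power2_eq_square)
    also have "\<dots> = 2 * (H * r)\<^sup>2 / q" by (simp add: q(2))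
    finally show ?thesis using Hnz by (simp add: power_mult_distrib power2_eq_square)
  qed
  moreover have "q = sqrt (1 - H\<^sup>2 * (r * r))" by (simp add: q_def power_mult_distrib power2_eq_square)
  ultimately show ?thesis by simp
qed

lemma \<mu>_deriv:
  assumes w: "H\<^sup>2 * w < 1"
  shows "((\<lambda>w. \<epsilon> * H / sqrt (1 - H\<^sup>2 * w)) has_real_derivative
    \<epsilon> * H * (H\<^sup>2 / (2 * (sqrt (1 - H\<^sup>2 * w)) ^ 3))) (at w)"
proof -
  define q where "q = sqrt (1 - H\<^sup>2 * w)"
  have q: "0 < q" using w by (simp add: q_def)
  have "((\<lambda>w. sqrt (1 - H\<^sup>2 * w)) has_real_derivative inverse q / 2 * (- (H\<^sup>2))) (at w)"
    unfolding q_def by (rule DERIV_chain2[OF DERIV_real_sqrt]) (use w in \<open>auto intro!: derivative_eq_intros\<close>)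
  from DERIV_divide[OF DERIV_const this, of "\<epsilon> * H"] q
  have "((\<lambda>w. \<epsilon> * H / sqrt (1 - H\<^sup>2 * w)) has_real_derivative
     (0 * q - \<epsilon> * H * (inverse q / 2 * (- (H\<^sup>2)))) / (q * q)) (at w)" unfolding q_def by simp
  moreover have "(0 * q - \<epsilon> * H * (inverse q / 2 * (- (H\<^sup>2)))) / (q * q) = \<epsilon> * H * (H\<^sup>2 / (2 * q ^ 3))"
    using q by (simp add: field_simps power3_eq_cube)
  ultimately show ?thesis unfolding q_def by simp
qed

lemma pole_spherical:
  assumes card: "CARD('n::finite) = n" and e: "e \<in> {lo, hi}"
  shows "\<exists>V S G'. openin (top_of_set (revolution_source I x t :: (real \<times> (complex^'n)) set)) V \<and> (e, 0) \<in> V \<and>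
     homeomorphism V S (revolution_map I t) G' \<and>
     C2_hypersurface S \<and> unit_normal heis_metric S (normal_field Y \<circ> G') \<and>
     (\<forall>p \<in> S - singular_set S (normal_field Y \<circ> G'). has_mean_curvature S (normal_field Y \<circ> G') p H)"
proof -
  define \<epsilon> where "\<epsilon> = Y e"
  have \<epsilon>: "\<epsilon> = 1 \<or> \<epsilon> = - 1" using e Y_ends by (auto simp: \<epsilon>_def)
  have \<epsilon>2: "\<epsilon> * \<epsilon> = 1" "\<epsilon>\<^sup>2 = 1" using \<epsilon> by auto
  \<comment> \<open>\<open>m\<close> is the equator, where \<open>y = 0\<close>; \<open>O'\<close>
    is the half-line on the side of the pole \<open>e\<close>, on which \<epsilon> is the sign of
    \<open>Y\<close>.\<close>
  define m where "m = G 0"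
  have m: "lo < m" "m < hi"
    using Y_iff(1)[of m lo] Y_iff(1)[of hi m] by (simp_all add: Y_ends m_def Y_G)
  define O' where "O' = {s. 0 < \<epsilon> * (m - s)}"
  have O'_iff: "s \<in> O' \<longleftrightarrow> 0 < \<epsilon> * Y s" for s
    using \<epsilon> Y_iff(1)[of m s] Y_iff(1)[of s m] by (auto simp: O'_def m_def Y_G)
  define Jp where "Jp = O' \<inter> I"
  have Jp: "s \<in> I" "0 < \<epsilon> * y s" if "s \<in> Jp" for s
    using that O'_iff[of s] Y_I[of s] by (auto simp: Jp_def)
  have y\<epsilon>: "y s = \<epsilon> * sqrt (1 - (H * x s)\<^sup>2)" if "s \<in> Jp" for s
  proof -
    have "(\<epsilon> * y s)\<^sup>2 = 1 - (H * x s)\<^sup>2" using Hx_y[OF Jp(1)[OF that]] by (simp add: power_mult_distrib \<epsilon>2)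
    then have "sqrt (1 - (H * x s)\<^sup>2) = \<epsilon> * y s" using Jp(2)[OF that] by (intro real_sqrt_unique) auto
    then show ?thesis by (simp add: mult.assoc[symmetric] \<epsilon>2)
  qed
  have H2: "(1 / \<bar>H\<bar>) * (1 / \<bar>H\<bar>) = 1 / H\<^sup>2" by (simp add: power2_eq_square)
  have small: "(H * r)\<^sup>2 < 1" if "\<bar>r\<bar> < 1 / \<bar>H\<bar>" for r
  proof -
    have "\<bar>H * r\<bar> < 1" using that Hnz by (simp add: abs_mult field_simps)
    then show ?thesis by (simp add: abs_square_less_1)
  qed
  show ?thesis
  \<comment> \<open>On this side \<open>y = \<epsilon> sqrt (1 - (H x)^2)\<close>, and the given
    \<xi> solves this relation for the parameter by means of \<open>G\<close>. The function
    \<open>k\<close> is the height above the pole as a function of the radius, found from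
    \<open>B_complement\<close>; the chart extends up to the radius \<open>1 / \<bar>H\<bar>\<close>
    of the equator.\<close>
  proof (rule pole_chart[where \<epsilon> = \<epsilon> and \<delta> = "1 / \<bar>H\<bar>" and k = "\<lambda>r. \<epsilon> * (2 * arcsin (H * r) - B (H * r)) / (2 * H\<^sup>2)"
        and \<mu> = "\<lambda>w. \<epsilon> * H / sqrt (1 - H\<^sup>2 * w)"
        and ?\<mu>1.0 = "\<lambda>w. \<epsilon> * H * (H\<^sup>2 / (2 * (sqrt (1 - H\<^sup>2 * w)) ^ 3))"
        and O' = O' and Jp = Jp and \<xi> = "\<lambda>r. G (\<epsilon> * sqrt (1 - (H * r)\<^sup>2))" and ?u0.0 = "te e", OF card])
    show "e \<in> axis_ends I x t" using e by (simp add: ends)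
    show "open O'" unfolding O'_def by (intro open_Collect_less continuous_intros)
    show "e \<in> O'" by (simp add: O'_iff \<epsilon>_def[symmetric] \<epsilon>2)
    show "O' \<inter> I = Jp" by (simp add: Jp_def)
    show "O' \<inter> axis_ends I x t = {e}" using e by (auto simp: ends O'_iff \<epsilon>_def Y_ends)
    show "0 < 1 / \<bar>H\<bar>" using Hnz by simp
    show "x ` Jp = {0<..<1 / \<bar>H\<bar>}"
    proof (intro subset_antisym subsetI)
      fix r assume "r \<in> x ` Jp"
      then obtain s where s: "s \<in> Jp" "r = x s" by blast
      have "0 < (y s)\<^sup>2" using Jp(2)[OF s(1)] by auto
      then have "(H * x s)\<^sup>2 < 1" using Hx_y[OF Jp(1)[OF s(1)]] by linarith
      then have "\<bar>H * x s\<bar> < 1" by (simp add: abs_square_less_1)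
      then show "r \<in> {0<..<1 / \<bar>H\<bar>}"
        using xpos[OF Jp(1)[OF s(1)]] Hnz by (simp add: s(2) abs_mult field_simps)
    next
      fix r assume r: "r \<in> {0<..<1 / \<bar>H\<bar>}"
      then have sm: "(H * r)\<^sup>2 < 1" using small by simp
      define v where "v = \<epsilon> * sqrt (1 - (H * r)\<^sup>2)"
      have v2: "v\<^sup>2 = 1 - (H * r)\<^sup>2" using sm by (simp add: v_def power_mult_distrib \<epsilon>2)
      have "0 < (H * r)\<^sup>2" using r Hnz by simp
      then have "v\<^sup>2 < 1" using v2 by linarith
      then have v1: "- 1 < v" "v < 1" by (simp_all add: abs_square_less_1 abs_less_iff)
      have GI: "G v \<in> I"
        using Y_iff(1)[of "G v" lo] Y_iff(1)[of hi "G v"] v1 by (simp add: I_iff Y_G Y_ends)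
      have "\<epsilon> * Y (G v) = sqrt (1 - (H * r)\<^sup>2)" by (simp add: Y_G v_def mult.assoc[symmetric] \<epsilon>2)
      then have "G v \<in> Jp" using GI sm by (simp add: Jp_def O'_iff)
      moreover have "x (G v) = \<bar>H * r\<bar> / \<bar>H\<bar>"
        unfolding extended(1)[OF GI, symmetric] xe_def Y_G v2 by simp
      then have "x (G v) = r" using r Hnz by (simp add: abs_mult)
      ultimately show "r \<in> x ` Jp" by force
    qed
    show "G (\<epsilon> * sqrt (1 - (H * 0)\<^sup>2)) = e" by (simp add: \<epsilon>_def G_Y)
    show "G (\<epsilon> * sqrt (1 - (H * x s)\<^sup>2)) = s" if "s \<in> Jp" for s
      unfolding y\<epsilon>[OF that, symmetric] using Y_I[OF Jp(1)[OF that]] G_Y by metis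
    show "continuous_on {0..<1 / \<bar>H\<bar>} (\<lambda>r. G (\<epsilon> * sqrt (1 - (H * r)\<^sup>2)))"
      by (rule continuous_on_compose2[OF G_continuous]) (auto intro!: continuous_intros)
    show "\<epsilon> = 1 \<or> \<epsilon> = - 1" by (rule \<epsilon>)
    show "t s = te e + \<epsilon> * (2 * arcsin (H * x s) - B (H * x s)) / (2 * H\<^sup>2)" if "s \<in> Jp" for s
    proof -
      define v where "v = \<bar>H\<bar> * x s"
      define g where "g = 2 * arcsin v - B v"
      have s: "s \<in> I" using Jp(1)[OF that] .
      have "(H * x s)\<^sup>2 \<le> 1" using Hx_y[OF s] zero_le_power2[of "y s"] by linarith
      then have "\<bar>H * x s\<bar> \<le> 1" by (simp add: abs_square_le_1)
      then have v: "0 \<le> v" "v \<le> 1" using xpos[OF s] by (simp_all add: v_def abs_mult)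
      have v2: "v\<^sup>2 = (H * x s)\<^sup>2" by (simp add: v_def power_mult_distrib)
      have ve: "H * x s = sgn H * v" by (simp add: v_def mult.assoc[symmetric] sgn_mult_abs)
      have sg: "sgn H = 1 \<or> sgn H = - 1" using Hnz by (simp add: sgn_if)
      have odd: "2 * arcsin (H * x s) - B (H * x s) = sgn H * g"
        using sg v unfolding ve g_def by (auto simp: B_minus arcsin_minus)
      have "v\<^sup>2 \<le> 1" using v by (simp add: power_le_one)
      then have "B (y s) = \<epsilon> * B (sqrt (1 - v\<^sup>2))"
        unfolding y\<epsilon>[OF that] v2[symmetric] using \<epsilon> by (auto simp: B_minus)
      then have By: "B (y s) = \<epsilon> * (B 1 - g)" unfolding B_complement[OF v] g_def .
      have Be: "B (Y e) = \<epsilon> * B 1" unfolding \<epsilon>_def[symmetric] using \<epsilon> by (auto simp: B_minus)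
      show ?thesis unfolding t_y[OF s] te_def By Be odd by (simp add: field_simps diff_divide_distrib)
    qed
    show "\<epsilon> * (2 * arcsin (H * 0) - B (H * 0)) / (2 * H\<^sup>2) = 0" by (simp add: B_def)
    show "Lim (at e within I) t = te e" by (rule Lim_t[OF e])
    show "((\<lambda>r. \<epsilon> * (2 * arcsin (H * r) - B (H * r)) / (2 * H\<^sup>2)) has_real_derivative
        \<epsilon> * H / sqrt (1 - H\<^sup>2 * (r * r)) * r * r) (at r)" if "\<bar>r\<bar> < 1 / \<bar>H\<bar>" for r
      by (rule k_deriv[OF small[OF that]])
    have w1: "H\<^sup>2 * w < 1" if "w < 1 / \<bar>H\<bar> * (1 / \<bar>H\<bar>)" for w
      using that Hnz unfolding H2 by (simp add: field_simps)
    show "((\<lambda>w. \<epsilon> * H / sqrt (1 - H\<^sup>2 * w)) has_real_derivative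
        \<epsilon> * H * (H\<^sup>2 / (2 * (sqrt (1 - H\<^sup>2 * w)) ^ 3))) (at w)" if "w < 1 / \<bar>H\<bar> * (1 / \<bar>H\<bar>)" for w
      by (rule \<mu>_deriv[OF w1[OF that]])
    have nz: "2 * sqrt (1 - H\<^sup>2 * w) ^ 3 \<noteq> 0" if "w < 1 / \<bar>H\<bar> * (1 / \<bar>H\<bar>)" for w
      using w1[OF that] by simp
    show "continuous_on {..<1 / \<bar>H\<bar> * (1 / \<bar>H\<bar>)} (\<lambda>w. \<epsilon> * H * (H\<^sup>2 / (2 * (sqrt (1 - H\<^sup>2 * w)) ^ 3)))"
      by (intro continuous_intros) (use nz in auto)
    have q: "\<epsilon> * H / sqrt (1 - H\<^sup>2 * (x s * x s)) * x s * x s = x s * P s / y s" if "s \<in> Jp" for s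
    proof -
      have "1 - H\<^sup>2 * (x s * x s) = 1 - (H * x s)\<^sup>2" by (simp add: power_mult_distrib power2_eq_square)
      moreover have "sqrt (1 - (H * x s)\<^sup>2) = \<epsilon> * y s" using y\<epsilon>[OF that] by (simp add: mult.assoc[symmetric] \<epsilon>2)
      moreover have "\<epsilon> \<noteq> 0" using \<epsilon> by auto
      ultimately show ?thesis by (simp add: P_H[OF Jp(1)[OF that]])
    qed
    show "sin (\<sigma> s) = \<epsilon> / sqrt (1 + (\<epsilon> * H / sqrt (1 - H\<^sup>2 * (x s * x s)) * x s * x s)\<^sup>2)"
      "cos (\<sigma> s) = \<epsilon> * (\<epsilon> * H / sqrt (1 - H\<^sup>2 * (x s * x s)) * x s * x s) /
         sqrt (1 + (\<epsilon> * H / sqrt (1 - H\<^sup>2 * (x s * x s)) * x s * x s)\<^sup>2)" if "s \<in> Jp" for s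
      by (rule polar_angle[OF Jp(1)[OF that] \<epsilon> Jp(2)[OF that] q[OF that]])+
    show "Y e = \<epsilon>" by (simp add: \<epsilon>_def)
  qed
qed

lemma cmc_spherical:
  assumes card: "CARD('n::finite) = n"
  shows "cmc_immersion (revolution_source I x t :: (real \<times> (complex^'n)) set) (revolution_map I t) (normal_field Y) H"
  by (rule cmc_immersion_normal_field[OF card]) (rule pole_spherical[OF card], simp add: ends)

end

section \<open>Reflection in a horizontal hyperplane\<close>

definition flip :: "'a \<times> real \<Rightarrow> 'a \<times> real" where "flip = (\<lambda>(r, u). (r, - u))"

lemma flip_simps [simp]: "flip (r, u) = (r, - u)" "flip (flip p) = p"
  by (simp_all add: flip_def case_prod_unfold)

lemma flip_image: "p \<in> flip ` A \<longleftrightarrow> flip p \<in> A"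
  by (metis flip_simps(2) image_iff)

lemma flip_curve: "profile_curve x (\<lambda>s. - t s) = flip \<circ> profile_curve x t"
  by (auto simp: profile_curve_def fun_eq_iff)

lemma flip_graph: "flip ` {(f u, c + u) | u. u \<in> A} = {(f (- u), - c + u) | u. - u \<in> A}"
proof (intro subset_antisym subsetI)
  fix p assume "p \<in> flip ` {(f u, c + u) | u. u \<in> A}"
  then obtain u where "u \<in> A" "p = (f u, - c - u)" by auto
  then show "p \<in> {(f (- u), - c + u) | u. - u \<in> A}" by (auto intro!: exI[of _ "- u"])
next
  fix p assume "p \<in> {(f (- u), - c + u) | u. - u \<in> A}"
  then obtain u where "- u \<in> A" "p = flip (f (- u), c + - u)" by auto
  then show "p \<in> flip ` {(f u, c + u) | u. u \<in> A}" by blast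
qed

lemma catenoidal_curve_flip: "catenoidal_curve C \<Longrightarrow> catenoidal_curve (flip ` C)"
proof -
  assume "catenoidal_curve C"
  then obtain c :: real and a :: ereal and f :: "real \<Rightarrow> real" where a: "0 < a"
    "C2_on (einterval (- a) a) f" "\<forall>u \<in> einterval (- a) a. 0 < f u \<and> f (- u) = f u"
    "strictly_convex_on (einterval (- a) a) f" "filterlim (f \<circ> real_of_ereal) at_top (at_left a)"
    "filterlim (f \<circ> real_of_ereal) at_top (at_right (- a))" and C: "C = {(f u, c + u) | u. u \<in> einterval (- a) a}"
    unfolding catenoidal_curve_def by blast
  have sym: "- u \<in> einterval (- a) a \<longleftrightarrow> u \<in> einterval (- a) a" for u
    by (cases a) (auto simp: einterval_def)
  have "flip ` C = {(f u, - c + u) | u. u \<in> einterval (- a) a}"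
    unfolding C flip_graph sym using a(3) by auto
  then show ?thesis
    unfolding catenoidal_curve_def using a by (intro exI[of _ "- c"] exI[of _ a] exI[of _ f] conjI)
qed

lemma periodic_graph_flip: "periodic_graph C \<Longrightarrow> periodic_graph (flip ` C)"
proof -
  assume "periodic_graph C"
  then obtain P f where P: "0 < P" "\<And>u. f (u + P) = f u" and C: "C = {(f u, u) | u. True}"
    unfolding periodic_graph_def by blast
  have "flip ` C = {(f (- u), u) | u. True}"
    using flip_graph[of f 0 UNIV] by (simp add: C)
  moreover have "f (- (u + P)) = f (- u)" for u using P(2)[of "- (u + P)"] by simp
  ultimately show ?thesis unfolding periodic_graph_def using P(1)
    by (intro exI[of _ P] exI[of _ "\<lambda>u. f (- u)"] conjI allI)
qed

lemma cylinder_curve_flip: "cylinder_curve C \<Longrightarrow> cylinder_curve (flip ` C)"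
proof -
  assume "cylinder_curve C"
  then obtain r where r: "0 < r" "C = {(r, u) | u. True}" unfolding cylinder_curve_def by blast
  have "flip ` C = C" using flip_graph[of "\<lambda>_. r" 0 UNIV] by (simp add: r(2))
  then show ?thesis using \<open>cylinder_curve C\<close> by simp
qed

lemma unduloid_curve_flip: "unduloid_curve C \<Longrightarrow> unduloid_curve (flip ` C)"
proof -
  assume "unduloid_curve C"
  then obtain c \<tau> t1 and f :: "real \<Rightarrow> real" where f: "0 < \<tau>" "0 < t1" "t1 < \<tau>" "C2_on UNIV f"
    "\<forall>u. 0 < f u \<and> f (- u) = f u \<and> f (u + 2 * \<tau>) = f u" "\<not> f constant_on UNIV" "strict_mono_on {0<..<\<tau>} f"
    "strictly_convex_on {0<..<t1} f" "strictly_concave_on {t1<..<\<tau>} f" and C: "C = {(f u, c + u) | u. True}"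
    unfolding unduloid_curve_def by blast
  have "flip ` C = {(f u, - c + u) | u. True}" using flip_graph[of f c UNIV] f(5) by (simp add: C)
  then show ?thesis unfolding unduloid_curve_def using f
    by (intro exI[of _ "- c"] exI[of _ \<tau>] exI[of _ t1] exI[of _ f] conjI)
qed

lemma continuous_flip: "continuous_on S (flip :: 'a::topological_space \<times> real \<Rightarrow> 'a \<times> real)"
  unfolding flip_def case_prod_unfold by (intro continuous_intros)

lemma embedding_on_flip:
  fixes F :: "'m::topological_space \<Rightarrow> 'a::topological_space \<times> real"
  assumes "embedding_on M F"
  shows "embedding_on M (flip \<circ> F)"
proof -
  obtain G where G: "homeomorphism M (F ` M) F G" using assms unfolding embedding_on_def by blast
  have "homeomorphism (F ` M) (flip ` F ` M) flip flip"
    by (rule homeomorphismI) (auto simp: continuous_flip flip_image)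
  from homeomorphism_compose[OF G this] show ?thesis unfolding embedding_on_def image_comp by blast
qed

lemma convex_flip: "convex K \<Longrightarrow> convex (flip ` K)" for K :: "(real \<times> real) set"
  by (rule convex_linear_image) (auto simp: flip_def linear_iff)

lemma frontier_flip: "frontier (flip ` K) = flip ` frontier K" for K :: "(real \<times> real) set"
proof -
  have lin: "linear (flip :: real \<times> real \<Rightarrow> real \<times> real)" by (auto simp: flip_def linear_iff)
  have "inj (flip :: real \<times> real \<Rightarrow> real \<times> real)" by (metis flip_simps(2) injI)
  moreover have "surj (flip :: real \<times> real \<Rightarrow> real \<times> real)" by (metis flip_simps(2) surjI)
  ultimately show ?thesis
    using closure_injective_linear_image[OF lin, of K] interior_bijective_linear_image[OF lin, of K]
    by (simp add: frontier_def image_set_diff bij_def)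
qed

lemma locally_convex_curve_flip:
  assumes "locally_convex_curve I \<gamma>"
  shows "locally_convex_curve I (flip \<circ> \<gamma>)"
  unfolding locally_convex_curve_def
proof
  fix s assume "s \<in> I"
  then obtain J K where J: "open J" "s \<in> J" "convex K" "\<gamma> ` (I \<inter> J) \<subseteq> frontier K"
    using assms unfolding locally_convex_curve_def by blast
  have "(flip \<circ> \<gamma>) ` (I \<inter> J) \<subseteq> frontier (flip ` K)"
    unfolding frontier_flip image_comp[symmetric] using J(4) by (rule image_mono)
  then show "\<exists>J K. open J \<and> s \<in> J \<and> convex K \<and> (flip \<circ> \<gamma>) ` (I \<inter> J) \<subseteq> frontier K"
    using J convex_flip[OF J(3)] by (intro exI[of _ J] exI[of _ "flip ` K"] conjI)
qed

lemma nodoid_curve_flip: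
  assumes "nodoid_curve I x t \<sigma>"
  shows "nodoid_curve I x (\<lambda>s. - t s) (\<lambda>s. pi - \<sigma> s)"
proof -
  let ?\<gamma> = "profile_curve x t"
  from assms have I: "I = UNIV" and lc: "locally_convex_curve UNIV ?\<gamma>"
    and mono: "strict_mono \<sigma> \<or> strict_mono (\<lambda>s. - \<sigma> s)"
    and mM: "\<exists>m M. 0 < m \<and> (\<forall>s. m \<le> x s \<and> x s \<le> M)"
    and tr: "\<exists>d. d \<noteq> 0 \<and> (\<lambda>(r, u). (r, u + d)) ` range ?\<gamma> = range ?\<gamma>"
    and refl: "\<forall>s0. deriv x s0 = 0 \<longrightarrow> (\<lambda>(r, u). (r, 2 * t s0 - u)) ` range ?\<gamma> = range ?\<gamma>"
    and emb: "\<not> embedding_on UNIV ?\<gamma>"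
    unfolding nodoid_curve_def by auto
  have "strict_mono (\<lambda>s. pi - \<sigma> s) \<or> strict_mono (\<lambda>s. - (pi - \<sigma> s))"
    using mono by (auto simp: strict_mono_def)
  moreover obtain d where d: "d \<noteq> 0" "(\<lambda>(r, u). (r, u + d)) ` range ?\<gamma> = range ?\<gamma>" using tr by blast
  have "(\<lambda>(r, u). (r, u + - d)) ` range (flip \<circ> ?\<gamma>) = flip ` ((\<lambda>(r, u). (r, u + d)) ` range ?\<gamma>)"
    by (simp add: image_image case_prod_unfold flip_def)
  then have "(\<lambda>(r, u). (r, u + - d)) ` range (flip \<circ> ?\<gamma>) = range (flip \<circ> ?\<gamma>)"
    unfolding d(2) by (simp add: image_image)
  then have "\<exists>d. d \<noteq> 0 \<and> (\<lambda>(r, u). (r, u + d)) ` range (flip \<circ> ?\<gamma>) = range (flip \<circ> ?\<gamma>)"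
    using d(1) by (intro exI[of _ "- d"]) simp
  moreover have "(\<lambda>(r, u). (r, 2 * - t s - u)) ` range (flip \<circ> ?\<gamma>) = range (flip \<circ> ?\<gamma>)"
    if "deriv x s = 0" for s
  proof -
    have "(\<lambda>(r, u). (r, 2 * - t s - u)) ` range (flip \<circ> ?\<gamma>) = flip ` ((\<lambda>(r, u). (r, 2 * t s - u)) ` range ?\<gamma>)"
      by (simp add: image_image case_prod_unfold flip_def)
    also have "\<dots> = range (flip \<circ> ?\<gamma>)"
      unfolding refl[rule_format, OF that] by (simp add: image_image)
    finally show ?thesis .
  qed
  moreover have "\<not> embedding_on UNIV (flip \<circ> ?\<gamma>)"
  proof
    assume "embedding_on UNIV (flip \<circ> ?\<gamma>)"
    then have "embedding_on UNIV (flip \<circ> (flip \<circ> ?\<gamma>))" by (rule embedding_on_flip)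
    moreover have "flip \<circ> (flip \<circ> ?\<gamma>) = ?\<gamma>" by (simp add: fun_eq_iff)
    ultimately show False using emb by simp
  qed
  ultimately show ?thesis
    unfolding nodoid_curve_def flip_curve using I mM locally_convex_curve_flip[OF lc] by blast
qed

lemma revolution_flip:
  "revolution_source UNIV x (\<lambda>s. - t s) = (revolution_source UNIV x t :: (real \<times> (complex^'n::finite)) set)"
  "revolution_map UNIV (\<lambda>s. - t s) = (flip \<circ> revolution_map UNIV t :: _ \<Rightarrow> 'n heis)"
  by (simp_all add: revolution_source_def axis_ends_UNIV) (auto simp: revolution_map_def fun_eq_iff)

section \<open>From normalised to arbitrary signs of energy and curvature\<close>

context profile
begin

lemma flipped: "profile n (- H) (- E) I x (\<lambda>s. - t s) (\<lambda>s. pi - \<sigma> s)"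
  by unfold_locales (use n complete_profile_solution_flip[OF comp] energy in \<open>auto simp: profile_energy_flip\<close>)

lemma catenoid_types:
  assumes "H = 0" "E \<noteq> 0"
  shows "embedding_on (revolution_source I x t :: (real \<times> (complex^'n::finite)) set) (revolution_map I t)"
    "catenoidal_curve (profile_curve x t ` I)" "2 \<le> n \<Longrightarrow> \<exists>a b. \<forall>s. a < t s \<and> t s < b"
proof -
  note IU = nonzero_energy_UNIV[OF assms(2)]
  have "embedding_on (revolution_source I x t :: (real \<times> (complex^'n)) set) (revolution_map I t) \<and>
    catenoidal_curve (profile_curve x t ` I) \<and> (2 \<le> n \<longrightarrow> (\<exists>a b. \<forall>s. a < t s \<and> t s < b))"
  proof (cases "0 < E")
    case True
    then interpret catenoid n H E I x t \<sigma> using assms by unfold_locales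
    show ?thesis using embedded catenoidal slab by blast
  next
    case False
    interpret f: profile n "- H" "- E" I x "\<lambda>s. - t s" "\<lambda>s. pi - \<sigma> s" by (rule flipped)
    interpret f: catenoid n "- H" "- E" I x "\<lambda>s. - t s" "\<lambda>s. pi - \<sigma> s"
      using assms False by unfold_locales auto
    \<comment> \<open>The flipped solution has the map
      \<open>flip \<circ> revolution_map I t\<close>; flipping a second time returns to the given
      one.\<close>
    have "embedding_on (revolution_source I x t :: (real \<times> (complex^'n)) set) (flip \<circ> (flip \<circ> revolution_map I t))"
      using embedding_on_flip[OF f.embedded] unfolding IU revolution_flip .
    moreover have "flip \<circ> (flip \<circ> revolution_map I t) = (revolution_map I t :: _ \<Rightarrow> 'n heis)" by (simp add: fun_eq_iff)
    moreover have "catenoidal_curve (profile_curve x t ` I)"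
      using catenoidal_curve_flip[OF f.catenoidal] by (simp add: flip_curve image_image)
    moreover have "\<exists>a b. \<forall>s. a < t s \<and> t s < b" if n2: "2 \<le> n"
    proof -
      obtain a b where "\<forall>s. a < - t s \<and> - t s < b" using f.slab[OF n2] by blast
      then have "\<forall>s. - b < t s \<and> t s < - a" by (metis minus_less_iff less_minus_iff)
      then show ?thesis by blast
    qed
    ultimately show ?thesis by simp
  qed
  then show "embedding_on (revolution_source I x t :: (real \<times> (complex^'n::finite)) set) (revolution_map I t)"
    "catenoidal_curve (profile_curve x t ` I)" "2 \<le> n \<Longrightarrow> \<exists>a b. \<forall>s. a < t s \<and> t s < b" by blast+
qed

lemma unduloid_types:
  assumes "0 < E * H"
  shows "periodic_graph (profile_curve x t ` I)"
    "cylinder_curve (profile_curve x t ` I) \<or>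
     embedding_on (revolution_source I x t :: (real \<times> (complex^'n::finite)) set) (revolution_map I t) \<and>
     unduloid_curve (profile_curve x t ` I)"
proof -
  have nz: "E \<noteq> 0" using assms by auto
  note IU = nonzero_energy_UNIV[OF nz]
  have "periodic_graph (profile_curve x t ` I) \<and> (cylinder_curve (profile_curve x t ` I) \<or>
     embedding_on (revolution_source I x t :: (real \<times> (complex^'n)) set) (revolution_map I t) \<and>
     unduloid_curve (profile_curve x t ` I))"
  proof (cases "0 < E")
    case True
    then have "0 < H" using assms by (simp add: zero_less_mult_iff)
    then interpret unduloid n H E I x t \<sigma> using True by unfold_locales auto
    show ?thesis using unduloid_type by blast
  next
    case False
    then have "E < 0" "H < 0" using assms by (auto simp: zero_less_mult_iff)
    interpret f: profile n "- H" "- E" I x "\<lambda>s. - t s" "\<lambda>s. pi - \<sigma> s" by (rule flipped)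
    interpret f: unduloid n "- H" "- E" I x "\<lambda>s. - t s" "\<lambda>s. pi - \<sigma> s"
      using \<open>E < 0\<close> \<open>H < 0\<close> by unfold_locales auto
    have c: "flip ` profile_curve x (\<lambda>s. - t s) ` I = profile_curve x t ` I" by (simp add: flip_curve image_image)
    have "embedding_on (revolution_source I x t :: (real \<times> (complex^'n)) set) (revolution_map I t)"
      if "embedding_on (revolution_source I x (\<lambda>s. - t s) :: (real \<times> (complex^'n)) set) (revolution_map I (\<lambda>s. - t s))"
    proof -
      have "embedding_on (revolution_source I x t :: (real \<times> (complex^'n)) set) (flip \<circ> (flip \<circ> revolution_map I t))"
        using embedding_on_flip[OF that] unfolding IU revolution_flip .
      moreover have "flip \<circ> (flip \<circ> revolution_map I t) = (revolution_map I t :: _ \<Rightarrow> 'n heis)" by (simp add: fun_eq_iff)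
      ultimately show ?thesis by simp
    qed
    moreover have "periodic_graph (profile_curve x t ` I)"
      using periodic_graph_flip[OF f.unduloid_type(1)] unfolding c .
    moreover have "cylinder_curve (profile_curve x t ` I)" if "cylinder_curve (profile_curve x (\<lambda>s. - t s) ` I)"
      using cylinder_curve_flip[OF that] unfolding c .
    moreover have "unduloid_curve (profile_curve x t ` I)" if "unduloid_curve (profile_curve x (\<lambda>s. - t s) ` I)"
      using unduloid_curve_flip[OF that] unfolding c .
    ultimately show ?thesis using f.unduloid_type(2) by blast
  qed
  then show "periodic_graph (profile_curve x t ` I)" "cylinder_curve (profile_curve x t ` I) \<or>
     embedding_on (revolution_source I x t :: (real \<times> (complex^'n)) set) (revolution_map I t) \<and>
     unduloid_curve (profile_curve x t ` I)" by blast+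
qed

lemma nodoid_types:
  assumes "E * H < 0"
  shows "locally_convex_curve I (profile_curve x t)" "nodoid_curve I x t \<sigma>"
    "\<not> inj_on (revolution_map I t) (revolution_source I x t :: (real \<times> (complex^'n::finite)) set)"
proof -
  have nz: "E \<noteq> 0" using assms by auto
  note IU = nonzero_energy_UNIV[OF nz]
  have main: "nodoid_curve I x t \<sigma> \<and> \<not> inj_on (revolution_map I t) (revolution_source I x t :: (real \<times> (complex^'n)) set)"
  proof (cases "E < 0")
    case True
    then have "0 < H" using assms by (simp add: mult_less_0_iff)
    then interpret nodoid n H E I x t \<sigma> using True by unfold_locales auto
    show ?thesis using nodoid_type not_injective by blast
  next
    case False
    then have "0 < E" "H < 0" using assms by (auto simp: mult_less_0_iff)
    interpret f: profile n "- H" "- E" I x "\<lambda>s. - t s" "\<lambda>s. pi - \<sigma> s" by (rule flipped)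
    interpret f: nodoid n "- H" "- E" I x "\<lambda>s. - t s" "\<lambda>s. pi - \<sigma> s"
      using \<open>0 < E\<close> \<open>H < 0\<close> by unfold_locales auto
    have "\<not> inj_on (flip \<circ> revolution_map I t) (revolution_source I x t :: (real \<times> (complex^'n)) set)"
      using f.not_injective unfolding IU revolution_flip .
    moreover have "inj (flip :: 'n heis \<Rightarrow> 'n heis)" by (metis flip_simps(2) injI)
    ultimately have "\<not> inj_on (revolution_map I t) (revolution_source I x t :: (real \<times> (complex^'n)) set)"
      using comp_inj_on inj_on_subset subset_UNIV by blast
    moreover have "nodoid_curve I x t \<sigma>" using nodoid_curve_flip[OF f.nodoid_type] by simp
    ultimately show ?thesis by blast
  qed
  then show "nodoid_curve I x t \<sigma>"
    "\<not> inj_on (revolution_map I t) (revolution_source I x t :: (real \<times> (complex^'n::finite)) set)" by blast+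
  from this(1) show "locally_convex_curve I (profile_curve x t)"
    unfolding nodoid_curve_def by blast
qed

end

theorem theorem5p4:
  fixes H E :: real and I :: "real set" and x t \<sigma> :: "real \<Rightarrow> real"
    and C :: "(real \<times> real) set"
    and \<Sigma> :: "'n::finite heis set"
    and M :: "(real \<times> (complex^'n)) set"
    and F :: "real \<times> (complex^'n) \<Rightarrow> 'n heis"
  assumes solution: "complete_profile_solution CARD('n) H I x t \<sigma>"
    and energy: "\<forall>s\<in>I. profile_energy CARD('n) H (x s) (\<sigma> s) = E"
    and C: "C = generating_curve I x t"
    and \<Sigma>: "\<Sigma> = revolve C"
    and M: "M = revolution_source I x t"
    and F: "F = revolution_map I t"
  shows "F ` M = \<Sigma> \<and>
     (\<exists>N. (\<forall>s\<in>I. \<forall>\<omega>. norm \<omega> = 1 \<longrightarrow>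
             N (s, x s *\<^sub>R \<omega>) = revolution_normal (x s) (t s) (deriv x s) (deriv t s) \<omega>) \<and>
          cmc_immersion M F N H) \<and>
     (H = 0 \<and> E = 0 \<longrightarrow>
        (\<exists>c. C = {(r, u). 0 \<le> r \<and> u = c}) \<and>
        (\<exists>a b. a \<noteq> 0 \<and> \<Sigma> = {p. a \<bullet> p = b})) \<and>
     (H = 0 \<and> E \<noteq> 0 \<longrightarrow>
        embedding_on M F \<and> catenoidal_curve C \<and>
        (CARD('n) \<ge> 2 \<longrightarrow> (\<exists>a b. \<Sigma> \<subseteq> {p. a < snd p \<and> snd p < b}))) \<and>
     (H \<noteq> 0 \<and> E = 0 \<longrightarrow>
        compact \<Sigma> \<and> \<Sigma> homeomorphic sphere (0 :: 'n heis) 1) \<and>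
     (E * H > 0 \<longrightarrow>
        periodic_graph C \<and>
        (cylinder_curve C \<or> embedding_on M F \<and> unduloid_curve C)) \<and>
     (E * H < 0 \<longrightarrow>
        locally_convex_curve I (profile_curve x t) \<and>
        nodoid_curve I x t \<sigma> \<and> \<not> inj_on F M)"
proof -
  have "1 \<le> CARD('n)" by (simp add: Suc_leI)
  then interpret profile "CARD('n)" H E I x t \<sigma>
    using solution energy by unfold_locales auto
  have line: "hyperplane CARD('n) H E I x t \<sigma>" if "H = 0" "E = 0"
    by unfold_locales (use that in auto)
  have round: "spherical CARD('n) H E I x t \<sigma>" if "H \<noteq> 0" "E = 0"
    by unfold_locales (use that in auto)
  have curve: "C = profile_curve x t ` I" if "E \<noteq> 0"
    unfolding C by (rule generating_curve_nonzero[OF that])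
  consider "H = 0" "E = 0" | "H \<noteq> 0" "E = 0" | "E \<noteq> 0" by blast
  then have image: "F ` M = \<Sigma>"
    unfolding F M \<Sigma> C
    by cases (rule hyperplane.hyperplane(1)[OF line refl] spherical.image_spherical[OF round] image_nonzero; assumption)+
  have "\<exists>e. cmc_immersion M F (normal_field e) H"
  proof -
    consider "H = 0" "E = 0" | "H \<noteq> 0" "E = 0" | "E \<noteq> 0" by blast
    then show ?thesis
    proof cases
      case 1
      show ?thesis unfolding M F by (rule hyperplane.hyperplane(2)[OF line[OF 1] refl])
    next
      case 2
      show ?thesis unfolding M F by (rule exI, rule spherical.cmc_spherical[OF round[OF 2] refl])
    next
      case 3
      \<comment> \<open>A solution defined on the whole line has no poles, so the constant 0 is an
        admissible choice of vertical values.\<close>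
      have "axis_ends I x t = {}" unfolding nonzero_energy_UNIV[OF 3] by (rule axis_ends_UNIV)
      then have "cmc_immersion M F (normal_field (\<lambda>_. 0)) H"
        unfolding M F by (intro cmc_immersion_normal_field) simp_all
      then show ?thesis by (rule exI[of _ "\<lambda>_. 0"])
    qed
  qed
  then have cmc: "\<exists>N. (\<forall>s\<in>I. \<forall>\<omega>. norm \<omega> = 1 \<longrightarrow>
      N (s, x s *\<^sub>R \<omega>) = revolution_normal (x s) (t s) (deriv x s) (deriv t s) \<omega>) \<and> cmc_immersion M F N H"
    using normal_field_eq by blast
  have slab: "\<exists>a b. \<Sigma> \<subseteq> {p. a < snd p \<and> snd p < b}" if H: "H = 0" "E \<noteq> 0" and n2: "2 \<le> CARD('n)"
  proof -
    obtain a b where ab: "\<And>s. a < t s \<and> t s < b" using catenoid_types(3)[OF H n2] by blast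
    have "\<Sigma> \<subseteq> {p. a < snd p \<and> snd p < b}"
      unfolding \<Sigma> curve[OF H(2)] revolve_def profile_curve_def using ab by auto
    then show ?thesis by blast
  qed
  show ?thesis
  proof (intro conjI impI; (elim conjE)?)
    show "F ` M = \<Sigma>" by (rule image)
    show "\<exists>N. (\<forall>s\<in>I. \<forall>\<omega>. norm \<omega> = 1 \<longrightarrow>
      N (s, x s *\<^sub>R \<omega>) = revolution_normal (x s) (t s) (deriv x s) (deriv t s) \<omega>) \<and> cmc_immersion M F N H"
      by (rule cmc)
  next
    assume "H = 0" "E = 0"
    note hyperplane.hyperplane(3,4)[OF line[OF this] refl]
    then show "\<exists>c. C = {(r, u). 0 \<le> r \<and> u = c}" "\<exists>a b. a \<noteq> 0 \<and> \<Sigma> = {p. a \<bullet> p = b}"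
      unfolding \<Sigma> C by blast+
  next
    assume H: "H = 0" "E \<noteq> 0"
    show "embedding_on M F" unfolding M F by (rule catenoid_types(1)[OF H])
    show "catenoidal_curve C" unfolding curve[OF H(2)] by (rule catenoid_types(2)[OF H])
    show "\<exists>a b. \<Sigma> \<subseteq> {p. a < snd p \<and> snd p < b}" if "2 \<le> CARD('n)" by (rule slab[OF H that])
  next
    assume H: "H \<noteq> 0" "E = 0"
    show "compact \<Sigma>" "\<Sigma> homeomorphic sphere (0 :: 'n heis) 1"
      unfolding \<Sigma> C by (rule spherical.sphere[OF round[OF H]])+
  next
    assume EH: "0 < E * H"
    then have nz: "E \<noteq> 0" by auto
    show "periodic_graph C" "cylinder_curve C \<or> embedding_on M F \<and> unduloid_curve C"
      unfolding curve[OF nz] M F by (rule unduloid_types[OF EH])+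
  next
    assume EH: "E * H < 0"
    show "locally_convex_curve I (profile_curve x t)" "nodoid_curve I x t \<sigma>" "\<not> inj_on F M"
      unfolding M F by (rule nodoid_types[OF EH])+
  qed
qed

end
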